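(* Let a symmetric normal Lagrangean contact structure be given, and suppose there are two different involutive symmetries $s_x\neq\bar s_x$ at $x$. Let $\sigma$ be an $s_x$-invariant Weyl structure at $x$ and let $\sigma\exp\Upsilon_1\exp\Upsilon_2$ be an $\bar s_x$-invariant Weyl structure at $x$, where $\Upsilon_i:\mathcal G_0\to\mathfrak g_i$ are $G_0$-equivariant. Identify $\Upsilon_1$ with its image in $T^{-1}M=L\oplus R$ via the isomorphism $(T^{-1}M)^*\simeq T^{-1}M$ given by a metric from the class $g$, and denote by $\Upsilon_1^L$ and $\Upsilon_1^R$ the corresponding components in $L$ and $R$. If $g(\Upsilon_1^R,\Upsilon_1^L)\neq 0$ at $x$, then the harmonic curvature vanishes at $x$.
   Context: Let $n\ge1$, $G=PGL(n+2,\mathbb R)$ (the quotient of $GL(n+2,\mathbb R)$ by its center), $\mathfrak g=\mathfrak{sl}(n+2,\mathbb R)$ with the contact grading given by blocks of sizes $1,n,1$: $$\begin{pmatrix}\mathfrak g_0&\mathfrak g_1^L&\mathfrak g_2\\ \mathfrak g_{-1}^L&\mathfrak g_0&\mathfrak g_1^R\\ \mathfrak g_{-2}&\mathfrak g_{-1}^R&\mathfrak g_0\end{pmatrix},$$ $\mathfrak g_{\pm1}=\mathfrak g_{\pm1}^L\oplus\mathfrak g_{\pm1}^R$. Let $P$ be the classes of block upper triangular matrices, $G_0\subset P$ the classes of block diagonal matrices, $\mathfrak p=\mathfrak g_0\oplus\mathfrak g_1\oplus\mathfrak g_2$, $\mathfrak p_+=\mathfrak g_1\oplus\mathfrak g_2$,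 $P_+=\exp\mathfrak p_+$, $\mathfrak g^{-1}=\mathfrak g_{-1}\oplus\mathfrak p$. A parabolic geometry of type $(G,P)$ is a principal $P$-bundle $p:\mathcal G\to M$ with a Cartan connection $\omega\in\Omega^1(\mathcal G,\mathfrak g)$. One has $TM\simeq\mathcal G\times_P\mathfrak g/\mathfrak p$; $T^{-1}M:=\mathcal G\times_P\mathfrak g^{-1}/\mathfrak p$ has corank one. The geometry is regular if the Levi bracket $\mathcal L:T^{-1}M\times T^{-1}M\to TM/T^{-1}M$ induced by the Lie bracket of vector fields corresponds to $[\,,]:\mathfrak g_{-1}\times\mathfrak g_{-1}\to\mathfrak g_{-2}$. A Lagrangean contact structure is (the structure underlying) a regular geometry of this type: a contact distribution $T^{-1}M=L\oplus R$ split into two rank-$n$ subbundles isotropic for $\mathcal L$, corresponding to $\mathfrak g_{-1}^L,\mathfrak g_{-1}^R$. Let $J:T^{-1}M\to T^{-1}M$, $J^2=\mathrm{id}$, be the operator with eigenspaces $L$ and $R$. Then $\mathcal L(\,\cdot\,,J\,\cdot\,)$ is symmetric and non-degenerate; identifications $TM/T^{-1}M\simeq\mathbb R$ turn it into a conformal class $g$ of pseudometrics of signature $(n,n)$ on $T^{-1}M$. Whether $g(\xi,\eta)=0$ does not depend on the choice from the class. Curvature. The curvature function $\kappa:\mathcal G\to\wedge^2(\mathfrak g/\mathfrak p)^*\otimes\mathfrak g$ represents $d\omega+\frac12[\omega,\omega]$. The geometry is normal if $\partial^*\circ\kappa=0$, where $\partial^*$ is the differential of the standard complex computing the Lie algebra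 homology of $\mathfrak p_+\cong(\mathfrak g/\mathfrak p)^*$ with coefficients in $\mathfrak g$; the harmonic curvature is then the composition of $\kappa$ with $\ker(\partial^* )\to\ker(\partial^* )/\mathrm{im}(\partial^* )$. Symmetries. A symmetry at $x$ is a locally defined diffeomorphism $s_x$ of $M$ with $s_x(x)=x$, $T_xs_x=-\mathrm{id}$ on $T_x^{-1}M$, which is the base map of a (unique) locally defined automorphism $\varphi$ ($P$-bundle morphism with $\varphi^*\omega=\omega$). The geometry is symmetric if there is a symmetry at each point. $s_x$ is involutive if $s_x\circ s_x=\mathrm{id}$. Local symmetries are considered up to restriction to smaller neighborhoods of $x$; "different" means different germs at $x$. Weyl structures. Let $\mathcal G_0=\mathcal G/P_+$ and let $\varphi_0$ be the map induced by $\varphi$ on $\mathcal G_0$. A Weyl structure is a smooth $G_0$-equivariant section $\sigma:\mathcal G_0\to\mathcal G$ of $\mathcal G\to\mathcal G_0$. Any two are related by $\hat\sigma(u_0)=\sigma(u_0)\exp\Upsilon_1(u_0)\exp\Upsilon_2(u_0)$ with $G_0$-equivariant $\Upsilon_i:\mathcal G_0\to\mathfrak g_i$. $\Upsilon_1$ is a section of $\mathcal G_0\times_{G_0}\mathfrak g_1\simeq(T^{-1}M)^*$. $\sigma$ is $s_x$-invariant at $x$ if $\varphi(\sigma(u_0))=\sigma(\varphi_0(u_0))$ for all $u_0$ in the fiber of $\mathcal G_0$ over $x$. *)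

theory Defs
  imports "HOL-Analysis.Analysis" "HOL-Algebra.Coset"
begin

section \<open>Smooth maps between open or arbitrary subsets of Euclidean spaces\<close>

primrec Ck_on :: "nat \<Rightarrow> 'a::euclidean_space set \<Rightarrow> ('a \<Rightarrow> 'b::real_normed_vector) \<Rightarrow> bool" where
  "Ck_on 0 S f \<longleftrightarrow> continuous_on S f"
| "Ck_on (Suc k) S f \<longleftrightarrow>
     f differentiable_on S \<and> (\<forall>v. Ck_on k S (\<lambda>x. frechet_derivative f (at x) v))"

text \<open>As usual, a map on an arbitrary subset is smooth if it locally extends to a smooth map on
  an open set (this matters only for maps parametrized by the group \<open>P\<close>, see below).\<close>

definition smooth_on :: "'a::euclidean_space set \<Rightarrow> ('a \<Rightarrow> 'b::real_normed_vector) \<Rightarrow> bool" where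
  "smooth_on S f \<longleftrightarrow>
     (\<forall>x\<in>S. \<exists>U h. open U \<and> x \<in> U \<and> (\<forall>k. Ck_on k U h) \<and> (\<forall>y\<in>U \<inter> S. h y = f y))"


section \<open>Manifolds, tangent spaces, vector fields\<close>

text \<open>A manifold is a topological space (a type, Hausdorff and second countable in the main
  statement) with an atlas.  A chart is a pair of an open domain and a map.\<close>

type_synonym ('m, 'e) chart = "'m set \<times> ('m \<Rightarrow> 'e)"

definition chart_inv :: "('m, 'e) chart \<Rightarrow> 'e \<Rightarrow> 'm" where
  "chart_inv c = inv_into (fst c) (snd c)"

definition is_chart :: "('m::topological_space, 'e::euclidean_space) chart \<Rightarrow> bool" where
  "is_chart c \<longleftrightarrow> open (fst c) \<and> open (snd c ` fst c) \<and>
     homeomorphism (fst c) (snd c ` fst c) (snd c) (chart_inv c)"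

definition smooth_atlas :: "('m::topological_space, 'e::euclidean_space) chart set \<Rightarrow> bool" where
  "smooth_atlas A \<longleftrightarrow> (\<forall>c\<in>A. is_chart c) \<and> (\<Union>c\<in>A. fst c) = UNIV \<and>
     (\<forall>c\<in>A. \<forall>d\<in>A. smooth_on (snd c ` (fst c \<inter> fst d)) (snd d \<circ> chart_inv c))"

definition euclid_atlas :: "('v::euclidean_space, 'v) chart set" where
  "euclid_atlas = {(UNIV, id)}"

definition prod_atlas ::
  "('m, 'e) chart set \<Rightarrow> ('k, 'f) chart set \<Rightarrow> ('m \<times> 'k, 'e \<times> 'f) chart set" where
  "prod_atlas A B = {(fst c \<times> fst d, map_prod (snd c) (snd d)) | c d. c \<in> A \<and> d \<in> B}"

definition smooth_map ::
  "('m::topological_space, 'e::euclidean_space) chart set \<Rightarrow>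
   ('k::topological_space, 'f::euclidean_space) chart set \<Rightarrow> 'm set \<Rightarrow> ('m \<Rightarrow> 'k) \<Rightarrow> bool" where
  "smooth_map A B S f \<longleftrightarrow> continuous_on S f \<and>
     (\<forall>c\<in>A. \<forall>d\<in>B. smooth_on (snd c ` (S \<inter> fst c \<inter> f -` fst d)) (snd d \<circ> f \<circ> chart_inv c))"

text \<open>Every point \<open>x\<close> gets a preferred chart, and the tangent space at \<open>x\<close> is the model space \<open>'e\<close>,
  a vector being given by its components in the preferred chart at \<open>x\<close>.  The functions
  \<open>to_coord\<close> and \<open>from_coord\<close> convert to and from the components in any other chart.\<close>

definition chart_at :: "('m, 'e) chart set \<Rightarrow> 'm \<Rightarrow> ('m, 'e) chart" where
  "chart_at A x = (SOME c. c \<in> A \<and> x \<in> fst c)"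

definition to_coord ::
  "('m, 'e::euclidean_space) chart set \<Rightarrow> ('m, 'e) chart \<Rightarrow> 'm \<Rightarrow> 'e \<Rightarrow> 'e" where
  "to_coord A c x =
     frechet_derivative (snd c \<circ> chart_inv (chart_at A x)) (at (snd (chart_at A x) x))"

definition from_coord ::
  "('m, 'e::euclidean_space) chart set \<Rightarrow> ('m, 'e) chart \<Rightarrow> 'm \<Rightarrow> 'e \<Rightarrow> 'e" where
  "from_coord A c x = frechet_derivative (snd (chart_at A x) \<circ> chart_inv c) (at (snd c x))"

definition tangent_map ::
  "('m, 'e::euclidean_space) chart set \<Rightarrow> ('k, 'f::euclidean_space) chart set \<Rightarrow>
   ('m \<Rightarrow> 'k) \<Rightarrow> 'm \<Rightarrow> 'e \<Rightarrow> 'f" where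
  "tangent_map A B f x =
     frechet_derivative (snd (chart_at B (f x)) \<circ> f \<circ> chart_inv (chart_at A x))
       (at (snd (chart_at A x) x))"

definition velocity :: "('m, 'e::euclidean_space) chart set \<Rightarrow> (real \<Rightarrow> 'm) \<Rightarrow> 'e" where
  "velocity A \<gamma> = vector_derivative (snd (chart_at A (\<gamma> 0)) \<circ> \<gamma>) (at 0)"

definition smooth_section_of ::
  "('m, 'e::euclidean_space) chart set \<Rightarrow> ('m \<Rightarrow> 'e set) \<Rightarrow> 'm set \<Rightarrow> ('m \<Rightarrow> 'e) \<Rightarrow> bool" where
  "smooth_section_of A D U \<xi> \<longleftrightarrow> (\<forall>y\<in>U. \<xi> y \<in> D y) \<and>
     (\<forall>c\<in>A. smooth_on (snd c ` (U \<inter> fst c))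
        (\<lambda>z. to_coord A c (chart_inv c z) (\<xi> (chart_inv c z))))"

definition lie_bracket_at ::
  "('m, 'e::euclidean_space) chart set \<Rightarrow> ('m \<Rightarrow> 'e) \<Rightarrow> ('m \<Rightarrow> 'e) \<Rightarrow> 'm \<Rightarrow> 'e" where
  "lie_bracket_at A \<xi> \<eta> x =
     (let c = chart_at A x;
          \<xi>c = (\<lambda>z. to_coord A c (chart_inv c z) (\<xi> (chart_inv c z)));
          \<eta>c = (\<lambda>z. to_coord A c (chart_inv c z) (\<eta> (chart_inv c z)))
      in frechet_derivative \<eta>c (at (snd c x)) (\<xi> x) - frechet_derivative \<xi>c (at (snd c x)) (\<eta> x))"

text \<open>The Levi bracket of a distribution \<open>D\<close>, with values in \<open>T\<^sub>xM / D\<^sub>x\<close>, i.e. cosets of \<open>D\<^sub>x\<close>.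
  Since the class of the Lie bracket is tensorial, all extensions give the same coset.\<close>

definition levi_bracket ::
  "('m::topological_space, 'e::euclidean_space) chart set \<Rightarrow> ('m \<Rightarrow> 'e set) \<Rightarrow>
   'm \<Rightarrow> 'e \<Rightarrow> 'e \<Rightarrow> 'e set" where
  "levi_bracket A D x v w =
     {lie_bracket_at A \<xi> \<eta> x + \<tau> | \<xi> \<eta> \<tau>. \<tau> \<in> D x \<and> \<xi> x = v \<and> \<eta> x = w \<and>
        (\<exists>U. open U \<and> x \<in> U \<and> smooth_section_of A D U \<xi> \<and> smooth_section_of A D U \<eta>)}"

text \<open>Vector-valued one-forms and the value of the exterior derivative on two tangent vectors.\<close>

definition smooth_form ::
  "('m, 'e::euclidean_space) chart set \<Rightarrow> ('m \<Rightarrow> 'e \<Rightarrow> 'v::euclidean_space) \<Rightarrow> bool" where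
  "smooth_form A \<omega> \<longleftrightarrow> (\<forall>x. linear (\<omega> x)) \<and>
     (\<forall>c\<in>A. \<forall>v. smooth_on (snd c ` fst c)
        (\<lambda>z. \<omega> (chart_inv c z) (from_coord A c (chart_inv c z) v)))"

definition ext_deriv ::
  "('m, 'e::euclidean_space) chart set \<Rightarrow> ('m \<Rightarrow> 'e \<Rightarrow> 'v::euclidean_space) \<Rightarrow>
   'm \<Rightarrow> 'e \<Rightarrow> 'e \<Rightarrow> 'v" where
  "ext_deriv A \<omega> x v w =
     (let c = chart_at A x;
          \<omega>c = (\<lambda>u z. \<omega> (chart_inv c z) (from_coord A c (chart_inv c z) u))
      in frechet_derivative (\<omega>c w) (at (snd c x)) v - frechet_derivative (\<omega>c v) (at (snd c x)) w)"


section \<open>The Lie algebra \<open>sl(n+2,\<real>)\<close> with its contact grading\<close>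

text \<open>\<open>n = CARD('n)\<close>; rows and columns are indexed by blocks of sizes \<open>1, n, 1\<close>.\<close>

datatype 'n idx = First | Mid 'n | Last

lemma UNIV_idx: "(UNIV :: 'n idx set) = insert First (insert Last (range Mid))"
  by (auto intro: idx.exhaust)

instance idx :: (finite) finite
  by standard (simp add: UNIV_idx)

type_synonym 'n matr = "real ^ 'n idx ^ 'n idx"

primrec blk :: "'n idx \<Rightarrow> int" where
  "blk First = 0" | "blk (Mid i) = 1" | "blk Last = 2"

definition commutator :: "'n::finite matr \<Rightarrow> 'n matr \<Rightarrow> 'n matr" where
  "commutator X Y = X ** Y - Y ** X"

definition sl :: "'n::finite matr set" where
  "sl = {X. trace X = 0}"

definition grade :: "int \<Rightarrow> 'n::finite matr set" where
  "grade k = {X \<in> sl. \<forall>i j. X $ i $ j \<noteq> 0 \<longrightarrow> blk j - blk i = k}"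

definition filt :: "int \<Rightarrow> 'n::finite matr set" where
  "filt k = {X \<in> sl. \<forall>i j. X $ i $ j \<noteq> 0 \<longrightarrow> blk j - blk i \<ge> k}"

abbreviation (input) par :: "'n::finite matr set"  \<comment> \<open>\<open>\<pp>\<close>\<close>
  where "par \<equiv> filt 0"

abbreviation (input) par_plus :: "'n::finite matr set"  \<comment> \<open>\<open>\<pp>\<^sub>+\<close>\<close>
  where "par_plus \<equiv> filt 1"

definition grade_m1_L :: "'n::finite matr set" where
  "grade_m1_L = {X \<in> grade (-1). \<forall>i j. X $ i $ j \<noteq> 0 \<longrightarrow> j = First}"

definition grade_m1_R :: "'n::finite matr set" where
  "grade_m1_R = {X \<in> grade (-1). \<forall>i j. X $ i $ j \<noteq> 0 \<longrightarrow> i = Last}"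

definition mat_exp :: "'n::finite matr \<Rightarrow> 'n matr" where
  "mat_exp X = (\<Sum>k. (1 / fact k) *\<^sub>R (((**) X) ^^ k) (mat 1))"


section \<open>The group \<open>PGL(n+2,\<real>)\<close> and its subgroups\<close>

definition GL :: "'n::finite matr monoid" where
  "GL = \<lparr>carrier = {A. invertible A}, monoid.mult = (**), one = mat 1\<rparr>"

definition grp_center :: "('a, 'b) monoid_scheme \<Rightarrow> 'a set" where
  "grp_center G = {z \<in> carrier G. \<forall>x\<in>carrier G. z \<otimes>\<^bsub>G\<^esub> x = x \<otimes>\<^bsub>G\<^esub> z}"

definition PGL :: "'n::finite matr set monoid" where
  "PGL = GL Mod (grp_center GL)"

definition cls :: "'n::finite matr \<Rightarrow> 'n matr set" where
  "cls A = grp_center GL #>\<^bsub>GL\<^esub> A"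

definition upper_mats :: "'n::finite matr set" where
  "upper_mats = {A. invertible A \<and> (\<forall>i j. A $ i $ j \<noteq> 0 \<longrightarrow> blk i \<le> blk j)}"

definition diag_mats :: "'n::finite matr set" where
  "diag_mats = {A. invertible A \<and> (\<forall>i j. A $ i $ j \<noteq> 0 \<longrightarrow> blk i = blk j)}"

definition P_grp :: "'n::finite matr set set" where
  "P_grp = cls ` upper_mats"

definition G0_grp :: "'n::finite matr set set" where
  "G0_grp = cls ` diag_mats"

definition Pplus_grp :: "'n::finite matr set set" where
  "Pplus_grp = cls ` mat_exp ` par_plus"

definition Ad :: "'n::finite matr set \<Rightarrow> 'n matr \<Rightarrow> 'n matr" where
  "Ad a X = (let A = (SOME A. A \<in> a) in A ** X ** matrix_inv A)"


section \<open>Homology differential\<close>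

text \<open>\<open>\<gg>/\<pp>\<close> is represented by strictly block lower triangular matrices, \<open>X\<close> having the
  representative \<open>lower_part X\<close>.  Elements of \<open>\<Lambda>\<^sup>k(\<gg>/\<pp>)\<^sup>* \<otimes> \<gg>\<close> are alternating \<open>k\<close>-linear maps
  defined on all matrices that vanish as soon as one entry is block upper triangular
  (note that \<open>\<gg>/\<pp>\<close> is also the quotient of all matrices by the block upper triangular ones).
  The isomorphism \<open>\<pp>\<^sub>+ \<cong> (\<gg>/\<pp>)\<^sup>*\<close> is given by the trace form; the Killing form is a
  nonzero multiple of it, which changes neither kernel nor image of the differential.\<close>

definition lower_part :: "'n::finite matr \<Rightarrow> 'n matr" where
  "lower_part X = (\<chi> i j. if blk j < blk i then X $ i $ j else 0)"

definition pairing :: "'n::finite matr \<Rightarrow> 'n matr \<Rightarrow> real" where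
  "pairing Z X = trace (Z ** X)"

definition wedge :: "'n::finite matr \<Rightarrow> 'n matr \<Rightarrow> 'n matr \<Rightarrow> 'n matr \<Rightarrow> 'n matr \<Rightarrow> 'n matr" where
  "wedge Z W C X Y = (pairing Z (lower_part X) * pairing W (lower_part Y)
                      - pairing Z (lower_part Y) * pairing W (lower_part X)) *\<^sub>R C"

definition one_form :: "'n::finite matr \<Rightarrow> 'n matr \<Rightarrow> 'n matr \<Rightarrow> 'n matr" where
  "one_form Z C X = pairing Z (lower_part X) *\<^sub>R C"

text \<open>The Lie algebra homology differential on decomposable elements \<open>Z\<^sub>1 \<and> \<dots> \<and> Z\<^sub>k \<otimes> C\<close>:
  \<open>\<Sum>\<^sub>i (-1)\<^sup>i Z\<^sub>1 \<and> \<dots>i\<dots> \<and> Z\<^sub>k \<otimes> [Z\<^sub>i, C] + \<Sum>\<^sub>i\<^sub><\<^sub>j (-1)\<^sup>i\<^sup>+\<^sup>j [Z\<^sub>i, Z\<^sub>j] \<and> Z\<^sub>1 \<and> \<dots>i\<dots>j\<dots> \<and> Z\<^sub>k \<otimes> C\<close>,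
  for \<open>k = 2\<close> and \<open>k = 3\<close>.\<close>

definition hdiff2 :: "'n::finite matr \<Rightarrow> 'n matr \<Rightarrow> 'n matr \<Rightarrow> 'n matr \<Rightarrow> 'n matr" where
  "hdiff2 Z\<^sub>1 Z\<^sub>2 C X =
     - one_form Z\<^sub>2 (commutator Z\<^sub>1 C) X + one_form Z\<^sub>1 (commutator Z\<^sub>2 C) X
     - one_form (commutator Z\<^sub>1 Z\<^sub>2) C X"

definition hdiff3 ::
  "'n::finite matr \<Rightarrow> 'n matr \<Rightarrow> 'n matr \<Rightarrow> 'n matr \<Rightarrow> 'n matr \<Rightarrow> 'n matr \<Rightarrow> 'n matr" where
  "hdiff3 Z\<^sub>1 Z\<^sub>2 Z\<^sub>3 C X Y =
     - wedge Z\<^sub>2 Z\<^sub>3 (commutator Z\<^sub>1 C) X Y + wedge Z\<^sub>1 Z\<^sub>3 (commutator Z\<^sub>2 C) X Y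
     - wedge Z\<^sub>1 Z\<^sub>2 (commutator Z\<^sub>3 C) X Y
     - wedge (commutator Z\<^sub>1 Z\<^sub>2) Z\<^sub>3 C X Y + wedge (commutator Z\<^sub>1 Z\<^sub>3) Z\<^sub>2 C X Y
     - wedge (commutator Z\<^sub>2 Z\<^sub>3) Z\<^sub>1 C X Y"

text \<open>A basis of \<open>\<gg>/\<pp>\<close> and the dual basis of \<open>\<pp>\<^sub>+\<close> are given by elementary matrices; the
  differential on general elements is obtained by expanding them in these bases.\<close>

definition elem_mat :: "'n::finite idx \<Rightarrow> 'n idx \<Rightarrow> 'n matr" where
  "elem_mat a b = (\<chi> i j. if i = a \<and> j = b then 1 else 0)"

definition low_idx :: "('n::finite idx \<times> 'n idx) set" where
  "low_idx = {(a, b). blk b < blk a}"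

definition bas :: "'n::finite idx \<times> 'n idx \<Rightarrow> 'n matr" where
  "bas \<alpha> = elem_mat (fst \<alpha>) (snd \<alpha>)"

definition dual_bas :: "'n::finite idx \<times> 'n idx \<Rightarrow> 'n matr" where
  "dual_bas \<alpha> = elem_mat (snd \<alpha>) (fst \<alpha>)"

definition codiff2 :: "('n::finite matr \<Rightarrow> 'n matr \<Rightarrow> 'n matr) \<Rightarrow> 'n matr \<Rightarrow> 'n matr" where
  "codiff2 \<phi> X = (1 / 2) *\<^sub>R (\<Sum>\<alpha>\<in>low_idx. \<Sum>\<beta>\<in>low_idx.
      hdiff2 (dual_bas \<alpha>) (dual_bas \<beta>) (\<phi> (bas \<alpha>) (bas \<beta>)) X)"

definition codiff3 ::
  "('n::finite matr \<Rightarrow> 'n matr \<Rightarrow> 'n matr \<Rightarrow> 'n matr) \<Rightarrow> 'n matr \<Rightarrow> 'n matr \<Rightarrow> 'n matr" where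
  "codiff3 \<psi> X Y = (1 / 6) *\<^sub>R (\<Sum>\<alpha>\<in>low_idx. \<Sum>\<beta>\<in>low_idx. \<Sum>\<gamma>\<in>low_idx.
      hdiff3 (dual_bas \<alpha>) (dual_bas \<beta>) (dual_bas \<gamma>) (\<psi> (bas \<alpha>) (bas \<beta>) (bas \<gamma>)) X Y)"

definition cochain3 :: "('n::finite matr \<Rightarrow> 'n matr \<Rightarrow> 'n matr \<Rightarrow> 'n matr) set" where
  "cochain3 = {\<psi>. (\<forall>Y Z. linear (\<lambda>X. \<psi> X Y Z)) \<and> (\<forall>X Z. linear (\<lambda>Y. \<psi> X Y Z)) \<and>
     (\<forall>X Y. linear (\<lambda>Z. \<psi> X Y Z)) \<and>
     (\<forall>X Y. \<psi> X X Y = 0 \<and> \<psi> X Y Y = 0) \<and>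
     (\<forall>X Y Z. lower_part X = 0 \<longrightarrow> \<psi> X Y Z = 0) \<and>
     (\<forall>X Y Z. \<psi> X Y Z \<in> sl)}"

definition im_codiff :: "('n::finite matr \<Rightarrow> 'n matr \<Rightarrow> 'n matr) set" where
  "im_codiff = codiff3 ` cochain3"


section \<open>Parabolic geometries of type \<open>(G, P)\<close>\<close>

record ('m, 'e, 'p, 'q, 'n) geometry =
  base_atlas :: "('m, 'e) chart set"
  total_atlas :: "('p, 'q) chart set"
  proj :: "'p \<Rightarrow> 'm"
  ract :: "'p \<Rightarrow> 'n matr set \<Rightarrow> 'p"
  conn :: "'p \<Rightarrow> 'q \<Rightarrow> 'n matr"

text \<open>Every element of \<open>P\<close> has a unique representing matrix with upper left entry \<open>1\<close>, so smooth
  maps from and to \<open>P\<close> are those which are smooth in terms of representing matrices.  In the last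
  clause, \<open>(y, a) \<mapsto> s y \<cdot> a\<close> is a local trivialization over \<open>U\<close>, with inverse
  \<open>u \<mapsto> (proj u, cls (\<tau> u))\<close>.\<close>

definition principal_bundle ::
  "('m::topological_space, 'e::euclidean_space, 'p::topological_space, 'q::euclidean_space, 'n::finite)
     geometry \<Rightarrow> bool" where
  "principal_bundle \<G> \<longleftrightarrow>
     smooth_atlas (base_atlas \<G>) \<and> smooth_atlas (total_atlas \<G>) \<and>
     smooth_map (total_atlas \<G>) (base_atlas \<G>) UNIV (proj \<G>) \<and> surj (proj \<G>) \<and>
     (\<forall>u. ract \<G> u \<one>\<^bsub>PGL\<^esub> = u) \<and>
     (\<forall>u. \<forall>a\<in>P_grp. \<forall>b\<in>P_grp. ract \<G> (ract \<G> u a) b = ract \<G> u (a \<otimes>\<^bsub>PGL\<^esub> b)) \<and>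
     (\<forall>u. \<forall>a\<in>P_grp. proj \<G> (ract \<G> u a) = proj \<G> u) \<and>
     smooth_map (prod_atlas (total_atlas \<G>) euclid_atlas) (total_atlas \<G>) (UNIV \<times> upper_mats)
       (\<lambda>(u, A). ract \<G> u (cls A)) \<and>
     (\<forall>x. \<exists>U s \<tau>. open U \<and> x \<in> U \<and>
        smooth_map (base_atlas \<G>) (total_atlas \<G>) U s \<and> (\<forall>y\<in>U. proj \<G> (s y) = y) \<and>
        smooth_map (total_atlas \<G>) euclid_atlas (proj \<G> -` U) \<tau> \<and>
        (\<forall>u\<in>proj \<G> -` U. \<tau> u \<in> upper_mats \<and> ract \<G> (s (proj \<G> u)) (cls (\<tau> u)) = u) \<and>
        (\<forall>y\<in>U. \<forall>a\<in>P_grp. cls (\<tau> (ract \<G> (s y) a)) = a))"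

definition cartan_connection ::
  "('m::topological_space, 'e::euclidean_space, 'p::topological_space, 'q::euclidean_space, 'n::finite)
     geometry \<Rightarrow> bool" where
  "cartan_connection \<G> \<longleftrightarrow>
     smooth_form (total_atlas \<G>) (conn \<G>) \<and>
     (\<forall>u. bij_betw (conn \<G> u) UNIV sl) \<and>
     (\<forall>u \<xi>. \<forall>a\<in>P_grp.
        conn \<G> (ract \<G> u a)
          (tangent_map (total_atlas \<G>) (total_atlas \<G>) (\<lambda>v. ract \<G> v a) u \<xi>) =
        Ad (m_inv PGL a) (conn \<G> u \<xi>)) \<and>
     (\<forall>u. \<forall>X\<in>par.
        conn \<G> u (velocity (total_atlas \<G>) (\<lambda>t. ract \<G> u (cls (mat_exp (t *\<^sub>R X))))) = X)"

definition parabolic_geometry ::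
  "('m::topological_space, 'e::euclidean_space, 'p::topological_space, 'q::euclidean_space, 'n::finite)
     geometry \<Rightarrow> bool" where
  "parabolic_geometry \<G> \<longleftrightarrow> principal_bundle \<G> \<and> cartan_connection \<G>"

definition conn_inv ::
  "('m, 'e, 'p, 'q::euclidean_space, 'n::finite) geometry \<Rightarrow> 'p \<Rightarrow> 'n matr \<Rightarrow> 'q" where
  "conn_inv \<G> u = inv_into UNIV (conn \<G> u)"

text \<open>The curvature function.  Since the curvature form is horizontal, its value on \<open>X + \<pp>\<close>,
  \<open>Y + \<pp>\<close> may be computed using the representatives \<open>lower_part X\<close>, \<open>lower_part Y\<close>.\<close>

definition curv ::
  "('m, 'e, 'p, 'q::euclidean_space, 'n::finite) geometry \<Rightarrow> 'p \<Rightarrow> 'n matr \<Rightarrow> 'n matr \<Rightarrow> 'n matr" where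
  "curv \<G> u X Y =
     ext_deriv (total_atlas \<G>) (conn \<G>) u
       (conn_inv \<G> u (lower_part X)) (conn_inv \<G> u (lower_part Y))
     + commutator (lower_part X) (lower_part Y)"

definition normal_geometry ::
  "('m, 'e, 'p, 'q::euclidean_space, 'n::finite) geometry \<Rightarrow> bool" where
  "normal_geometry \<G> \<longleftrightarrow> (\<forall>u X. codiff2 (curv \<G> u) X = 0)"

text \<open>The harmonic curvature at \<open>u\<close> as a coset in \<open>ker \<partial>\<^sup>* / im \<partial>\<^sup>*\<close>, whose zero is \<open>im \<partial>\<^sup>*\<close>.\<close>

definition harmonic_curv ::
  "('m, 'e, 'p, 'q::euclidean_space, 'n::finite) geometry \<Rightarrow> 'p \<Rightarrow>
   ('n matr \<Rightarrow> 'n matr \<Rightarrow> 'n matr) set" where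
  "harmonic_curv \<G> u = {(\<lambda>X Y. curv \<G> u X Y + \<beta> X Y) | \<beta>. \<beta> \<in> im_codiff}"

definition harmonic_curv_vanishes_at ::
  "('m, 'e, 'p, 'q::euclidean_space, 'n::finite) geometry \<Rightarrow> 'm \<Rightarrow> bool" where
  "harmonic_curv_vanishes_at \<G> x \<longleftrightarrow> (\<forall>u. proj \<G> u = x \<longrightarrow> harmonic_curv \<G> u = im_codiff)"


section \<open>The underlying Lagrangean contact structure\<close>

text \<open>\<open>frame_vec \<G> u X\<close> is the tangent vector corresponding to the class of \<open>(u, X + \<pp>)\<close> under
  \<open>TM \<cong> \<G> \<times>\<^sub>P \<gg>/\<pp>\<close>.\<close>

definition frame_vec ::
  "('m, 'e::euclidean_space, 'p, 'q::euclidean_space, 'n::finite) geometry \<Rightarrow> 'p \<Rightarrow> 'n matr \<Rightarrow> 'e" where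
  "frame_vec \<G> u X =
     tangent_map (total_atlas \<G>) (base_atlas \<G>) (proj \<G>) u (conn_inv \<G> u X)"

definition contact_distr ::
  "('m, 'e::euclidean_space, 'p, 'q::euclidean_space, 'n::finite) geometry \<Rightarrow> 'm \<Rightarrow> 'e set" where
  "contact_distr \<G> x = {frame_vec \<G> u X | u X. proj \<G> u = x \<and> X \<in> filt (-1)}"

definition distr_L ::
  "('m, 'e::euclidean_space, 'p, 'q::euclidean_space, 'n::finite) geometry \<Rightarrow> 'm \<Rightarrow> 'e set" where
  "distr_L \<G> x = {frame_vec \<G> u X | u X. proj \<G> u = x \<and> X \<in> grade_m1_L}"

definition distr_R ::
  "('m, 'e::euclidean_space, 'p, 'q::euclidean_space, 'n::finite) geometry \<Rightarrow> 'm \<Rightarrow> 'e set" where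
  "distr_R \<G> x = {frame_vec \<G> u X | u X. proj \<G> u = x \<and> X \<in> grade_m1_R}"

definition levi ::
  "('m::topological_space, 'e::euclidean_space, 'p, 'q::euclidean_space, 'n::finite) geometry \<Rightarrow>
   'm \<Rightarrow> 'e \<Rightarrow> 'e \<Rightarrow> 'e set" where
  "levi \<G> = levi_bracket (base_atlas \<G>) (contact_distr \<G>)"

definition regular_geometry ::
  "('m::topological_space, 'e::euclidean_space, 'p, 'q::euclidean_space, 'n::finite) geometry \<Rightarrow> bool" where
  "regular_geometry \<G> \<longleftrightarrow> (\<forall>u. \<forall>X\<in>grade (-1). \<forall>Y\<in>grade (-1).
     levi \<G> (proj \<G> u) (frame_vec \<G> u X) (frame_vec \<G> u Y) =
     {frame_vec \<G> u (commutator X Y) + \<tau> | \<tau>. \<tau> \<in> contact_distr \<G> (proj \<G> u)})"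

definition comp_L ::
  "('m, 'e::euclidean_space, 'p, 'q::euclidean_space, 'n::finite) geometry \<Rightarrow> 'm \<Rightarrow> 'e \<Rightarrow> 'e" where
  "comp_L \<G> x \<xi> = (THE l. l \<in> distr_L \<G> x \<and> \<xi> - l \<in> distr_R \<G> x)"

definition comp_R ::
  "('m, 'e::euclidean_space, 'p, 'q::euclidean_space, 'n::finite) geometry \<Rightarrow> 'm \<Rightarrow> 'e \<Rightarrow> 'e" where
  "comp_R \<G> x \<xi> = (THE r. r \<in> distr_R \<G> x \<and> \<xi> - r \<in> distr_L \<G> x)"

definition J_op ::
  "('m, 'e::euclidean_space, 'p, 'q::euclidean_space, 'n::finite) geometry \<Rightarrow> 'm \<Rightarrow> 'e \<Rightarrow> 'e" where
  "J_op \<G> x \<xi> = comp_L \<G> x \<xi> - comp_R \<G> x \<xi>"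

text \<open>An identification of \<open>T\<^sub>xM / T\<^sub>x\<^sup>-\<^sup>1M\<close> with the real line is given by a linear functional on
  \<open>T\<^sub>xM\<close> with kernel \<open>T\<^sub>x\<^sup>-\<^sup>1M\<close>; each of them yields a pseudometric from the class \<open>g\<close> at \<open>x\<close>.\<close>

definition transversal_identification ::
  "('m, 'e::euclidean_space, 'p, 'q::euclidean_space, 'n::finite) geometry \<Rightarrow> 'm \<Rightarrow> ('e \<Rightarrow> real) \<Rightarrow> bool" where
  "transversal_identification \<G> x \<theta> \<longleftrightarrow> linear \<theta> \<and> (\<forall>\<xi>. \<theta> \<xi> = 0 \<longleftrightarrow> \<xi> \<in> contact_distr \<G> x)"

definition contact_metric ::
  "('m::topological_space, 'e::euclidean_space, 'p, 'q::euclidean_space, 'n::finite) geometry \<Rightarrow>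
   'm \<Rightarrow> ('e \<Rightarrow> real) \<Rightarrow> 'e \<Rightarrow> 'e \<Rightarrow> real" where
  "contact_metric \<G> x \<theta> \<xi> \<eta> = the_elem (\<theta> ` levi \<G> x \<xi> (J_op \<G> x \<eta>))"


section \<open>Symmetries\<close>

definition local_diffeo ::
  "('m::topological_space, 'e::euclidean_space) chart set \<Rightarrow> 'm set \<Rightarrow> ('m \<Rightarrow> 'm) \<Rightarrow> bool" where
  "local_diffeo A U s \<longleftrightarrow> open U \<and> open (s ` U) \<and> inj_on s U \<and>
     smooth_map A A U s \<and> smooth_map A A (s ` U) (inv_into U s)"

definition local_automorphism ::
  "('m::topological_space, 'e::euclidean_space, 'p::topological_space, 'q::euclidean_space, 'n::finite)
     geometry \<Rightarrow> 'm set \<Rightarrow> ('m \<Rightarrow> 'm) \<Rightarrow> ('p \<Rightarrow> 'p) \<Rightarrow> bool" where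
  "local_automorphism \<G> U s \<phi> \<longleftrightarrow>
     local_diffeo (base_atlas \<G>) U s \<and>
     smooth_map (total_atlas \<G>) (total_atlas \<G>) (proj \<G> -` U) \<phi> \<and>
     (\<forall>u\<in>proj \<G> -` U. proj \<G> (\<phi> u) = s (proj \<G> u) \<and>
        (\<forall>a\<in>P_grp. \<phi> (ract \<G> u a) = ract \<G> (\<phi> u) a) \<and>
        (\<forall>\<xi>. conn \<G> (\<phi> u) (tangent_map (total_atlas \<G>) (total_atlas \<G>) \<phi> u \<xi>) = conn \<G> u \<xi>))"

text \<open>\<open>s\<close>, defined on the neighborhood \<open>U\<close> of \<open>x\<close>, is a symmetry at \<open>x\<close> covered by \<open>\<phi>\<close>.\<close>

definition symmetry_at ::
  "('m::topological_space, 'e::euclidean_space, 'p::topological_space, 'q::euclidean_space, 'n::finite)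
     geometry \<Rightarrow> 'm \<Rightarrow> 'm set \<Rightarrow> ('m \<Rightarrow> 'm) \<Rightarrow> ('p \<Rightarrow> 'p) \<Rightarrow> bool" where
  "symmetry_at \<G> x U s \<phi> \<longleftrightarrow> x \<in> U \<and> local_automorphism \<G> U s \<phi> \<and> s x = x \<and>
     (\<forall>\<xi>\<in>contact_distr \<G> x. tangent_map (base_atlas \<G>) (base_atlas \<G>) s x \<xi> = - \<xi>)"

definition symmetric_geometry ::
  "('m::topological_space, 'e::euclidean_space, 'p::topological_space, 'q::euclidean_space, 'n::finite)
     geometry \<Rightarrow> bool" where
  "symmetric_geometry \<G> \<longleftrightarrow> (\<forall>x. \<exists>U s \<phi>. symmetry_at \<G> x U s \<phi>)"

definition involutive_at :: "'m::topological_space \<Rightarrow> ('m \<Rightarrow> 'm) \<Rightarrow> bool" where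
  "involutive_at x s \<longleftrightarrow> (\<forall>\<^sub>F y in nhds x. s (s y) = y)"

definition same_germ :: "'m::topological_space \<Rightarrow> ('m \<Rightarrow> 'm) \<Rightarrow> ('m \<Rightarrow> 'm) \<Rightarrow> bool" where
  "same_germ x s s' \<longleftrightarrow> (\<forall>\<^sub>F y in nhds x. s y = s' y)"


section \<open>Weyl structures\<close>

text \<open>Points of \<open>\<G>\<^sub>0 = \<G>/P\<^sub>+\<close> are \<open>P\<^sub>+\<close>-orbits.  Since \<open>\<G> \<rightarrow> \<G>\<^sub>0\<close> is a surjective submersion, a map
  on \<open>\<G>\<^sub>0\<close> is smooth iff its composition with this projection is.\<close>

definition orbit_plus :: "('m, 'e, 'p, 'q, 'n::finite) geometry \<Rightarrow> 'p \<Rightarrow> 'p set" where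
  "orbit_plus \<G> u = (\<lambda>a. ract \<G> u a) ` Pplus_grp"

definition bundle0 :: "('m, 'e, 'p, 'q, 'n::finite) geometry \<Rightarrow> 'p set set" where
  "bundle0 \<G> = range (orbit_plus \<G>)"

definition ract0 :: "('m, 'e, 'p, 'q, 'n::finite) geometry \<Rightarrow> 'p set \<Rightarrow> 'n matr set \<Rightarrow> 'p set" where
  "ract0 \<G> u\<^sub>0 a = (\<lambda>u. ract \<G> u a) ` u\<^sub>0"

definition weyl_structure ::
  "('m, 'e, 'p::topological_space, 'q::euclidean_space, 'n::finite) geometry \<Rightarrow>
   ('p set \<Rightarrow> 'p) \<Rightarrow> bool" where
  "weyl_structure \<G> \<sigma> \<longleftrightarrow>
     (\<forall>u\<^sub>0\<in>bundle0 \<G>. \<sigma> u\<^sub>0 \<in> u\<^sub>0) \<and>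
     (\<forall>u\<^sub>0\<in>bundle0 \<G>. \<forall>a\<in>G0_grp. \<sigma> (ract0 \<G> u\<^sub>0 a) = ract \<G> (\<sigma> u\<^sub>0) a) \<and>
     smooth_map (total_atlas \<G>) (total_atlas \<G>) UNIV (\<lambda>u. \<sigma> (orbit_plus \<G> u))"

text \<open>The induced map on \<open>\<G>\<^sub>0\<close> sends an orbit \<open>u\<^sub>0\<close> to its image under \<open>\<phi>\<close>.\<close>

definition weyl_invariant_at ::
  "('m, 'e, 'p, 'q, 'n::finite) geometry \<Rightarrow> 'm \<Rightarrow> ('p \<Rightarrow> 'p) \<Rightarrow> ('p set \<Rightarrow> 'p) \<Rightarrow> bool" where
  "weyl_invariant_at \<G> x \<phi> \<sigma> \<longleftrightarrow>
     (\<forall>u. proj \<G> u = x \<longrightarrow>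
        \<phi> (\<sigma> (orbit_plus \<G> u)) = \<sigma> (\<phi> ` orbit_plus \<G> u))"

definition G0_equivariant ::
  "('m, 'e, 'p, 'q, 'n::finite) geometry \<Rightarrow> int \<Rightarrow> ('p set \<Rightarrow> 'n matr) \<Rightarrow> bool" where
  "G0_equivariant \<G> k \<Upsilon> \<longleftrightarrow>
     (\<forall>u\<^sub>0\<in>bundle0 \<G>. \<Upsilon> u\<^sub>0 \<in> grade k \<and>
        (\<forall>a\<in>G0_grp. \<Upsilon> (ract0 \<G> u\<^sub>0 a) = Ad (m_inv PGL a) (\<Upsilon> u\<^sub>0)))"

definition weyl_change ::
  "('m, 'e, 'p, 'q, 'n::finite) geometry \<Rightarrow> ('p set \<Rightarrow> 'p) \<Rightarrow> ('p set \<Rightarrow> 'n matr) \<Rightarrow>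
   ('p set \<Rightarrow> 'n matr) \<Rightarrow> 'p set \<Rightarrow> 'p" where
  "weyl_change \<G> \<sigma> \<Upsilon>\<^sub>1 \<Upsilon>\<^sub>2 u\<^sub>0 =
     ract \<G> (ract \<G> (\<sigma> u\<^sub>0) (cls (mat_exp (\<Upsilon>\<^sub>1 u\<^sub>0)))) (cls (mat_exp (\<Upsilon>\<^sub>2 u\<^sub>0)))"

text \<open>The covector on \<open>T\<^sub>x\<^sup>-\<^sup>1M\<close> corresponding to \<open>\<Upsilon>\<^sub>1\<close> under
  \<open>\<G>\<^sub>0 \<times>\<^bsub>G\<^sub>0\<^esub> \<gg>\<^sub>1 \<cong> (T\<^sup>-\<^sup>1M)\<^sup>*\<close>, and its image in \<open>T\<^sub>x\<^sup>-\<^sup>1M\<close> under the metric.\<close>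

definition covector_at ::
  "('m, 'e::euclidean_space, 'p, 'q::euclidean_space, 'n::finite) geometry \<Rightarrow> 'm \<Rightarrow>
   ('p set \<Rightarrow> 'n matr) \<Rightarrow> 'e \<Rightarrow> real" where
  "covector_at \<G> x \<Upsilon> \<xi> = (THE t. \<exists>u X. proj \<G> u = x \<and> X \<in> filt (-1) \<and> frame_vec \<G> u X = \<xi> \<and>
     t = pairing (\<Upsilon> (orbit_plus \<G> u)) X)"

definition sharp ::
  "('m::topological_space, 'e::euclidean_space, 'p, 'q::euclidean_space, 'n::finite) geometry \<Rightarrow>
   'm \<Rightarrow> ('e \<Rightarrow> real) \<Rightarrow> ('e \<Rightarrow> real) \<Rightarrow> 'e" where
  "sharp \<G> x \<theta> \<alpha> = (THE v. v \<in> contact_distr \<G> x \<and>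
     (\<forall>\<xi>\<in>contact_distr \<G> x. contact_metric \<G> x \<theta> v \<xi> = \<alpha> \<xi>))"

end

theory Submission
  imports Defs
begin

text \<open>The harmonic curvature is the class of \<open>\<kappa>\<close> in \<open>ker \<partial>\<^sup>* / im \<partial>\<^sup>*\<close>, and \<open>P\<^sub>+\<close> acts trivially on this
quotient: for \<open>Z \<in> \<pp>\<^sub>+\<close> and a coclosed cochain \<open>\<psi>\<close> the derivative \<open>Z \<cdot> \<psi>\<close> is \<open>- \<partial>\<^sup>*(Z \<and> \<psi>)\<close>
(\<open>homotopy_formula\<close>).  So for a linear functional \<open>l\<close> on cochains that annihilates \<open>im \<partial>\<^sup>*\<close> the function
\<open>f\<^sub>l(u) = l(\<kappa>(u))\<close> on the total space is constant along the \<open>P\<^sub>+\<close>-orbits (\<open>curv_fun_unipotent\<close>), and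
it is preserved by automorphisms (\<open>automorphism_K\<close>).  Since such functionals separate cochains from
\<open>im \<partial>\<^sup>*\<close> (\<open>im_codiff_separation\<close>), it has to be shown that \<open>f\<^sub>l\<close> vanishes on the fibre over \<open>x\<close>.

The two symmetries provide a derivative of \<open>f\<^sub>l\<close>.  In the frame \<open>w = \<sigma>(u\<^sub>0)\<close> given by an invariant Weyl
structure, a symmetry is right multiplication by the class of \<open>D = diag(1, -1, 1)\<close>
(\<open>symmetry_weyl\<close>).  As \<open>D\<close> anticommutes with \<open>\<Upsilon>\<^sub>1\<close> and commutes with \<open>\<Upsilon>\<^sub>2\<close>, the composition of both
symmetries moves \<open>w\<close> to \<open>w C\<close> with \<open>C = exp(2 \<Upsilon>\<^sub>1)\<close> (\<open>symmetry_product\<close>).  Hence the derivatives of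
\<open>f\<^sub>l\<close> at \<open>w\<close> along the tangent vectors \<open>\<omega>\<^sup>-\<^sup>1(X)\<close> and \<open>\<omega>\<^sup>-\<^sup>1(C X C\<^sup>-\<^sup>1)\<close> agree for each \<open>X \<in> \<gg>\<close>.  Take
for \<open>X\<close> the transpose of \<open>\<Upsilon>\<^sub>1\<close> with its two components interchanged.  Then \<open>[\<Upsilon>\<^sub>1, X] = c E\<close>, where \<open>E\<close> is the
grading element and \<open>c\<close> is the product of the row and the column of \<open>\<Upsilon>\<^sub>1\<close>, so
\<open>C X C\<^sup>-\<^sup>1 = X + 2 c (E - \<Upsilon>\<^sub>1)\<close> (\<open>conj_opposite\<close>).  The hypothesis on \<open>g\<close> says exactly that \<open>c \<noteq> 0\<close>
(\<open>metric_condition\<close>), and the derivative along \<open>\<Upsilon>\<^sub>1 \<in> \<pp>\<^sub>+\<close> is zero anyway.  So the derivative of \<open>f\<^sub>l\<close>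
along \<open>E\<close> is zero on the whole fibre over \<open>x\<close> (\<open>grading_derivative_vanishes\<close>).

Consequently \<open>f\<^sub>l\<close> is constant along \<open>u exp(t E)\<close>.  On the other hand the component of homogeneity \<open>k\<close> of
\<open>\<kappa>\<close> is multiplied by \<open>exp(- k t)\<close> along this curve.  No cochain has components with \<open>k < 0\<close>, and
\<open>\<partial>\<^sup>* \<kappa> = 0\<close> excludes \<open>k = 0\<close> (\<open>coclosed_homogeneity_0\<close>).  Letting \<open>t\<close> tend to infinity gives
\<open>f\<^sub>l(u) = 0\<close> (\<open>curvature_boundary\<close>).\<close>

section \<open>Calculus on open sets of Euclidean spaces\<close>

lemma frechet_derivative_cong_open:
  assumes "open S" "x \<in> S" "\<And>y. y \<in> S \<Longrightarrow> f y = g y"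
  shows "frechet_derivative f (at x) = frechet_derivative g (at x)"
proof -
  have "(f has_derivative D) (at x) \<longleftrightarrow> (g has_derivative D) (at x)" for D
    using has_derivative_transform_within_open[OF _ assms(1,2), of f D UNIV g]
          has_derivative_transform_within_open[OF _ assms(1,2), of g D UNIV f] assms(3) by auto
  then show ?thesis by (simp add: frechet_derivative_def)
qed

lemma frechet_derivative_eqI: "(f has_derivative D) (at x) \<Longrightarrow> frechet_derivative f (at x) = D"
  by (metis frechet_derivative_at)

lemma differentiable_on_open_at:
  "open S \<Longrightarrow> f differentiable_on S \<longleftrightarrow> (\<forall>x\<in>S. f differentiable (at x))"
  by (auto simp: differentiable_on_def at_within_open_NO_MATCH)

lemma Ck_on_cong:
  assumes "open S"
  shows "(\<And>x. x \<in> S \<Longrightarrow> f x = g x) \<Longrightarrow> Ck_on k S f \<Longrightarrow> Ck_on k S g"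
proof (induction k arbitrary: f g)
  case 0 then show ?case by (auto cong: continuous_on_cong)
next
  case (Suc k)
  have "g differentiable (at x)" if x: "x \<in> S" for x
  proof -
    have "(f has_derivative frechet_derivative f (at x)) (at x)"
      using Suc.prems(2) x by (simp add: differentiable_on_open_at[OF assms] frechet_derivative_works)
    then have "(g has_derivative frechet_derivative f (at x)) (at x)"
      by (rule has_derivative_transform_within_open[OF _ assms x]) (rule Suc.prems(1))
    then show ?thesis unfolding differentiable_def by blast
  qed
  then have "g differentiable_on S" by (simp add: differentiable_on_open_at[OF assms])
  moreover have "Ck_on k S (\<lambda>x. frechet_derivative g (at x) v)" for v
    apply (rule Suc.IH[of "\<lambda>x. frechet_derivative f (at x) v"])
    using Suc.prems frechet_derivative_cong_open[OF assms, of _ f g] by auto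
  ultimately show ?case by simp
qed

lemma Ck_on_local:
  assumes "open S" "\<And>x. x \<in> S \<Longrightarrow> \<exists>U. open U \<and> x \<in> U \<and> Ck_on k U f"
  shows "Ck_on k S f"
  using assms(2)
proof (induction k arbitrary: f)
  case 0
  have "continuous (at x) f" if "x \<in> S" for x
    using 0[OF that] by (auto simp: continuous_on_eq_continuous_at)
  then show ?case by (simp add: continuous_at_imp_continuous_on)
next
  case (Suc k)
  have "f differentiable (at x)" if "x \<in> S" for x
    using Suc.prems[OF that] by (auto simp: differentiable_on_open_at)
  moreover have "Ck_on k S (\<lambda>x. frechet_derivative f (at x) v)" for v
    by (rule Suc.IH) (use Suc.prems in force)
  ultimately show ?case by (simp add: differentiable_on_open_at[OF assms(1)])
qed

lemma Ck_on_subset: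
  assumes "open T" "T \<subseteq> S" "open S"
  shows "Ck_on k S f \<Longrightarrow> Ck_on k T f"
  using Ck_on_local[OF assms(1)] assms by blast

lemma smooth_on_open:
  assumes "open S"
  shows "smooth_on S f \<longleftrightarrow> (\<forall>k. Ck_on k S f)"
proof
  assume L: "smooth_on S f"
  show "\<forall>k. Ck_on k S f"
  proof (intro allI Ck_on_local[OF assms])
    fix k x assume "x \<in> S"
    then obtain U h where U: "open U" "x \<in> U" "\<forall>k. Ck_on k U h" "\<forall>y\<in>U \<inter> S. h y = f y"
      using L unfolding smooth_on_def by blast
    have "Ck_on k (U \<inter> S) h" using U assms by (intro Ck_on_subset[of "U \<inter> S" U]) auto
    then have "Ck_on k (U \<inter> S) f" using U assms by (intro Ck_on_cong[of "U \<inter> S" h f]) auto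
    then show "\<exists>U. open U \<and> x \<in> U \<and> Ck_on k U f" using U assms \<open>x \<in> S\<close> by blast
  qed
next
  assume "\<forall>k. Ck_on k S f" then show "smooth_on S f" using assms unfolding smooth_on_def by blast
qed

lemma smooth_on_subset:
  assumes "smooth_on S f" "T \<subseteq> S"
  shows "smooth_on T f"
  unfolding smooth_on_def
proof
  fix x assume "x \<in> T"
  then obtain U h where "open U" "x \<in> U" "\<forall>k. Ck_on k U h" "\<forall>y\<in>U \<inter> S. h y = f y"
    using assms unfolding smooth_on_def by (meson subsetD)
  then show "\<exists>U h. open U \<and> x \<in> U \<and> (\<forall>k. Ck_on k U h) \<and> (\<forall>y\<in>U \<inter> T. h y = f y)"
    using assms(2) by (intro exI[of _ U] exI[of _ h]) auto
qed

lemma smooth_on_has_derivative: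
  assumes "open S" "smooth_on S f" "x \<in> S"
  shows "(f has_derivative frechet_derivative f (at x)) (at x)"
proof -
  have "Ck_on (Suc 0) S f" using assms smooth_on_open by blast
  then show ?thesis using assms by (auto simp: differentiable_on_open_at frechet_derivative_works)
qed

lemma smooth_on_derivative:
  assumes "open S" "smooth_on S f"
  shows "smooth_on S (\<lambda>x. frechet_derivative f (at x) v)"
proof -
  have "Ck_on (Suc k) S f" for k using assms smooth_on_open by blast
  then show ?thesis by (simp add: smooth_on_open[OF assms(1)])
qed

lemma smooth_on_imp_continuous_on: "open S \<Longrightarrow> smooth_on S f \<Longrightarrow> continuous_on S f"
  using smooth_on_open[of S f] Ck_on.simps(1) by metis

text \<open>The second difference of \<open>f\<close> over the parallelogram spanned by \<open>h v\<close> and \<open>h w\<close>: the mean value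
theorem is applied in the direction \<open>v\<close> and then, to the resulting derivative, in the direction \<open>w\<close>.\<close>

lemma double_mvt:
  fixes f :: "'a::real_normed_vector \<Rightarrow> real"
  assumes f1: "\<And>y. y \<in> ball x e \<Longrightarrow> (f has_derivative f1 y) (at y)"
    and f2: "\<And>y. y \<in> ball x e \<Longrightarrow> ((\<lambda>y. f1 y v) has_derivative f2 y) (at y)"
    and h: "h > 0" "h * (norm v + norm w) < e"
  shows "\<exists>s t. 0 \<le> s \<and> s \<le> h \<and> 0 \<le> t \<and> t \<le> h \<and>
    f (x + h *\<^sub>R v + h *\<^sub>R w) - f (x + h *\<^sub>R v) - f (x + h *\<^sub>R w) + f x
      = h * h * f2 (x + s *\<^sub>R v + t *\<^sub>R w) w"
proof -
  have inb: "x + s *\<^sub>R v + t *\<^sub>R w \<in> ball x e" if "0 \<le> s" "s \<le> h" "0 \<le> t" "t \<le> h" for s t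
  proof -
    have "norm (s *\<^sub>R v + t *\<^sub>R w) \<le> s * norm v + t * norm w"
      using norm_triangle_ineq[of "s *\<^sub>R v" "t *\<^sub>R w"] that by simp
    also have "\<dots> \<le> h * (norm v + norm w)"
      using that by (simp add: distrib_left add_mono mult_right_mono)
    finally have "dist (x + (s *\<^sub>R v + t *\<^sub>R w)) x < e" using h by (simp add: dist_norm)
    then show ?thesis by (simp add: dist_commute add.assoc)
  qed
  have inb0: "x + s *\<^sub>R v \<in> ball x e" if "0 \<le> s" "s \<le> h" for s
    using inb[OF that, of 0] h by simp
  let ?g = "\<lambda>s. f (x + s *\<^sub>R v + h *\<^sub>R w) - f (x + s *\<^sub>R v)"
  have dg: "DERIV ?g s :> f1 (x + s *\<^sub>R v + h *\<^sub>R w) v - f1 (x + s *\<^sub>R v) v" if "0 \<le> s" "s \<le> h" for s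
  proof -
    have a: "((\<lambda>s. x + s *\<^sub>R v + h *\<^sub>R w) has_derivative (\<lambda>r. r *\<^sub>R v)) (at s)"
      "((\<lambda>s. x + s *\<^sub>R v) has_derivative (\<lambda>r. r *\<^sub>R v)) (at s)"
      by (auto intro!: derivative_eq_intros)
    have l: "f1 y (r *\<^sub>R v) = r * f1 y v" if "y \<in> ball x e" for y r
      using f1[OF that] by (simp add: has_derivative_bounded_linear linear_simps)
    have l1: "f1 (x + s *\<^sub>R v + h *\<^sub>R w) (r *\<^sub>R v) = r * f1 (x + s *\<^sub>R v + h *\<^sub>R w) v" for r
      by (rule l[OF inb]) (use that h in auto)
    have l2: "f1 (x + s *\<^sub>R v) (r *\<^sub>R v) = r * f1 (x + s *\<^sub>R v) v" for r
      by (rule l[OF inb0]) (use that h in auto)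
    show ?thesis
      unfolding has_field_derivative_def
      apply (rule has_derivative_eq_rhs)
      apply (rule has_derivative_diff)
      apply (rule has_derivative_compose[OF a(1) f1]) using inb that h apply simp
      apply (rule has_derivative_compose[OF a(2) f1]) using inb0 that h apply simp
      apply (rule ext) by (simp only: l1 l2) (simp add: algebra_simps)
  qed
  obtain s where s: "0 < s" "s < h"
    "?g h - ?g 0 = (h - 0) * (f1 (x + s *\<^sub>R v + h *\<^sub>R w) v - f1 (x + s *\<^sub>R v) v)"
    using MVT2[OF h(1), of ?g, OF dg] by blast
  let ?k = "\<lambda>t. f1 (x + s *\<^sub>R v + t *\<^sub>R w) v"
  have dk: "DERIV ?k t :> f2 (x + s *\<^sub>R v + t *\<^sub>R w) w" if "0 \<le> t" "t \<le> h" for t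
  proof -
    have a: "((\<lambda>t. x + s *\<^sub>R v + t *\<^sub>R w) has_derivative (\<lambda>r. r *\<^sub>R w)) (at t)"
      by (auto intro!: derivative_eq_intros)
    have l: "f2 y (r *\<^sub>R w) = r * f2 y w" if "y \<in> ball x e" for y r
      using f2[OF that] by (simp add: has_derivative_bounded_linear linear_simps)
    have l1: "f2 (x + s *\<^sub>R v + t *\<^sub>R w) (r *\<^sub>R w) = r * f2 (x + s *\<^sub>R v + t *\<^sub>R w) w" for r
      by (rule l[OF inb]) (use that s in auto)
    show ?thesis
      unfolding has_field_derivative_def
      apply (rule has_derivative_eq_rhs)
      apply (rule has_derivative_compose[OF a f2]) using inb that s apply simp
      apply (rule ext) by (simp only: l1) (simp add: algebra_simps)
  qed
  obtain t where t: "0 < t" "t < h" "?k h - ?k 0 = (h - 0) * f2 (x + s *\<^sub>R v + t *\<^sub>R w) w"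
    using MVT2[OF h(1), of ?k, OF dk] by blast
  show ?thesis
    apply (rule exI[of _ s], rule exI[of _ t])
    using s t by (simp add: algebra_simps)
qed

text \<open>The second difference does not change when \<open>v\<close> and \<open>w\<close> are exchanged, so both iterated derivatives
agree at points close to \<open>x\<close>, and continuity carries this to \<open>x\<close>.\<close>

lemma symmetric_second_derivative_real:
  fixes f :: "'a::euclidean_space \<Rightarrow> real"
  assumes S: "open S" "x \<in> S"
    and f1: "\<And>y. y \<in> S \<Longrightarrow> (f has_derivative f1 y) (at y)"
    and fv: "\<And>y. y \<in> S \<Longrightarrow> ((\<lambda>y. f1 y v) has_derivative fv y) (at y)"
    and fw: "\<And>y. y \<in> S \<Longrightarrow> ((\<lambda>y. f1 y w) has_derivative fw y) (at y)"
    and c: "continuous_on S (\<lambda>y. fv y w)" "continuous_on S (\<lambda>y. fw y v)"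
  shows "fv x w = fw x v"
proof (rule ccontr)
  assume ne: "fv x w \<noteq> fw x v"
  define d where "d = \<bar>fv x w - fw x v\<bar> / 2"
  have d: "d > 0" using ne by (simp add: d_def)
  obtain e0 where e0: "e0 > 0" "ball x e0 \<subseteq> S" using S openE by blast
  obtain e1 where e1: "e1 > 0" "\<And>y. y \<in> S \<Longrightarrow> dist y x < e1 \<Longrightarrow> \<bar>fv y w - fv x w\<bar> < d"
    using c(1) S d unfolding continuous_on_iff dist_real_def by meson
  obtain e2 where e2: "e2 > 0" "\<And>y. y \<in> S \<Longrightarrow> dist y x < e2 \<Longrightarrow> \<bar>fw y v - fw x v\<bar> < d"
    using c(2) S d unfolding continuous_on_iff dist_real_def by meson
  define e where "e = Min {e0, e1, e2}"
  have e: "e > 0" "e \<le> e0" "e \<le> e1" "e \<le> e2" using e0 e1 e2 by (auto simp: e_def)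
  define N where "N = norm v + norm w + 1"
  define h where "h = e / (2 * N)"
  have n: "N > 0" using norm_ge_zero[of v] norm_ge_zero[of w] unfolding N_def by linarith
  have h: "h > 0" "h * (norm v + norm w) < e"
  proof -
    show "h > 0" using e n by (simp add: h_def)
    have "h * (norm v + norm w) \<le> h * N" using \<open>h > 0\<close> by (simp add: N_def)
    also have "\<dots> = e / 2" using n by (simp add: h_def)
    finally show "h * (norm v + norm w) < e" using e by simp
  qed
  have bS: "y \<in> S" if "y \<in> ball x e" for y using that e e0 by auto
  obtain s t where st: "0 \<le> s" "s \<le> h" "0 \<le> t" "t \<le> h"
    "f (x + h *\<^sub>R v + h *\<^sub>R w) - f (x + h *\<^sub>R v) - f (x + h *\<^sub>R w) + f x
      = h * h * fv (x + s *\<^sub>R v + t *\<^sub>R w) w"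
    using double_mvt[of x e f f1 v fv h w] f1 fv bS h by metis
  obtain s' t' where st': "0 \<le> s'" "s' \<le> h" "0 \<le> t'" "t' \<le> h"
    "f (x + h *\<^sub>R w + h *\<^sub>R v) - f (x + h *\<^sub>R w) - f (x + h *\<^sub>R v) + f x
      = h * h * fw (x + s' *\<^sub>R w + t' *\<^sub>R v) v"
    using double_mvt[of x e f f1 w fw h v] f1 fw bS h by (metis add.commute)
  have eq: "fv (x + s *\<^sub>R v + t *\<^sub>R w) w = fw (x + s' *\<^sub>R w + t' *\<^sub>R v) v"
    using st(5) st'(5) h by (simp add: algebra_simps)
  have near: "dist (x + a *\<^sub>R v + b *\<^sub>R w) x < e" if "0 \<le> a" "a \<le> h" "0 \<le> b" "b \<le> h" for a b
  proof -
    have "dist (x + a *\<^sub>R v + b *\<^sub>R w) x = norm (a *\<^sub>R v + b *\<^sub>R w)" by (simp add: dist_norm add.assoc)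
    also have "\<dots> \<le> a * norm v + b * norm w"
      using norm_triangle_ineq[of "a *\<^sub>R v" "b *\<^sub>R w"] that by simp
    also have "\<dots> \<le> h * (norm v + norm w)"
      using that by (simp add: distrib_left add_mono mult_right_mono)
    finally show ?thesis using h by simp
  qed
  have 1: "dist (x + s *\<^sub>R v + t *\<^sub>R w) x < e" using near st by blast
  have 2: "dist (x + s' *\<^sub>R w + t' *\<^sub>R v) x < e" using near[of t' s'] st' by (simp add: algebra_simps)
  have "\<bar>fv (x + s *\<^sub>R v + t *\<^sub>R w) w - fv x w\<bar> < d"
    using e1(2) 1 bS e by (simp add: dist_commute)
  moreover have "\<bar>fw (x + s' *\<^sub>R w + t' *\<^sub>R v) v - fw x v\<bar> < d"
    using e2(2) 2 bS e by (simp add: dist_commute)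
  ultimately have "\<bar>fv x w - fw x v\<bar> < 2 * d" using eq by linarith
  then show False by (simp add: d_def)
qed

lemma symmetric_second_derivative:
  fixes f :: "'a::euclidean_space \<Rightarrow> 'b::euclidean_space"
  assumes S: "open S" "smooth_on S f" "x \<in> S"
  shows "frechet_derivative (\<lambda>y. frechet_derivative f (at y) v) (at x) w =
         frechet_derivative (\<lambda>y. frechet_derivative f (at y) w) (at x) v"
proof (rule euclidean_eqI)
  fix i :: 'b assume "i \<in> Basis"
  let ?d = "\<lambda>y. frechet_derivative f (at y)"
  let ?d2 = "\<lambda>v y. frechet_derivative (\<lambda>y. ?d y v) (at y)"
  have c: "continuous_on S (\<lambda>y. ?d2 v y w \<bullet> i)" for v w
    by (intro continuous_intros smooth_on_imp_continuous_on smooth_on_derivative S)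
  have d2: "((\<lambda>y. ?d y v \<bullet> i) has_derivative (\<lambda>u. ?d2 v y u \<bullet> i)) (at y)" if "y \<in> S" for y v
    by (intro has_derivative_inner_left smooth_on_has_derivative[OF S(1) smooth_on_derivative[OF S(1,2)] that])
  show "?d2 v x w \<bullet> i = ?d2 w x v \<bullet> i"
    by (rule symmetric_second_derivative_real[OF S(1,3),
          of "\<lambda>y. f y \<bullet> i" "\<lambda>y u. ?d y u \<bullet> i" v "\<lambda>y u. ?d2 v y u \<bullet> i" w "\<lambda>y u. ?d2 w y u \<bullet> i"])
       (auto intro!: has_derivative_inner_left smooth_on_has_derivative[OF S(1,2)] d2 c)
qed

text \<open>Linear maps are expanded in a basis, which reduces this product rule to finitely many scalar multiples.
Differentiability is required for each argument \<open>v\<close> separately, because one-forms on a manifold are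
given in this way.\<close>

lemma has_derivative_apply_family:
  fixes \<beta> :: "'b::euclidean_space \<Rightarrow> 'c::euclidean_space \<Rightarrow> 'v::real_normed_vector"
  assumes \<Omega>: "open \<Omega>" "\<gamma> x \<in> \<Omega>" and lin: "\<And>y. y \<in> \<Omega> \<Longrightarrow> linear (\<beta> y)"
    and diff: "\<And>v. (\<lambda>y. \<beta> y v) differentiable (at (\<gamma> x))"
    and \<gamma>: "(\<gamma> has_derivative \<gamma>') (at x)" and \<eta>: "(\<eta> has_derivative \<eta>') (at x)"
  shows "((\<lambda>x. \<beta> (\<gamma> x) (\<eta> x)) has_derivative
    (\<lambda>h. frechet_derivative (\<lambda>y. \<beta> y (\<eta> x)) (at (\<gamma> x)) (\<gamma>' h) + \<beta> (\<gamma> x) (\<eta>' h))) (at x)"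
proof -
  have ex: "\<beta> y v = (\<Sum>b\<in>Basis. (v \<bullet> b) *\<^sub>R \<beta> y b)" if "y \<in> \<Omega>" for y v
  proof -
    have "\<beta> y v = \<beta> y (\<Sum>b\<in>Basis. (v \<bullet> b) *\<^sub>R b)" by (simp add: euclidean_representation)
    also have "\<dots> = (\<Sum>b\<in>Basis. (v \<bullet> b) *\<^sub>R \<beta> y b)"
      using lin[OF that] by (simp add: linear_sum linear_scale o_def)
    finally show ?thesis .
  qed
  have db: "((\<lambda>y. \<beta> y v) has_derivative frechet_derivative (\<lambda>y. \<beta> y v) (at (\<gamma> x))) (at (\<gamma> x))" for v
    using diff frechet_derivative_works by blast
  have D1: "frechet_derivative (\<lambda>y. \<beta> y v) (at (\<gamma> x)) =
     (\<lambda>h. \<Sum>b\<in>Basis. (v \<bullet> b) *\<^sub>R frechet_derivative (\<lambda>y. \<beta> y b) (at (\<gamma> x)) h)" for v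
  proof (rule frechet_derivative_eqI)
    have "((\<lambda>y. \<Sum>b\<in>Basis. (v \<bullet> b) *\<^sub>R \<beta> y b) has_derivative
      (\<lambda>h. \<Sum>b\<in>Basis. (v \<bullet> b) *\<^sub>R frechet_derivative (\<lambda>y. \<beta> y b) (at (\<gamma> x)) h)) (at (\<gamma> x))"
      by (intro has_derivative_sum has_derivative_scaleR_right db)
    then show "((\<lambda>y. \<beta> y v) has_derivative
      (\<lambda>h. \<Sum>b\<in>Basis. (v \<bullet> b) *\<^sub>R frechet_derivative (\<lambda>y. \<beta> y b) (at (\<gamma> x)) h)) (at (\<gamma> x))"
      by (rule has_derivative_transform_within_open[OF _ \<Omega>]) (simp add: ex[symmetric])
  qed
  have "((\<lambda>x. \<Sum>b\<in>Basis. (\<eta> x \<bullet> b) *\<^sub>R \<beta> (\<gamma> x) b) has_derivative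
    (\<lambda>h. \<Sum>b\<in>Basis. (\<eta> x \<bullet> b) *\<^sub>R frechet_derivative (\<lambda>y. \<beta> y b) (at (\<gamma> x)) (\<gamma>' h)
         + (\<eta>' h \<bullet> b) *\<^sub>R \<beta> (\<gamma> x) b)) (at x)"
    by (intro has_derivative_sum has_derivative_scaleR has_derivative_inner_left \<eta>
        has_derivative_compose[OF \<gamma> db])
  also have "(\<lambda>h. \<Sum>b\<in>Basis. (\<eta> x \<bullet> b) *\<^sub>R frechet_derivative (\<lambda>y. \<beta> y b) (at (\<gamma> x)) (\<gamma>' h)
         + (\<eta>' h \<bullet> b) *\<^sub>R \<beta> (\<gamma> x) b)
    = (\<lambda>h. frechet_derivative (\<lambda>y. \<beta> y (\<eta> x)) (at (\<gamma> x)) (\<gamma>' h) + \<beta> (\<gamma> x) (\<eta>' h))"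
    by (simp add: sum.distrib D1[of "\<eta> x"] ex[OF \<Omega>(2), of "\<eta>' _"])
  finally have d: "((\<lambda>x. \<Sum>b\<in>Basis. (\<eta> x \<bullet> b) *\<^sub>R \<beta> (\<gamma> x) b) has_derivative
    (\<lambda>h. frechet_derivative (\<lambda>y. \<beta> y (\<eta> x)) (at (\<gamma> x)) (\<gamma>' h) + \<beta> (\<gamma> x) (\<eta>' h))) (at x)" .
  have "isCont \<gamma> x" using \<gamma> has_derivative_continuous by blast
  then have "\<forall>\<^sub>F y in at x. \<gamma> y \<in> \<Omega>" using \<Omega> unfolding continuous_at tendsto_def by blast
  then have "\<forall>\<^sub>F y in at x. (\<Sum>b\<in>Basis. (\<eta> y \<bullet> b) *\<^sub>R \<beta> (\<gamma> y) b) = \<beta> (\<gamma> y) (\<eta> y)"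
    by (rule eventually_mono) (rule ex[symmetric])
  then show ?thesis
    by (rule has_derivative_transform_eventually[OF d]) (use ex \<Omega> in auto)
qed

definition dform :: "('b::euclidean_space \<Rightarrow> 'b \<Rightarrow> 'v::real_normed_vector) \<Rightarrow> 'b \<Rightarrow> 'b \<Rightarrow> 'b \<Rightarrow> 'v" where
  "dform \<beta> y v w = frechet_derivative (\<lambda>y. \<beta> y w) (at y) v - frechet_derivative (\<lambda>y. \<beta> y v) (at y) w"

text \<open>Pulling back commutes with \<open>d\<close>, the second derivatives of \<open>g\<close> cancelling by symmetry.  The derivatives of
the pulled back form enter as derivatives along two lines only.  This makes the lemma applicable to an
extension \<open>g\<close> of the action of \<open>P\<close> on which the form is known only at points of \<open>P\<close>.\<close>

lemma dform_pullback:
  fixes g :: "'a::euclidean_space \<Rightarrow> 'b::euclidean_space" and \<beta> :: "'b \<Rightarrow> 'b \<Rightarrow> 'v::real_normed_vector"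
  assumes W: "open W" "smooth_on W g" "p \<in> W"
    and \<Omega>: "open \<Omega>" "g p \<in> \<Omega>" "\<And>y. y \<in> \<Omega> \<Longrightarrow> linear (\<beta> y)" "\<And>v. (\<lambda>y. \<beta> y v) differentiable (at (g p))"
    and D1: "((\<lambda>t. \<beta> (g (p + t *\<^sub>R v)) (frechet_derivative g (at (p + t *\<^sub>R v)) w)) has_vector_derivative D1) (at 0)"
    and D2: "((\<lambda>t. \<beta> (g (p + t *\<^sub>R w)) (frechet_derivative g (at (p + t *\<^sub>R w)) v)) has_vector_derivative D2) (at 0)"
  shows "dform \<beta> (g p) (frechet_derivative g (at p) v) (frechet_derivative g (at p) w) = D1 - D2"
proof -
  let ?g = "\<lambda>q. frechet_derivative g (at q)"
  have main: "((\<lambda>t. \<beta> (g (p + t *\<^sub>R v)) (?g (p + t *\<^sub>R v) w)) has_vector_derivative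
      (frechet_derivative (\<lambda>y. \<beta> y (?g p w)) (at (g p)) (?g p v) +
       \<beta> (g p) (frechet_derivative (\<lambda>q. ?g q w) (at p) v))) (at 0)" for v w
  proof -
    have 0: "((\<lambda>t. p + t *\<^sub>R v) has_derivative (\<lambda>r. r *\<^sub>R v)) (at 0)"
      by (auto intro!: derivative_eq_intros)
    have g1: "(g has_derivative ?g p) (at (p + 0 *\<^sub>R v))" using smooth_on_has_derivative[OF W] by simp
    have g2: "((\<lambda>q. ?g q w) has_derivative frechet_derivative (\<lambda>q. ?g q w) (at p)) (at (p + 0 *\<^sub>R v))"
      using smooth_on_has_derivative[OF W(1) smooth_on_derivative[OF W(1,2)] W(3)] by simp
    have c1: "((\<lambda>t. g (p + t *\<^sub>R v)) has_derivative (\<lambda>r. ?g p (r *\<^sub>R v))) (at 0)"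
      by (rule has_derivative_compose[OF 0 g1])
    have c2: "((\<lambda>t. ?g (p + t *\<^sub>R v) w) has_derivative
               (\<lambda>r. frechet_derivative (\<lambda>q. ?g q w) (at p) (r *\<^sub>R v))) (at 0)"
      by (rule has_derivative_compose[OF 0 g2])
    have d: "((\<lambda>t. \<beta> (g (p + t *\<^sub>R v)) (?g (p + t *\<^sub>R v) w)) has_derivative
      (\<lambda>r. frechet_derivative (\<lambda>y. \<beta> y (?g p w)) (at (g p)) (?g p (r *\<^sub>R v)) +
           \<beta> (g p) (frechet_derivative (\<lambda>q. ?g q w) (at p) (r *\<^sub>R v)))) (at 0)"
      using has_derivative_apply_family[of \<Omega> "\<lambda>t. g (p + t *\<^sub>R v)" 0 \<beta>, OF \<Omega>(1) _ \<Omega>(3) _ c1 c2] \<Omega>(2,4)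
      by simp
    have l1: "linear (?g p)" using smooth_on_has_derivative[OF W] has_derivative_linear by blast
    have l2: "linear (frechet_derivative (\<lambda>y. \<beta> y (?g p w)) (at (g p)))"
      using \<Omega>(4) frechet_derivative_works has_derivative_linear by blast
    have l3: "linear (frechet_derivative (\<lambda>q. ?g q w) (at p))"
      using g2 has_derivative_linear by simp blast
    show ?thesis unfolding has_vector_derivative_def
      by (rule has_derivative_eq_rhs[OF d])
         (auto simp: fun_eq_iff linear_scale[OF l1] linear_scale[OF l2] linear_scale[OF l3]
            linear_scale[OF \<Omega>(3)[OF \<Omega>(2)]] scaleR_right_distrib)
  qed
  have "D1 = frechet_derivative (\<lambda>y. \<beta> y (?g p w)) (at (g p)) (?g p v) +
       \<beta> (g p) (frechet_derivative (\<lambda>q. ?g q w) (at p) v)"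
    using vector_derivative_unique_at[OF D1 main] .
  moreover have "D2 = frechet_derivative (\<lambda>y. \<beta> y (?g p v)) (at (g p)) (?g p w) +
       \<beta> (g p) (frechet_derivative (\<lambda>q. ?g q v) (at p) w)"
    using vector_derivative_unique_at[OF D2 main] .
  ultimately show ?thesis
    unfolding dform_def by (simp add: symmetric_second_derivative[OF W, of v w])
qed

text \<open>With a left inverse \<open>L\<close> of \<open>M(z\<^sub>0)\<close> the equation \<open>M(z) y = X\<close> reads \<open>y = L X + N(z) y\<close>, where
\<open>N(z) = id - L M(z)\<close> tends to zero.  This bounds \<open>y(z) - y(z\<^sub>0)\<close> and shows that \<open>N(z) y(z)\<close> has the same
first order part as \<open>N(z) y(z\<^sub>0)\<close>.  Applied to a Cartan connection it says that the vector fields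
\<open>\<omega>\<^sup>-\<^sup>1(X)\<close> are differentiable.\<close>

lemma differentiable_linear_solution:
  fixes M :: "'a::euclidean_space \<Rightarrow> 'b::euclidean_space \<Rightarrow> 'c::euclidean_space"
  assumes S: "open S" "z0 \<in> S" and lin: "\<And>z. z \<in> S \<Longrightarrow> linear (M z)"
    and diff: "\<And>v. (\<lambda>z. M z v) differentiable (at z0)"
    and inj: "inj (M z0)" and sol: "\<And>z. z \<in> S \<Longrightarrow> M z (y z) = X"
  shows "y differentiable (at z0)"
proof -
  have l0: "linear (M z0)" using lin S by blast
  obtain L where L: "linear L" "L \<circ> M z0 = id"
    using linear_injective_left_inverse[OF l0 inj] by blast
  have Lb: "bounded_linear L" using L linear_conv_bounded_linear by blast
  define N where "N z v = v - L (M z v)" for z v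
  have N0: "N z0 v = 0" for v using L(2) by (simp add: N_def fun_eq_iff)
  have linN: "linear (N z)" if "z \<in> S" for z
    unfolding N_def using lin[OF that] L(1)
    by (intro linear_compose_sub linear_id[unfolded id_def] linear_compose[of "M z" L, unfolded o_def])
  have diffN: "(\<lambda>z. N z v) differentiable (at z0)" for v
  proof -
    have "((\<lambda>z. N z v) has_derivative (\<lambda>h. 0 - L (frechet_derivative (\<lambda>z. M z v) (at z0) h))) (at z0)"
      unfolding N_def
      by (intro has_derivative_diff has_derivative_const
           bounded_linear.has_derivative[OF Lb] frechet_derivative_works[THEN iffD1] diff)
    then show ?thesis using differentiable_def by blast
  qed
  have yN: "y z = L X + N z (y z)" if "z \<in> S" for z using sol[OF that] by (simp add: N_def)
  have y0: "y z0 = L X" using yN[OF S(2)] N0 by simp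
  define B where "B z = (\<Sum>b\<in>Basis. norm (N z b))" for z
  have Bn: "norm (N z v) \<le> B z * norm v" if "z \<in> S" for z v
  proof -
    have "N z v = N z (\<Sum>b\<in>Basis. (v \<bullet> b) *\<^sub>R b)" by (simp add: euclidean_representation)
    also have "\<dots> = (\<Sum>b\<in>Basis. (v \<bullet> b) *\<^sub>R N z b)"
      using linN[OF that] by (simp add: linear_sum linear_scale)
    finally have "norm (N z v) \<le> (\<Sum>b\<in>Basis. norm ((v \<bullet> b) *\<^sub>R N z b))" by (simp only: norm_sum)
    also have "\<dots> \<le> (\<Sum>b\<in>Basis. norm v * norm (N z b))"
      by (intro sum_mono) (simp add: Basis_le_norm mult_right_mono)
    finally show ?thesis by (simp add: B_def sum_distrib_left mult.commute)
  qed
  have "isCont B z0" unfolding B_def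
    by (intro continuous_intros differentiable_imp_continuous_within diffN)
  then have Bt: "(B \<longlongrightarrow> 0) (at z0)" using N0 by (simp add: B_def isCont_def)
  have ineq: "norm (y z - y z0) \<le> B z * norm (y z - y z0) + B z * norm (y z0)" if "z \<in> S" for z
  proof -
    have "y z - y z0 = N z (y z)" using yN[OF that] y0 by (metis add_diff_cancel_left')
    then have "norm (y z - y z0) \<le> B z * norm (y z)" using Bn[OF that, of "y z"] by simp
    also have "\<dots> \<le> B z * (norm (y z - y z0) + norm (y z0))"
      using norm_triangle_ineq[of "y z - y z0" "y z0"]
      by (intro mult_left_mono) (auto simp: B_def sum_nonneg)
    finally show ?thesis by (simp add: algebra_simps)
  qed
  have evS: "\<forall>\<^sub>F z in at z0. z \<in> S" using S eventually_at_topological by blast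
  have evB: "\<forall>\<^sub>F z in at z0. B z < 1/2" using Bt by (rule order_tendstoD) simp
  have ev2: "\<forall>\<^sub>F z in at z0. norm (y z - y z0) \<le> 2 * B z * norm (y z0)"
    using evS evB
  proof eventually_elim
    case (elim z)
    have "B z * norm (y z - y z0) \<le> 1/2 * norm (y z - y z0)"
      using elim by (intro mult_right_mono) auto
    with ineq[OF elim(1)] show ?case by simp
  qed
  have yt: "((\<lambda>z. y z - y z0) \<longlongrightarrow> 0) (at z0)"
  proof (rule tendsto_norm_zero_cancel, rule tendsto_sandwich)
    show "\<forall>\<^sub>F z in at z0. 0 \<le> norm (y z - y z0)" by simp
    show "((\<lambda>z. 2 * B z * norm (y z0)) \<longlongrightarrow> 0) (at z0)"
      by (rule tendsto_eq_intros Bt | simp)+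
  qed (use ev2 in auto)
  have dN: "((\<lambda>z. N z v) has_derivative frechet_derivative (\<lambda>z. N z v) (at z0)) (at z0)" for v
    using diffN frechet_derivative_works by blast
  have d0: "((\<lambda>z. L X + (\<Sum>b\<in>Basis. (y z0 \<bullet> b) *\<^sub>R N z b) ) has_derivative
     (\<lambda>h. 0 + (\<Sum>b\<in>Basis. (y z0 \<bullet> b) *\<^sub>R frechet_derivative (\<lambda>z. N z b) (at z0) h))) (at z0)"
    by (intro has_derivative_add has_derivative_const has_derivative_sum has_derivative_scaleR_right dN)
  have d1: "((\<lambda>z. ((y z - y z0) \<bullet> b) *\<^sub>R N z b) has_derivative (\<lambda>h. 0)) (at z0)" for b
  proof -
    have lim: "((\<lambda>z. norm (N z b) / norm (z - z0) * norm ((y z - y z0) \<bullet> b)) \<longlongrightarrow> 0) (at z0)"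
    proof -
      obtain K where K: "K > 0" "\<And>h. norm (frechet_derivative (\<lambda>z. N z b) (at z0) h) \<le> norm h * K"
        using dN[of b] has_derivative_bounded_linear bounded_linear.pos_bounded by blast
      have "((\<lambda>z. norm (N z b - N z0 b - frechet_derivative (\<lambda>z. N z b) (at z0) (z - z0)) / norm (z - z0)) \<longlongrightarrow> 0) (at z0)"
        using dN[of b] unfolding has_derivative_iff_norm by simp
      then have ev: "\<forall>\<^sub>F z in at z0. norm (N z b - frechet_derivative (\<lambda>z. N z b) (at z0) (z - z0)) / norm (z - z0) < 1"
        using order_tendstoD(2)[OF _ zero_less_one] by (simp add: N0)
      have evne: "\<forall>\<^sub>F z in at z0. z \<noteq> z0" by (simp add: eventually_at_filter)
      have bd: "\<forall>\<^sub>F z in at z0. norm (N z b) / norm (z - z0) * norm ((y z - y z0) \<bullet> b) \<le> (1 + K) * norm ((y z - y z0) \<bullet> b)"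
        using ev evne
      proof eventually_elim
        case (elim z)
        have p: "norm (z - z0) > 0" using elim by simp
        have "norm (N z b) \<le> norm (N z b - frechet_derivative (\<lambda>z. N z b) (at z0) (z - z0)) + norm (frechet_derivative (\<lambda>z. N z b) (at z0) (z - z0))"
          by (metis diff_add_cancel norm_triangle_ineq)
        also have "\<dots> \<le> norm (z - z0) + norm (z - z0) * K"
          using elim(1) p K(2)[of "z - z0"] by (intro add_mono) (auto simp: divide_less_eq)
        finally have "norm (N z b) / norm (z - z0) \<le> 1 + K"
          using p by (simp add: divide_le_eq algebra_simps)
        then show ?case by (intro mult_right_mono) auto
      qed
      show ?thesis
      proof (rule tendsto_sandwich[of "\<lambda>_. 0" _ _ "\<lambda>z. (1 + K) * norm ((y z - y z0) \<bullet> b)"])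
        have "((\<lambda>z. (1 + K) * norm ((y z - y z0) \<bullet> b)) \<longlongrightarrow> (1 + K) * norm ((0::'b) \<bullet> b)) (at z0)"
          by (intro tendsto_intros yt)
        then show "((\<lambda>z. (1 + K) * norm ((y z - y z0) \<bullet> b)) \<longlongrightarrow> 0) (at z0)" by simp
      qed (use bd in auto)
    qed
    show ?thesis unfolding has_derivative_iff_norm
      using lim by (simp add: N0 mult_ac divide_inverse)
  qed
  have "((\<lambda>z. (L X + (\<Sum>b\<in>Basis. (y z0 \<bullet> b) *\<^sub>R N z b)) + (\<Sum>b\<in>Basis. ((y z - y z0) \<bullet> b) *\<^sub>R N z b)) has_derivative
     (\<lambda>h. (0 + (\<Sum>b\<in>Basis. (y z0 \<bullet> b) *\<^sub>R frechet_derivative (\<lambda>z. N z b) (at z0) h)) + (\<Sum>b\<in>(Basis::'b set). 0))) (at z0)"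
    by (rule has_derivative_add[OF d0 has_derivative_sum[OF d1]])
  moreover have "(L X + (\<Sum>b\<in>Basis. (y z0 \<bullet> b) *\<^sub>R N z b)) + (\<Sum>b\<in>Basis. ((y z - y z0) \<bullet> b) *\<^sub>R N z b) = y z"
    if "z \<in> S" for z
  proof -
    have "N z (y z) = N z (\<Sum>b\<in>Basis. (y z \<bullet> b) *\<^sub>R b)" by (simp add: euclidean_representation)
    also have "\<dots> = (\<Sum>b\<in>Basis. (y z \<bullet> b) *\<^sub>R N z b)"
      using linN[OF that] by (simp add: linear_sum linear_scale)
    finally have "y z = L X + (\<Sum>b\<in>Basis. (y z \<bullet> b) *\<^sub>R N z b)" using yN[OF that] by simp
    then show ?thesis
      by (simp add: inner_diff_left scaleR_diff_left sum_subtractf)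
  qed
  ultimately show ?thesis
    using has_derivative_transform_within_open[OF _ S, of _ _ UNIV y] unfolding differentiable_def by blast
qed

section \<open>Derivatives of maps between manifolds\<close>

lemma tendsto_nhds_continuous_on:
  "continuous_on S f \<Longrightarrow> open S \<Longrightarrow> p \<in> S \<Longrightarrow> (f \<longlongrightarrow> f p) (nhds p)"
  by (metis at_within_open continuous_on_def tendsto_at_iff_tendsto_nhds)

lemma tendsto_nhds_eventually:
  "(f \<longlongrightarrow> f p) (nhds p) \<Longrightarrow> open S \<Longrightarrow> f p \<in> S \<Longrightarrow> \<forall>\<^sub>F y in nhds p. f y \<in> S"
  by (simp add: tendsto_def)

lemma is_chart_inverse:
  assumes "is_chart c"
  shows "p \<in> fst c \<Longrightarrow> chart_inv c (snd c p) = p"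
    and "z \<in> snd c ` fst c \<Longrightarrow> snd c (chart_inv c z) = z"
    and "z \<in> snd c ` fst c \<Longrightarrow> chart_inv c z \<in> fst c"
  using assms unfolding is_chart_def homeomorphism_def by auto

lemma is_chart_open:
  assumes "is_chart c"
  shows "open (fst c)" "open (snd c ` fst c)"
  using assms unfolding is_chart_def by auto

lemma is_chart_open_image:
  assumes c: "is_chart c" and S: "open S"
  shows "open (snd c ` (fst c \<inter> S))"
proof -
  have "continuous_on (snd c ` fst c) (chart_inv c)"
    using c unfolding is_chart_def homeomorphism_def by blast
  then have "open (chart_inv c -` S \<inter> snd c ` fst c)"
    using continuous_on_open_vimage[OF is_chart_open(2)[OF c]] S by blast
  moreover have "chart_inv c -` S \<inter> snd c ` fst c = snd c ` (fst c \<inter> S)"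
    using is_chart_inverse[OF c] by fastforce
  ultimately show ?thesis by simp
qed

lemma is_chart_tendsto:
  assumes c: "is_chart c"
  shows "p \<in> fst c \<Longrightarrow> (snd c \<longlongrightarrow> snd c p) (nhds p)"
    and "p \<in> fst c \<Longrightarrow> (chart_inv c \<longlongrightarrow> p) (nhds (snd c p))"
    and "z \<in> snd c ` fst c \<Longrightarrow> (chart_inv c \<longlongrightarrow> chart_inv c z) (nhds z)"
proof -
  have co: "continuous_on (fst c) (snd c)" "continuous_on (snd c ` fst c) (chart_inv c)"
    using c unfolding is_chart_def homeomorphism_def by auto
  show "p \<in> fst c \<Longrightarrow> (snd c \<longlongrightarrow> snd c p) (nhds p)"
    by (rule tendsto_nhds_continuous_on[OF co(1)]) (use is_chart_open[OF c] in auto)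
  show 3: "z \<in> snd c ` fst c \<Longrightarrow> (chart_inv c \<longlongrightarrow> chart_inv c z) (nhds z)" for z
    by (rule tendsto_nhds_continuous_on[OF co(2)]) (use is_chart_open[OF c] in auto)
  show "p \<in> fst c \<Longrightarrow> (chart_inv c \<longlongrightarrow> p) (nhds (snd c p))"
    using 3[of "snd c p"] is_chart_inverse[OF c] by simp
qed

lemma smooth_atlasD:
  assumes "smooth_atlas A"
  shows "c \<in> A \<Longrightarrow> is_chart c"
    and "c \<in> A \<Longrightarrow> d \<in> A \<Longrightarrow> smooth_on (snd c ` (fst c \<inter> fst d)) (snd d \<circ> chart_inv c)"
  using assms unfolding smooth_atlas_def by blast+

lemma chart_at_facts:
  assumes "smooth_atlas A"
  shows "chart_at A p \<in> A" "p \<in> fst (chart_at A p)" "is_chart (chart_at A p)"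
proof -
  obtain c0 where "c0 \<in> A \<and> p \<in> fst c0" using assms unfolding smooth_atlas_def by blast
  from someI[of "\<lambda>c. c \<in> A \<and> p \<in> fst c", OF this]
  show 1: "chart_at A p \<in> A" "p \<in> fst (chart_at A p)" unfolding chart_at_def by auto
  show "is_chart (chart_at A p)" using 1 smooth_atlasD(1)[OF assms] by blast
qed

text \<open>A tangent vector is represented by its components in the preferred chart of its base point, so
the derivative of a map is taken in preferred charts.  Real functions and curves are included through
\<open>euclid_atlas\<close>.  Continuity is demanded separately because the composition with charts has a meaning
only near points that are mapped into the chart domain.\<close>

definition mderiv ::
  "('m::topological_space, 'e::euclidean_space) chart set \<Rightarrow> ('k::topological_space, 'f::euclidean_space) chart set
   \<Rightarrow> ('m \<Rightarrow> 'k) \<Rightarrow> 'm \<Rightarrow> ('e \<Rightarrow> 'f) \<Rightarrow> bool" where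
  "mderiv A B f p L \<longleftrightarrow> (f \<longlongrightarrow> f p) (nhds p) \<and>
     ((snd (chart_at B (f p)) \<circ> f \<circ> chart_inv (chart_at A p)) has_derivative L) (at (snd (chart_at A p) p))"

lemma mderiv_tangent_map: "mderiv A B f p L \<Longrightarrow> tangent_map A B f p = L"
  unfolding mderiv_def tangent_map_def by (blast intro: frechet_derivative_eqI)

lemma mderiv_linear: "mderiv A B f p L \<Longrightarrow> linear L"
  unfolding mderiv_def using has_derivative_linear by blast

lemma has_derivative_cong_nhds:
  assumes "\<forall>\<^sub>F y in nhds x. f y = g y"
  shows "(f has_derivative D) (at x) \<longleftrightarrow> (g has_derivative D) (at x)"
proof -
  obtain S where S: "open S" "x \<in> S" "\<And>y. y \<in> S \<Longrightarrow> f y = g y"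
    using assms unfolding eventually_nhds by blast
  show ?thesis
    using has_derivative_transform_within_open[OF _ S(1,2), of f D UNIV g]
          has_derivative_transform_within_open[OF _ S(1,2), of g D UNIV f] S(3) by auto
qed

lemma mderiv_cong:
  assumes A: "smooth_atlas A" and e: "\<forall>\<^sub>F y in nhds p. f y = g y"
  shows "mderiv A B f p L \<longleftrightarrow> mderiv A B g p L"
proof -
  have p: "f p = g p" using e eventually_nhds_x_imp_x by blast
  have t: "(f \<longlongrightarrow> l) (nhds p) \<longleftrightarrow> (g \<longlongrightarrow> l) (nhds p)" for l
    by (rule tendsto_cong[OF e])
  let ?c = "chart_at A p"
  have "(chart_inv ?c \<longlongrightarrow> p) (nhds (snd ?c p))"
    by (rule is_chart_tendsto) (use chart_at_facts[OF A] in auto)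
  then have "\<forall>\<^sub>F z in nhds (snd ?c p). f (chart_inv ?c z) = g (chart_inv ?c z)"
    using e eventually_compose_filterlim by blast
  then have "\<forall>\<^sub>F z in nhds (snd ?c p). (snd (chart_at B (f p)) \<circ> f \<circ> chart_inv ?c) z
       = (snd (chart_at B (g p)) \<circ> g \<circ> chart_inv ?c) z"
    by eventually_elim (simp add: p)
  from has_derivative_cong_nhds[OF this, of L] show ?thesis
    unfolding mderiv_def by (simp only: t p)
qed

lemma mderiv_transform:
  "mderiv A B f p L \<Longrightarrow> \<forall>\<^sub>F y in nhds p. f y = g y \<Longrightarrow> smooth_atlas A \<Longrightarrow> mderiv A B g p L"
  using mderiv_cong by blast

lemma mderiv_compose:
  assumes A: "smooth_atlas A" and B: "smooth_atlas B"
    and f: "mderiv A B f p L" and g: "mderiv B C g (f p) M"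
  shows "mderiv A C (\<lambda>x. g (f x)) p (\<lambda>v. M (L v))"
proof -
  let ?a = "chart_at A p" and ?b = "chart_at B (f p)" and ?c = "chart_at C (g (f p))"
  note a = chart_at_facts[OF A, of p] and b = chart_at_facts[OF B, of "f p"]
  have ft: "(f \<longlongrightarrow> f p) (nhds p)" and gt: "(g \<longlongrightarrow> g (f p)) (nhds (f p))"
    using f g by (auto simp: mderiv_def)
  have t: "((\<lambda>x. g (f x)) \<longlongrightarrow> g (f p)) (nhds p)"
    using filterlim_compose[OF gt ft] .
  have at: "(chart_inv ?a \<longlongrightarrow> p) (nhds (snd ?a p))"
    by (rule is_chart_tendsto) (use a in auto)
  have "\<forall>\<^sub>F y in nhds p. f y \<in> fst ?b"
    by (rule tendsto_nhds_eventually[OF ft]) (use b is_chart_open[OF b(3)] in auto)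
  then have ev: "\<forall>\<^sub>F z in nhds (snd ?a p). f (chart_inv ?a z) \<in> fst ?b"
    using at eventually_compose_filterlim by blast
  have ip: "chart_inv ?a (snd ?a p) = p" using a is_chart_inverse by blast
  have gd: "((snd ?c \<circ> g \<circ> chart_inv ?b) has_derivative M) (at ((snd ?b \<circ> f \<circ> chart_inv ?a) (snd ?a p)))"
    using g by (simp add: mderiv_def ip)
  have fd: "((snd ?b \<circ> f \<circ> chart_inv ?a) has_derivative L) (at (snd ?a p))"
    using f by (simp add: mderiv_def)
  have d: "((\<lambda>z. (snd ?c \<circ> g \<circ> chart_inv ?b) ((snd ?b \<circ> f \<circ> chart_inv ?a) z)) has_derivative (\<lambda>v. M (L v))) (at (snd ?a p))"
    by (rule has_derivative_compose[OF fd gd])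
  have "\<forall>\<^sub>F z in nhds (snd ?a p). (snd ?c \<circ> g \<circ> chart_inv ?b) ((snd ?b \<circ> f \<circ> chart_inv ?a) z)
      = (snd ?c \<circ> (\<lambda>x. g (f x)) \<circ> chart_inv ?a) z"
    using ev by eventually_elim (use is_chart_inverse[OF b(3)] in simp)
  from has_derivative_cong_nhds[OF this, of "\<lambda>v. M (L v)"] d t show ?thesis
    unfolding mderiv_def by (simp only: simp_thms)
qed

lemma chart_at_euclid [simp]: "chart_at euclid_atlas x = (UNIV, id)"
  unfolding chart_at_def euclid_atlas_def by (rule some_equality) auto

lemma chart_inv_id [simp]: "chart_inv (UNIV, id) = id"
  unfolding chart_inv_def by (auto simp: fun_eq_iff inv_into_def)

lemma Ck_on_const: "Ck_on k S (\<lambda>x. c)"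
  by (induction k arbitrary: c) auto

lemma Ck_on_id: "Ck_on k S id"
proof -
  have "frechet_derivative id (at x) = (\<lambda>v. v)" for x :: 'a
    by (intro frechet_derivative_eqI) (simp add: id_def)
  then show ?thesis by (cases k) (auto simp: Ck_on_const id_def)
qed

lemma smooth_atlas_euclid: "smooth_atlas (euclid_atlas :: ('v::euclidean_space, 'v) chart set)"
proof -
  have "is_chart (UNIV, id :: 'v \<Rightarrow> 'v)" unfolding is_chart_def by (auto simp: homeomorphism_def)
  moreover have "smooth_on UNIV (id :: 'v \<Rightarrow> 'v)" by (simp add: smooth_on_open Ck_on_id)
  ultimately show ?thesis unfolding smooth_atlas_def by (simp add: euclid_atlas_def)
qed

lemma mderiv_euclid: "mderiv euclid_atlas euclid_atlas f p L \<longleftrightarrow> (f has_derivative L) (at p)"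
  unfolding mderiv_def using has_derivative_continuous[of f L p UNIV]
  by (auto simp: continuous_at tendsto_at_iff_tendsto_nhds comp_def)

lemma mderiv_const: "mderiv A B (\<lambda>x. q) p (\<lambda>v. 0)"
  unfolding mderiv_def comp_def by simp

lemma smooth_map_mderiv:
  assumes A: "smooth_atlas A" and B: "smooth_atlas B" and f: "smooth_map A B S f" and S: "open S" "p \<in> S"
  shows "mderiv A B f p (tangent_map A B f p)"
proof -
  let ?c = "chart_at A p" and ?d = "chart_at B (f p)"
  note a = chart_at_facts[OF A, of p] and b = chart_at_facts[OF B, of "f p"]
  have co: "continuous_on S f" using f by (simp add: smooth_map_def)
  have t: "(f \<longlongrightarrow> f p) (nhds p)" by (rule tendsto_nhds_continuous_on[OF co S])
  have "open (S \<inter> f -` fst ?d)"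
    by (rule continuous_open_preimage[OF co S(1) is_chart_open(1)[OF b(3)]])
  then have o: "open (snd ?c ` (fst ?c \<inter> (S \<inter> f -` fst ?d)))" by (rule is_chart_open_image[OF a(3)])
  have e: "fst ?c \<inter> (S \<inter> f -` fst ?d) = S \<inter> fst ?c \<inter> f -` fst ?d" by blast
  have s: "smooth_on (snd ?c ` (S \<inter> fst ?c \<inter> f -` fst ?d)) (snd ?d \<circ> f \<circ> chart_inv ?c)"
    using f a b unfolding smooth_map_def by blast
  have "((snd ?d \<circ> f \<circ> chart_inv ?c) has_derivative tangent_map A B f p) (at (snd ?c p))"
    unfolding tangent_map_def
    by (rule smooth_on_has_derivative[OF o[unfolded e] s]) (use a b S in auto)
  then show ?thesis using t unfolding mderiv_def by blast
qed

lemma mderiv_chart: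
  assumes A: "smooth_atlas A" and c: "c \<in> A"
  shows "p \<in> fst c \<Longrightarrow> mderiv A euclid_atlas (snd c) p (to_coord A c p)"
    and "z \<in> snd c ` fst c \<Longrightarrow> mderiv euclid_atlas A (chart_inv c) z (from_coord A c (chart_inv c z))"
proof -
  note ic = smooth_atlasD(1)[OF A c]
  show "mderiv A euclid_atlas (snd c) p (to_coord A c p)" if p: "p \<in> fst c"
  proof -
    let ?d = "chart_at A p"
    note d = chart_at_facts[OF A, of p]
    have "((snd c \<circ> chart_inv ?d) has_derivative to_coord A c p) (at (snd ?d p))"
      unfolding to_coord_def
      by (rule smooth_on_has_derivative[OF is_chart_open_image[OF d(3) is_chart_open(1)[OF ic]] smooth_atlasD(2)[OF A d(1) c]])
         (use p d in auto)
    then show ?thesis using is_chart_tendsto(1)[OF ic p] unfolding mderiv_def by simp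
  qed
  show "mderiv euclid_atlas A (chart_inv c) z (from_coord A c (chart_inv c z))" if z: "z \<in> snd c ` fst c"
  proof -
    let ?d = "chart_at A (chart_inv c z)"
    note d = chart_at_facts[OF A, of "chart_inv c z"]
    have "((snd ?d \<circ> chart_inv c) has_derivative from_coord A c (chart_inv c z)) (at (snd c (chart_inv c z)))"
      unfolding from_coord_def
      by (rule smooth_on_has_derivative[OF is_chart_open_image[OF ic is_chart_open(1)[OF d(3)]] smooth_atlasD(2)[OF A c d(1)]])
         (use z d is_chart_inverse[OF ic] in force)
    then show ?thesis using is_chart_tendsto(3)[OF ic z] is_chart_inverse(2)[OF ic z] unfolding mderiv_def by simp
  qed
qed

lemma mderiv_unique:
  "mderiv A B f p L \<Longrightarrow> mderiv A B f p M \<Longrightarrow> L = M"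
  using mderiv_tangent_map by metis

lemma mderiv_id:
  assumes "smooth_atlas A" shows "mderiv A A (\<lambda>x. x) p (\<lambda>v. v)"
proof -
  let ?c = "chart_at A p"
  note a = chart_at_facts[OF assms, of p]
  have "\<forall>\<^sub>F z in nhds (snd ?c p). z \<in> snd ?c ` fst ?c"
    using is_chart_open(2)[OF a(3)] a(2) by (simp add: eventually_nhds_in_open)
  then have "\<forall>\<^sub>F z in nhds (snd ?c p). z = (snd ?c \<circ> (\<lambda>x. x) \<circ> chart_inv ?c) z"
    by eventually_elim (simp add: is_chart_inverse(2)[OF a(3)])
  then have "((snd ?c \<circ> (\<lambda>x. x) \<circ> chart_inv ?c) has_derivative (\<lambda>v. v)) (at (snd ?c p))"
    by (rule iffD1[OF has_derivative_cong_nhds has_derivative_ident])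
  then show ?thesis unfolding mderiv_def by (simp add: filterlim_ident)
qed

lemma to_from_coord:
  assumes A: "smooth_atlas A" and c: "c \<in> A" "p \<in> fst c"
  shows "to_coord A c p (from_coord A c p v) = v" "from_coord A c p (to_coord A c p v) = v"
proof -
  note ic = smooth_atlasD(1)[OF A c(1)]
  have ip: "chart_inv c (snd c p) = p" using ic c is_chart_inverse by blast
  note E = smooth_atlas_euclid
  have z: "snd c p \<in> snd c ` fst c" using c by blast
  have m2: "mderiv euclid_atlas A (chart_inv c) (snd c p) (from_coord A c p)"
    using mderiv_chart(2)[OF A c(1) z] ip by simp
  have m1: "mderiv A euclid_atlas (snd c) (chart_inv c (snd c p)) (to_coord A c p)"
    using mderiv_chart(1)[OF A c] ip by simp
  have "mderiv euclid_atlas euclid_atlas (\<lambda>z. snd c (chart_inv c z)) (snd c p) (\<lambda>v. to_coord A c p (from_coord A c p v))"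
    by (rule mderiv_compose[OF E A m2 m1])
  moreover have "\<forall>\<^sub>F z in nhds (snd c p). snd c (chart_inv c z) = z"
    using eventually_nhds_in_open[OF is_chart_open(2)[OF ic] z]
    by eventually_elim (simp add: is_chart_inverse(2)[OF ic])
  ultimately have "mderiv euclid_atlas euclid_atlas (\<lambda>z. z) (snd c p) (\<lambda>v. to_coord A c p (from_coord A c p v))"
    by (rule mderiv_transform[OF _ _ E])
  then show "to_coord A c p (from_coord A c p v) = v" using mderiv_unique mderiv_id[OF E] by metis
  have m1': "mderiv A euclid_atlas (snd c) p (to_coord A c p)" using m1 ip by simp
  have "mderiv A A (\<lambda>z. chart_inv c (snd c z)) p (\<lambda>v. from_coord A c p (to_coord A c p v))"
    by (rule mderiv_compose[OF A E m1' m2])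
  moreover have "\<forall>\<^sub>F z in nhds p. chart_inv c (snd c z) = z"
    using eventually_nhds_in_open[OF is_chart_open(1)[OF ic] c(2)]
    by eventually_elim (simp add: is_chart_inverse(1)[OF ic])
  ultimately have "mderiv A A (\<lambda>z. z) p (\<lambda>v. from_coord A c p (to_coord A c p v))"
    by (rule mderiv_transform[OF _ _ A])
  then show "from_coord A c p (to_coord A c p v) = v" using mderiv_unique mderiv_id[OF A] by metis
qed

lemma linear_coord:
  assumes A: "smooth_atlas A" and c: "c \<in> A" "p \<in> fst c"
  shows "linear (to_coord A c p)" "linear (from_coord A c p)"
proof -
  show "linear (to_coord A c p)" using mderiv_chart(1)[OF A c] mderiv_linear by blast
  have "snd c p \<in> snd c ` fst c" "chart_inv c (snd c p) = p"
    using c is_chart_inverse smooth_atlasD(1)[OF A] by blast+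
  then show "linear (from_coord A c p)" using mderiv_chart(2)[OF A c(1)] mderiv_linear by metis
qed

lemma from_coord_chart_at:
  assumes A: "smooth_atlas A"
  shows "from_coord A (chart_at A p) p = (\<lambda>v. v)" "to_coord A (chart_at A p) p = (\<lambda>v. v)"
proof -
  note a = chart_at_facts[OF A, of p]
  have "((snd (chart_at A p) \<circ> (\<lambda>x. x) \<circ> chart_inv (chart_at A p)) has_derivative (\<lambda>v. v)) (at (snd (chart_at A p) p))"
    using mderiv_id[OF A, of p] unfolding mderiv_def by blast
  then show 1: "from_coord A (chart_at A p) p = (\<lambda>v. v)"
    unfolding from_coord_def by (intro frechet_derivative_eqI) (simp add: comp_def)
  show "to_coord A (chart_at A p) p = (\<lambda>v. v)"
    using to_from_coord(1)[OF A a(1,2)] 1 by (metis (no_types))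
qed

lemma mderiv_charts:
  assumes A: "smooth_atlas A" and B: "smooth_atlas B" and c: "c \<in> A" "p \<in> fst c" and d: "d \<in> B" "f p \<in> fst d"
    and f: "mderiv A B f p L"
  shows "((\<lambda>z. snd d (f (chart_inv c z))) has_derivative (\<lambda>v. to_coord B d (f p) (L (from_coord A c p v)))) (at (snd c p))"
proof -
  note E = smooth_atlas_euclid
  have ip: "chart_inv c (snd c p) = p" using c is_chart_inverse smooth_atlasD(1)[OF A] by blast
  have m2: "mderiv euclid_atlas A (chart_inv c) (snd c p) (from_coord A c p)"
    using mderiv_chart(2)[OF A c(1)] c ip by force
  have "mderiv A euclid_atlas (\<lambda>x. snd d (f x)) p (\<lambda>v. to_coord B d (f p) (L v))"
    by (rule mderiv_compose[OF A B f mderiv_chart(1)[OF B d]])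
  then have "mderiv euclid_atlas euclid_atlas (\<lambda>z. snd d (f (chart_inv c z))) (snd c p)
     (\<lambda>v. to_coord B d (f p) (L (from_coord A c p v)))"
    by (intro mderiv_compose[OF E A m2]) (simp add: ip)
  then show ?thesis by (simp add: mderiv_euclid)
qed

text \<open>Used for maps that are constructed in a chart, in particular for the representation of the action of
\<open>P\<close> in charts.\<close>

lemma mderiv_into_chart:
  assumes B: "smooth_atlas B" and d: "d \<in> B" and g: "(g has_derivative D) (at p)" and p: "g p \<in> snd d ` fst d"
  shows "mderiv euclid_atlas B (\<lambda>q. chart_inv d (g q)) p (\<lambda>v. from_coord B d (chart_inv d (g p)) (D v))"
  by (rule mderiv_compose[OF smooth_atlas_euclid smooth_atlas_euclid g[folded mderiv_euclid] mderiv_chart(2)[OF B d p]])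

lemma mderiv_from_chart:
  assumes A: "smooth_atlas A" and c: "c \<in> A" "p \<in> fst c"
    and w: "((\<lambda>z. w (chart_inv c z)) has_derivative D) (at (snd c p))"
  shows "mderiv A euclid_atlas w p (\<lambda>v. D (to_coord A c p v))"
proof -
  have ic: "is_chart c" using smooth_atlasD(1)[OF A c(1)] .
  have "mderiv A euclid_atlas (\<lambda>x. w (chart_inv c (snd c x))) p (\<lambda>v. D (to_coord A c p v))"
    by (rule mderiv_compose[OF A smooth_atlas_euclid mderiv_chart(1)[OF A c] w[folded mderiv_euclid]])
  moreover have "\<forall>\<^sub>F x in nhds p. w (chart_inv c (snd c x)) = w x"
    using eventually_nhds_in_open[OF is_chart_open(1)[OF ic] c(2)]
    by eventually_elim (simp add: is_chart_inverse(1)[OF ic])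
  ultimately show ?thesis by (rule mderiv_transform[OF _ _ A])
qed

lemma line_has_vector_derivative:
  assumes "(f has_derivative D) (at p)"
  shows "((\<lambda>t. f (p + t *\<^sub>R v)) has_vector_derivative D v) (at 0)"
proof -
  have 0: "((\<lambda>t. p + t *\<^sub>R v) has_derivative (\<lambda>r. r *\<^sub>R v)) (at 0)"
    by (auto intro!: derivative_eq_intros)
  have "((\<lambda>t. f (p + t *\<^sub>R v)) has_derivative (\<lambda>r. D (r *\<^sub>R v))) (at 0)"
    by (rule has_derivative_compose[OF 0]) (use assms in simp)
  then show ?thesis unfolding has_vector_derivative_def
    using linear_scale[OF has_derivative_linear[OF assms]] by simp
qed

lemma has_vector_derivative_cong_nhds:
  "\<forall>\<^sub>F t in nhds x. f t = g t \<Longrightarrow> (f has_vector_derivative D) (at x) \<longleftrightarrow> (g has_vector_derivative D) (at x)"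
  unfolding has_vector_derivative_def by (rule has_derivative_cong_nhds)

lemma has_vector_derivative_transform_nhds:
  "(f has_vector_derivative D) (at x) \<Longrightarrow> \<forall>\<^sub>F t in nhds x. g t = f t \<Longrightarrow> (g has_vector_derivative D) (at x)"
  using has_vector_derivative_cong_nhds by blast

lemma eventually_line_in_open:
  fixes p :: "'a::real_normed_vector"
  assumes "open W" "p \<in> W" shows "\<forall>\<^sub>F t in nhds (0::real). p + t *\<^sub>R v \<in> W"
proof -
  have "((\<lambda>t. p + t *\<^sub>R v) \<longlongrightarrow> p + 0 *\<^sub>R v) (nhds 0)"
    by (intro tendsto_intros filterlim_ident)
  then show ?thesis using assms by (simp add: tendsto_def)
qed

section \<open>The exterior derivative on manifolds\<close>

definition chart_form ::
  "('m, 'e::euclidean_space) chart set \<Rightarrow> ('m \<Rightarrow> 'e \<Rightarrow> 'v) \<Rightarrow> ('m, 'e) chart \<Rightarrow> 'e \<Rightarrow> 'e \<Rightarrow> 'v" where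
  "chart_form A \<omega> c z v = \<omega> (chart_inv c z) (from_coord A c (chart_inv c z) v)"

lemma ext_deriv_dform:
  "ext_deriv A \<omega> x v w = dform (chart_form A \<omega> (chart_at A x)) (snd (chart_at A x) x) v w"
  by (simp add: ext_deriv_def dform_def chart_form_def Let_def)

lemma chart_form_props:
  assumes A: "smooth_atlas A" and \<omega>: "smooth_form A \<omega>" and c: "c \<in> A"
  shows "smooth_on (snd c ` fst c) (\<lambda>z. chart_form A \<omega> c z v)"
    and "z \<in> snd c ` fst c \<Longrightarrow> linear (chart_form A \<omega> c z)"
    and "z \<in> snd c ` fst c \<Longrightarrow> (\<lambda>z. chart_form A \<omega> c z v) differentiable (at z)"
proof -
  show 1: "smooth_on (snd c ` fst c) (\<lambda>z. chart_form A \<omega> c z v)" for v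
    using \<omega> c unfolding smooth_form_def chart_form_def by blast
  note ic = smooth_atlasD(1)[OF A c]
  show "linear (chart_form A \<omega> c z)" if z: "z \<in> snd c ` fst c"
  proof -
    have "linear (from_coord A c (chart_inv c z))" using linear_coord(2)[OF A c] is_chart_inverse(3)[OF ic z] .
    moreover have "linear (\<omega> (chart_inv c z))" using \<omega> unfolding smooth_form_def by blast
    ultimately show ?thesis unfolding chart_form_def
      using linear_compose[unfolded o_def] by blast
  qed
  show "z \<in> snd c ` fst c \<Longrightarrow> (\<lambda>z. chart_form A \<omega> c z v) differentiable (at z)"
    using smooth_on_has_derivative[OF is_chart_open(2)[OF ic] 1] unfolding differentiable_def by blast
qed

text \<open>The exterior derivative is computed in the preferred chart of the point, which jumps from
point to point.  Invariance under changes of charts allows a fixed chart \<open>d\<close> to be used in a neighborhood.\<close>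

lemma ext_deriv_chart:
  assumes A: "smooth_atlas A" and \<omega>: "smooth_form A \<omega>" and d: "d \<in> A" "q \<in> fst d"
  shows "ext_deriv A \<omega> q \<xi> \<eta> = dform (chart_form A \<omega> d) (snd d q) (to_coord A d q \<xi>) (to_coord A d q \<eta>)"
proof -
  let ?c = "chart_at A q"
  note c = chart_at_facts[OF A, of q] and id = smooth_atlasD(1)[OF A d(1)]
  define W where "W = snd ?c ` (fst ?c \<inter> fst d)"
  define g where "g = snd d \<circ> chart_inv ?c"
  have W: "open W" unfolding W_def by (rule is_chart_open_image[OF c(3) is_chart_open(1)[OF id]])
  have gs: "smooth_on W g" unfolding W_def g_def by (rule smooth_atlasD(2)[OF A c(1) d(1)])
  have qW: "snd ?c q \<in> W" using c d by (auto simp: W_def)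
  have iq: "chart_inv ?c (snd ?c q) = q" using c is_chart_inverse by blast
  have gq: "g (snd ?c q) = snd d q" by (simp add: g_def iq)
  have Dg: "frechet_derivative g (at z) v = to_coord A d (chart_inv ?c z) (from_coord A ?c (chart_inv ?c z) v)"
    if z: "z \<in> W" for z v
  proof -
    have zc: "z \<in> snd ?c ` fst ?c" and iz: "chart_inv ?c z \<in> fst d" "chart_inv ?c z \<in> fst ?c" "snd ?c (chart_inv ?c z) = z"
      using z is_chart_inverse[OF c(3)] unfolding W_def by auto
    have "((\<lambda>z. snd d ((\<lambda>x. x) (chart_inv ?c z))) has_derivative
       (\<lambda>v. to_coord A d (chart_inv ?c z) (from_coord A ?c (chart_inv ?c z) v))) (at (snd ?c (chart_inv ?c z)))"
      by (rule mderiv_charts[OF A A c(1) iz(2) d(1) _ mderiv_id[OF A]]) (rule iz)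
    then show ?thesis using iz(3) by (simp add: g_def comp_def frechet_derivative_eqI)
  qed
  have eq: "chart_form A \<omega> d (g z) (frechet_derivative g (at z) v) = chart_form A \<omega> ?c z v"
    if z: "z \<in> W" for z v
  proof -
    have zc: "z \<in> snd ?c ` fst ?c" and iz: "chart_inv ?c z \<in> fst d" "chart_inv ?c z \<in> fst ?c"
      using z is_chart_inverse[OF c(3)] unfolding W_def by auto
    have "chart_inv d (g z) = chart_inv ?c z" using iz is_chart_inverse(1)[OF id] by (simp add: g_def)
    then show ?thesis using Dg[OF z] to_from_coord(2)[OF A d(1) iz(1)] by (simp add: chart_form_def)
  qed
  have zq: "snd ?c q \<in> snd ?c ` fst ?c" using c by blast
  have D: "((\<lambda>t. chart_form A \<omega> d (g (snd ?c q + t *\<^sub>R v)) (frechet_derivative g (at (snd ?c q + t *\<^sub>R v)) w))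
     has_vector_derivative frechet_derivative (\<lambda>z. chart_form A \<omega> ?c z w) (at (snd ?c q)) v) (at 0)" for v w
  proof -
    have "((\<lambda>t. chart_form A \<omega> ?c (snd ?c q + t *\<^sub>R v) w)
     has_vector_derivative frechet_derivative (\<lambda>z. chart_form A \<omega> ?c z w) (at (snd ?c q)) v) (at 0)"
      by (rule line_has_vector_derivative)
         (use chart_form_props(3)[OF A \<omega> c(1) zq] frechet_derivative_works in blast)
    moreover have "\<forall>\<^sub>F t in nhds 0. chart_form A \<omega> d (g (snd ?c q + t *\<^sub>R v)) (frechet_derivative g (at (snd ?c q + t *\<^sub>R v)) w)
       = chart_form A \<omega> ?c (snd ?c q + t *\<^sub>R v) w"
      using eventually_line_in_open[OF W qW] by eventually_elim (rule eq)
    ultimately show ?thesis by (rule has_vector_derivative_transform_nhds)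
  qed
  have gqd: "g (snd ?c q) \<in> snd d ` fst d" using gq d by blast
  have "dform (chart_form A \<omega> d) (g (snd ?c q)) (frechet_derivative g (at (snd ?c q)) \<xi>) (frechet_derivative g (at (snd ?c q)) \<eta>)
     = dform (chart_form A \<omega> ?c) (snd ?c q) \<xi> \<eta>"
    unfolding dform_def[of "chart_form A \<omega> ?c"]
    by (rule dform_pullback[OF W gs qW is_chart_open(2)[OF id] gqd _ _ D D])
       (use chart_form_props[OF A \<omega> d(1)] gqd in auto)
  moreover have "frechet_derivative g (at (snd ?c q)) = to_coord A d q"
    by (simp add: to_coord_def g_def)
  ultimately show ?thesis by (simp add: ext_deriv_dform gq)
qed

text \<open>All later computations of \<open>d\<omega>\<close> rest on this: it reduces \<open>d\<omega>\<close> to the values of \<open>\<omega>\<close> along two coordinate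
lines of a map into the manifold, without vector fields or Lie brackets.\<close>

lemma ext_deriv_param:
  fixes g :: "'a::euclidean_space \<Rightarrow> 'e::euclidean_space"
  assumes A: "smooth_atlas A" and \<omega>: "smooth_form A \<omega>" and d: "d \<in> A"
    and W: "open W" "smooth_on W g" "p \<in> W" "g ` W \<subseteq> snd d ` fst d"
    and D1: "((\<lambda>t. \<omega> (chart_inv d (g (p + t *\<^sub>R v))) (tangent_map euclid_atlas A (\<lambda>q. chart_inv d (g q)) (p + t *\<^sub>R v) w)) has_vector_derivative D1) (at 0)"
    and D2: "((\<lambda>t. \<omega> (chart_inv d (g (p + t *\<^sub>R w))) (tangent_map euclid_atlas A (\<lambda>q. chart_inv d (g q)) (p + t *\<^sub>R w) v)) has_vector_derivative D2) (at 0)"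
  shows "ext_deriv A \<omega> (chart_inv d (g p)) (tangent_map euclid_atlas A (\<lambda>q. chart_inv d (g q)) p v)
      (tangent_map euclid_atlas A (\<lambda>q. chart_inv d (g q)) p w) = D1 - D2"
proof -
  note id = smooth_atlasD(1)[OF A d]
  have T: "tangent_map euclid_atlas A (\<lambda>q. chart_inv d (g q)) q u = from_coord A d (chart_inv d (g q)) (frechet_derivative g (at q) u)"
    if q: "q \<in> W" for q u
    using mderiv_tangent_map[OF mderiv_into_chart[OF A d smooth_on_has_derivative[OF W(1,2) q]]] W(4) q by auto
  have D: "((\<lambda>t. chart_form A \<omega> d (g (p + t *\<^sub>R v)) (frechet_derivative g (at (p + t *\<^sub>R v)) w)) has_vector_derivative D1) (at 0)"
    if "((\<lambda>t. \<omega> (chart_inv d (g (p + t *\<^sub>R v))) (tangent_map euclid_atlas A (\<lambda>q. chart_inv d (g q)) (p + t *\<^sub>R v) w)) has_vector_derivative D1) (at 0)"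
    for v w D1
  proof -
    have "\<forall>\<^sub>F t in nhds 0. \<omega> (chart_inv d (g (p + t *\<^sub>R v))) (tangent_map euclid_atlas A (\<lambda>q. chart_inv d (g q)) (p + t *\<^sub>R v) w)
        = chart_form A \<omega> d (g (p + t *\<^sub>R v)) (frechet_derivative g (at (p + t *\<^sub>R v)) w)"
      using eventually_line_in_open[OF W(1,3), of v] by eventually_elim (simp add: T chart_form_def)
    then show ?thesis by (rule iffD1[OF has_vector_derivative_cong_nhds that])
  qed
  have gp: "g p \<in> snd d ` fst d" using W by blast
  have "dform (chart_form A \<omega> d) (g p) (frechet_derivative g (at p) v) (frechet_derivative g (at p) w) = D1 - D2"
    by (rule dform_pullback[OF W(1-3) is_chart_open(2)[OF id] gp _ _ D[OF D1] D[OF D2]])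
       (use chart_form_props[OF A \<omega> d] gp in auto)
  moreover have "ext_deriv A \<omega> (chart_inv d (g p)) \<xi> \<eta> =
      dform (chart_form A \<omega> d) (g p) (to_coord A d (chart_inv d (g p)) \<xi>) (to_coord A d (chart_inv d (g p)) \<eta>)" for \<xi> \<eta>
    using ext_deriv_chart[OF A \<omega> d is_chart_inverse(3)[OF id gp]] is_chart_inverse(2)[OF id gp] by simp
  ultimately show ?thesis
    using T[OF W(3)] to_from_coord(1)[OF A d is_chart_inverse(3)[OF id gp]] by simp
qed

section \<open>Matrices in block form\<close>

lemma sum_idx: "(\<Sum>i\<in>UNIV. f i) = f First + f Last + (\<Sum>m\<in>UNIV. f (Mid m))"
  for f :: "'n::finite idx \<Rightarrow> 'a::comm_monoid_add"
proof -
  have "(\<Sum>i\<in>UNIV. f i) = f First + (f Last + (\<Sum>i\<in>range Mid. f i))"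
    unfolding UNIV_idx by (subst sum.insert; (subst sum.insert)?; auto)
  also have "(\<Sum>i\<in>range Mid. f i) = (\<Sum>m\<in>UNIV. f (Mid m))"
    by (subst sum.reindex) (auto simp: inj_on_def)
  finally show ?thesis by (simp add: add.assoc)
qed

lemma all_idx: "(\<forall>i. P i) \<longleftrightarrow> P First \<and> P Last \<and> (\<forall>m. P (Mid m))"
  by (metis idx.exhaust)

lemma matr_eq_iff: "A = B \<longleftrightarrow> (\<forall>i j. A $ i $ j = B $ i $ j)" for A B :: "'n::finite matr"
  by (auto simp: vec_eq_iff)

lemma matr_mult_entry:
  "(A ** B) $ i $ j = A $ i $ First * B $ First $ j + A $ i $ Last * B $ Last $ j
      + (\<Sum>m\<in>UNIV. A $ i $ Mid m * B $ Mid m $ j)" for A B :: "'n::finite matr"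
  by (simp add: matrix_matrix_mult_def sum_idx)

lemma mat_one_entry: "(mat 1 :: 'n::finite matr) $ i $ j = (if i = j then 1 else 0)"
  by (simp add: mat_def)

lemma trace_idx: "trace A = A $ First $ First + A $ Last $ Last + (\<Sum>m\<in>UNIV. A $ Mid m $ Mid m)"
  for A :: "'n::finite matr"
  by (simp add: trace_def sum_idx)

lemma bounded_bilinear_matr: "bounded_bilinear ((**) :: 'n::finite matr \<Rightarrow> 'n matr \<Rightarrow> 'n matr)"
  unfolding bilinear_conv_bounded_bilinear[symmetric] bilinear_def linear_iff
  by (auto simp: matr_eq_iff matr_mult_entry algebra_simps sum.distrib sum_distrib_left)

interpretation mm: bounded_bilinear "(**) :: 'n::finite matr \<Rightarrow> 'n matr \<Rightarrow> 'n matr"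
  by (rule bounded_bilinear_matr)

lemma matrix_inv_works:
  fixes A :: "'n::finite matr" assumes "invertible A"
  shows "A ** matrix_inv A = mat 1" "matrix_inv A ** A = mat 1"
proof -
  obtain B where "A ** B = mat 1 \<and> B ** A = mat 1" using assms unfolding invertible_def by blast
  from someI[of "\<lambda>B. A ** B = mat 1 \<and> B ** A = mat 1", OF this]
  show "A ** matrix_inv A = mat 1" "matrix_inv A ** A = mat 1" unfolding matrix_inv_def by auto
qed

lemma matrix_inv_eqI:
  fixes A :: "'n::finite matr" assumes "A ** B = mat 1"
  shows "invertible A" "matrix_inv A = B" "invertible B"
proof -
  have BA: "B ** A = mat 1" using assms matrix_left_right_inverse by blast
  show i: "invertible A" "invertible B" using assms BA unfolding invertible_def by blast+
  show "matrix_inv A = B" using matrix_inv_works(2)[OF i(1)] assms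
    by (metis matrix_mul_assoc matrix_mul_lid matrix_mul_rid)
qed

lemma invertible_inverse:
  fixes A :: "'n::finite matr" assumes "invertible A"
  shows "invertible (matrix_inv A)" "matrix_inv (matrix_inv A) = A"
  using matrix_inv_eqI[OF matrix_inv_works(2)[OF assms]] by auto

lemma conj_eq_iff:
  fixes A :: "'n::finite matr" assumes "invertible A"
  shows "A ** X ** matrix_inv A = Y \<longleftrightarrow> A ** X = Y ** A"
  using matrix_inv_works[OF assms] by (metis matrix_mul_assoc matrix_mul_rid)

lemma trace_mult_commute: "trace (A ** B) = trace (B ** A)" for A B :: "'n::finite matr"
  by (rule trace_mul_sym)

lemma conj_sl:
  fixes A :: "'n::finite matr" assumes "invertible A" "X \<in> sl" shows "A ** X ** matrix_inv A \<in> sl"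
  using assms matrix_inv_works[OF assms(1)] unfolding sl_def
  by (simp add: trace_mult_commute[of "A ** X"] matrix_mul_assoc)

section \<open>The projective linear group\<close>

lemma GL_simps [simp]: "carrier GL = {A. invertible A}" "x \<otimes>\<^bsub>GL\<^esub> y = x ** y" "\<one>\<^bsub>GL\<^esub> = mat 1"
  by (simp_all add: GL_def)

lemma group_GL: "group (GL :: 'n::finite matr monoid)"
proof (rule groupI)
  fix x :: "'n matr" assume "x \<in> carrier GL"
  then show "\<exists>y\<in>carrier GL. y \<otimes>\<^bsub>GL\<^esub> x = \<one>\<^bsub>GL\<^esub>"
    using invertible_inverse matrix_inv_works(2)[of x] by (intro bexI[of _ "matrix_inv x"]) auto
next
  show "\<one>\<^bsub>GL\<^esub> \<in> carrier (GL :: 'n matr monoid)" by (auto simp: invertible_def intro: exI[of _ "mat 1"])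
qed (simp_all add: invertible_mult matrix_mul_assoc)

text \<open>Every matrix differs from an invertible one by a multiple of the identity.  So what commutes with all
invertible matrices commutes with all matrices.\<close>

lemma shift_invertible: "\<exists>t. invertible (Y + t *\<^sub>R mat 1)" for Y :: "'n::finite matr"
proof -
  obtain B where B: "B > 0" "\<And>v. norm (Y *v v) \<le> B * norm v"
    using linear_bounded_pos[OF matrix_vector_mul_linear[of Y]] by blast
  have "inj ((*v) (Y + (B + 1) *\<^sub>R mat 1))"
    unfolding linear_injective_0[OF matrix_vector_mul_linear]
  proof (intro allI impI)
    fix v assume "(Y + (B + 1) *\<^sub>R mat 1) *v v = 0"
    then have "Y *v v = - ((B + 1) *\<^sub>R v)"
      by (simp add: matrix_vector_mult_add_rdistrib scaleR_matrix_vector_assoc[symmetric] eq_neg_iff_add_eq_0)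
    then have "(B + 1) * norm v \<le> B * norm v" using B(2)[of v] B(1) by simp
    then show "v = 0" by (simp add: algebra_simps)
  qed
  then have "invertible (Y + (B + 1) *\<^sub>R mat 1)"
    by (simp add: invertible_left_inverse matrix_left_invertible_injective)
  then show ?thesis by blast
qed

lemma center_commutes:
  fixes z :: "'n::finite matr" assumes "z \<in> grp_center GL" shows "invertible z" "z ** Y = Y ** z"
proof -
  show "invertible z" using assms by (simp add: grp_center_def)
  obtain t where "invertible (Y + t *\<^sub>R mat 1)" using shift_invertible by blast
  then have "z ** (Y + t *\<^sub>R mat 1) = (Y + t *\<^sub>R mat 1) ** z" using assms by (simp add: grp_center_def)
  then show "z ** Y = Y ** z" by (simp add: mm.add_left mm.add_right mm.scaleR_left mm.scaleR_right)
qed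

lemma center_normal: "normal (grp_center GL) (GL :: 'n::finite matr monoid)"
proof -
  interpret group "GL :: 'n matr monoid" by (rule group_GL)
  have inv: "inv\<^bsub>GL\<^esub> a = matrix_inv a" if "invertible a" for a :: "'n matr"
    by (rule inv_equality) (use that invertible_inverse matrix_inv_works in auto)
  have "subgroup (grp_center GL) (GL :: 'n matr monoid)"
  proof (rule subgroupI)
    show "grp_center GL \<subseteq> carrier (GL :: 'n matr monoid)" by (auto simp: grp_center_def)
    have "mat 1 \<in> grp_center (GL :: 'n matr monoid)" by (auto simp: grp_center_def invertible_def intro: exI[of _ "mat 1"])
    then show "grp_center (GL :: 'n matr monoid) \<noteq> {}" by blast
    fix a :: "'n matr" assume a: "a \<in> grp_center GL"
    have "matrix_inv a ** x = x ** matrix_inv a" for x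
      using matrix_inv_works[OF center_commutes(1)[OF a]] center_commutes(2)[OF a, of x]
      by (metis matrix_mul_assoc matrix_mul_lid matrix_mul_rid)
    then show "inv\<^bsub>GL\<^esub> a \<in> grp_center GL"
      using inv invertible_inverse center_commutes(1)[OF a] by (simp add: grp_center_def)
    fix b :: "'n matr" assume b: "b \<in> grp_center GL"
    have "a ** b ** x = x ** (a ** b)" for x
      using center_commutes(2)[OF a] center_commutes(2)[OF b] by (metis matrix_mul_assoc)
    then show "a \<otimes>\<^bsub>GL\<^esub> b \<in> grp_center GL"
      using center_commutes(1)[OF a] center_commutes(1)[OF b] by (simp add: grp_center_def invertible_mult)
  qed
  moreover have "x \<otimes>\<^bsub>GL\<^esub> h \<otimes>\<^bsub>GL\<^esub> inv\<^bsub>GL\<^esub> x \<in> grp_center GL"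
    if "x \<in> carrier GL" "h \<in> grp_center GL" for x h :: "'n matr"
  proof -
    have "x ** h ** matrix_inv x = h"
      using that center_commutes(2)[OF that(2)] by (subst conj_eq_iff) auto
    then show ?thesis using that inv by simp
  qed
  ultimately show ?thesis using normal_inv_iff by blast
qed

lemma PGL_mult:
  fixes A B :: "'n::finite matr" assumes "invertible A" "invertible B"
  shows "cls A \<otimes>\<^bsub>PGL\<^esub> cls B = cls (A ** B)"
  using normal.rcos_sum[OF center_normal, of A B] assms
  by (simp add: PGL_def cls_def FactGroup_def)

lemma cls_one: "cls (mat 1 :: 'n::finite matr) = \<one>\<^bsub>PGL\<^esub>"
proof -
  have "grp_center GL #>\<^bsub>GL\<^esub> (mat 1 :: 'n matr) = grp_center GL"
    by (simp add: r_coset_def)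
  then show ?thesis by (simp add: PGL_def cls_def FactGroup_def)
qed

lemma PGL_inv:
  fixes A :: "'n::finite matr" assumes "invertible A"
  shows "m_inv PGL (cls A) = cls (matrix_inv A)"
proof -
  interpret group "PGL :: 'n matr set monoid"
    unfolding PGL_def by (rule normal.factorgroup_is_group[OF center_normal])
  have c: "cls B \<in> carrier PGL" if "invertible B" for B :: "'n matr"
    using that by (auto simp: PGL_def cls_def FactGroup_def RCOSETS_def)
  show ?thesis
    by (rule inv_equality)
       (simp_all add: assms c invertible_inverse matrix_inv_works PGL_mult cls_one)
qed

lemma cls_member:
  assumes "B \<in> cls A" obtains z where "z \<in> grp_center GL" "B = z ** A"
  using assms by (auto simp: cls_def r_coset_def)

text \<open>The representative chosen in the definition of \<open>Ad\<close> differs from \<open>A\<close> by a central factor, which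
cancels in the conjugation.\<close>

lemma Ad_cls:
  fixes A :: "'n::finite matr" assumes A: "invertible A"
  shows "Ad (cls A) X = A ** X ** matrix_inv A"
proof -
  have "mat 1 \<in> grp_center (GL :: 'n matr monoid)" by (auto simp: grp_center_def invertible_def intro: exI[of _ "mat 1"])
  then have "A \<in> cls A" unfolding cls_def r_coset_def by force
  then have "(SOME B. B \<in> cls A) \<in> cls A" by (rule someI)
  then obtain z where z: "z \<in> grp_center GL" "(SOME B. B \<in> cls A) = z ** A" using cls_member by blast
  have "z ** A ** X ** matrix_inv (z ** A) = A ** X ** matrix_inv A"
  proof (subst conj_eq_iff)
    show "invertible (z ** A)" using center_commutes(1)[OF z(1)] A invertible_mult by blast
    define Y where "Y = A ** X ** matrix_inv A"
    have YA: "Y ** A = A ** X" using conj_eq_iff[OF A] Y_def by metis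
    have "z ** A ** X = z ** (Y ** A)" by (simp only: YA matrix_mul_assoc)
    also have "\<dots> = z ** Y ** A" by (simp only: matrix_mul_assoc)
    also have "\<dots> = Y ** (z ** A)" by (simp only: center_commutes(2)[OF z(1), of Y] matrix_mul_assoc)
    finally show "z ** A ** X = A ** X ** matrix_inv A ** (z ** A)" by (simp only: Y_def)
  qed
  then show ?thesis unfolding Ad_def by (simp add: z(2))
qed

lemma cls_scale:
  fixes A :: "'n::finite matr" assumes "c \<noteq> 0" shows "cls (c *\<^sub>R A) = cls A"
proof -
  have cen: "d *\<^sub>R mat 1 \<in> grp_center (GL :: 'n matr monoid)" if "d \<noteq> 0" for d
  proof -
    have "(d *\<^sub>R mat 1) ** (inverse d *\<^sub>R mat 1) = (mat 1 :: 'n matr)"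
      using that by (simp add: mm.scaleR_left mm.scaleR_right)
    then have "invertible (d *\<^sub>R mat 1 :: 'n matr)" using matrix_inv_eqI(1) by blast
    then show ?thesis by (auto simp: grp_center_def mm.scaleR_left mm.scaleR_right)
  qed
  have sub: "z ** (d *\<^sub>R B) \<in> cls B" if "z \<in> grp_center GL" "d \<noteq> 0" for z d and B :: "'n matr"
  proof -
    have "z ** (d *\<^sub>R mat 1) \<in> grp_center GL"
      using subgroup.m_closed[OF normal_imp_subgroup[OF center_normal] that(1) cen[OF that(2)]] by simp
    moreover have "z ** (d *\<^sub>R B) = z ** (d *\<^sub>R mat 1) ** B"
      by (simp add: mm.scaleR_left mm.scaleR_right)
    ultimately show ?thesis unfolding cls_def r_coset_def by auto
  qed
  have "cls (c *\<^sub>R A) \<subseteq> cls A" using sub[OF _ assms] cls_member by blast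
  moreover have "cls A \<subseteq> cls (c *\<^sub>R A)"
  proof
    fix B assume "B \<in> cls A"
    then obtain z where z: "z \<in> grp_center GL" "B = z ** A" by (rule cls_member)
    have "B = z ** (inverse c *\<^sub>R (c *\<^sub>R A))" using assms z by simp
    then show "B \<in> cls (c *\<^sub>R A)" using sub[OF z(1), of "inverse c" "c *\<^sub>R A"] assms by simp
  qed
  ultimately show ?thesis by blast
qed

section \<open>Entries of the pieces of the grading\<close>

lemma in_filt_m1: "X \<in> filt (-1) \<longleftrightarrow> trace X = 0 \<and> X $ Last $ First = 0"
  by (simp add: filt_def sl_def all_idx)

lemma in_filt_0: "X \<in> filt 0 \<longleftrightarrow> trace X = 0 \<and> X $ Last $ First = 0 \<and> (\<forall>m. X $ Mid m $ First = 0 \<and> X $ Last $ Mid m = 0)"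
  by (auto simp: filt_def sl_def all_idx)

lemma in_filt_1: "X \<in> filt 1 \<longleftrightarrow> (\<forall>i j. blk j \<le> blk i \<longrightarrow> X $ i $ j = 0)"
  by (auto simp: filt_def sl_def all_idx trace_idx)

lemma in_upper: "A \<in> upper_mats \<longleftrightarrow> invertible A \<and> A $ Last $ First = 0 \<and> (\<forall>m. A $ Mid m $ First = 0 \<and> A $ Last $ Mid m = 0)"
  by (auto simp: upper_mats_def all_idx)

lemma in_grade_m1: "X \<in> grade (-1) \<longleftrightarrow> (\<forall>i j. blk j - blk i \<noteq> -1 \<longrightarrow> X $ i $ j = 0)"
  by (auto simp: grade_def sl_def all_idx trace_idx)

lemma in_grade_1: "X \<in> grade 1 \<longleftrightarrow> (\<forall>i j. blk j - blk i \<noteq> 1 \<longrightarrow> X $ i $ j = 0)"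
  by (auto simp: grade_def sl_def all_idx trace_idx)

lemma in_grade_2: "X \<in> grade 2 \<longleftrightarrow> (\<forall>i j. blk j - blk i \<noteq> 2 \<longrightarrow> X $ i $ j = 0)"
  by (auto simp: grade_def sl_def all_idx trace_idx)

lemma upper_inv:
  assumes A: "A \<in> upper_mats" shows "matrix_inv A \<in> upper_mats"
proof -
  let ?C = "matrix_inv A"
  have i: "invertible A" using A by (simp add: upper_mats_def)
  have 1: "(A ** ?C) $ Last $ j = (mat 1 :: 'a matr) $ Last $ j" for j using matrix_inv_works(1)[OF i] by simp
  have 2: "(?C ** A) $ k $ First = (mat 1 :: 'a matr) $ k $ First" for k using matrix_inv_works(2)[OF i] by simp
  have L: "A $ Last $ Last * ?C $ Last $ j = (if j = Last then 1 else 0)" for j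
    using 1[of j] A by (auto simp: matr_mult_entry in_upper mat_one_entry)
  have F: "?C $ k $ First * A $ First $ First = (if k = First then 1 else 0)" for k
    using 2[of k] A by (auto simp: matr_mult_entry in_upper mat_one_entry)
  have "A $ Last $ Last \<noteq> 0" "A $ First $ First \<noteq> 0" using L[of Last] F[of First] by auto
  then show ?thesis using L F invertible_inverse[OF i] by (auto simp: in_upper)
      (metis idx.distinct mult_eq_0_iff)+
qed

lemma upper_mult: "A \<in> upper_mats \<Longrightarrow> B \<in> upper_mats \<Longrightarrow> A ** B \<in> upper_mats"
  by (auto simp: in_upper invertible_mult matr_mult_entry)

lemma upper_one: "mat 1 \<in> upper_mats"
  by (auto simp: in_upper mat_one_entry invertible_def intro: exI[of _ "mat 1"])

lemma upper_diag_nonzero: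
  assumes "A \<in> upper_mats" shows "A $ First $ First \<noteq> 0" "A $ Last $ Last \<noteq> 0"
proof -
  have i: "invertible A" using assms by (simp add: upper_mats_def)
  have "(A ** matrix_inv A) $ Last $ Last = 1" "(matrix_inv A ** A) $ First $ First = 1"
    using matrix_inv_works[OF i] by (simp_all add: mat_one_entry)
  then show "A $ First $ First \<noteq> 0" "A $ Last $ Last \<noteq> 0"
    using assms upper_inv[OF assms] by (auto simp: matr_mult_entry in_upper)
qed

section \<open>Exponentials\<close>

lemma filt1_mult: "X \<in> filt 1 \<Longrightarrow> Y \<in> filt 1 \<Longrightarrow> X ** Y \<in> filt 1"
  unfolding in_filt_1 by (auto simp: all_idx matr_mult_entry)

lemma filt1_cube: "X \<in> filt 1 \<Longrightarrow> Y \<in> filt 1 \<Longrightarrow> Z \<in> filt 1 \<Longrightarrow> X ** Y ** Z = 0"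
  unfolding in_filt_1 by (auto simp: all_idx matr_mult_entry matr_eq_iff)

lemma filt1_linear: "X \<in> filt 1 \<Longrightarrow> Y \<in> filt 1 \<Longrightarrow> a *\<^sub>R X + b *\<^sub>R Y \<in> filt 1"
  "X \<in> filt 1 \<Longrightarrow> Y \<in> filt 1 \<Longrightarrow> X + Y \<in> filt 1" "X \<in> filt 1 \<Longrightarrow> Y \<in> filt 1 \<Longrightarrow> X - Y \<in> filt 1"
  "X \<in> filt 1 \<Longrightarrow> - X \<in> filt 1" "X \<in> filt 1 \<Longrightarrow> a *\<^sub>R X \<in> filt 1"
  by (auto simp: in_filt_1)

lemma grade_filt1: "X \<in> grade 1 \<Longrightarrow> X \<in> filt 1" "X \<in> grade 2 \<Longrightarrow> X \<in> filt 1"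
  by (auto simp: grade_def filt_def)

lemma mat_exp_nilpotent:
  assumes "Z \<in> filt 1" shows "mat_exp Z = mat 1 + Z + (1/2) *\<^sub>R (Z ** Z)"
proof -
  have z: "(((**) Z) ^^ k) (mat 1) = 0" if "k \<ge> 3" for k
    using that
  proof (induction k rule: dec_induct)
    case base
    show ?case using filt1_cube[OF assms assms assms] by (simp add: numeral_3_eq_3 matrix_mul_assoc)
  next
    case (step k) then show ?case by (simp add: mm.zero_right)
  qed
  have "(\<lambda>k. (1 / fact k) *\<^sub>R (((**) Z) ^^ k) (mat 1)) sums (\<Sum>k<3. (1 / fact k) *\<^sub>R (((**) Z) ^^ k) (mat 1))"
    by (rule sums_finite) (use z in auto)
  then show ?thesis
    unfolding mat_exp_def by (simp add: sums_unique[symmetric] eval_nat_numeral)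
qed

lemma nilpotent_exp_mult:
  assumes "Z \<in> filt 1"
  shows "(mat 1 + s *\<^sub>R Z + (s\<^sup>2 / 2) *\<^sub>R (Z ** Z)) ** (mat 1 + t *\<^sub>R Z + (t\<^sup>2 / 2) *\<^sub>R (Z ** Z)) =
      mat 1 + (s + t) *\<^sub>R Z + ((s + t)\<^sup>2 / 2) *\<^sub>R (Z ** Z)"
proof -
  define W where "W = Z ** Z"
  have W: "Z ** Z = W" "Z ** W = 0" "W ** Z = 0" "W ** W = 0"
    using filt1_cube[OF assms assms assms] by (simp_all add: W_def matrix_mul_assoc mm.zero_left)
  have "(mat 1 + s *\<^sub>R Z + (s\<^sup>2 / 2) *\<^sub>R W) ** (mat 1 + t *\<^sub>R Z + (t\<^sup>2 / 2) *\<^sub>R W) =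
      mat 1 + (t *\<^sub>R Z + s *\<^sub>R Z) + (((t\<^sup>2 / 2) *\<^sub>R W + (s * t) *\<^sub>R W) + (s\<^sup>2 / 2) *\<^sub>R W)"
    by (simp add: mm.add_left mm.add_right mm.scaleR_left mm.scaleR_right W scaleR_add_right)
  also have "\<dots> = mat 1 + (s + t) *\<^sub>R Z + ((s + t)\<^sup>2 / 2) *\<^sub>R W"
    by (simp only: scaleR_add_left[symmetric]) (simp add: power2_sum add_divide_distrib add_ac)
  finally show ?thesis by (simp only: W)
qed

lemma unipotent_invertible:
  assumes "N \<in> filt 1" shows "(mat 1 + N) ** (mat 1 - N + N ** N) = mat 1"
  using filt1_cube[OF assms assms assms]
  by (simp add: mm.add_left mm.add_right mm.diff_right matrix_mul_assoc)

lemma unipotent_upper: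
  assumes "N \<in> filt 1" shows "mat 1 + N \<in> upper_mats"
  using matrix_inv_eqI(1)[OF unipotent_invertible[OF assms]] assms
  by (auto simp: in_upper in_filt_1 mat_one_entry)

text \<open>The logarithm is \<open>N - N\<^sup>2 / 2\<close>, as products of three elements of \<open>\<pp>\<^sub>+\<close> vanish.\<close>

lemma unipotent_log:
  assumes N: "N \<in> filt 1"
  obtains Z where "Z \<in> filt 1" "mat_exp Z = mat 1 + N"
proof
  define Z where "Z = N - (1/2) *\<^sub>R (N ** N)"
  have Z: "Z \<in> filt 1" unfolding Z_def by (intro filt1_linear(3,5) filt1_mult N)
  have c: "N ** (N ** N) = 0" "N ** N ** N = 0" "N ** N ** (N ** N) = 0"
    using filt1_cube[OF N N N] by (simp_all add: matrix_mul_assoc mm.zero_left)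
  have "Z ** Z = N ** N"
    unfolding Z_def by (simp add: mm.diff_left mm.diff_right mm.scaleR_left mm.scaleR_right c)
  then show "mat_exp Z = mat 1 + N" using mat_exp_nilpotent[OF Z] by (simp add: Z_def)
  show "Z \<in> filt 1" by (rule Z)
qed

lemma Pplus_unipotent: "Pplus_grp = {cls (mat 1 + N) | N. N \<in> filt 1}" (is "?L = ?R")
proof
  show "?L \<subseteq> ?R"
  proof
    fix a assume "a \<in> ?L"
    then obtain Z where Z: "Z \<in> filt 1" "a = cls (mat_exp Z)" by (auto simp: Pplus_grp_def)
    have "Z + (1/2) *\<^sub>R (Z ** Z) \<in> filt 1" by (intro filt1_linear(2,5) filt1_mult Z)
    then show "a \<in> ?R" using Z mat_exp_nilpotent[OF Z(1)] by (auto simp: add.assoc)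
  qed
  show "?R \<subseteq> ?L"
  proof
    fix a assume "a \<in> ?R"
    then obtain N where N: "N \<in> filt 1" "a = cls (mat 1 + N)" by blast
    obtain Z where "Z \<in> filt 1" "mat_exp Z = mat 1 + N" using unipotent_log[OF N(1)] .
    then show "a \<in> ?L" using N(2) unfolding Pplus_grp_def by (metis imageI)
  qed
qed

lemma matr_has_vector_derivative:
  fixes M :: "real \<Rightarrow> 'n::finite matr"
  assumes "\<And>i j. ((\<lambda>t. M t $ i $ j) has_vector_derivative D $ i $ j) (at t)"
  shows "(M has_vector_derivative D) (at t)"
  unfolding has_vector_derivative_def
proof (subst has_derivative_componentwise_within, intro ballI)
  fix b :: "'n matr" assume "b \<in> Basis"
  then obtain i j where b: "b = axis i (axis j 1)" by (auto simp: Basis_vec_def)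
  show "((\<lambda>x. M x \<bullet> b) has_derivative (\<lambda>x. x *\<^sub>R D \<bullet> b)) (at t)"
    using assms[of i j] by (simp add: b inner_axis has_vector_derivative_def)
qed

lemma summable_mat_exp:
  "summable (\<lambda>k. (1 / fact k) *\<^sub>R (((**) X) ^^ k) (mat 1))" for X :: "'n::finite matr"
proof -
  obtain K where K: "K > 0" "\<forall>(A :: 'n matr) (B :: 'n matr). norm (A ** B) \<le> norm A * norm B * K"
    using mm.pos_bounded by auto
  have b: "norm ((((**) X) ^^ k) (mat 1)) \<le> (norm X * K) ^ k * norm (mat 1 :: 'n matr)" for k
  proof (induction k)
    case (Suc k)
    have "norm ((((**) X) ^^ Suc k) (mat 1)) \<le> norm X * norm ((((**) X) ^^ k) (mat 1)) * K"
      using K(2)[rule_format, of X "(((**) X) ^^ k) (mat 1)"] by simp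
    also have "\<dots> \<le> norm X * ((norm X * K) ^ k * norm (mat 1 :: 'n matr)) * K"
      using Suc K(1) by (intro mult_right_mono mult_left_mono) auto
    finally show ?case by (simp add: mult_ac)
  qed simp
  have s: "summable (\<lambda>k. inverse (fact k) * (norm X * K) ^ k * norm (mat 1 :: 'n matr))"
    by (intro summable_mult2 summable_exp)
  show ?thesis
    by (rule summable_comparison_test'[OF s, of 0])
       (use b in \<open>simp add: divide_inverse mult_left_mono mult.assoc\<close>)
qed

lemma mat_exp_entry: "mat_exp (t *\<^sub>R X) $ i $ j = (\<Sum>k. ((((**) X) ^^ k) (mat 1) $ i $ j / fact k) * t ^ k)"
    and summable_mat_exp_entry: "summable (\<lambda>k. ((((**) X) ^^ k) (mat 1) $ i $ j / fact k) * t ^ k)"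
  for X :: "'n::finite matr"
proof -
  have p: "(((**) (t *\<^sub>R X)) ^^ k) (mat 1) = t ^ k *\<^sub>R (((**) X) ^^ k) (mat 1)" for k
    by (induction k) (simp_all add: mm.scaleR_left mm.scaleR_right)
  have bl: "bounded_linear (\<lambda>A::'n matr. A $ i $ j)"
    using bounded_linear_compose[OF bounded_linear_vec_nth bounded_linear_vec_nth] .
  have e: "((1 / fact k) *\<^sub>R (((**) (t *\<^sub>R X)) ^^ k) (mat 1)) $ i $ j = ((((**) X) ^^ k) (mat 1) $ i $ j / fact k) * t ^ k" for k
    by (simp add: p)
  show "mat_exp (t *\<^sub>R X) $ i $ j = (\<Sum>k. ((((**) X) ^^ k) (mat 1) $ i $ j / fact k) * t ^ k)"
    unfolding mat_exp_def using bounded_linear.suminf[OF bl summable_mat_exp[of "t *\<^sub>R X"]] by (simp only: e)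
  show "summable (\<lambda>k. ((((**) X) ^^ k) (mat 1) $ i $ j / fact k) * t ^ k)"
    using bounded_linear.summable[OF bl summable_mat_exp[of "t *\<^sub>R X"]] by (simp only: e)
qed

text \<open>The entries of \<open>exp(t X)\<close> are everywhere convergent power series in \<open>t\<close>.\<close>

lemma mat_exp_derivative: "((\<lambda>t. mat_exp (t *\<^sub>R X)) has_vector_derivative X) (at 0)" for X :: "'n::finite matr"
proof (rule matr_has_vector_derivative)
  fix i j
  let ?c = "\<lambda>k. (((**) X) ^^ k) (mat 1) $ i $ j / fact k"
  have "((\<lambda>t. \<Sum>k. ?c k * t ^ k) has_field_derivative (\<Sum>k. diffs ?c k * 0 ^ k)) (at 0)"
    by (rule termdiffs_strong_converges_everywhere) (rule summable_mat_exp_entry)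
  moreover have "(\<Sum>k. diffs ?c k * 0 ^ k) = X $ i $ j"
    unfolding powser_zero by (simp add: diffs_def)
  ultimately show "((\<lambda>t. mat_exp (t *\<^sub>R X) $ i $ j) has_vector_derivative X $ i $ j) (at 0)"
    by (simp only: mat_exp_entry has_real_derivative_iff_has_vector_derivative)
qed

lemma mat_exp_upper_entry:
  assumes "X \<in> filt 0" "blk j < blk i" shows "mat_exp (t *\<^sub>R X) $ i $ j = 0"
proof -
  have "(((**) X) ^^ k) (mat 1) $ i $ j = 0" if "blk j < blk i" for k i j
    using that
  proof (induction k arbitrary: i j)
    case 0 then show ?case by (auto simp: mat_one_entry)
  next
    case (Suc k)
    then show ?case using assms(1)
      by (cases i; cases j) (auto simp: matr_mult_entry in_filt_0)
  qed
  then show ?thesis using assms(2) by (simp add: mat_exp_entry)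
qed

lemma mat_exp_zero: "mat_exp (0 :: 'n::finite matr) = mat 1"
proof -
  have "(0 :: 'n matr) \<in> filt 1" by (simp add: in_filt_1)
  from mat_exp_nilpotent[OF this] show ?thesis by (simp add: mm.zero_left)
qed

lemma eventually_invertible:
  fixes M :: "real \<Rightarrow> 'n::finite matr"
  assumes "(M has_vector_derivative D) (at 0)" "M 0 = mat 1"
  shows "\<forall>\<^sub>F t in nhds 0. invertible (M t)"
proof -
  have "isCont M 0" using assms(1) has_vector_derivative_continuous by blast
  then have c: "isCont (\<lambda>t. M t $ i $ j) 0" for i j by (intro continuous_intros)
  have "isCont (\<lambda>t. det (M t)) 0" unfolding det_def by (intro continuous_intros c)
  then have "((\<lambda>t. det (M t)) \<longlongrightarrow> 1) (nhds 0)"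
    using assms(2) tendsto_at_iff_tendsto_nhds[of "\<lambda>t. det (M t)" 0] by (simp add: isCont_def)
  then have "\<forall>\<^sub>F t in nhds 0. det (M t) \<in> - {0}"
    by (rule topological_tendstoD) auto
  then show ?thesis by eventually_elim (simp add: invertible_det_nz)
qed

lemma mat_exp_upper: "X \<in> filt 0 \<Longrightarrow> \<forall>\<^sub>F t in nhds 0. mat_exp (t *\<^sub>R X) \<in> upper_mats"
  using eventually_invertible[OF mat_exp_derivative[of X]]
  by (auto elim!: eventually_mono simp: mat_exp_zero in_upper mat_exp_upper_entry)

section \<open>The trace form and dual bases\<close>

lemma elem_mat_entry: "elem_mat a b $ i $ j = (if i = a \<and> j = b then 1 else 0)"
  by (simp add: elem_mat_def)

lemma bas_entry: "bas \<alpha> $ i $ j = (if i = fst \<alpha> \<and> j = snd \<alpha> then 1 else 0)"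
  by (simp add: bas_def elem_mat_entry)

lemma dual_bas_entry: "dual_bas \<alpha> $ i $ j = (if i = snd \<alpha> \<and> j = fst \<alpha> then 1 else 0)"
  by (simp add: dual_bas_def elem_mat_entry)

lemma lower_part_entry: "lower_part X $ i $ j = (if blk j < blk i then X $ i $ j else 0)"
  by (simp add: lower_part_def)

lemma lower_part_linear: "linear (lower_part :: 'n::finite matr \<Rightarrow> 'n matr)"
  by (auto simp: linear_iff matr_eq_iff lower_part_entry)

lemma lower_part_idem [simp]: "lower_part (lower_part X) = lower_part X"
  by (simp add: matr_eq_iff lower_part_entry)

lemma lower_part_bas: "\<alpha> \<in> low_idx \<Longrightarrow> lower_part (bas \<alpha>) = bas \<alpha>" "\<alpha> \<notin> low_idx \<Longrightarrow> lower_part (bas \<alpha>) = 0"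
  by (auto simp: matr_eq_iff lower_part_entry bas_entry low_idx_def)

lemma pairing_sum: "pairing Z X = (\<Sum>i\<in>UNIV. \<Sum>j\<in>UNIV. Z $ i $ j * X $ j $ i)"
  by (simp add: pairing_def trace_def matrix_matrix_mult_def)

lemma bounded_bilinear_pairing: "bounded_bilinear (pairing :: 'n::finite matr \<Rightarrow> 'n matr \<Rightarrow> real)"
  unfolding bilinear_conv_bounded_bilinear[symmetric] bilinear_def linear_iff
  by (auto simp: pairing_sum algebra_simps sum.distrib sum_distrib_left)

interpretation pair: bounded_bilinear "pairing :: 'n::finite matr \<Rightarrow> 'n matr \<Rightarrow> real"
  by (rule bounded_bilinear_pairing)

lemma bounded_bilinear_commutator: "bounded_bilinear (commutator :: 'n::finite matr \<Rightarrow> 'n matr \<Rightarrow> 'n matr)"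
  unfolding bilinear_conv_bounded_bilinear[symmetric] bilinear_def linear_iff commutator_def
  by (auto simp: mm.add_left mm.add_right mm.scaleR_left mm.scaleR_right algebra_simps)

interpretation com: bounded_bilinear "commutator :: 'n::finite matr \<Rightarrow> 'n matr \<Rightarrow> 'n matr"
  by (rule bounded_bilinear_commutator)

lemma pairing_lower:
  assumes "Z \<in> filt 1" shows "pairing Z (lower_part X) = pairing Z X"
  unfolding pairing_sum
proof (intro sum.cong refl)
  fix i j show "Z $ i $ j * lower_part X $ j $ i = Z $ i $ j * X $ j $ i"
    using assms unfolding in_filt_1 by (cases "blk i < blk j") (auto simp: lower_part_entry not_less)
qed

lemma pairing_dual_bas: "pairing (dual_bas \<alpha>) X = X $ fst \<alpha> $ snd \<alpha>"
proof -
  have "pairing (dual_bas \<alpha>) X = (\<Sum>i\<in>UNIV. \<Sum>j\<in>UNIV. if i = snd \<alpha> then (if j = fst \<alpha> then X $ j $ i else 0) else 0)"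
    unfolding pairing_sum by (intro sum.cong refl) (auto simp: dual_bas_entry)
  also have "\<dots> = X $ fst \<alpha> $ snd \<alpha>" by (subst sum.swap) (simp add: if_distrib[of "\<lambda>x. sum x _"])
  finally show ?thesis .
qed

lemma dual_bas_filt1: "\<alpha> \<in> low_idx \<Longrightarrow> dual_bas \<alpha> \<in> filt 1"
  by (auto simp: in_filt_1 dual_bas_entry low_idx_def)

lemma commutator_filt1: "X \<in> filt 1 \<Longrightarrow> Y \<in> filt 1 \<Longrightarrow> commutator X Y \<in> filt 1"
  unfolding commutator_def by (intro filt1_linear(3) filt1_mult)

lemma pairing_commutator: "pairing (commutator A B) X = pairing A (commutator B X)"
  unfolding pairing_def commutator_def
  by (simp add: mm.diff_left mm.diff_right matrix_mul_assoc trace_sub)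
     (metis matrix_mul_assoc trace_mul_sym)

lemma pairing_commute: "pairing A B = pairing B A"
  unfolding pairing_def by (rule trace_mul_sym)

lemma commutator_anti: "commutator B A = - commutator A B"
  by (simp add: commutator_def)

lemma lower_part_expand: "lower_part X = (\<Sum>\<alpha>\<in>low_idx. pairing (dual_bas \<alpha>) X *\<^sub>R bas \<alpha>)"
proof -
  have "(\<Sum>\<alpha>\<in>low_idx. pairing (dual_bas \<alpha>) X *\<^sub>R bas \<alpha>) $ i $ j = lower_part X $ i $ j" for i j
  proof -
    have "(\<Sum>\<alpha>\<in>low_idx. pairing (dual_bas \<alpha>) X *\<^sub>R bas \<alpha>) $ i $ j
       = (\<Sum>\<alpha>\<in>low_idx. if \<alpha> = (i, j) then X $ i $ j else 0)"
      unfolding sum_component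
      by (intro sum.cong refl) (auto simp: pairing_dual_bas bas_entry)
    then show ?thesis by (simp add: lower_part_entry low_idx_def)
  qed
  then show ?thesis by (simp add: matr_eq_iff)
qed

section \<open>The homology differential\<close>

definition cochain2 :: "('n::finite matr \<Rightarrow> 'n matr \<Rightarrow> 'n matr) set" where
  "cochain2 = {\<psi>. (\<forall>Y. linear (\<lambda>X. \<psi> X Y)) \<and> (\<forall>X. linear (\<lambda>Y. \<psi> X Y)) \<and>
     (\<forall>X. \<psi> X X = 0) \<and> (\<forall>X Y. lower_part X = 0 \<longrightarrow> \<psi> X Y = 0) \<and> (\<forall>X Y. \<psi> X Y \<in> sl)}"

lemma linear_lower_part:
  assumes l: "linear f" and z: "\<And>X. lower_part X = 0 \<Longrightarrow> f X = 0"
  shows "f (lower_part X) = f X"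
proof -
  have "lower_part (X - lower_part X) = 0" using linear_diff[OF lower_part_linear, of X "lower_part X"] by simp
  then have "f (X - lower_part X) = 0" using z by blast
  then show ?thesis using linear_diff[OF l] by simp
qed

lemma linear_expand:
  assumes l: "linear f" and z: "\<And>X. lower_part X = 0 \<Longrightarrow> f X = 0"
  shows "f X = (\<Sum>\<alpha>\<in>low_idx. pairing (dual_bas \<alpha>) X *\<^sub>R f (bas \<alpha>))"
proof -
  have "f X = f (\<Sum>\<alpha>\<in>low_idx. pairing (dual_bas \<alpha>) X *\<^sub>R bas \<alpha>)"
    using linear_lower_part[OF l z, of X] by (simp add: lower_part_expand)
  then show ?thesis by (simp add: linear_sum[OF l] linear_scale[OF l])
qed

lemma cochain2D:
  assumes "\<psi> \<in> cochain2"
  shows "linear (\<lambda>X. \<psi> X Y)" "linear (\<lambda>Y. \<psi> X Y)" "\<psi> Y X = - \<psi> X Y" "\<psi> X X = 0"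
    "lower_part X = 0 \<Longrightarrow> \<psi> X Y = 0" "lower_part Y = 0 \<Longrightarrow> \<psi> X Y = 0" "\<psi> X Y \<in> sl"
proof -
  show l: "linear (\<lambda>X. \<psi> X Y)" "linear (\<lambda>Y. \<psi> X Y)" for X Y using assms by (auto simp: cochain2_def)
  show z: "\<psi> X X = 0" for X using assms by (auto simp: cochain2_def)
  have "\<psi> (X + Y) (X + Y) = 0" by (rule z)
  then show a: "\<psi> Y X = - \<psi> X Y"
    using z[of X] z[of Y] linear_add[OF l(1)] linear_add[OF l(2)]
    by (simp add: eq_neg_iff_add_eq_0 add.commute)
  show "lower_part X = 0 \<Longrightarrow> \<psi> X Y = 0" for X Y using assms by (auto simp: cochain2_def)
  then show "lower_part Y = 0 \<Longrightarrow> \<psi> X Y = 0"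
    using a by (metis neg_equal_0_iff_equal)
  show "\<psi> X Y \<in> sl" using assms by (auto simp: cochain2_def)
qed

lemma cochain3D:
  assumes "\<xi> \<in> cochain3"
  shows "linear (\<lambda>X. \<xi> X Y W)" "linear (\<lambda>Y. \<xi> X Y W)" "linear (\<lambda>W. \<xi> X Y W)"
    "\<xi> Y X W = - \<xi> X Y W" "\<xi> X W Y = - \<xi> X Y W"
    "lower_part X = 0 \<Longrightarrow> \<xi> X Y W = 0" "lower_part Y = 0 \<Longrightarrow> \<xi> X Y W = 0" "lower_part W = 0 \<Longrightarrow> \<xi> X Y W = 0"
proof -
  show l: "linear (\<lambda>X. \<xi> X Y W)" "linear (\<lambda>Y. \<xi> X Y W)" "linear (\<lambda>W. \<xi> X Y W)" for X Y W
    using assms by (auto simp: cochain3_def)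
  have z: "\<xi> X X W = 0" "\<xi> X W W = 0" for X W using assms by (auto simp: cochain3_def)
  have "\<xi> (X + Y) (X + Y) W = 0" for X Y W by (rule z)
  then show a: "\<xi> Y X W = - \<xi> X Y W" for X Y W
    using z(1)[of X W] z(1)[of Y W] linear_add[OF l(1)[where Y = "X + Y" and W = W], of X Y]
      linear_add[OF l(2)[where X = X and W = W], of X Y] linear_add[OF l(2)[where X = Y and W = W], of X Y]
    by (simp add: eq_neg_iff_add_eq_0 add.commute)
  have "\<xi> X (Y + W) (Y + W) = 0" for X Y W by (rule z)
  then show b: "\<xi> X W Y = - \<xi> X Y W" for X Y W
    using z(2)[of X Y] z(2)[of X W] linear_add[OF l(2)[where X = X and W = "Y + W"], of Y W]
      linear_add[OF l(3)[where X = X and Y = Y], of Y W] linear_add[OF l(3)[where X = X and Y = W], of Y W]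
    by (simp add: eq_neg_iff_add_eq_0 add.commute)
  show 0: "lower_part X = 0 \<Longrightarrow> \<xi> X Y W = 0" for X Y W using assms by (auto simp: cochain3_def)
  show 1: "lower_part Y = 0 \<Longrightarrow> \<xi> X Y W = 0" for X Y W using 0 a by (metis neg_equal_0_iff_equal)
  show "lower_part W = 0 \<Longrightarrow> \<xi> X Y W = 0" using 1 b by (metis neg_equal_0_iff_equal)
qed

text \<open>In terms of dual bases \<open>e\<^sub>\<alpha>\<close> of \<open>\<gg>/\<pp>\<close> and \<open>Z\<^sub>\<alpha>\<close> of \<open>\<pp>\<^sub>+\<close> the differential is a contraction.  Summing over one
of the two indices restores the arbitrary argument \<open>X\<close>.\<close>

lemma codiff2_formula:
  assumes \<psi>: "\<psi> \<in> cochain2"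
  shows "codiff2 \<psi> X = - (\<Sum>\<alpha>\<in>low_idx. commutator (dual_bas \<alpha>) (\<psi> (bas \<alpha>) X))
     - (1/2) *\<^sub>R (\<Sum>\<beta>\<in>low_idx. \<psi> (commutator (dual_bas \<beta>) X) (bas \<beta>))"
proof -
  let ?Z = dual_bas and ?e = bas
  note c = cochain2D[OF \<psi>]
  define F where "F \<alpha> \<beta> = pairing (?Z \<beta>) X *\<^sub>R commutator (?Z \<alpha>) (\<psi> (?e \<alpha>) (?e \<beta>))" for \<alpha> \<beta>
  define G where "G \<alpha> \<beta> = pairing (?Z \<alpha>) (commutator (?Z \<beta>) X) *\<^sub>R \<psi> (?e \<alpha>) (?e \<beta>)" for \<alpha> \<beta>
  have pc: "pairing (commutator (?Z \<alpha>) (?Z \<beta>)) (lower_part U) = pairing (?Z \<alpha>) (commutator (?Z \<beta>) U)"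
    if "\<alpha> \<in> low_idx" "\<beta> \<in> low_idx" for \<alpha> \<beta> U
    using pairing_lower[OF commutator_filt1[OF dual_bas_filt1[OF that(1)] dual_bas_filt1[OF that(2)]], of U]
    by (simp only: pairing_commutator)
  have half: "(1/2) *\<^sub>R (- A - A - B) = - A - (1/2) *\<^sub>R B" for A B :: "'a matr"
    by (simp add: matr_eq_iff field_simps)
  have h: "hdiff2 (?Z \<alpha>) (?Z \<beta>) (\<psi> (?e \<alpha>) (?e \<beta>)) X = - F \<alpha> \<beta> - F \<beta> \<alpha> - G \<alpha> \<beta>"
    if "\<alpha> \<in> low_idx" "\<beta> \<in> low_idx" for \<alpha> \<beta>
    using that c(3)[of "?e \<beta>" "?e \<alpha>"]
    by (simp add: hdiff2_def one_form_def F_def G_def pc pairing_lower dual_bas_filt1 com.minus_right)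
  have sF: "(\<Sum>\<beta>\<in>low_idx. F \<alpha> \<beta>) = commutator (?Z \<alpha>) (\<psi> (?e \<alpha>) X)" for \<alpha>
  proof -
    have "\<psi> (?e \<alpha>) X = (\<Sum>\<beta>\<in>low_idx. pairing (?Z \<beta>) X *\<^sub>R \<psi> (?e \<alpha>) (?e \<beta>))"
      by (rule linear_expand[OF c(2) c(6)])
    then show ?thesis by (simp add: F_def com.sum_right com.scaleR_right)
  qed
  have sG: "(\<Sum>\<alpha>\<in>low_idx. G \<alpha> \<beta>) = \<psi> (commutator (?Z \<beta>) X) (?e \<beta>)" for \<beta>
    unfolding G_def by (rule linear_expand[OF c(1) c(5), symmetric])
  have "(\<Sum>\<alpha>\<in>low_idx. \<Sum>\<beta>\<in>low_idx. hdiff2 (?Z \<alpha>) (?Z \<beta>) (\<psi> (?e \<alpha>) (?e \<beta>)) X)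
     = (\<Sum>\<alpha>\<in>low_idx. \<Sum>\<beta>\<in>low_idx. - F \<alpha> \<beta> - F \<beta> \<alpha> - G \<alpha> \<beta>)"
    by (intro sum.cong refl h)
  also have "\<dots> = - (\<Sum>\<alpha>\<in>low_idx. \<Sum>\<beta>\<in>low_idx. F \<alpha> \<beta>) - (\<Sum>\<alpha>\<in>low_idx. \<Sum>\<beta>\<in>low_idx. F \<beta> \<alpha>) - (\<Sum>\<alpha>\<in>low_idx. \<Sum>\<beta>\<in>low_idx. G \<alpha> \<beta>)"
    by (simp add: sum_subtractf sum_negf)
  also have "(\<Sum>\<alpha>\<in>low_idx. \<Sum>\<beta>\<in>low_idx. F \<beta> \<alpha>) = (\<Sum>\<alpha>\<in>low_idx. \<Sum>\<beta>\<in>low_idx. F \<alpha> \<beta>)"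
    by (rule sum.swap)
  also have "(\<Sum>\<alpha>\<in>low_idx. \<Sum>\<beta>\<in>low_idx. G \<alpha> \<beta>) = (\<Sum>\<beta>\<in>low_idx. \<Sum>\<alpha>\<in>low_idx. G \<alpha> \<beta>)"
    by (rule sum.swap)
  finally show ?thesis unfolding codiff2_def sF sG by (simp only: half)
qed

lemma codiff3_formula:
  assumes \<xi>: "\<xi> \<in> cochain3"
  shows "codiff3 \<xi> X Y = - (\<Sum>\<alpha>\<in>low_idx. commutator (dual_bas \<alpha>) (\<xi> (bas \<alpha>) X Y))
     - (1/2) *\<^sub>R (\<Sum>\<beta>\<in>low_idx. \<xi> (commutator (dual_bas \<beta>) X) (bas \<beta>) Y - \<xi> (commutator (dual_bas \<beta>) Y) (bas \<beta>) X)"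
proof -
  let ?Z = dual_bas and ?e = bas and ?I = "low_idx :: ('a idx \<times> 'a idx) set"
  note c = cochain3D[OF \<xi>]
  define F where "F \<alpha> \<beta> \<gamma> = wedge (?Z \<beta>) (?Z \<gamma>) (commutator (?Z \<alpha>) (\<xi> (?e \<alpha>) (?e \<beta>) (?e \<gamma>))) X Y" for \<alpha> \<beta> \<gamma>
  define G where "G \<alpha> \<beta> \<gamma> = wedge (commutator (?Z \<alpha>) (?Z \<beta>)) (?Z \<gamma>) (\<xi> (?e \<alpha>) (?e \<beta>) (?e \<gamma>)) X Y" for \<alpha> \<beta> \<gamma>
  have wm: "wedge A B (- C) X Y = - wedge A B C X Y" for A B C :: "'a matr" by (simp add: wedge_def)
  have h: "hdiff3 (?Z \<alpha>) (?Z \<beta>) (?Z \<gamma>) (\<xi> (?e \<alpha>) (?e \<beta>) (?e \<gamma>)) X Y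
     = - F \<alpha> \<beta> \<gamma> - F \<beta> \<alpha> \<gamma> - F \<gamma> \<alpha> \<beta> - G \<alpha> \<beta> \<gamma> - G \<alpha> \<gamma> \<beta> - G \<beta> \<gamma> \<alpha>" for \<alpha> \<beta> \<gamma>
  proof -
    have 1: "\<xi> (?e \<beta>) (?e \<alpha>) (?e \<gamma>) = - \<xi> (?e \<alpha>) (?e \<beta>) (?e \<gamma>)" by (rule c(4))
    have 2: "\<xi> (?e \<alpha>) (?e \<gamma>) (?e \<beta>) = - \<xi> (?e \<alpha>) (?e \<beta>) (?e \<gamma>)" by (rule c(5))
    have 3: "\<xi> (?e \<gamma>) (?e \<alpha>) (?e \<beta>) = \<xi> (?e \<alpha>) (?e \<beta>) (?e \<gamma>)"
      using c(4)[where X = "?e \<alpha>" and Y = "?e \<gamma>" and W = "?e \<beta>"] 2 by simp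
    have 4: "\<xi> (?e \<beta>) (?e \<gamma>) (?e \<alpha>) = \<xi> (?e \<alpha>) (?e \<beta>) (?e \<gamma>)"
      using c(5)[where X = "?e \<beta>" and W = "?e \<gamma>" and Y = "?e \<alpha>"] 1 by simp
    show ?thesis unfolding hdiff3_def F_def G_def 1 2 3 4 wm com.minus_right by simp
  qed
  have s1: "(\<Sum>\<alpha>\<in>?I. \<Sum>\<beta>\<in>?I. \<Sum>\<gamma>\<in>?I. H \<beta> \<alpha> \<gamma>) = (\<Sum>\<alpha>\<in>?I. \<Sum>\<beta>\<in>?I. \<Sum>\<gamma>\<in>?I. H \<alpha> \<beta> \<gamma>)"
    for H :: "_ \<Rightarrow> _ \<Rightarrow> _ \<Rightarrow> 'a matr" by (rule sum.swap)
  have s2: "(\<Sum>\<alpha>\<in>?I. \<Sum>\<beta>\<in>?I. \<Sum>\<gamma>\<in>?I. H \<alpha> \<gamma> \<beta>) = (\<Sum>\<alpha>\<in>?I. \<Sum>\<beta>\<in>?I. \<Sum>\<gamma>\<in>?I. H \<alpha> \<beta> \<gamma>)"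
    for H :: "_ \<Rightarrow> _ \<Rightarrow> _ \<Rightarrow> 'a matr" by (rule sum.cong[OF refl], rule sum.swap)
  have s3: "(\<Sum>\<alpha>\<in>?I. \<Sum>\<beta>\<in>?I. \<Sum>\<gamma>\<in>?I. H \<gamma> \<alpha> \<beta>) = (\<Sum>\<alpha>\<in>?I. \<Sum>\<beta>\<in>?I. \<Sum>\<gamma>\<in>?I. H \<alpha> \<beta> \<gamma>)"
    for H :: "_ \<Rightarrow> _ \<Rightarrow> _ \<Rightarrow> 'a matr"
    using s2[of "\<lambda>\<alpha> \<beta> \<gamma>. H \<beta> \<alpha> \<gamma>"] s1[of H] by simp
  have s4: "(\<Sum>\<alpha>\<in>?I. \<Sum>\<beta>\<in>?I. \<Sum>\<gamma>\<in>?I. H \<beta> \<gamma> \<alpha>) = (\<Sum>\<alpha>\<in>?I. \<Sum>\<beta>\<in>?I. \<Sum>\<gamma>\<in>?I. H \<alpha> \<beta> \<gamma>)"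
    for H :: "_ \<Rightarrow> _ \<Rightarrow> _ \<Rightarrow> 'a matr"
    using s1[of "\<lambda>\<alpha> \<beta> \<gamma>. H \<alpha> \<gamma> \<beta>"] s2[of H] by simp
  have S: "(\<Sum>\<alpha>\<in>?I. \<Sum>\<beta>\<in>?I. \<Sum>\<gamma>\<in>?I. hdiff3 (?Z \<alpha>) (?Z \<beta>) (?Z \<gamma>) (\<xi> (?e \<alpha>) (?e \<beta>) (?e \<gamma>)) X Y)
     = - (3 *\<^sub>R (\<Sum>\<alpha>\<in>?I. \<Sum>\<beta>\<in>?I. \<Sum>\<gamma>\<in>?I. F \<alpha> \<beta> \<gamma>)) - 3 *\<^sub>R (\<Sum>\<alpha>\<in>?I. \<Sum>\<beta>\<in>?I. \<Sum>\<gamma>\<in>?I. G \<alpha> \<beta> \<gamma>)"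
  proof -
    have "3 *\<^sub>R A = A + A + A" for A :: "'a matr"
      by (simp add: matr_eq_iff)
    then show ?thesis
      unfolding h by (simp add: sum_subtractf sum_negf s1[of F] s3[of F] s2[of G] s4[of G])
  qed
  have sF: "(\<Sum>\<beta>\<in>?I. \<Sum>\<gamma>\<in>?I. F \<alpha> \<beta> \<gamma>) = 2 *\<^sub>R commutator (?Z \<alpha>) (\<xi> (?e \<alpha>) X Y)" for \<alpha>
  proof -
    have ex: "(\<Sum>\<beta>\<in>?I. \<Sum>\<gamma>\<in>?I. (pairing (?Z \<beta>) U * pairing (?Z \<gamma>) V) *\<^sub>R commutator (?Z \<alpha>) (\<xi> (?e \<alpha>) (?e \<beta>) (?e \<gamma>)))
        = commutator (?Z \<alpha>) (\<xi> (?e \<alpha>) U V)" for U V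
    proof -
      have "\<xi> (?e \<alpha>) U V = (\<Sum>\<beta>\<in>?I. pairing (?Z \<beta>) U *\<^sub>R \<xi> (?e \<alpha>) (?e \<beta>) V)"
        by (rule linear_expand[OF c(2) c(7)])
      also have "\<dots> = (\<Sum>\<beta>\<in>?I. pairing (?Z \<beta>) U *\<^sub>R (\<Sum>\<gamma>\<in>?I. pairing (?Z \<gamma>) V *\<^sub>R \<xi> (?e \<alpha>) (?e \<beta>) (?e \<gamma>)))"
        by (intro sum.cong refl arg_cong2[of _ _ _ _ scaleR] linear_expand[OF c(3) c(8)])
      finally show ?thesis by (simp add: com.sum_right com.scaleR_right scaleR_sum_right)
    qed
    have "(\<Sum>\<beta>\<in>?I. \<Sum>\<gamma>\<in>?I. F \<alpha> \<beta> \<gamma>) =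
        (\<Sum>\<beta>\<in>?I. \<Sum>\<gamma>\<in>?I. (pairing (?Z \<beta>) X * pairing (?Z \<gamma>) Y) *\<^sub>R commutator (?Z \<alpha>) (\<xi> (?e \<alpha>) (?e \<beta>) (?e \<gamma>)))
      - (\<Sum>\<beta>\<in>?I. \<Sum>\<gamma>\<in>?I. (pairing (?Z \<beta>) Y * pairing (?Z \<gamma>) X) *\<^sub>R commutator (?Z \<alpha>) (\<xi> (?e \<alpha>) (?e \<beta>) (?e \<gamma>)))"
      unfolding sum_subtractf[symmetric]
      by (intro sum.cong refl) (simp add: F_def wedge_def pairing_lower dual_bas_filt1 scaleR_diff_left)
    then have "(\<Sum>\<beta>\<in>?I. \<Sum>\<gamma>\<in>?I. F \<alpha> \<beta> \<gamma>) = commutator (?Z \<alpha>) (\<xi> (?e \<alpha>) X Y) - commutator (?Z \<alpha>) (\<xi> (?e \<alpha>) Y X)"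
      unfolding ex .
    then show ?thesis using c(5)[where X = "?e \<alpha>" and W = Y and Y = X] by (simp add: com.minus_right scaleR_2)
  qed
  have pc: "pairing (commutator (?Z \<alpha>) (?Z \<beta>)) (lower_part U) = pairing (?Z \<alpha>) (commutator (?Z \<beta>) U)"
    if "\<alpha> \<in> ?I" "\<beta> \<in> ?I" for \<alpha> \<beta> U
    using pairing_lower[OF commutator_filt1[OF dual_bas_filt1[OF that(1)] dual_bas_filt1[OF that(2)]], of U]
    by (simp only: pairing_commutator)
  have sG: "(\<Sum>\<alpha>\<in>?I. \<Sum>\<gamma>\<in>?I. G \<alpha> \<beta> \<gamma>) = \<xi> (commutator (?Z \<beta>) X) (?e \<beta>) Y - \<xi> (commutator (?Z \<beta>) Y) (?e \<beta>) X"
    if b: "\<beta> \<in> ?I" for \<beta>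
  proof -
    have ex: "(\<Sum>\<alpha>\<in>?I. \<Sum>\<gamma>\<in>?I. (pairing (?Z \<alpha>) (commutator (?Z \<beta>) U) * pairing (?Z \<gamma>) V) *\<^sub>R \<xi> (?e \<alpha>) (?e \<beta>) (?e \<gamma>))
        = \<xi> (commutator (?Z \<beta>) U) (?e \<beta>) V" for U V
    proof -
      have "\<xi> (commutator (?Z \<beta>) U) (?e \<beta>) V = (\<Sum>\<alpha>\<in>?I. pairing (?Z \<alpha>) (commutator (?Z \<beta>) U) *\<^sub>R \<xi> (?e \<alpha>) (?e \<beta>) V)"
        by (rule linear_expand[OF c(1) c(6)])
      also have "\<dots> = (\<Sum>\<alpha>\<in>?I. pairing (?Z \<alpha>) (commutator (?Z \<beta>) U) *\<^sub>R (\<Sum>\<gamma>\<in>?I. pairing (?Z \<gamma>) V *\<^sub>R \<xi> (?e \<alpha>) (?e \<beta>) (?e \<gamma>)))"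
        by (intro sum.cong refl arg_cong2[of _ _ _ _ scaleR] linear_expand[OF c(3) c(8)])
      finally show ?thesis by (simp add: scaleR_sum_right)
    qed
    have "(\<Sum>\<alpha>\<in>?I. \<Sum>\<gamma>\<in>?I. G \<alpha> \<beta> \<gamma>) =
        (\<Sum>\<alpha>\<in>?I. \<Sum>\<gamma>\<in>?I. (pairing (?Z \<alpha>) (commutator (?Z \<beta>) X) * pairing (?Z \<gamma>) Y) *\<^sub>R \<xi> (?e \<alpha>) (?e \<beta>) (?e \<gamma>))
      - (\<Sum>\<alpha>\<in>?I. \<Sum>\<gamma>\<in>?I. (pairing (?Z \<alpha>) (commutator (?Z \<beta>) Y) * pairing (?Z \<gamma>) X) *\<^sub>R \<xi> (?e \<alpha>) (?e \<beta>) (?e \<gamma>))"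
      unfolding sum_subtractf[symmetric]
      by (intro sum.cong refl)
         (simp add: G_def wedge_def pc pairing_lower dual_bas_filt1 b scaleR_diff_left)
    then show ?thesis unfolding ex .
  qed
  have tF: "(\<Sum>\<alpha>\<in>?I. \<Sum>\<beta>\<in>?I. \<Sum>\<gamma>\<in>?I. F \<alpha> \<beta> \<gamma>) = 2 *\<^sub>R (\<Sum>\<alpha>\<in>?I. commutator (?Z \<alpha>) (\<xi> (?e \<alpha>) X Y))"
    by (simp add: sF scaleR_sum_right)
  have "(\<Sum>\<alpha>\<in>?I. \<Sum>\<beta>\<in>?I. \<Sum>\<gamma>\<in>?I. G \<alpha> \<beta> \<gamma>) = (\<Sum>\<beta>\<in>?I. \<Sum>\<alpha>\<in>?I. \<Sum>\<gamma>\<in>?I. G \<alpha> \<beta> \<gamma>)"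
    by (rule sum.swap)
  also have "\<dots> = (\<Sum>\<beta>\<in>?I. \<xi> (commutator (?Z \<beta>) X) (?e \<beta>) Y - \<xi> (commutator (?Z \<beta>) Y) (?e \<beta>) X)"
    by (intro sum.cong refl sG)
  finally have tG: "(\<Sum>\<alpha>\<in>?I. \<Sum>\<beta>\<in>?I. \<Sum>\<gamma>\<in>?I. G \<alpha> \<beta> \<gamma>)
     = (\<Sum>\<beta>\<in>?I. \<xi> (commutator (?Z \<beta>) X) (?e \<beta>) Y - \<xi> (commutator (?Z \<beta>) Y) (?e \<beta>) X)" .
  show ?thesis unfolding codiff3_def S tF tG by (simp add: scaleR_diff_right)
qed

text \<open>The natural action of \<open>\<pp>\<close> on cochains with values in \<open>\<gg>\<close>.\<close>

definition act2 :: "'n::finite matr \<Rightarrow> ('n matr \<Rightarrow> 'n matr \<Rightarrow> 'n matr) \<Rightarrow> 'n matr \<Rightarrow> 'n matr \<Rightarrow> 'n matr" where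
  "act2 A \<psi> X Y = commutator A (\<psi> X Y) - \<psi> (commutator A X) Y - \<psi> X (commutator A Y)"

lemma codiff3_linear:
  "codiff3 (\<lambda>X Y W. a *\<^sub>R \<xi> X Y W + b *\<^sub>R \<eta> X Y W) X Y = a *\<^sub>R codiff3 \<xi> X Y + b *\<^sub>R codiff3 \<eta> X Y"
proof -
  have l: "linear (\<lambda>C. hdiff3 A B D C X Y)" for A B D :: "'a matr"
    by (auto simp: linear_iff hdiff3_def wedge_def com.add_right com.scaleR_right algebra_simps)
  show ?thesis
    by (simp add: codiff3_def linear_add[OF l] linear_scale[OF l] sum.distrib scaleR_add_right scaleR_sum_right mult.commute)
qed

lemma sl_linear: "A \<in> sl \<Longrightarrow> B \<in> sl \<Longrightarrow> a *\<^sub>R A + b *\<^sub>R B \<in> sl"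
  by (simp add: sl_def trace_def sum.distrib sum_distrib_left[symmetric])

lemma lower_part_sl: "lower_part X \<in> sl"
  by (simp add: sl_def trace_def lower_part_entry)

lemma filt0_sl: "X \<in> filt 0 \<Longrightarrow> X \<in> sl" "X \<in> filt 1 \<Longrightarrow> X \<in> sl" "X \<in> filt 1 \<Longrightarrow> X \<in> filt 0"
  by (auto simp: in_filt_0 in_filt_1 trace_idx sl_def)

lemma sl_add: "A \<in> sl \<Longrightarrow> B \<in> sl \<Longrightarrow> A + B \<in> sl" and sl_diff: "A \<in> sl \<Longrightarrow> B \<in> sl \<Longrightarrow> A - B \<in> sl"
  using sl_linear[of A B 1 1] sl_linear[of A B 1 "-1"] by simp_all

lemma upper_part_filt0: "X \<in> sl \<Longrightarrow> X - lower_part X \<in> filt 0"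
  by (auto simp: in_filt_0 lower_part_entry sl_def trace_def)

lemma commutator_sl: "commutator X Y \<in> sl"
  by (simp add: sl_def commutator_def trace_sub trace_mult_commute)

lemma cochain3_linear:
  assumes x: "\<xi> \<in> cochain3" "\<eta> \<in> cochain3"
  shows "(\<lambda>X Y W. a *\<^sub>R \<xi> X Y W + b *\<^sub>R \<eta> X Y W) \<in> cochain3"
  using x unfolding cochain3_def
  by (auto intro!: linear_compose_add linear_compose_scale_right sl_linear)

text \<open>A homotopy formula in the style of Cartan: \<open>\<partial>\<^sup>*(Z \<and> \<psi>) + Z \<and> \<partial>\<^sup>*\<psi> = - Z \<cdot> \<psi>\<close>.  For coclosed \<open>\<psi>\<close> it exhibits
\<open>Z \<cdot> \<psi>\<close> as a boundary.  This is why \<open>P\<^sub>+\<close> does not move the harmonic curvature.\<close>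

lemma homotopy_formula:
  assumes \<psi>: "\<psi> \<in> cochain2" and Z: "Z \<in> filt 1" and cl: "\<And>X. codiff2 \<psi> X = 0"
  shows "act2 Z \<psi> \<in> im_codiff"
proof -
  note c = cochain2D[OF \<psi>]
  define \<xi> where "\<xi> X Y W = pairing Z X *\<^sub>R \<psi> Y W - pairing Z Y *\<^sub>R \<psi> X W + pairing Z W *\<^sub>R \<psi> X Y" for X Y W
  have lp: "pairing Z X = 0" if "lower_part X = 0" for X using pairing_lower[OF Z, of X] that by (simp add: pair.zero_right)
  have sl: "a *\<^sub>R A - b *\<^sub>R B + d *\<^sub>R D \<in> sl" if "A \<in> sl" "B \<in> sl" "D \<in> sl" for a b d and A B D :: "'a matr"
    using sl_linear[OF sl_linear[OF that(1,2), of a "- b"] that(3), of 1 d] by simp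
  have l: "linear (\<lambda>X. pairing Z X *\<^sub>R C)" for C :: "'a matr"
    by (simp add: linear_iff pair.add_right pair.scaleR_right scaleR_add_left)
  have cc: "\<xi> \<in> cochain3"
    unfolding cochain3_def \<xi>_def
  proof (intro CollectI conjI allI impI)
    fix X Y W :: "'a matr"
    show "linear (\<lambda>X. pairing Z X *\<^sub>R \<psi> Y W - pairing Z Y *\<^sub>R \<psi> X W + pairing Z W *\<^sub>R \<psi> X Y)"
      "linear (\<lambda>Y. pairing Z X *\<^sub>R \<psi> Y W - pairing Z Y *\<^sub>R \<psi> X W + pairing Z W *\<^sub>R \<psi> X Y)"
      "linear (\<lambda>W. pairing Z X *\<^sub>R \<psi> Y W - pairing Z Y *\<^sub>R \<psi> X W + pairing Z W *\<^sub>R \<psi> X Y)"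
      by (intro linear_compose_add linear_compose_sub linear_compose_scale_right l c)+
    show "pairing Z X *\<^sub>R \<psi> X Y - pairing Z X *\<^sub>R \<psi> X Y + pairing Z Y *\<^sub>R \<psi> X X = 0"
      "pairing Z X *\<^sub>R \<psi> Y Y - pairing Z Y *\<^sub>R \<psi> X Y + pairing Z Y *\<^sub>R \<psi> X Y = 0"
      by (simp_all add: c(4))
    show "pairing Z X *\<^sub>R \<psi> Y W - pairing Z Y *\<^sub>R \<psi> X W + pairing Z W *\<^sub>R \<psi> X Y \<in> sl"
      by (intro sl c)
    show "pairing Z X *\<^sub>R \<psi> Y W - pairing Z Y *\<^sub>R \<psi> X W + pairing Z W *\<^sub>R \<psi> X Y = 0" if "lower_part X = 0"
      by (simp add: lp[OF that] c(5)[OF that])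
  qed
  have k: "codiff3 \<xi> X Y = - act2 Z \<psi> X Y" for X Y
  proof -
    let ?Q = "\<lambda>X. \<Sum>\<beta>\<in>low_idx. \<psi> (commutator (dual_bas \<beta>) X) (bas \<beta>)"
    let ?R = "\<lambda>X. \<Sum>\<alpha>\<in>low_idx. commutator (dual_bas \<alpha>) (\<psi> (bas \<alpha>) X)"
    have QR: "?R X = - ((1/2) *\<^sub>R ?Q X)" for X
    proof -
      have n: "A = - B" if "- A - B = 0" for A B :: "'a matr"
        using that by (metis add.inverse_inverse eq_iff_diff_eq_0)
      show ?thesis by (rule n) (use cl[of X] in \<open>simp only: codiff2_formula[OF \<psi>]\<close>)
    qed
    have dz: "(\<Sum>\<alpha>\<in>low_idx. pairing Z (bas \<alpha>) *\<^sub>R dual_bas \<alpha>) = Z"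
    proof -
      have "pairing Z (bas \<alpha>) = Z $ snd \<alpha> $ fst \<alpha>" for \<alpha>
        using pairing_dual_bas[of "(snd \<alpha>, fst \<alpha>)" Z] by (simp add: pairing_commute[of Z] dual_bas_def bas_def)
      then have "(\<Sum>\<alpha>\<in>low_idx. pairing Z (bas \<alpha>) *\<^sub>R dual_bas \<alpha>) $ i $ j
         = (\<Sum>\<alpha>\<in>low_idx. if \<alpha> = (j, i) then Z $ i $ j else 0)" for i j
        unfolding sum_component by (intro sum.cong refl) (auto simp: dual_bas_entry)
      then show ?thesis using Z by (auto simp: matr_eq_iff in_filt_1 low_idx_def)
    qed
    have 1: "(\<Sum>\<alpha>\<in>low_idx. commutator (dual_bas \<alpha>) (\<xi> (bas \<alpha>) X Y))
       = commutator Z (\<psi> X Y) - pairing Z X *\<^sub>R ?R Y + pairing Z Y *\<^sub>R ?R X"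
    proof -
      have "(\<Sum>\<alpha>\<in>low_idx. commutator (dual_bas \<alpha>) (\<xi> (bas \<alpha>) X Y))
         = (\<Sum>\<alpha>\<in>low_idx. commutator (pairing Z (bas \<alpha>) *\<^sub>R dual_bas \<alpha>) (\<psi> X Y)) - pairing Z X *\<^sub>R ?R Y + pairing Z Y *\<^sub>R ?R X"
        by (simp add: \<xi>_def com.add_right com.diff_right com.scaleR_right com.scaleR_left sum.distrib sum_subtractf scaleR_sum_right)
      then show ?thesis by (simp add: com.sum_left[symmetric] dz)
    qed
    have 2: "(\<Sum>\<beta>\<in>low_idx. \<xi> (commutator (dual_bas \<beta>) X) (bas \<beta>) Y) = - 2 *\<^sub>R \<psi> (commutator Z X) Y + pairing Z Y *\<^sub>R ?Q X" for X Y
    proof -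
      have p: "pairing Z (commutator (dual_bas \<beta>) X) = - pairing (dual_bas \<beta>) (commutator Z X)" for \<beta>
        by (simp only: pairing_commutator[symmetric] commutator_anti[of "dual_bas \<beta>" Z] pair.minus_left)
      have e1: "(\<Sum>\<beta>\<in>low_idx. pairing (dual_bas \<beta>) (commutator Z X) *\<^sub>R \<psi> (bas \<beta>) Y) = \<psi> (commutator Z X) Y"
        by (rule linear_expand[OF c(1) c(5), symmetric])
      have e2: "(\<Sum>\<beta>\<in>low_idx. pairing Z (bas \<beta>) *\<^sub>R \<psi> (commutator (dual_bas \<beta>) X) Y) = \<psi> (commutator Z X) Y"
      proof -
        have "\<psi> (commutator Z X) Y = \<psi> (commutator (\<Sum>\<alpha>\<in>low_idx. pairing Z (bas \<alpha>) *\<^sub>R dual_bas \<alpha>) X) Y" by (simp only: dz)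
        then show ?thesis by (simp add: com.sum_left com.scaleR_left linear_sum[OF c(1)] linear_scale[OF c(1)])
      qed
      have "(\<Sum>\<beta>\<in>low_idx. \<xi> (commutator (dual_bas \<beta>) X) (bas \<beta>) Y)
        = - (\<Sum>\<beta>\<in>low_idx. pairing (dual_bas \<beta>) (commutator Z X) *\<^sub>R \<psi> (bas \<beta>) Y)
          - (\<Sum>\<beta>\<in>low_idx. pairing Z (bas \<beta>) *\<^sub>R \<psi> (commutator (dual_bas \<beta>) X) Y) + pairing Z Y *\<^sub>R ?Q X"
        by (simp add: \<xi>_def p sum.distrib sum_subtractf sum_negf scaleR_sum_right)
      then show ?thesis unfolding e1 e2 by (simp add: scaleR_2)
    qed
    have 3: "\<psi> (commutator Z Y) X = - \<psi> X (commutator Z Y)" by (rule c(3))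
    show ?thesis
      unfolding codiff3_formula[OF cc] 1 sum_subtractf 2 QR 3
      by (simp add: act2_def algebra_simps)
  qed
  have "act2 Z \<psi> = codiff3 (\<lambda>X Y W. (-1) *\<^sub>R \<xi> X Y W + 0 *\<^sub>R \<xi> X Y W)"
    by (intro ext) (simp only: codiff3_linear k, simp)
  then show ?thesis unfolding im_codiff_def using cochain3_linear[OF cc cc, of "-1" 0] by blast
qed

section \<open>Separating cochains from boundaries\<close>

text \<open>Cochains as elements of a Euclidean space, so that boundaries can be split off
orthogonally and linear functionals are inner products.\<close>

definition coords2 :: "('n::finite matr \<Rightarrow> 'n matr \<Rightarrow> 'n matr) \<Rightarrow> ('n matr ^ ('n idx \<times> 'n idx)) ^ ('n idx \<times> 'n idx)" where
  "coords2 \<psi> = (\<chi> \<alpha> \<beta>. \<psi> (bas \<alpha>) (bas \<beta>))"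

lemma im_codiff_expand:
  assumes "\<psi> \<in> im_codiff"
  shows "linear (\<lambda>X. \<psi> X Y)" "linear (\<lambda>Y. \<psi> X Y)" "lower_part X = 0 \<Longrightarrow> \<psi> X Y = 0" "lower_part Y = 0 \<Longrightarrow> \<psi> X Y = 0"
proof -
  obtain \<xi> where \<psi>: "\<psi> = codiff3 \<xi>" using assms by (auto simp: im_codiff_def)
  have l: "linear (\<lambda>X. wedge A B C X Y)" "linear (\<lambda>Y. wedge A B C X Y)" for A B C X and Y :: "'a matr"
    by (auto simp: linear_iff wedge_def linear_add[OF lower_part_linear] linear_scale[OF lower_part_linear] pair.add_right pair.scaleR_right algebra_simps)
  show "linear (\<lambda>X. \<psi> X Y)" "linear (\<lambda>Y. \<psi> X Y)"
    unfolding \<psi> codiff3_def hdiff3_def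
    by (intro linear_compose_scale_right linear_compose_sum ballI linear_compose_sub linear_compose_add linear_compose_neg l)+
  show "lower_part X = 0 \<Longrightarrow> \<psi> X Y = 0" "lower_part Y = 0 \<Longrightarrow> \<psi> X Y = 0"
    by (simp_all add: \<psi> codiff3_def hdiff3_def wedge_def pair.zero_right)
qed

lemma coords2_inj:
  assumes "\<And>Y. linear (\<lambda>X. \<psi> X Y)" "\<And>X. linear (\<lambda>Y. \<psi> X Y)"
    "\<And>X Y. lower_part X = 0 \<Longrightarrow> \<psi> X Y = 0" "\<And>X Y. lower_part Y = 0 \<Longrightarrow> \<psi> X Y = 0"
    and "\<And>Y. linear (\<lambda>X. \<phi> X Y)" "\<And>X. linear (\<lambda>Y. \<phi> X Y)"
    "\<And>X Y. lower_part X = 0 \<Longrightarrow> \<phi> X Y = 0" "\<And>X Y. lower_part Y = 0 \<Longrightarrow> \<phi> X Y = 0"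
    and eq: "coords2 \<psi> = coords2 \<phi>"
  shows "\<psi> = \<phi>"
proof (intro ext)
  fix X Y
  have b: "\<psi> (bas \<alpha>) (bas \<beta>) = \<phi> (bas \<alpha>) (bas \<beta>)" for \<alpha> \<beta>
    using arg_cong[OF eq, of "\<lambda>v. v $ \<alpha> $ \<beta>"] by (simp add: coords2_def)
  have "\<psi> (bas \<alpha>) Y = \<phi> (bas \<alpha>) Y" for \<alpha>
    using linear_expand[OF assms(2,4), of "bas \<alpha>" Y] linear_expand[OF assms(6,8), of "bas \<alpha>" Y] b by simp
  then show "\<psi> X Y = \<phi> X Y"
    using linear_expand[OF assms(1)[of Y] assms(3)[of _ Y], of X]
      linear_expand[OF assms(5)[of Y] assms(7)[of _ Y], of X] by simp
qed

lemma im_codiff_linear: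
  assumes "\<psi> \<in> im_codiff" "\<phi> \<in> im_codiff"
  shows "(\<lambda>X Y. a *\<^sub>R \<psi> X Y + b *\<^sub>R \<phi> X Y) \<in> im_codiff"
proof -
  obtain \<xi> \<xi>' where x: "\<xi> \<in> cochain3" "\<xi>' \<in> cochain3" "\<psi> = codiff3 \<xi>" "\<phi> = codiff3 \<xi>'"
    using assms by (auto simp: im_codiff_def)
  have "(\<lambda>X Y. a *\<^sub>R \<psi> X Y + b *\<^sub>R \<phi> X Y) = codiff3 (\<lambda>X Y W. a *\<^sub>R \<xi> X Y W + b *\<^sub>R \<xi>' X Y W)"
    by (simp add: fun_eq_iff codiff3_linear x)
  then show ?thesis using cochain3_linear[OF x(1,2), of a b] unfolding im_codiff_def by blast
qed

lemma subspace_coords_im_codiff: "subspace (coords2 ` im_codiff)"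
proof -
  note im = im_codiff_linear
  have z: "(\<lambda>X Y. 0) \<in> (im_codiff :: ('a matr \<Rightarrow> 'a matr \<Rightarrow> 'a matr) set)"
  proof -
    have "(\<lambda>X Y W. 0) \<in> (cochain3 :: ('a matr \<Rightarrow> 'a matr \<Rightarrow> 'a matr \<Rightarrow> 'a matr) set)"
      by (auto simp: cochain3_def linear_iff sl_def trace_def)
    moreover have "codiff3 (\<lambda>X Y W. 0) = (\<lambda>X Y. 0 :: 'a matr)"
      by (simp add: fun_eq_iff codiff3_def hdiff3_def wedge_def com.zero_right)
    ultimately show ?thesis unfolding im_codiff_def by (metis imageI)
  qed
  show ?thesis unfolding subspace_def
  proof (intro conjI ballI allI)
    show "0 \<in> coords2 ` (im_codiff :: ('a matr \<Rightarrow> 'a matr \<Rightarrow> 'a matr) set)"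
      by (rule image_eqI[OF _ z]) (simp add: coords2_def vec_eq_iff)
    fix x y assume "x \<in> coords2 ` (im_codiff :: ('a matr \<Rightarrow> 'a matr \<Rightarrow> 'a matr) set)" "y \<in> coords2 ` (im_codiff :: ('a matr \<Rightarrow> 'a matr \<Rightarrow> 'a matr) set)"
    then obtain \<psi> \<phi> where p: "\<psi> \<in> im_codiff" "\<phi> \<in> im_codiff" "x = coords2 \<psi>" "y = coords2 \<phi>" by blast
    show "x + y \<in> coords2 ` (im_codiff :: ('a matr \<Rightarrow> 'a matr \<Rightarrow> 'a matr) set)"
      by (rule image_eqI[OF _ im[OF p(1,2), of 1 1]]) (simp add: coords2_def vec_eq_iff p)
  next
    fix c x assume "x \<in> coords2 ` (im_codiff :: ('a matr \<Rightarrow> 'a matr \<Rightarrow> 'a matr) set)"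
    then obtain \<psi> where p: "\<psi> \<in> im_codiff" "x = coords2 \<psi>" by blast
    show "c *\<^sub>R x \<in> coords2 ` (im_codiff :: ('a matr \<Rightarrow> 'a matr \<Rightarrow> 'a matr) set)"
      by (rule image_eqI[OF _ im[OF p(1,1), of c 0]]) (simp add: coords2_def vec_eq_iff p)
  qed
qed

lemma im_codiff_separation:
  assumes \<psi>: "\<psi> \<in> cochain2"
    and l: "\<And>l. (\<And>\<beta>. \<beta> \<in> im_codiff \<Longrightarrow> l \<bullet> coords2 \<beta> = 0) \<Longrightarrow> l \<bullet> coords2 \<psi> = 0"
  shows "\<psi> \<in> im_codiff"
proof -
  let ?S = "coords2 ` (im_codiff :: ('a matr \<Rightarrow> 'a matr \<Rightarrow> 'a matr) set)"
  obtain y z where yz: "y \<in> span ?S" "\<And>w. w \<in> span ?S \<Longrightarrow> orthogonal z w" "coords2 \<psi> = y + z"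
    using orthogonal_subspace_decomp_exists[of ?S "coords2 \<psi>"] by blast
  have "z \<bullet> coords2 \<beta> = 0" if "\<beta> \<in> im_codiff" for \<beta>
    using yz(2)[of "coords2 \<beta>"] that span_base[of "coords2 \<beta>" ?S] by (auto simp: orthogonal_def)
  then have "z \<bullet> coords2 \<psi> = 0" by (rule l)
  moreover have "z \<bullet> y = 0" using yz by (simp add: orthogonal_def)
  ultimately have "z = 0" using yz(3) by (simp add: inner_add_right)
  moreover have "span ?S = ?S" using subspace_coords_im_codiff span_eq_iff by blast
  ultimately have "coords2 \<psi> \<in> ?S" using yz(1,3) by (simp del: span_eq_iff)
  then obtain \<beta> where b: "\<beta> \<in> im_codiff" "coords2 \<psi> = coords2 \<beta>" by blast
  have "\<psi> = \<beta>"
    by (rule coords2_inj[OF cochain2D(1)[OF \<psi>] cochain2D(2)[OF \<psi>] cochain2D(5)[OF \<psi>] cochain2D(6)[OF \<psi>]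
        im_codiff_expand(1)[OF b(1)] im_codiff_expand(2)[OF b(1)] im_codiff_expand(3)[OF b(1)] im_codiff_expand(4)[OF b(1)] b(2)])
  then show ?thesis using b by simp
qed

text \<open>Let \<open>e\<^sub>\<beta>\<close> be of degree \<open>-1\<close>.  Then \<open>[Z\<^sub>\<gamma>, e\<^sub>\<beta>]\<close> lies in \<open>\<pp>\<close> for all \<open>\<gamma>\<close>, so that \<open>\<partial>\<^sup>*\<psi> = 0\<close> at \<open>e\<^sub>\<beta>\<close> reduces to
\<open>\<Sum>\<^sub>\<gamma> [Z\<^sub>\<gamma>, \<psi>(e\<^sub>\<gamma>, e\<^sub>\<beta>)] = 0\<close>.  Each entry of this sum of degree \<open>-1\<close> consists, up to sign, of a
single \<open>\<gg>\<^sub>-\<^sub>2\<close>-component \<open>\<psi>(e\<^sub>\<alpha>, e\<^sub>\<beta>)\<close> with \<open>e\<^sub>\<alpha>\<close> of degree \<open>-1\<close>.\<close>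

lemma coclosed_homogeneity_0:
  assumes \<psi>: "\<psi> \<in> cochain2" and cl: "\<And>X. codiff2 \<psi> X = 0"
    and \<alpha>: "\<alpha> \<in> low_idx" "blk (fst \<alpha>) - blk (snd \<alpha>) = 1" and \<beta>: "\<beta> \<in> low_idx" "blk (fst \<beta>) - blk (snd \<beta>) = 1"
  shows "\<psi> (bas \<alpha>) (bas \<beta>) $ Last $ First = 0"
proof -
  note c = cochain2D[OF \<psi>]
  have "lower_part (commutator (dual_bas \<gamma>) (bas \<beta>)) = 0" if "\<gamma> \<in> low_idx" for \<gamma>
  proof -
    have "commutator (dual_bas \<gamma>) (bas \<beta>) $ i $ j = 0" if "blk j < blk i" for i j
    proof -
      have "dual_bas \<gamma> $ i $ k * bas \<beta> $ k $ j = 0" "bas \<beta> $ i $ k * dual_bas \<gamma> $ k $ j = 0" for k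
        using \<open>\<gamma> \<in> low_idx\<close> that \<beta> by (auto simp: dual_bas_entry bas_entry low_idx_def)
      then have "(\<Sum>k\<in>UNIV. dual_bas \<gamma> $ i $ k * bas \<beta> $ k $ j) = 0" "(\<Sum>k\<in>UNIV. bas \<beta> $ i $ k * dual_bas \<gamma> $ k $ j) = 0"
        by (simp_all only: sum.neutral_const)
      then show ?thesis by (simp add: commutator_def matrix_matrix_mult_def)
    qed
    then show ?thesis by (simp add: matr_eq_iff lower_part_entry)
  qed
  then have R: "(\<Sum>\<gamma>\<in>low_idx. commutator (dual_bas \<gamma>) (\<psi> (bas \<gamma>) (bas \<beta>))) = 0"
    using cl[of "bas \<beta>"] c(5) by (simp add: codiff2_formula[OF \<psi>])
  have e1: "commutator (dual_bas \<gamma>) C $ Mid m $ First = (if \<gamma> = (Last, Mid m) then C $ Last $ First else 0)"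
    if "\<gamma> \<in> low_idx" for \<gamma> C m
  proof (cases \<gamma>)
    case (Pair a b)
    then show ?thesis using that
      by (cases a; cases b) (auto simp: commutator_def matr_mult_entry dual_bas_entry low_idx_def if_distrib if_distribR cong: if_cong)
  qed
  have e2: "commutator (dual_bas \<gamma>) C $ Last $ Mid m = (if \<gamma> = (Mid m, First) then - C $ Last $ First else 0)"
    if "\<gamma> \<in> low_idx" for \<gamma> C m
  proof (cases \<gamma>)
    case (Pair a b)
    then show ?thesis using that
      by (cases a; cases b) (auto simp: commutator_def matr_mult_entry dual_bas_entry low_idx_def if_distrib if_distribR cong: if_cong)
  qed
  have "\<exists>m. \<alpha> = (Last, Mid m) \<or> \<alpha> = (Mid m, First)"
    by (cases "fst \<alpha>"; cases "snd \<alpha>") (use \<alpha>(2) in \<open>auto simp: prod_eq_iff\<close>)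
  then obtain m where "\<alpha> = (Last, Mid m) \<or> \<alpha> = (Mid m, First)" by blast
  then show ?thesis
  proof
    assume a: "\<alpha> = (Last, Mid m)"
    have "0 = (\<Sum>\<gamma>\<in>low_idx. commutator (dual_bas \<gamma>) (\<psi> (bas \<gamma>) (bas \<beta>))) $ Mid m $ First" by (simp add: R)
    also have "\<dots> = (\<Sum>\<gamma>\<in>low_idx. if \<gamma> = (Last, Mid m) then \<psi> (bas \<gamma>) (bas \<beta>) $ Last $ First else 0)"
      unfolding sum_component by (intro sum.cong refl e1)
    also have "\<dots> = \<psi> (bas \<alpha>) (bas \<beta>) $ Last $ First" using \<alpha> a by simp
    finally show ?thesis by simp
  next
    assume a: "\<alpha> = (Mid m, First)"
    have "0 = (\<Sum>\<gamma>\<in>low_idx. commutator (dual_bas \<gamma>) (\<psi> (bas \<gamma>) (bas \<beta>))) $ Last $ Mid m" by (simp add: R)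
    also have "\<dots> = (\<Sum>\<gamma>\<in>low_idx. if \<gamma> = (Mid m, First) then - \<psi> (bas \<gamma>) (bas \<beta>) $ Last $ First else 0)"
      unfolding sum_component by (intro sum.cong refl e2)
    also have "\<dots> = - \<psi> (bas \<alpha>) (bas \<beta>) $ Last $ First" using \<alpha> a by simp
    finally show ?thesis by simp
  qed
qed

section \<open>Exterior derivatives of related forms\<close>

lemma mderiv_self: "mderiv A B f p L \<Longrightarrow> mderiv A B f p (tangent_map A B f p)"
  using mderiv_tangent_map[of A B f p L] by simp

lemma mderiv_velocity: "mderiv euclid_atlas A \<gamma> 0 L \<Longrightarrow> velocity A \<gamma> = L 1"
proof -
  assume m: "mderiv euclid_atlas A \<gamma> 0 L"
  have "((snd (chart_at A (\<gamma> 0)) \<circ> \<gamma>) has_derivative L) (at 0)" using m by (simp add: mderiv_def)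
  moreover have "L r = r *\<^sub>R L 1" for r using linear_scale[OF mderiv_linear[OF m], of r 1] by simp
  ultimately have "((snd (chart_at A (\<gamma> 0)) \<circ> \<gamma>) has_vector_derivative L 1) (at 0)"
    unfolding has_vector_derivative_def by (metis (no_types, lifting) ext)
  then show ?thesis unfolding velocity_def by (rule vector_derivative_at)
qed

lemma chart_inv_prod:
  assumes c: "is_chart c" and z: "z \<in> snd c ` fst c"
  shows "chart_inv (fst c \<times> UNIV, map_prod (snd c) id) (z, M) = (chart_inv c z, M)"
proof -
  have "inj_on (map_prod (snd c) id) (fst c \<times> UNIV)"
    by (rule inj_onI) (auto, metis is_chart_inverse(1)[OF c])
  moreover have "map_prod (snd c) id (chart_inv c z, M) = (z, M)" "(chart_inv c z, M) \<in> fst c \<times> UNIV"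
    using is_chart_inverse[OF c] z by auto
  ultimately show ?thesis
    unfolding chart_inv_def[of "(fst c \<times> UNIV, map_prod (snd c) id)"] fst_conv snd_conv by (intro inv_into_f_eq)
qed

text \<open>If the pullback of \<open>\<omega>\<close> along \<open>g\<close> is \<open>T \<circ> \<omega>\<close> with a constant linear map \<open>T\<close>, the same holds for \<open>d\<omega>\<close>.
Both equivariance of the curvature and its invariance under automorphisms are of this form; \<open>\<iota>\<close> is the
inclusion of the directions along which the relation is known.\<close>

lemma ext_deriv_related:
  fixes g :: "'a::euclidean_space \<Rightarrow> 'e::euclidean_space" and \<iota> :: "'e \<Rightarrow> 'a"
    and \<omega> :: "'m::topological_space \<Rightarrow> 'e \<Rightarrow> 'v::euclidean_space"
  assumes A: "smooth_atlas A" and \<omega>: "smooth_form A \<omega>" and d: "d \<in> A"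
    and W: "open W" "smooth_on W g" "p \<in> W" "g ` W \<subseteq> snd d ` fst d"
    and T: "linear T"
    and rel: "\<And>v w. \<forall>\<^sub>F t in nhds 0. \<omega> (chart_inv d (g (p + t *\<^sub>R \<iota> v))) (tangent_map euclid_atlas A (\<lambda>q. chart_inv d (g q)) (p + t *\<^sub>R \<iota> v) (\<iota> w))
       = T (chart_form A \<omega> (chart_at A u) (snd (chart_at A u) u + t *\<^sub>R v) w)"
  shows "ext_deriv A \<omega> (chart_inv d (g p)) (tangent_map euclid_atlas A (\<lambda>q. chart_inv d (g q)) p (\<iota> v))
      (tangent_map euclid_atlas A (\<lambda>q. chart_inv d (g q)) p (\<iota> w)) = T (ext_deriv A \<omega> u v w)"
proof -
  let ?c = "chart_at A u" and ?z = "snd (chart_at A u) u"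
  note c = chart_at_facts[OF A, of u]
  have z: "?z \<in> snd ?c ` fst ?c" using c by blast
  have D: "((\<lambda>t. \<omega> (chart_inv d (g (p + t *\<^sub>R \<iota> v))) (tangent_map euclid_atlas A (\<lambda>q. chart_inv d (g q)) (p + t *\<^sub>R \<iota> v) (\<iota> w)))
      has_vector_derivative T (frechet_derivative (\<lambda>z. chart_form A \<omega> ?c z w) (at ?z) v)) (at 0)" for v w
  proof -
    have "((\<lambda>t. chart_form A \<omega> ?c (?z + t *\<^sub>R v) w) has_vector_derivative frechet_derivative (\<lambda>z. chart_form A \<omega> ?c z w) (at ?z) v) (at 0)"
      by (rule line_has_vector_derivative)
         (use chart_form_props(3)[OF A \<omega> c(1) z] frechet_derivative_works in blast)
    then have "((\<lambda>t. T (chart_form A \<omega> ?c (?z + t *\<^sub>R v) w)) has_vector_derivative T (frechet_derivative (\<lambda>z. chart_form A \<omega> ?c z w) (at ?z) v)) (at 0)"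
      by (rule bounded_linear.has_vector_derivative[OF T[unfolded linear_conv_bounded_linear]])
    then show ?thesis by (rule has_vector_derivative_transform_nhds[OF _ rel])
  qed
  show ?thesis
    unfolding ext_deriv_param[OF A \<omega> d W D D]
    by (simp add: ext_deriv_dform dform_def linear_diff[OF T])
qed

lemma dform_linear:
  assumes lin: "\<forall>\<^sub>F z in nhds x. linear (\<beta> z)" and diff: "\<And>v. (\<lambda>z. \<beta> z v) differentiable (at x)"
  shows "linear (\<lambda>v. dform \<beta> x v w)" "linear (\<lambda>w. dform \<beta> x v w)"
proof -
  have d: "((\<lambda>z. \<beta> z v) has_derivative frechet_derivative (\<lambda>z. \<beta> z v) (at x)) (at x)" for v
    using diff frechet_derivative_works by blast
  have l1: "linear (frechet_derivative (\<lambda>z. \<beta> z w) (at x))" for w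
    using d has_derivative_linear by blast
  have a: "frechet_derivative (\<lambda>z. \<beta> z (v + w)) (at x) = (\<lambda>h. frechet_derivative (\<lambda>z. \<beta> z v) (at x) h + frechet_derivative (\<lambda>z. \<beta> z w) (at x) h)" for v w
  proof (rule frechet_derivative_eqI)
    have e: "\<forall>\<^sub>F z in nhds x. \<beta> z v + \<beta> z w = \<beta> z (v + w)" using lin by eventually_elim (simp add: linear_add)
    show "((\<lambda>z. \<beta> z (v + w)) has_derivative (\<lambda>h. frechet_derivative (\<lambda>z. \<beta> z v) (at x) h + frechet_derivative (\<lambda>z. \<beta> z w) (at x) h)) (at x)"
      by (rule iffD1[OF has_derivative_cong_nhds[OF e] has_derivative_add[OF d d]])
  qed
  have s: "frechet_derivative (\<lambda>z. \<beta> z (r *\<^sub>R v)) (at x) = (\<lambda>h. r *\<^sub>R frechet_derivative (\<lambda>z. \<beta> z v) (at x) h)" for v r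
  proof (rule frechet_derivative_eqI)
    have e: "\<forall>\<^sub>F z in nhds x. r *\<^sub>R \<beta> z v = \<beta> z (r *\<^sub>R v)" using lin by eventually_elim (simp add: linear_scale)
    show "((\<lambda>z. \<beta> z (r *\<^sub>R v)) has_derivative (\<lambda>h. r *\<^sub>R frechet_derivative (\<lambda>z. \<beta> z v) (at x) h)) (at x)"
      by (rule iffD1[OF has_derivative_cong_nhds[OF e] has_derivative_scaleR_right[OF d]])
  qed
  show "linear (\<lambda>v. dform \<beta> x v w)"
    by (rule linearI) (simp_all add: dform_def a s linear_add[OF l1] linear_scale[OF l1] algebra_simps)
  show "linear (\<lambda>w. dform \<beta> x v w)"
    by (rule linearI) (simp_all add: dform_def a s linear_add[OF l1] linear_scale[OF l1] algebra_simps)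
qed

lemma dform_apply_differentiable:
  fixes \<beta> :: "'b::euclidean_space \<Rightarrow> 'b \<Rightarrow> 'v::euclidean_space"
  assumes S: "open S" "x \<in> S" and lin: "\<And>z. z \<in> S \<Longrightarrow> linear (\<beta> z)" and sm: "\<And>v. smooth_on S (\<lambda>z. \<beta> z v)"
    and y1: "y1 differentiable (at x)" and y2: "y2 differentiable (at x)"
  shows "(\<lambda>z. dform \<beta> z (y1 z) (y2 z)) differentiable (at x)"
proof -
  have diff: "(\<lambda>z. \<beta> z v) differentiable (at z)" if "z \<in> S" for z v
    using smooth_on_has_derivative[OF S(1) sm that] unfolding differentiable_def by blast
  have dl: "linear (\<lambda>v. dform \<beta> z v w)" "linear (\<lambda>w. dform \<beta> z v w)" if "z \<in> S" for z v w
  proof -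
    have e: "\<forall>\<^sub>F z in nhds z. linear (\<beta> z)"
      using eventually_nhds_in_open[OF S(1) that] by eventually_elim (rule lin)
    show "linear (\<lambda>v. dform \<beta> z v w)" "linear (\<lambda>w. dform \<beta> z v w)"
      by (rule dform_linear[OF e diff[OF that]])+
  qed
  have d2: "(\<lambda>z. dform \<beta> z v w) differentiable (at x)" for v w
  proof -
    have "((\<lambda>z. frechet_derivative (\<lambda>z. \<beta> z w) (at z) v) has_derivative frechet_derivative (\<lambda>z. frechet_derivative (\<lambda>z. \<beta> z w) (at z) v) (at x)) (at x)" for v w
      by (rule smooth_on_has_derivative[OF S(1) smooth_on_derivative[OF S(1) sm] S(2)])
    from has_derivative_diff[OF this[of w v] this[of v w]] show ?thesis
      unfolding dform_def differentiable_def by blast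
  qed
  obtain y1' y2' where y': "(y1 has_derivative y1') (at x)" "(y2 has_derivative y2') (at x)"
    using y1 y2 unfolding differentiable_def by blast
  have d1: "\<exists>D. ((\<lambda>z. dform \<beta> z (y1 z) b) has_derivative D) (at x)" for b
    using has_derivative_apply_family[OF S(1), where \<gamma> = "\<lambda>z. z" and \<beta> = "\<lambda>z v. dform \<beta> z v b" and \<eta> = y1, OF _ dl(1) d2 has_derivative_ident y'(1)]
      S(2) by blast
  then obtain D where D: "\<And>b. ((\<lambda>z. dform \<beta> z (y1 z) b) has_derivative D b) (at x)" by metis
  have "((\<lambda>z. \<Sum>b\<in>Basis. (y2 z \<bullet> b) *\<^sub>R dform \<beta> z (y1 z) b) has_derivative
     (\<lambda>h. \<Sum>b\<in>Basis. (y2 x \<bullet> b) *\<^sub>R D b h + (y2' h \<bullet> b) *\<^sub>R dform \<beta> x (y1 x) b)) (at x)"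
    by (intro has_derivative_sum has_derivative_scaleR has_derivative_inner_left y' D)
  moreover have "(\<Sum>b\<in>Basis. (y2 z \<bullet> b) *\<^sub>R dform \<beta> z (y1 z) b) = dform \<beta> z (y1 z) (y2 z)" if "z \<in> S" for z
  proof -
    have "dform \<beta> z (y1 z) (y2 z) = dform \<beta> z (y1 z) (\<Sum>b\<in>Basis. (y2 z \<bullet> b) *\<^sub>R b)" by (simp add: euclidean_representation)
    then show ?thesis by (simp add: linear_sum[OF dl(2)[OF that]] linear_scale[OF dl(2)[OF that]])
  qed
  ultimately have "((\<lambda>z. dform \<beta> z (y1 z) (y2 z)) has_derivative
     (\<lambda>h. \<Sum>b\<in>Basis. (y2 x \<bullet> b) *\<^sub>R D b h + (y2' h \<bullet> b) *\<^sub>R dform \<beta> x (y1 x) b)) (at x)"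
    by (rule has_derivative_transform_within_open[OF _ S])
  then show ?thesis unfolding differentiable_def by blast
qed

lemma matrix_inv_differentiable:
  fixes X :: "'n::finite matr"
  shows "(\<lambda>t. matrix_inv (mat 1 + t *\<^sub>R X)) differentiable (at 0)"
proof -
  let ?S = "{t. det (mat 1 + t *\<^sub>R X) \<noteq> 0}"
  have "open ?S"
    by (intro open_Collect_neq) (auto intro!: continuous_intros simp: det_def)
  moreover have "(\<lambda>t. (mat 1 + t *\<^sub>R X) ** V) differentiable (at 0)" for V :: "'n matr"
  proof -
    have "((\<lambda>t. mat 1 ** V + t *\<^sub>R (X ** V)) has_derivative (\<lambda>r. r *\<^sub>R (X ** V))) (at 0)"
      by (auto intro!: derivative_eq_intros)
    then show ?thesis unfolding differentiable_def by (auto simp: mm.add_left mm.scaleR_left)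
  qed
  moreover have "linear (\<lambda>V :: 'n matr. (mat 1 + t *\<^sub>R X) ** V)" for t
    by (simp add: linear_iff mm.add_right mm.scaleR_right)
  moreover have "inj (\<lambda>V :: 'n matr. (mat 1 + 0 *\<^sub>R X) ** V)" by (simp add: inj_def)
  moreover have "(mat 1 + t *\<^sub>R X) ** matrix_inv (mat 1 + t *\<^sub>R X) = mat 1" if "t \<in> ?S" for t
    using that by (intro matrix_inv_works) (simp add: invertible_det_nz)
  ultimately show ?thesis
    using differentiable_linear_solution[of ?S 0 "\<lambda>t V :: 'n matr. (mat 1 + t *\<^sub>R X) ** V" "\<lambda>t. matrix_inv (mat 1 + t *\<^sub>R X)" "mat 1"]
    by (simp add: det_I)
qed

lemma matrix_inv_one [simp]: "matrix_inv (mat 1 :: 'n::finite matr) = mat 1"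
  using matrix_inv_eqI(2)[of "mat 1" "mat 1"] by simp

text \<open>The curve \<open>1 + t X\<close> is used instead of the exponential because it is a line in the space of matrices, as
needed for computing \<open>d\<omega>\<close> along coordinate lines.\<close>

lemma conj_derivative:
  fixes X Y :: "'n::finite matr"
  shows "((\<lambda>t. matrix_inv (mat 1 + t *\<^sub>R X) ** Y ** (mat 1 + t *\<^sub>R X)) has_vector_derivative - commutator X Y) (at 0)"
proof -
  let ?N = "\<lambda>t. matrix_inv (mat 1 + t *\<^sub>R X)"
  obtain N' where N': "(?N has_vector_derivative N') (at 0)"
    using matrix_inv_differentiable vector_derivative_works by blast
  have l: "((\<lambda>t. mat 1 + t *\<^sub>R X) has_vector_derivative X) (at 0)"
    by (auto intro!: derivative_eq_intros)
  have p: "((\<lambda>t. (mat 1 + t *\<^sub>R X) ** ?N t) has_vector_derivative (mat 1 + 0 *\<^sub>R X) ** N' + X ** ?N 0) (at 0)"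
    by (rule mm.has_vector_derivative[OF l N'])
  have "\<forall>\<^sub>F t in nhds 0. mat 1 = (mat 1 + t *\<^sub>R X) ** ?N t"
    using eventually_invertible[OF l] by (auto elim!: eventually_mono simp: matrix_inv_works)
  then have "((\<lambda>t. mat 1 :: 'n matr) has_vector_derivative (mat 1 + 0 *\<^sub>R X) ** N' + X ** ?N 0) (at 0)"
    by (rule has_vector_derivative_transform_nhds[OF p])
  then have "(mat 1 + 0 *\<^sub>R X) ** N' + X ** ?N 0 = 0"
    using vector_derivative_unique_at has_vector_derivative_const by blast
  then have N'X: "N' = - X" by (simp add: eq_neg_iff_add_eq_0)
  have "((\<lambda>t. ?N t ** Y) has_vector_derivative N' ** Y) (at 0)"
    using mm.has_vector_derivative[OF N' has_vector_derivative_const[of Y]] by (simp add: mm.zero_right)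
  from mm.has_vector_derivative[OF this l]
  show ?thesis by (simp add: N'X commutator_def mm.minus_left)
qed

section \<open>The Cartan connection and the action of \<open>P\<close>\<close>

locale parabolic =
  fixes \<G> :: "('m::{t2_space,second_countable_topology}, 'e::euclidean_space,
               'p::{t2_space,second_countable_topology}, 'q::euclidean_space, 'n::finite) geometry"
  assumes parabolic: "parabolic_geometry \<G>"
begin

abbreviation "TA \<equiv> total_atlas \<G>"
abbreviation "BA \<equiv> base_atlas \<G>"
abbreviation R :: "'p \<Rightarrow> 'n matr \<Rightarrow> 'p" where "R u M \<equiv> ract \<G> u (cls M)"

lemma TA: "smooth_atlas TA" and BA: "smooth_atlas BA"
  using parabolic by (simp_all add: parabolic_geometry_def principal_bundle_def)

lemma proj_mderiv: "mderiv TA BA (proj \<G>) u (tangent_map TA BA (proj \<G>) u)"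
  by (rule smooth_map_mderiv[OF TA BA _ open_UNIV])
     (use parabolic in \<open>simp_all add: parabolic_geometry_def principal_bundle_def\<close>)

lemma R_one: "R u (mat 1) = u"
  using parabolic by (simp add: cls_one parabolic_geometry_def principal_bundle_def)

lemma R_mult:
  assumes "M \<in> upper_mats" "N \<in> upper_mats"
  shows "R (R u M) N = R u (M ** N)"
proof -
  have "cls M \<in> P_grp" "cls N \<in> P_grp" using assms by (auto simp: P_grp_def)
  moreover have "\<forall>u. \<forall>a\<in>P_grp. \<forall>b\<in>P_grp. ract \<G> (ract \<G> u a) b = ract \<G> u (a \<otimes>\<^bsub>PGL\<^esub> b)"
    using parabolic by (simp add: parabolic_geometry_def principal_bundle_def)
  ultimately have "ract \<G> (ract \<G> u (cls M)) (cls N) = ract \<G> u (cls M \<otimes>\<^bsub>PGL\<^esub> cls N)" by simp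
  then show ?thesis using PGL_mult[of M N] assms by (simp add: upper_mats_def)
qed

lemma proj_R: "M \<in> upper_mats \<Longrightarrow> proj \<G> (R u M) = proj \<G> u"
proof -
  assume "M \<in> upper_mats"
  then have "cls M \<in> P_grp" by (simp add: P_grp_def)
  moreover have "\<forall>u. \<forall>a\<in>P_grp. proj \<G> (ract \<G> u a) = proj \<G> u"
    using parabolic by (simp add: parabolic_geometry_def principal_bundle_def)
  ultimately show ?thesis by simp
qed

lemma conn_form: "smooth_form TA (conn \<G>)" and conn_bij: "bij_betw (conn \<G> u) UNIV sl"
  using parabolic by (auto simp: parabolic_geometry_def cartan_connection_def)

lemma conn_linear: "linear (conn \<G> u)" using conn_form by (simp add: smooth_form_def)

lemma conn_sl: "conn \<G> u \<xi> \<in> sl" using conn_bij[of u] by (auto simp: bij_betw_def)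

lemma conn_conn_inv: "X \<in> sl \<Longrightarrow> conn \<G> u (conn_inv \<G> u X) = X"
  unfolding conn_inv_def using conn_bij[of u] by (metis bij_betw_inv_into_right)

lemma conn_inv_conn: "conn_inv \<G> u (conn \<G> u \<xi>) = \<xi>"
  unfolding conn_inv_def using conn_bij[of u] by (simp add: bij_betw_def)

lemma conn_inv_eqI: "conn \<G> u \<xi> = X \<Longrightarrow> conn_inv \<G> u X = \<xi>"
  using conn_inv_conn by blast

lemma conn_inv_linear:
  "X \<in> sl \<Longrightarrow> Y \<in> sl \<Longrightarrow> conn_inv \<G> u (X + Y) = conn_inv \<G> u X + conn_inv \<G> u Y"
  "X \<in> sl \<Longrightarrow> conn_inv \<G> u (r *\<^sub>R X) = r *\<^sub>R conn_inv \<G> u X"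
  by (auto intro!: conn_inv_eqI simp: linear_add[OF conn_linear] linear_scale[OF conn_linear] conn_conn_inv)

text \<open>Block upper triangular matrices have no interior points among all matrices, so smoothness of the action
of \<open>P\<close> only means that it extends smoothly to open sets.  The map \<open>g\<close> is such an extension in
charts \<open>c\<close> and \<open>d\<close>.  Calculus is applied to \<open>g\<close>, and the action is recovered at the points with \<open>M \<in> P\<close>.\<close>

definition action_rep :: "('p, 'q) chart \<Rightarrow> ('p, 'q) chart \<Rightarrow> ('q \<times> 'n matr) set \<Rightarrow> ('q \<times> 'n matr \<Rightarrow> 'q) \<Rightarrow> bool" where
  "action_rep c d W g \<longleftrightarrow> c \<in> TA \<and> d \<in> TA \<and> open W \<and> smooth_on W g \<and> g ` W \<subseteq> snd d ` fst d \<and>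
     (\<forall>z M. (z, M) \<in> W \<longrightarrow> z \<in> snd c ` fst c \<and>
        (M \<in> upper_mats \<longrightarrow> chart_inv d (g (z, M)) = R (chart_inv c z) M))"

lemma action_repD:
  assumes "action_rep c d W g"
  shows "c \<in> TA" "d \<in> TA" "open W" "smooth_on W g" "g ` W \<subseteq> snd d ` fst d"
    "(z, M) \<in> W \<Longrightarrow> z \<in> snd c ` fst c"
    "(z, M) \<in> W \<Longrightarrow> M \<in> upper_mats \<Longrightarrow> chart_inv d (g (z, M)) = R (chart_inv c z) M"
    "(z, M) \<in> W \<Longrightarrow> (g has_derivative frechet_derivative g (at (z, M))) (at (z, M))"
    "(z, M) \<in> W \<Longrightarrow> g (z, M) \<in> snd d ` fst d"
  using assms smooth_on_has_derivative[of W g "(z, M)"] unfolding action_rep_def by auto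

lemma action_chart:
  assumes c: "c \<in> TA" "u \<in> fst c" and M0: "M0 \<in> upper_mats"
  obtains d g W where "action_rep c d W g" "(snd c u, M0) \<in> W"
proof -
  define F where "F = (\<lambda>(u, M). R u M)"
  let ?S = "(UNIV :: 'p set) \<times> (upper_mats :: 'n matr set)"
  note ic = smooth_atlasD(1)[OF TA c(1)]
  let ?d = "chart_at TA (F (u, M0))"
  note d = chart_at_facts[OF TA, of "F (u, M0)"]
  let ?pc = "(fst c \<times> UNIV, map_prod (snd c) id) :: ('p \<times> 'n matr, 'q \<times> 'n matr) chart"
  have Fs: "smooth_map (prod_atlas TA euclid_atlas) TA ?S F"
    using parabolic by (simp add: parabolic_geometry_def principal_bundle_def F_def)
  have pc: "?pc \<in> prod_atlas TA euclid_atlas"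
    unfolding prod_atlas_def euclid_atlas_def using c by force
  have "smooth_on (snd ?pc ` (?S \<inter> fst ?pc \<inter> F -` fst ?d)) (snd ?d \<circ> F \<circ> chart_inv ?pc)"
    by (rule bspec[OF bspec[OF conjunct2[OF Fs[unfolded smooth_map_def]] pc] d(1)])
  moreover have "(snd c u, M0) \<in> snd ?pc ` (?S \<inter> fst ?pc \<inter> F -` fst ?d)"
    using c M0 d(2) by (intro image_eqI[of _ _ "(u, M0)"]) auto
  ultimately obtain U h where U: "open U" "(snd c u, M0) \<in> U" "\<forall>k. Ck_on k U h"
    "\<forall>y\<in>U \<inter> snd ?pc ` (?S \<inter> fst ?pc \<inter> F -` fst ?d). h y = (snd ?d \<circ> F \<circ> chart_inv ?pc) y"
    unfolding smooth_on_def by blast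
  have hs: "smooth_on U h" using U by (simp add: smooth_on_open)
  have "continuous_on ?S F" using Fs by (simp add: smooth_map_def)
  then obtain T where T: "open T" "?S \<inter> F -` fst ?d = ?S \<inter> T"
    using continuous_openin_preimage_gen[of ?S F "fst ?d"] is_chart_open(1)[OF d(3)] unfolding openin_open by blast
  let ?V = "snd c ` fst c \<times> (UNIV :: 'n matr set)"
  have Vo: "open ?V" using is_chart_open(2)[OF ic] by (intro open_Times) auto
  have "continuous_on ?V (\<lambda>q. (chart_inv c (fst q), snd q))"
  proof (intro continuous_on_Pair continuous_on_snd continuous_on_id)
    have "continuous_on (snd c ` fst c) (chart_inv c)" using ic unfolding is_chart_def homeomorphism_def by blast
    then show "continuous_on ?V (\<lambda>q. chart_inv c (fst q))"
      by (intro continuous_on_compose2[of _ "chart_inv c" _ fst] continuous_intros) auto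
  qed
  then have W1: "open (?V \<inter> (\<lambda>q. (chart_inv c (fst q), snd q)) -` T)"
    by (rule continuous_open_preimage[OF _ Vo T(1)])
  have W2: "open (U \<inter> h -` (snd ?d ` fst ?d))"
    by (rule continuous_open_preimage[OF smooth_on_imp_continuous_on[OF U(1) hs] U(1) is_chart_open(2)[OF d(3)]])
  define W where "W = (?V \<inter> (\<lambda>q. (chart_inv c (fst q), snd q)) -` T) \<inter> (U \<inter> h -` (snd ?d ` fst ?d))"
  have Wo: "open W" unfolding W_def using W1 W2 by blast
  have key: "h (z, M) = snd ?d (R (chart_inv c z) M) \<and> R (chart_inv c z) M \<in> fst ?d"
    if "z \<in> snd c ` fst c" "(chart_inv c z, M) \<in> T" "(z, M) \<in> U" "M \<in> upper_mats" for z M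
  proof -
    have "(chart_inv c z, M) \<in> ?S \<inter> F -` fst ?d" using T(2) that by blast
    then have Fd: "F (chart_inv c z, M) \<in> fst ?d" by blast
    have "(z, M) \<in> snd ?pc ` (?S \<inter> fst ?pc \<inter> F -` fst ?d)"
      using that is_chart_inverse[OF ic] Fd by (intro image_eqI[of _ _ "(chart_inv c z, M)"]) auto
    then have "h (z, M) = (snd ?d \<circ> F \<circ> chart_inv ?pc) (z, M)" using U(4) that(3) by blast
    also have "\<dots> = snd ?d (F (chart_inv c z, M))" by (simp only: o_apply chart_inv_prod[OF ic that(1)])
    finally show ?thesis using Fd by (simp add: F_def)
  qed
  have iu: "chart_inv c (snd c u) = u" using is_chart_inverse(1)[OF ic c(2)] .
  have uT: "(u, M0) \<in> T" using T(2) M0 d(2) by blast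
  show ?thesis
  proof (rule that[of ?d W h])
    have "smooth_on W h" by (rule smooth_on_subset[OF hs]) (auto simp: W_def)
    moreover have "chart_inv ?d (h (z, M)) = R (chart_inv c z) M" if "(z, M) \<in> W" "M \<in> upper_mats" for z M
      using key[of z M] that is_chart_inverse(1)[OF d(3)] by (simp add: W_def)
    ultimately show "action_rep c ?d W h"
      unfolding action_rep_def using c d(1) Wo by (auto simp: W_def)
    show "(snd c u, M0) \<in> W"
      using key[of "snd c u" M0] U(2) uT iu M0 c by (auto simp: W_def)
  qed
qed

lemma R_mderiv:
  assumes M: "M \<in> upper_mats"
  shows "mderiv TA TA (\<lambda>v. R v M) u (tangent_map TA TA (\<lambda>v. R v M) u)"
proof -
  let ?c = "chart_at TA u"
  note c = chart_at_facts[OF TA, of u]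
  obtain d g W where W: "action_rep ?c d W g" "(snd ?c u, M) \<in> W"
    by (rule action_chart[OF c(1,2) M])
  note D = action_repD[OF W(1)] and E = smooth_atlas_euclid
  have 1: "((\<lambda>z. g (z, M)) has_derivative (\<lambda>v. frechet_derivative g (at (snd ?c u, M)) (v, 0))) (at (snd ?c u))"
    by (rule has_derivative_compose[where f = "\<lambda>z. (z, M)" and g = g, OF _ D(8)[OF W(2)]]) (auto intro!: derivative_eq_intros)
  have "mderiv euclid_atlas TA (\<lambda>z. chart_inv d (g (z, M))) (snd ?c u) (\<lambda>v. from_coord TA d (chart_inv d (g (snd ?c u, M))) (frechet_derivative g (at (snd ?c u, M)) (v, 0)))"
    by (rule mderiv_into_chart[OF TA D(2) 1 D(9)[OF W(2)]])
  from mderiv_compose[OF TA E mderiv_chart(1)[OF TA c(1,2)] this]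
  obtain L where L: "mderiv TA TA (\<lambda>v. chart_inv d (g (snd ?c v, M))) u L" by blast
  have "open ((\<lambda>z. (z, M)) -` W)" by (rule open_vimage[OF D(3)]) (intro continuous_intros)
  then have "\<forall>\<^sub>F v in nhds u. snd ?c v \<in> (\<lambda>z. (z, M)) -` W"
    by (rule tendsto_nhds_eventually[OF is_chart_tendsto(1)[OF c(3,2)]]) (use W(2) in simp)
  then have "\<forall>\<^sub>F v in nhds u. chart_inv d (g (snd ?c v, M)) = R v M"
    using eventually_nhds_in_open[OF is_chart_open(1)[OF c(3)] c(2)]
  proof eventually_elim
    case (elim v)
    then show ?case using D(7)[of "snd ?c v" M] M is_chart_inverse(1)[OF c(3)] by simp
  qed
  from mderiv_self[OF mderiv_transform[OF L this TA]] show ?thesis .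
qed

lemma conn_R:
  assumes M: "M \<in> upper_mats"
  shows "conn \<G> (R u M) (tangent_map TA TA (\<lambda>v. R v M) u \<xi>) = matrix_inv M ** conn \<G> u \<xi> ** M"
proof -
  have i: "invertible M" using M by (simp add: upper_mats_def)
  have "cls M \<in> P_grp" using M by (simp add: P_grp_def)
  then have "conn \<G> (R u M) (tangent_map TA TA (\<lambda>v. R v M) u \<xi>) = Ad (m_inv PGL (cls M)) (conn \<G> u \<xi>)"
    using parabolic unfolding parabolic_geometry_def cartan_connection_def by blast
  then show ?thesis using PGL_inv[OF i] Ad_cls[OF invertible_inverse(1)[OF i]] invertible_inverse[OF i] by simp
qed

lemma action_mderiv:
  assumes "action_rep c d W g" "(z, M) \<in> W"
  shows "mderiv euclid_atlas TA (\<lambda>q. chart_inv d (g q)) (z, M) (tangent_map euclid_atlas TA (\<lambda>q. chart_inv d (g q)) (z, M))"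
  by (rule mderiv_self[OF mderiv_into_chart[OF TA action_repD(2,8,9)[OF assms(1)]]]) (rule assms)+

lemma action_partial1:
  assumes g: "action_rep c d W g" and M: "(z, M) \<in> W" "M \<in> upper_mats"
  shows "tangent_map euclid_atlas TA (\<lambda>q. chart_inv d (g q)) (z, M) (w, 0) =
     tangent_map TA TA (\<lambda>v. R v M) (chart_inv c z) (from_coord TA c (chart_inv c z) w)"
proof -
  note E = smooth_atlas_euclid and D = action_repD[OF g]
  have h: "((\<lambda>z. (z, M)) has_derivative (\<lambda>w. (w, 0))) (at z)" by (auto intro!: derivative_eq_intros)
  have 1: "mderiv euclid_atlas TA (\<lambda>z. chart_inv d (g (z, M))) z (\<lambda>w. tangent_map euclid_atlas TA (\<lambda>q. chart_inv d (g q)) (z, M) (w, 0))"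
    by (rule mderiv_compose[OF E E h[folded mderiv_euclid] action_mderiv[OF g M(1)]])
  have 2: "mderiv euclid_atlas TA (\<lambda>z. R (chart_inv c z) M) z (\<lambda>w. tangent_map TA TA (\<lambda>v. R v M) (chart_inv c z) (from_coord TA c (chart_inv c z) w))"
    by (rule mderiv_compose[OF E TA mderiv_chart(2)[OF TA D(1) D(6)[OF M(1)]] R_mderiv[OF M(2)]])
  have "open ((\<lambda>z. (z, M)) -` W)" by (rule open_vimage[OF D(3)]) (intro continuous_intros)
  then have "\<forall>\<^sub>F z in nhds z. z \<in> (\<lambda>z. (z, M)) -` W"
    by (rule eventually_nhds_in_open) (use M(1) in simp)
  then have "\<forall>\<^sub>F z in nhds z. chart_inv d (g (z, M)) = R (chart_inv c z) M"
    by eventually_elim (use D(7) M(2) in simp)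
  from fun_cong[OF mderiv_unique[OF mderiv_transform[OF 1 this E] 2], of w] show ?thesis .
qed

lemma action_curve:
  assumes g: "action_rep c d W g" and z: "(z, mat 1) \<in> W"
    and m: "m 0 = mat 1" "(m has_vector_derivative X) (at 0)" "\<forall>\<^sub>F t in nhds 0. m t \<in> upper_mats"
  shows "mderiv euclid_atlas TA (\<lambda>t. R (chart_inv c z) (m t)) 0 (\<lambda>r. tangent_map euclid_atlas TA (\<lambda>q. chart_inv d (g q)) (z, mat 1) (0, r *\<^sub>R X))"
proof -
  note E = smooth_atlas_euclid and D = action_repD[OF g]
  have h: "((\<lambda>t. (z, m t)) has_derivative (\<lambda>r. (0, r *\<^sub>R X))) (at 0)"
    using m(2) unfolding has_vector_derivative_def by (intro has_derivative_Pair has_derivative_const)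
  have 1: "mderiv euclid_atlas TA (\<lambda>t. chart_inv d (g (z, m t))) 0 (\<lambda>r. tangent_map euclid_atlas TA (\<lambda>q. chart_inv d (g q)) (z, mat 1) (0, r *\<^sub>R X))"
    by (rule mderiv_compose[OF E E h[folded mderiv_euclid]]) (simp only: m(1) action_mderiv[OF g z])
  have "isCont (\<lambda>t. (z, m t)) 0" using has_derivative_continuous[OF h] by simp
  then have "((\<lambda>t. (z, m t)) \<longlongrightarrow> (z, m 0)) (nhds 0)"
    using tendsto_at_iff_tendsto_nhds[of "\<lambda>t. (z, m t)" 0] by (simp add: isCont_def)
  then have "\<forall>\<^sub>F t in nhds 0. (z, m t) \<in> W"
    using D(3) z m(1) tendsto_nhds_eventually[of "\<lambda>t. (z, m t)" 0 W] by simp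
  then have "\<forall>\<^sub>F t in nhds 0. chart_inv d (g (z, m t)) = R (chart_inv c z) (m t)"
    using m(3) by eventually_elim (use D(7) in simp)
  from mderiv_transform[OF 1 this E] show ?thesis .
qed

text \<open>At the identity the derivative of the extension in a direction of \<open>\<pp>\<close> is the fundamental vector
field.  It suffices to differentiate along \<open>exp(t X)\<close>, which stays in \<open>P\<close> and has velocity \<open>X\<close>.\<close>

lemma action_partial2:
  assumes g: "action_rep c d W g" and z: "(z, mat 1) \<in> W" and X: "X \<in> filt 0"
  shows "tangent_map euclid_atlas TA (\<lambda>q. chart_inv d (g q)) (z, mat 1) (0, X) = conn_inv \<G> (chart_inv c z) X"
proof -
  have m: "mat_exp (0 *\<^sub>R X) = mat 1" by (simp add: mat_exp_zero)
  have "velocity TA (\<lambda>t. R (chart_inv c z) (mat_exp (t *\<^sub>R X))) =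
     tangent_map euclid_atlas TA (\<lambda>q. chart_inv d (g q)) (z, mat 1) (0, X)"
    using mderiv_velocity[OF action_curve[where m = "\<lambda>t. mat_exp (t *\<^sub>R X)", OF g z m mat_exp_derivative mat_exp_upper[OF X]]] by simp
  moreover have "conn \<G> (chart_inv c z) (velocity TA (\<lambda>t. R (chart_inv c z) (mat_exp (t *\<^sub>R X)))) = X"
    using parabolic X unfolding parabolic_geometry_def cartan_connection_def by blast
  ultimately show ?thesis by (metis conn_inv_eqI)
qed

text \<open>The connection is normalized on the curves \<open>u exp(t X)\<close>; by the chain rule the same velocity belongs to every
curve \<open>u m(t)\<close> in \<open>P\<close> with the same initial derivative.\<close>

lemma fundamental_velocity:
  assumes X: "X \<in> filt 0" and m: "m 0 = mat 1" "(m has_vector_derivative X) (at 0)" "\<forall>\<^sub>F t in nhds 0. m t \<in> upper_mats"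
  shows "mderiv euclid_atlas TA (\<lambda>t. R u (m t)) 0 (\<lambda>r. r *\<^sub>R conn_inv \<G> u X)"
proof -
  let ?c = "chart_at TA u"
  note c = chart_at_facts[OF TA, of u]
  obtain d g W where W: "action_rep ?c d W g" "(snd ?c u, mat 1) \<in> W"
    by (rule action_chart[OF c(1,2) upper_one])
  note D = action_repD[OF W(1)]
  have iu: "chart_inv ?c (snd ?c u) = u" using is_chart_inverse(1)[OF c(3,2)] .
  note cu = action_curve[OF W m, unfolded iu]
  have X1: "tangent_map euclid_atlas TA (\<lambda>q. chart_inv d (g q)) (snd ?c u, mat 1) (0, X) = conn_inv \<G> u X"
    using action_partial2[OF W X] iu by simp
  have "tangent_map euclid_atlas TA (\<lambda>q. chart_inv d (g q)) (snd ?c u, mat 1) (0, r *\<^sub>R X) = r *\<^sub>R conn_inv \<G> u X" for r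
    using linear_scale[OF mderiv_linear[OF cu], of r 1] X1 by simp
  then show ?thesis using cu by simp
qed

section \<open>The curvature\<close>

text \<open>The curvature form on arbitrary elements of \<open>\<gg>\<close>, without passing to representatives modulo \<open>\<pp>\<close>.  For this
function, in contrast to \<open>curv\<close>, equivariance is a direct consequence of the equivariance of \<open>\<omega>\<close>.\<close>

definition K :: "'p \<Rightarrow> 'n matr \<Rightarrow> 'n matr \<Rightarrow> 'n matr" where
  "K u X Y = ext_deriv TA (conn \<G>) u (conn_inv \<G> u X) (conn_inv \<G> u Y) + commutator X Y"

lemma curv_K: "curv \<G> u X Y = K u (lower_part X) (lower_part Y)"
  by (simp add: curv_def K_def)

text \<open>In the parametrization \<open>(v, M) \<mapsto> R v M\<close> one has \<open>d\<omega>(X, Y) = D\<^sub>1 - D\<^sub>2\<close>.  Here \<open>D\<^sub>1\<close> is the derivative of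
\<open>M\<^sup>-\<^sup>1 Y M\<close> in the direction \<open>X\<close> of the fibre, which is \<open>- [X, Y]\<close>, and \<open>D\<^sub>2 = 0\<close> because \<open>\<omega>\<close> is constant on
fundamental vector fields.\<close>

lemma K_horizontal:
  assumes X: "X \<in> filt 0" and Y: "Y \<in> sl"
  shows "K u X Y = 0"
proof -
  let ?c = "chart_at TA u" and ?w = "conn_inv \<G> u Y"
  note c = chart_at_facts[OF TA, of u]
  obtain d g W where W: "action_rep ?c d W g" "(snd ?c u, mat 1) \<in> W"
    by (rule action_chart[OF c(1,2) upper_one])
  note D = action_repD[OF W(1)]
  have iu: "chart_inv ?c (snd ?c u) = u" using is_chart_inverse(1)[OF c(3,2)] .
  let ?T = "tangent_map euclid_atlas TA (\<lambda>q. chart_inv d (g q))"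
  let ?p = "(snd ?c u, mat 1 :: 'n matr)"
  note p1 = action_partial1[OF W(1)] and p2 = action_partial2[OF W(1) _ X]
  have gp: "chart_inv d (g ?p) = u" using D(7)[OF W(2) upper_one] iu R_one by simp
  have Tv: "?T ?p (0, X) = conn_inv \<G> u X" using p2[OF W(2)] iu by simp
  have Tw: "?T ?p (?w, 0) = ?w"
  proof -
    have "tangent_map TA TA (\<lambda>v. R v (mat 1)) u = (\<lambda>\<xi>. \<xi>)"
      unfolding R_one by (rule mderiv_tangent_map[OF mderiv_id[OF TA]])
    then show ?thesis using p1[OF W(2) upper_one] iu from_coord_chart_at[OF TA] by simp
  qed
  have up: "\<forall>\<^sub>F t in nhds 0. mat 1 + t *\<^sub>R X \<in> upper_mats"
  proof -
    have "((\<lambda>t. mat 1 + t *\<^sub>R X) has_vector_derivative X) (at 0)" by (auto intro!: derivative_eq_intros)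
    then have "\<forall>\<^sub>F t in nhds 0. invertible (mat 1 + t *\<^sub>R X)" by (rule eventually_invertible) simp
    then show ?thesis
      by (rule eventually_mono) (use X in \<open>auto simp: in_upper in_filt_0 mat_one_entry\<close>)
  qed
  have D1: "((\<lambda>t. conn \<G> (chart_inv d (g (?p + t *\<^sub>R (0, X)))) (?T (?p + t *\<^sub>R (0, X)) (?w, 0))) has_vector_derivative - commutator X Y) (at 0)"
  proof (rule has_vector_derivative_transform_nhds[OF conj_derivative])
    show "\<forall>\<^sub>F t in nhds 0. conn \<G> (chart_inv d (g (?p + t *\<^sub>R (0, X)))) (?T (?p + t *\<^sub>R (0, X)) (?w, 0))
       = matrix_inv (mat 1 + t *\<^sub>R X) ** Y ** (mat 1 + t *\<^sub>R X)"
      using up eventually_line_in_open[OF D(3) W(2), of "(0, X)"]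
    proof eventually_elim
      case (elim t)
      have e: "?p + t *\<^sub>R (0, X) = (snd ?c u, mat 1 + t *\<^sub>R X)" by simp
      have W': "(snd ?c u, mat 1 + t *\<^sub>R X) \<in> W" using elim e by simp
      show ?case unfolding e D(7)[OF W' elim(1)] p1[OF W' elim(1)] conn_R[OF elim(1)] iu
        by (simp add: from_coord_chart_at[OF TA] conn_conn_inv[OF Y])
    qed
  qed
  have D2: "((\<lambda>t. conn \<G> (chart_inv d (g (?p + t *\<^sub>R (?w, 0)))) (?T (?p + t *\<^sub>R (?w, 0)) (0, X))) has_vector_derivative 0) (at 0)"
  proof (rule has_vector_derivative_transform_nhds[OF has_vector_derivative_const])
    show "\<forall>\<^sub>F t in nhds 0. conn \<G> (chart_inv d (g (?p + t *\<^sub>R (?w, 0)))) (?T (?p + t *\<^sub>R (?w, 0)) (0, X)) = X"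
      using eventually_line_in_open[OF D(3) W(2), of "(?w, 0)"]
    proof eventually_elim
      case (elim t)
      have e: "?p + t *\<^sub>R (?w, 0) = (snd ?c u + t *\<^sub>R ?w, mat 1)" by simp
      have W': "(snd ?c u + t *\<^sub>R ?w, mat 1) \<in> W" using elim e by simp
      have "X \<in> sl" using X by (simp add: filt_def)
      then show ?case unfolding e D(7)[OF W' upper_one] p2[OF W'] R_one by (simp add: conn_conn_inv)
    qed
  qed
  have "ext_deriv TA (conn \<G>) (chart_inv d (g ?p)) (?T ?p (0, X)) (?T ?p (?w, 0)) = - commutator X Y - 0"
    by (rule ext_deriv_param[OF TA conn_form D(2,3,4) W(2) D(5) D1 D2])
  then show ?thesis by (simp add: K_def gp Tv Tw)
qed

lemma conn_inv_R:
  assumes M: "M \<in> upper_mats" and X: "X \<in> sl"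
  shows "tangent_map TA TA (\<lambda>v. R v M) u (conn_inv \<G> u X) = conn_inv \<G> (R u M) (matrix_inv M ** X ** M)"
  by (rule conn_inv_eqI[symmetric]) (simp add: conn_R[OF M] conn_conn_inv[OF X])

lemma K_equivariant:
  assumes M: "M \<in> upper_mats" and X: "X \<in> sl" and Y: "Y \<in> sl"
  shows "K (R u M) (matrix_inv M ** X ** M) (matrix_inv M ** Y ** M) = matrix_inv M ** K u X Y ** M"
proof -
  let ?c = "chart_at TA u" and ?N = "matrix_inv M"
  note c = chart_at_facts[OF TA, of u]
  obtain d g W where W: "action_rep ?c d W g" "(snd ?c u, M) \<in> W"
    by (rule action_chart[OF c(1,2) M])
  note D = action_repD[OF W(1)]
  have iu: "chart_inv ?c (snd ?c u) = u" using is_chart_inverse(1)[OF c(3,2)] .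
  let ?T = "tangent_map euclid_atlas TA (\<lambda>q. chart_inv d (g q))"
  let ?p = "(snd ?c u, M)"
  note p1 = action_partial1[OF W(1)]
  have gp: "chart_inv d (g ?p) = R u M" using D(7)[OF W(2) M] iu by simp
  have Tw: "?T ?p (conn_inv \<G> u V, 0) = conn_inv \<G> (R u M) (?N ** V ** M)" if "V \<in> sl" for V
    using p1[OF W(2) M] iu from_coord_chart_at[OF TA] conn_inv_R[OF M that] by simp
  have lT: "linear (\<lambda>V. ?N ** V ** M)" by (simp add: linear_iff mm.add_left mm.add_right mm.scaleR_left mm.scaleR_right)
  have rel: "\<forall>\<^sub>F t in nhds 0. conn \<G> (chart_inv d (g (?p + t *\<^sub>R (v, 0)))) (?T (?p + t *\<^sub>R (v, 0)) (w, 0))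
       = ?N ** chart_form TA (conn \<G>) ?c (snd ?c u + t *\<^sub>R v) w ** M" for v w
    using eventually_line_in_open[OF D(3) W(2), of "(v, 0)"]
  proof eventually_elim
    case (elim t)
    have e: "?p + t *\<^sub>R (v, 0) = (snd ?c u + t *\<^sub>R v, M)" by simp
    have W': "(snd ?c u + t *\<^sub>R v, M) \<in> W" using elim e by simp
    show ?case unfolding e D(7)[OF W' M] p1[OF W' M] conn_R[OF M] by (simp add: chart_form_def)
  qed
  have "ext_deriv TA (conn \<G>) (chart_inv d (g ?p)) (?T ?p (conn_inv \<G> u X, 0)) (?T ?p (conn_inv \<G> u Y, 0))
     = ?N ** ext_deriv TA (conn \<G>) u (conn_inv \<G> u X) (conn_inv \<G> u Y) ** M"
    by (rule ext_deriv_related[OF TA conn_form D(2,3,4) W(2) D(5) lT, where \<iota> = "\<lambda>v. (v, 0)"]) (rule rel)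
  moreover have "commutator (?N ** X ** M) (?N ** Y ** M) = ?N ** commutator X Y ** M"
  proof -
    have i: "M ** ?N = mat 1" using matrix_inv_works(1)[of M] M by (simp add: upper_mats_def)
    have "(?N ** A ** M) ** (?N ** B ** M) = ?N ** (A ** B) ** M" for A B
    proof -
      have "(?N ** A ** M) ** (?N ** B ** M) = ?N ** A ** (M ** ?N) ** B ** M" by (simp only: matrix_mul_assoc)
      then show ?thesis by (simp add: i matrix_mul_assoc)
    qed
    then show ?thesis by (simp only: commutator_def mm.diff_left mm.diff_right)
  qed
  ultimately show ?thesis by (simp add: K_def gp Tw X Y mm.add_left mm.add_right)
qed

text \<open>A map preserving \<open>\<omega>\<close> preserves \<open>d\<omega>\<close>, and it preserves the fields \<open>\<omega>\<^sup>-\<^sup>1(X)\<close>.\<close>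

lemma automorphism_K:
  assumes S: "open S" and u: "u \<in> S" and \<phi>: "smooth_map TA TA S \<phi>"
    and pres: "\<And>v \<xi>. v \<in> S \<Longrightarrow> conn \<G> (\<phi> v) (tangent_map TA TA \<phi> v \<xi>) = conn \<G> v \<xi>"
    and X: "X \<in> sl" and Y: "Y \<in> sl"
  shows "K (\<phi> u) X Y = K u X Y"
proof -
  let ?c = "chart_at TA u" and ?d = "chart_at TA (\<phi> u)"
  note c = chart_at_facts[OF TA, of u] and d = chart_at_facts[OF TA, of "\<phi> u"] and E = smooth_atlas_euclid
  define W where "W = snd ?c ` (S \<inter> fst ?c \<inter> \<phi> -` fst ?d)"
  define g where "g = snd ?d \<circ> \<phi> \<circ> chart_inv ?c"
  have co: "continuous_on S \<phi>" using \<phi> by (simp add: smooth_map_def)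
  have "open (S \<inter> \<phi> -` fst ?d)"
    by (rule continuous_open_preimage[OF co S is_chart_open(1)[OF d(3)]])
  then have Wo: "open W" using is_chart_open_image[OF c(3), of "S \<inter> \<phi> -` fst ?d"]
    unfolding W_def by (simp add: Int_assoc Int_left_commute)
  have gs: "smooth_on W g" using \<phi> c(1) d(1) unfolding smooth_map_def W_def g_def by blast
  have uW: "snd ?c u \<in> W" using u c d by (auto simp: W_def)
  have Wz: "chart_inv ?c z \<in> S" "chart_inv ?c z \<in> fst ?c" "z \<in> snd ?c ` fst ?c" "\<phi> (chart_inv ?c z) \<in> fst ?d" if "z \<in> W" for z
    using that is_chart_inverse(1)[OF c(3)] by (auto simp: W_def)
  have gW: "g ` W \<subseteq> snd ?d ` fst ?d" using Wz by (auto simp: g_def)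
  have gz: "chart_inv ?d (g z) = \<phi> (chart_inv ?c z)" if "z \<in> W" for z
    using Wz(4)[OF that] is_chart_inverse(1)[OF d(3)] by (simp add: g_def)
  let ?T = "tangent_map euclid_atlas TA (\<lambda>q. chart_inv ?d (g q))"
  have T: "?T z w = tangent_map TA TA \<phi> (chart_inv ?c z) (from_coord TA ?c (chart_inv ?c z) w)" if z: "z \<in> W" for z w
  proof -
    have "mderiv euclid_atlas TA (\<lambda>z. \<phi> (chart_inv ?c z)) z (\<lambda>w. tangent_map TA TA \<phi> (chart_inv ?c z) (from_coord TA ?c (chart_inv ?c z) w))"
      by (rule mderiv_compose[OF E TA mderiv_chart(2)[OF TA c(1) Wz(3)[OF z]] smooth_map_mderiv[OF TA TA \<phi> S Wz(1)[OF z]]])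
    moreover have "\<forall>\<^sub>F z in nhds z. \<phi> (chart_inv ?c z) = chart_inv ?d (g z)"
      using eventually_nhds_in_open[OF Wo z] by eventually_elim (simp add: gz)
    ultimately have "mderiv euclid_atlas TA (\<lambda>z. chart_inv ?d (g z)) z (\<lambda>w. tangent_map TA TA \<phi> (chart_inv ?c z) (from_coord TA ?c (chart_inv ?c z) w))"
      by (rule mderiv_transform[OF _ _ E])
    from mderiv_tangent_map[OF this] show ?thesis by simp
  qed
  have iu: "chart_inv ?c (snd ?c u) = u" using is_chart_inverse(1)[OF c(3,2)] .
  have gp: "chart_inv ?d (g (snd ?c u)) = \<phi> u" using gz[OF uW] iu by simp
  have Tu: "?T (snd ?c u) (conn_inv \<G> u V) = conn_inv \<G> (\<phi> u) V" if "V \<in> sl" for V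
    unfolding T[OF uW] iu from_coord_chart_at[OF TA]
    by (rule conn_inv_eqI[symmetric]) (simp add: pres[OF u] conn_conn_inv[OF that])
  have rel: "\<forall>\<^sub>F t in nhds 0. conn \<G> (chart_inv ?d (g (snd ?c u + t *\<^sub>R v))) (?T (snd ?c u + t *\<^sub>R v) w)
       = chart_form TA (conn \<G>) ?c (snd ?c u + t *\<^sub>R v) w" for v w
    using eventually_line_in_open[OF Wo uW, of v]
    by eventually_elim (simp add: gz T pres Wz(1) chart_form_def)
  have "ext_deriv TA (conn \<G>) (chart_inv ?d (g (snd ?c u))) (?T (snd ?c u) (conn_inv \<G> u X)) (?T (snd ?c u) (conn_inv \<G> u Y))
     = ext_deriv TA (conn \<G>) u (conn_inv \<G> u X) (conn_inv \<G> u Y)"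
    by (rule ext_deriv_related[OF TA conn_form d(1) Wo gs uW gW, where \<iota> = "\<lambda>v. v" and T = "\<lambda>v. v"])
       (auto simp: linear_id[unfolded id_def] rel)
  then show ?thesis by (simp add: K_def gp Tu X Y)
qed

end

section \<open>The grading element\<close>

text \<open>\<open>[E, X] = k X\<close> for \<open>X \<in> \<gg>\<^sub>k\<close>.\<close>

definition grading_elt :: "'n::finite matr" where "grading_elt = (\<chi> i j. if i = j then 1 - real_of_int (blk i) else 0)"

text \<open>The one-parameter group of the grading element, written in closed form so that it is defined by its
entries.\<close>

definition grading_exp :: "real \<Rightarrow> 'n::finite matr" where
  "grading_exp t = (\<chi> i j. if i = j then exp (t * (1 - real_of_int (blk i))) else 0)"

lemma grading_exp_mult_entry:
  "(grading_exp t ** A) $ i $ j = exp (t * (1 - real_of_int (blk i))) * A $ i $ j"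
  "(A ** grading_exp t) $ i $ j = A $ i $ j * exp (t * (1 - real_of_int (blk j)))"
  by (simp_all add: matrix_matrix_mult_def grading_exp_def if_distrib[of "\<lambda>x. x * _"] if_distrib[of "\<lambda>x. _ * x"] cong: if_cong)

lemma grading_elt_filt0: "grading_elt \<in> filt 0"
  by (auto simp: in_filt_0 grading_elt_def trace_idx)

lemma grading_elt_curve:
  "grading_exp 0 = mat 1" "(grading_exp has_vector_derivative grading_elt) (at 0)" "grading_exp t \<in> upper_mats"
  "matrix_inv (grading_exp t) = grading_exp (- t)" "grading_exp s ** grading_exp t = grading_exp (s + t)"
proof -
  show 0: "grading_exp 0 = mat 1" by (simp add: matr_eq_iff grading_exp_def mat_one_entry)
  show "(grading_exp has_vector_derivative grading_elt) (at 0)"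
  proof (rule matr_has_vector_derivative)
    fix i j
    show "((\<lambda>t. grading_exp t $ i $ j) has_vector_derivative grading_elt $ i $ j) (at 0)"
      unfolding has_real_derivative_iff_has_vector_derivative[symmetric]
      by (cases "i = j") (auto simp: grading_exp_def grading_elt_def intro!: derivative_eq_intros)
  qed
  show a: "grading_exp s ** grading_exp t = grading_exp (s + t)" for s t
    by (auto simp: matr_eq_iff grading_exp_mult_entry) (auto simp: grading_exp_def exp_add[symmetric] algebra_simps)
  have i: "grading_exp t ** grading_exp (- t) = mat 1" by (simp add: a 0)
  show "matrix_inv (grading_exp t) = grading_exp (- t)" by (rule matrix_inv_eqI(2)[OF i])
  show "grading_exp t \<in> upper_mats" using matrix_inv_eqI(1)[OF i] by (auto simp: in_upper grading_exp_def)
qed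

context parabolic begin

section \<open>The curvature as a cochain\<close>

lemma ext_deriv_linear:
  "linear (\<lambda>v. ext_deriv TA (conn \<G>) u v w)" "linear (\<lambda>w. ext_deriv TA (conn \<G>) u v w)"
proof -
  let ?c = "chart_at TA u"
  note c = chart_at_facts[OF TA, of u]
  have z: "snd ?c u \<in> snd ?c ` fst ?c" using c by blast
  have e: "\<forall>\<^sub>F z in nhds (snd ?c u). linear (chart_form TA (conn \<G>) ?c z)"
    using eventually_nhds_in_open[OF is_chart_open(2)[OF c(3)] z]
    by eventually_elim (rule chart_form_props(2)[OF TA conn_form c(1)])
  note d = dform_linear[OF e chart_form_props(3)[OF TA conn_form c(1) z]]
  show "linear (\<lambda>v. ext_deriv TA (conn \<G>) u v w)" unfolding ext_deriv_dform by (rule d(1))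
  show "linear (\<lambda>w. ext_deriv TA (conn \<G>) u v w)" unfolding ext_deriv_dform by (rule d(2))
qed

lemma ext_deriv_sl: "ext_deriv TA (conn \<G>) u v w \<in> sl"
proof -
  let ?c = "chart_at TA u"
  note c = chart_at_facts[OF TA, of u]
  have z: "snd ?c u \<in> snd ?c ` fst ?c" using c by blast
  have tr: "bounded_linear (trace :: 'n matr \<Rightarrow> real)"
    unfolding linear_conv_bounded_linear[symmetric] by (simp add: linear_iff trace_def sum.distrib sum_distrib_left)
  have "frechet_derivative (\<lambda>z. chart_form TA (conn \<G>) ?c z w) (at (snd ?c u)) v \<in> sl" for v w
  proof -
    have "((\<lambda>z. chart_form TA (conn \<G>) ?c z w) has_derivative frechet_derivative (\<lambda>z. chart_form TA (conn \<G>) ?c z w) (at (snd ?c u))) (at (snd ?c u))"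
      using chart_form_props(3)[OF TA conn_form c(1) z] frechet_derivative_works by blast
    from bounded_linear.has_derivative[OF tr this]
    have "((\<lambda>z. trace (chart_form TA (conn \<G>) ?c z w)) has_derivative (\<lambda>h. trace (frechet_derivative (\<lambda>z. chart_form TA (conn \<G>) ?c z w) (at (snd ?c u)) h))) (at (snd ?c u))" .
    moreover have "trace (chart_form TA (conn \<G>) ?c z w) = 0" for z
      using conn_sl by (simp add: chart_form_def sl_def)
    ultimately have "((\<lambda>z. 0) has_derivative (\<lambda>h. trace (frechet_derivative (\<lambda>z. chart_form TA (conn \<G>) ?c z w) (at (snd ?c u)) h))) (at (snd ?c u))" by simp
    then have "(\<lambda>h. trace (frechet_derivative (\<lambda>z. chart_form TA (conn \<G>) ?c z w) (at (snd ?c u)) h)) = (\<lambda>h. 0)"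
      by (rule has_derivative_unique) (rule has_derivative_const)
    then show ?thesis unfolding sl_def by (simp add: fun_eq_iff)
  qed
  then show ?thesis unfolding ext_deriv_dform dform_def by (intro sl_diff)
qed

lemma K_linear:
  assumes "X \<in> sl" "X' \<in> sl" "Y \<in> sl"
  shows "K u (X + X') Y = K u X Y + K u X' Y" "K u (r *\<^sub>R X) Y = r *\<^sub>R K u X Y"
    "K u Y (X + X') = K u Y X + K u Y X'" "K u Y (r *\<^sub>R X) = r *\<^sub>R K u Y X"
    "K u X Y = - K u Y X" "K u X Y \<in> sl"
proof -
  note l = ext_deriv_linear
  show "K u (X + X') Y = K u X Y + K u X' Y" "K u (r *\<^sub>R X) Y = r *\<^sub>R K u X Y"
    "K u Y (X + X') = K u Y X + K u Y X'" "K u Y (r *\<^sub>R X) = r *\<^sub>R K u Y X"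
    using assms by (simp_all add: K_def conn_inv_linear linear_add[OF l(1)] linear_add[OF l(2)] linear_scale[OF l(1)] linear_scale[OF l(2)]
        com.add_left com.add_right com.scaleR_left com.scaleR_right algebra_simps)
  show "K u X Y = - K u Y X" by (simp add: K_def ext_deriv_dform dform_def commutator_def)
  show "K u X Y \<in> sl" unfolding K_def by (intro sl_add ext_deriv_sl commutator_sl)
qed

lemma K_curv:
  assumes X: "X \<in> sl" and Y: "Y \<in> sl" shows "K u X Y = curv \<G> u X Y"
proof -
  note l = lower_part_sl
  let ?X = "X - lower_part X" and ?Y = "Y - lower_part Y"
  have h: "?X \<in> filt 0" "?Y \<in> filt 0" using upper_part_filt0 X Y by auto
  have s: "?X \<in> sl" "?Y \<in> sl" using h filt0_sl by auto
  have "K u (lower_part X + ?X) Y = K u (lower_part X) Y"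
    by (subst K_linear(1)[OF l s(1) Y]) (simp add: K_horizontal[OF h(1) Y])
  moreover have "K u (lower_part X) (lower_part Y + ?Y) = K u (lower_part X) (lower_part Y)"
    by (subst K_linear(3)[OF l s(2) l]) (simp add: K_linear(5)[OF l l s(2)] K_horizontal[OF h(2) l])
  ultimately show ?thesis by (simp add: curv_K)
qed

lemma curv_cochain2: "curv \<G> u \<in> cochain2"
proof -
  note l = lower_part_sl and pl = linear_add[OF lower_part_linear] linear_scale[OF lower_part_linear]
  have z: "K u 0 Y = 0" if "Y \<in> sl" for Y
    using K_linear(2)[OF that that that, where r = 0] by simp
  have a: "K u X X = 0" if "X \<in> sl" for X by (simp add: K_def ext_deriv_dform dform_def commutator_def)
  show ?thesis unfolding cochain2_def
    by (auto simp: linear_iff curv_K pl K_linear(1-4)[OF l l l] K_linear(6)[OF l l l] a[OF l] z[OF l])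
qed

lemma curv_R:
  assumes M: "M \<in> upper_mats"
  shows "curv \<G> (R u M) X Y = matrix_inv M ** curv \<G> u (M ** lower_part X ** matrix_inv M) (M ** lower_part Y ** matrix_inv M) ** M"
proof -
  have i: "invertible M" using M by (simp add: upper_mats_def)
  let ?N = "matrix_inv M"
  have e: "?N ** (M ** V ** ?N) ** M = V" for V
    using matrix_inv_works[OF i] by (simp add: matrix_mul_assoc) (simp add: matrix_mul_assoc[symmetric])
  have s: "M ** lower_part V ** ?N \<in> sl" for V by (rule conj_sl[OF i lower_part_sl])
  show ?thesis
    using K_equivariant[OF M s s, of u X Y] K_curv[OF s s] by (simp add: e curv_K[of "R u M"])
qed

text \<open>In a fixed chart \<open>K\<close> is \<open>d\<omega>\<close> evaluated on the fields \<open>\<omega>\<^sup>-\<^sup>1(X)\<close> and \<open>\<omega>\<^sup>-\<^sup>1(Y)\<close>, which are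
differentiable as solutions of a linear equation.\<close>

lemma K_differentiable:
  assumes X: "X \<in> sl" and Y: "Y \<in> sl"
  shows "(\<lambda>z. K (chart_inv (chart_at TA u) z) X Y) differentiable (at (snd (chart_at TA u) u))"
proof -
  let ?c = "chart_at TA u"
  note c = chart_at_facts[OF TA, of u]
  let ?S = "snd ?c ` fst ?c" and ?z = "snd ?c u"
  note p = chart_form_props[OF TA conn_form c(1)]
  have S: "open ?S" "?z \<in> ?S" using is_chart_open(2)[OF c(3)] c by auto
  define y where "y V z = to_coord TA ?c (chart_inv ?c z) (conn_inv \<G> (chart_inv ?c z) V)" for V z
  have fc: "from_coord TA ?c (chart_inv ?c z) (y V z) = conn_inv \<G> (chart_inv ?c z) V" if "z \<in> ?S" for V z
    unfolding y_def by (rule to_from_coord(2)[OF TA c(1) is_chart_inverse(3)[OF c(3) that]])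
  have sol: "chart_form TA (conn \<G>) ?c z (y V z) = V" if "z \<in> ?S" "V \<in> sl" for V z
    using fc[OF that(1)] conn_conn_inv[OF that(2)] by (simp add: chart_form_def)
  have inj: "inj (chart_form TA (conn \<G>) ?c ?z)"
  proof (rule injI)
    fix v w assume "chart_form TA (conn \<G>) ?c ?z v = chart_form TA (conn \<G>) ?c ?z w"
    then have "conn \<G> u v = conn \<G> u w"
      using is_chart_inverse(1)[OF c(3,2)] from_coord_chart_at[OF TA, of u] by (simp add: chart_form_def)
    then show "v = w" using conn_inv_conn by metis
  qed
  have yd: "y V differentiable (at ?z)" if "V \<in> sl" for V
    by (rule differentiable_linear_solution[OF S p(2) p(3)[OF S(2)] inj sol]) (use that in auto)
  have d: "(\<lambda>z. dform (chart_form TA (conn \<G>) ?c) z (y X z) (y Y z)) differentiable (at ?z)"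
    by (rule dform_apply_differentiable[OF S p(2) p(1) yd[OF X] yd[OF Y]])
  have eq: "dform (chart_form TA (conn \<G>) ?c) z (y X z) (y Y z) + commutator X Y = K (chart_inv ?c z) X Y" if z: "z \<in> ?S" for z
    unfolding K_def ext_deriv_chart[OF TA conn_form c(1) is_chart_inverse(3)[OF c(3) z]] is_chart_inverse(2)[OF c(3) z] y_def ..
  from d obtain D where D: "((\<lambda>z. dform (chart_form TA (conn \<G>) ?c) z (y X z) (y Y z)) has_derivative D) (at ?z)"
    unfolding differentiable_def by blast
  have "((\<lambda>z. dform (chart_form TA (conn \<G>) ?c) z (y X z) (y Y z) + commutator X Y) has_derivative (\<lambda>h. D h + 0)) (at ?z)"
    by (rule has_derivative_add[OF D has_derivative_const])
  then have "((\<lambda>z. K (chart_inv ?c z) X Y) has_derivative (\<lambda>h. D h + 0)) (at ?z)"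
    by (rule has_derivative_transform_within_open[OF _ S]) (rule eq)
  then show ?thesis unfolding differentiable_def by blast
qed

section \<open>Linear functionals of the curvature\<close>

definition curv_fun :: "('n matr ^ ('n idx \<times> 'n idx)) ^ ('n idx \<times> 'n idx) \<Rightarrow> 'p \<Rightarrow> real" where
  "curv_fun l u = l \<bullet> coords2 (curv \<G> u)"

definition curv_fun_deriv :: "('n matr ^ ('n idx \<times> 'n idx)) ^ ('n idx \<times> 'n idx) \<Rightarrow> 'n matr \<Rightarrow> 'p \<Rightarrow> real" where
  "curv_fun_deriv l X u = tangent_map TA euclid_atlas (curv_fun l) u (conn_inv \<G> u X)"

lemma inner_coords2: "l \<bullet> coords2 \<psi> = (\<Sum>\<alpha>\<in>UNIV. \<Sum>\<beta>\<in>UNIV. l $ \<alpha> $ \<beta> \<bullet> \<psi> (bas \<alpha>) (bas \<beta>))"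
  for l :: "('n matr ^ ('n idx \<times> 'n idx)) ^ ('n idx \<times> 'n idx)"
  by (simp add: coords2_def inner_vec_def)

lemma curv_fun_mderiv: "mderiv TA euclid_atlas (curv_fun l) u (tangent_map TA euclid_atlas (curv_fun l) u)"
proof -
  let ?c = "chart_at TA u"
  note c = chart_at_facts[OF TA, of u]
  have "\<exists>D. ((\<lambda>z. curv \<G> (chart_inv ?c z) (bas \<alpha>) (bas \<beta>)) has_derivative D) (at (snd ?c u))" for \<alpha> \<beta>
    using K_differentiable[OF lower_part_sl lower_part_sl, of u] by (simp add: curv_K differentiable_def)
  then obtain D where D: "\<And>\<alpha> \<beta>. ((\<lambda>z. curv \<G> (chart_inv ?c z) (bas \<alpha>) (bas \<beta>)) has_derivative D \<alpha> \<beta>) (at (snd ?c u))"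
    by metis
  have "((\<lambda>z. curv_fun l (chart_inv ?c z)) has_derivative (\<lambda>h. \<Sum>\<alpha>\<in>UNIV. \<Sum>\<beta>\<in>UNIV. l $ \<alpha> $ \<beta> \<bullet> D \<alpha> \<beta> h)) (at (snd ?c u))"
    unfolding curv_fun_def inner_coords2 by (intro has_derivative_sum has_derivative_inner_right D)
  from mderiv_self[OF mderiv_from_chart[OF TA c(1,2) this]] show ?thesis .
qed

lemma curv_fun_deriv_linear:
  assumes "X \<in> sl" "Y \<in> sl"
  shows "curv_fun_deriv l (X + Y) u = curv_fun_deriv l X u + curv_fun_deriv l Y u"
    "curv_fun_deriv l (r *\<^sub>R X) u = r * curv_fun_deriv l X u"
  using mderiv_linear[OF curv_fun_mderiv, of l u] assms
  by (simp_all add: curv_fun_deriv_def conn_inv_linear linear_add linear_scale)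

lemma curv_fun_along_curve:
  assumes X: "X \<in> filt 0" and m: "m 0 = mat 1" "(m has_vector_derivative X) (at 0)" "\<forall>\<^sub>F t in nhds 0. m t \<in> upper_mats"
  shows "((\<lambda>t. curv_fun l (R u (m t))) has_vector_derivative curv_fun_deriv l X u) (at 0)"
proof -
  have w: "mderiv TA euclid_atlas (curv_fun l) (R u (m 0)) (tangent_map TA euclid_atlas (curv_fun l) u)"
    using curv_fun_mderiv by (simp add: m(1) R_one)
  have "mderiv euclid_atlas euclid_atlas (\<lambda>t. curv_fun l (R u (m t))) 0 (\<lambda>r. tangent_map TA euclid_atlas (curv_fun l) u (r *\<^sub>R conn_inv \<G> u X))"
    by (rule mderiv_compose[OF smooth_atlas_euclid TA fundamental_velocity[OF X m] w])
  then show ?thesis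
    using linear_scale[OF mderiv_linear[OF curv_fun_mderiv, of l u]]
    by (simp add: mderiv_euclid has_vector_derivative_def curv_fun_deriv_def)
qed

text \<open>The common part of two arguments: \<open>f\<close> is either the right action of an element of \<open>P\<^sub>+\<close>, which changes constant
vector fields by conjugation, or an automorphism, which preserves them.\<close>

lemma curv_fun_deriv_transport:
  assumes f: "mderiv TA TA f u (tangent_map TA TA f u)" and inv: "\<forall>\<^sub>F v in nhds u. curv_fun l (f v) = curv_fun l v"
    and X: "tangent_map TA TA f u (conn_inv \<G> u X) = conn_inv \<G> (f u) Y"
  shows "curv_fun_deriv l Y (f u) = curv_fun_deriv l X u"
proof -
  have "mderiv TA euclid_atlas (\<lambda>v. curv_fun l (f v)) u (\<lambda>\<xi>. tangent_map TA euclid_atlas (curv_fun l) (f u) (tangent_map TA TA f u \<xi>))"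
    by (rule mderiv_compose[OF TA TA f curv_fun_mderiv])
  from fun_cong[OF mderiv_unique[OF mderiv_transform[OF this inv TA] curv_fun_mderiv], of "conn_inv \<G> u X"]
  show ?thesis by (simp add: curv_fun_deriv_def X)
qed

section \<open>The nilpotent part acts trivially modulo boundaries\<close>

text \<open>On \<open>\<pp>\<^sub>+\<close> the exponential series stops after the quadratic term, so the one-parameter group is polynomial.\<close>

lemma nilpotent_curve:
  assumes Z: "Z \<in> filt 1"
  obtains m :: "real \<Rightarrow> 'n matr" where "m 0 = mat 1" "(m has_vector_derivative Z) (at 0)"
    "((\<lambda>t. m (- t)) has_vector_derivative - Z) (at 0)" "\<And>t. m t \<in> upper_mats"
    "\<And>t. matrix_inv (m t) = m (- t)" "\<And>s t. m s ** m t = m (s + t)" "m 1 = mat_exp Z"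
proof
  define m where "m = (\<lambda>t::real. mat 1 + t *\<^sub>R Z + (t\<^sup>2 / 2) *\<^sub>R (Z ** Z))"
  show 0: "m 0 = mat 1" by (simp add: m_def)
  show "(m has_vector_derivative Z) (at 0)" "((\<lambda>t. m (- t)) has_vector_derivative - Z) (at 0)"
    unfolding m_def by (auto intro!: derivative_eq_intros)
  show "m t \<in> upper_mats" for t
  proof -
    have "t *\<^sub>R Z + (t\<^sup>2 / 2) *\<^sub>R (Z ** Z) \<in> filt 1" by (intro filt1_linear(2,5) filt1_mult Z)
    from unipotent_upper[OF this] show ?thesis by (simp add: m_def add.assoc)
  qed
  show a: "m s ** m t = m (s + t)" for s t unfolding m_def by (rule nilpotent_exp_mult[OF Z])
  show "matrix_inv (m t) = m (- t)" for t by (rule matrix_inv_eqI(2)) (simp add: a 0)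
  show "m 1 = mat_exp Z" unfolding mat_exp_nilpotent[OF Z] by (simp add: m_def)
qed

text \<open>Equivariance turns the derivative of \<open>\<kappa>\<close> in the direction \<open>Z\<close> into \<open>- Z \<cdot> \<kappa>\<close>, a boundary by the homotopy
formula.\<close>

lemma curv_fun_deriv_nilpotent:
  assumes normal: "normal_geometry \<G>" and l: "\<And>\<beta>. \<beta> \<in> im_codiff \<Longrightarrow> l \<bullet> coords2 \<beta> = 0" and Z: "Z \<in> filt 1"
  shows "curv_fun_deriv l Z u = 0"
proof -
  obtain m :: "real \<Rightarrow> 'n matr" where m: "m 0 = mat 1" "(m has_vector_derivative Z) (at 0)"
    "((\<lambda>t. m (- t)) has_vector_derivative - Z) (at 0)" "\<And>t. m t \<in> upper_mats"
    "\<And>t. matrix_inv (m t) = m (- t)" "\<And>s t. m s ** m t = m (s + t)" "m 1 = mat_exp Z"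
    by (rule nilpotent_curve[OF Z]) (rule that)
  let ?\<psi> = "curv \<G> u"
  note c = cochain2D[OF curv_cochain2[of u]]
  have bb: "bounded_bilinear ?\<psi>"
    unfolding bilinear_conv_bounded_bilinear[symmetric] bilinear_def by (intro conjI allI c)
  note n = m(3)
  have im: "act2 Z ?\<psi> \<in> im_codiff"
    by (rule homotopy_formula[OF curv_cochain2 Z]) (use normal in \<open>simp add: normal_geometry_def\<close>)
  have d: "((\<lambda>t. curv \<G> (R u (m t)) (bas \<alpha>) (bas \<beta>)) has_vector_derivative - act2 Z ?\<psi> (bas \<alpha>) (bas \<beta>)) (at 0)" for \<alpha> \<beta>
  proof -
    have cj: "((\<lambda>t. m t ** V ** m (- t)) has_vector_derivative commutator Z V) (at 0)" for V
      using mm.has_vector_derivative[OF mm.has_vector_derivative[OF m(2) has_vector_derivative_const[of V]] n]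
      by (simp add: m(1) mm.zero_right mm.minus_right commutator_def)
    let ?X = "lower_part (bas \<alpha>)" and ?Y = "lower_part (bas \<beta>)"
    have "((\<lambda>t. m (- t) ** ?\<psi> (m t ** ?X ** m (- t)) (m t ** ?Y ** m (- t)) ** m t) has_vector_derivative
       - act2 Z ?\<psi> ?X ?Y) (at 0)"
      using mm.has_vector_derivative[OF mm.has_vector_derivative[OF n bounded_bilinear.has_vector_derivative[OF bb cj[of ?X] cj[of ?Y]]] m(2)]
      by (simp add: m(1) act2_def commutator_def[of Z "?\<psi> ?X ?Y"] mm.minus_left algebra_simps)
    moreover have "curv \<G> (R u (m t)) (bas \<alpha>) (bas \<beta>) = m (- t) ** ?\<psi> (m t ** ?X ** m (- t)) (m t ** ?Y ** m (- t)) ** m t" for t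
      using curv_R[OF m(4)] m(5) by simp
    moreover have "act2 Z ?\<psi> ?X ?Y = act2 Z ?\<psi> (bas \<alpha>) (bas \<beta>)"
      using linear_lower_part[OF im_codiff_expand(1,3)[OF im], of "bas \<alpha>"] linear_lower_part[OF im_codiff_expand(2,4)[OF im], of _ "bas \<beta>"] by simp
    ultimately show ?thesis by simp
  qed
  have "((\<lambda>t. curv_fun l (R u (m t))) has_vector_derivative (\<Sum>\<alpha>\<in>UNIV. \<Sum>\<beta>\<in>UNIV. l $ \<alpha> $ \<beta> \<bullet> - act2 Z ?\<psi> (bas \<alpha>) (bas \<beta>))) (at 0)"
    unfolding curv_fun_def inner_coords2
    by (intro has_vector_derivative_sum bounded_linear.has_vector_derivative[OF bounded_linear_inner_right] d)
  moreover have "(\<Sum>\<alpha>\<in>UNIV. \<Sum>\<beta>\<in>UNIV. l $ \<alpha> $ \<beta> \<bullet> - act2 Z ?\<psi> (bas \<alpha>) (bas \<beta>)) = - (l \<bullet> coords2 (act2 Z ?\<psi>))"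
    by (simp add: inner_coords2 sum_negf)
  ultimately have "((\<lambda>t. curv_fun l (R u (m t))) has_vector_derivative 0) (at 0)" using l[OF im] by simp
  moreover have "((\<lambda>t. curv_fun l (R u (m t))) has_vector_derivative curv_fun_deriv l Z u) (at 0)"
    by (rule curv_fun_along_curve[OF filt0_sl(3)[OF Z] m(1,2)]) (simp add: m(4))
  ultimately show ?thesis using vector_derivative_unique_at by blast
qed

lemma curv_fun_constant_along:
  assumes X: "X \<in> filt 0" and m: "m 0 = mat 1" "(m has_vector_derivative X) (at 0)" "\<And>t. m t \<in> upper_mats" "\<And>s t. m s ** m t = m (s + t)"
    and z: "\<And>v. proj \<G> v = proj \<G> u \<Longrightarrow> curv_fun_deriv l X v = 0"
  shows "curv_fun l (R u (m t)) = curv_fun l u"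
proof -
  have "DERIV (\<lambda>t. curv_fun l (R u (m t))) t :> 0" for t
  proof -
    let ?v = "R u (m t)"
    have "((\<lambda>s. curv_fun l (R ?v (m s))) has_vector_derivative curv_fun_deriv l X ?v) (at 0)"
      by (rule curv_fun_along_curve[OF X m(1,2)]) (simp add: m(3))
    then have "((\<lambda>s. curv_fun l (R u (m (t + s)))) has_vector_derivative 0) (at 0)"
      using z[of ?v] proj_R[OF m(3)] by (simp add: R_mult m(3,4))
    then have "DERIV (\<lambda>s. curv_fun l (R u (m (t + s)))) 0 :> 0" by (simp add: has_real_derivative_iff_has_vector_derivative)
    then show ?thesis
      using DERIV_shift[of "\<lambda>t. curv_fun l (R u (m t))" 0 0 t] by (simp add: add.commute)
  qed
  then have "curv_fun l (R u (m t)) = curv_fun l (R u (m 0))" using DERIV_isconst_all by blast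
  then show ?thesis by (simp add: m(1) R_one)
qed

lemma curv_fun_unipotent:
  assumes normal: "normal_geometry \<G>" and l: "\<And>\<beta>. \<beta> \<in> im_codiff \<Longrightarrow> l \<bullet> coords2 \<beta> = 0" and N: "N \<in> filt 1"
  shows "curv_fun l (R u (mat 1 + N)) = curv_fun l u"
proof -
  obtain Z where Z: "Z \<in> filt 1" "mat_exp Z = mat 1 + N" using unipotent_log[OF N] .
  obtain m :: "real \<Rightarrow> 'n matr" where m: "m 0 = mat 1" "(m has_vector_derivative Z) (at 0)"
    "((\<lambda>t. m (- t)) has_vector_derivative - Z) (at 0)" "\<And>t. m t \<in> upper_mats"
    "\<And>t. matrix_inv (m t) = m (- t)" "\<And>s t. m s ** m t = m (s + t)" "m 1 = mat_exp Z"
    by (rule nilpotent_curve[OF Z(1)]) (rule that)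
  have "curv_fun l (R u (m 1)) = curv_fun l u"
    by (rule curv_fun_constant_along[OF filt0_sl(3)[OF Z(1)] m(1,2,4,6)]) (rule curv_fun_deriv_nilpotent[OF normal l Z(1)])
  then show ?thesis by (simp add: m(7) Z(2))
qed

lemma curv_fun_deriv_unipotent:
  assumes normal: "normal_geometry \<G>" and l: "\<And>\<beta>. \<beta> \<in> im_codiff \<Longrightarrow> l \<bullet> coords2 \<beta> = 0" and N: "N \<in> filt 1" and X: "X \<in> sl"
  shows "curv_fun_deriv l (matrix_inv (mat 1 + N) ** X ** (mat 1 + N)) (R u (mat 1 + N)) = curv_fun_deriv l X u"
  by (rule curv_fun_deriv_transport[OF R_mderiv[OF unipotent_upper[OF N]] _ conn_inv_R[OF unipotent_upper[OF N] X]])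
     (simp add: curv_fun_unipotent[OF normal l N])

lemma curv_fun_deriv_automorphism:
  assumes S: "open S" "u \<in> S" and \<phi>: "smooth_map TA TA S \<phi>"
    and pres: "\<And>v \<xi>. v \<in> S \<Longrightarrow> conn \<G> (\<phi> v) (tangent_map TA TA \<phi> v \<xi>) = conn \<G> v \<xi>" and X: "X \<in> sl"
  shows "curv_fun_deriv l X (\<phi> u) = curv_fun_deriv l X u"
proof (rule curv_fun_deriv_transport[OF smooth_map_mderiv[OF TA TA \<phi> S]])
  show "\<forall>\<^sub>F v in nhds u. curv_fun l (\<phi> v) = curv_fun l v"
    using eventually_nhds_in_open[OF S]
    by eventually_elim (simp add: curv_fun_def coords2_def curv_K automorphism_K[OF S(1) _ \<phi> pres lower_part_sl lower_part_sl])
  show "tangent_map TA TA \<phi> u (conn_inv \<G> u X) = conn_inv \<G> (\<phi> u) X"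
    by (rule conn_inv_eqI[symmetric]) (simp add: pres[OF S(2)] conn_conn_inv[OF X])
qed

text \<open>The exponent is \<open>- k t\<close>, where \<open>k\<close> is the homogeneity of the component.\<close>

lemma curv_grading_exp:
  assumes \<alpha>: "\<alpha> \<in> low_idx" and \<beta>: "\<beta> \<in> low_idx"
  shows "curv \<G> (R u (grading_exp t)) (bas \<alpha>) (bas \<beta>) $ i $ j =
     exp (t * real_of_int ((blk i - blk j) - (blk (fst \<alpha>) - blk (snd \<alpha>)) - (blk (fst \<beta>) - blk (snd \<beta>)))) * curv \<G> u (bas \<alpha>) (bas \<beta>) $ i $ j"
proof -
  note c = cochain2D[OF curv_cochain2[of u]]
  have b: "grading_exp t ** bas \<gamma> ** grading_exp (- t) = exp (- t * real_of_int (blk (fst \<gamma>) - blk (snd \<gamma>))) *\<^sub>R bas \<gamma>" for \<gamma> :: "'n idx \<times> 'n idx"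
    by (auto simp: matr_eq_iff grading_exp_mult_entry bas_entry exp_add[symmetric] algebra_simps)
  have e: "exp (- (t * (1 - real_of_int (blk i)))) * ((exp a * (exp b * C)) * exp (t * (1 - real_of_int (blk j))))
     = exp (t * real_of_int (blk i - blk j) + a + b) * C" for a b C
    by (simp add: exp_add[symmetric] algebra_simps mult_exp_exp)
  show ?thesis
    unfolding curv_R[OF grading_elt_curve(3)] grading_elt_curve(4) lower_part_bas(1)[OF \<alpha>] lower_part_bas(1)[OF \<beta>] b
      linear_scale[OF c(1)] linear_scale[OF c(2)] grading_exp_mult_entry
    by (simp add: exp_add[symmetric] mult_exp_exp algebra_simps)
qed

text \<open>The function is constant along \<open>u exp(t E)\<close>, whereas all components of positive homogeneity decay
exponentially as \<open>t\<close> tends to infinity.  The only components of homogeneity at most zero are the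
\<open>\<gg>\<^sub>-\<^sub>2\<close>-components on two arguments of degree \<open>-1\<close>, which vanish by normality.\<close>

lemma curvature_boundary:
  assumes normal: "normal_geometry \<G>"
    and z: "\<And>(l :: ('n matr ^ ('n idx \<times> 'n idx)) ^ ('n idx \<times> 'n idx)) v. (\<And>\<beta>. \<beta> \<in> im_codiff \<Longrightarrow> l \<bullet> coords2 \<beta> = 0) \<Longrightarrow> proj \<G> v = proj \<G> u \<Longrightarrow> curv_fun_deriv l grading_elt v = 0"
  shows "curv \<G> u \<in> im_codiff"
proof (rule im_codiff_separation[OF curv_cochain2])
  fix l :: "('n matr ^ ('n idx \<times> 'n idx)) ^ ('n idx \<times> 'n idx)" assume l: "\<And>\<beta>. \<beta> \<in> im_codiff \<Longrightarrow> l \<bullet> coords2 \<beta> = 0"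
  have const: "curv_fun l (R u (grading_exp t)) = curv_fun l u" for t
    by (rule curv_fun_constant_along[OF grading_elt_filt0 grading_elt_curve(1,2,3,5)]) (rule z[OF l])
  note c = cochain2D[OF curv_cochain2[of u]]
  have cl: "codiff2 (curv \<G> u) X = 0" for X using normal by (simp add: normal_geometry_def)
  have lim: "((\<lambda>t. curv \<G> (R u (grading_exp t)) (bas \<alpha>) (bas \<beta>)) \<longlongrightarrow> 0) at_top" for \<alpha> \<beta>
  proof (cases "\<alpha> \<in> low_idx \<and> \<beta> \<in> low_idx")
    case False
    then have "curv \<G> v (bas \<alpha>) (bas \<beta>) = 0" for v
      using cochain2D(5,6)[OF curv_cochain2[of v]] lower_part_bas(2) by blast
    then show ?thesis by simp
  next
    case True
    show ?thesis
    proof (intro vec_tendstoI)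
      fix i j :: "'n idx"
      let ?k = "(blk i - blk j) - (blk (fst \<alpha>) - blk (snd \<alpha>)) - (blk (fst \<beta>) - blk (snd \<beta>))"
      show "((\<lambda>t. curv \<G> (R u (grading_exp t)) (bas \<alpha>) (bas \<beta>) $ i $ j) \<longlongrightarrow> 0 $ i $ j) at_top"
      proof (cases "?k < 0")
        case k: True
        have "filterlim (\<lambda>t. real_of_int ?k * t) at_bot at_top"
          by (rule filterlim_tendsto_neg_mult_at_bot[OF tendsto_const _ filterlim_ident]) (use k in linarith)
        then have "filterlim (\<lambda>t. t * real_of_int ?k) at_bot at_top" by (simp only: mult.commute)
        from filterlim_compose[OF exp_at_bot this]
        have "((\<lambda>t. exp (t * real_of_int ?k) * curv \<G> u (bas \<alpha>) (bas \<beta>) $ i $ j) \<longlongrightarrow> 0 * curv \<G> u (bas \<alpha>) (bas \<beta>) $ i $ j) at_top"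
          by (intro tendsto_mult tendsto_const)
        then show ?thesis using True by (simp only: curv_grading_exp) simp
      next
        case k: False
        have "blk i - blk j \<le> 2" by (cases i; cases j) auto
        moreover have "1 \<le> blk (fst \<alpha>) - blk (snd \<alpha>)" "1 \<le> blk (fst \<beta>) - blk (snd \<beta>)" using True by (auto simp: low_idx_def)
        ultimately have e: "blk i - blk j = 2" "blk (fst \<alpha>) - blk (snd \<alpha>) = 1" "blk (fst \<beta>) - blk (snd \<beta>) = 1" using k by linarith+
        have "i = Last" "j = First" using e(1) by (cases i; cases j; simp)+
        then have "curv \<G> u (bas \<alpha>) (bas \<beta>) $ i $ j = 0"
          using coclosed_homogeneity_0[OF curv_cochain2 cl _ e(2) _ e(3)] True by simp
        then show ?thesis using True by (simp only: curv_grading_exp) simp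
      qed
    qed
  qed
  have "((\<lambda>t. curv_fun l (R u (grading_exp t))) \<longlongrightarrow> (\<Sum>\<alpha>\<in>UNIV. \<Sum>\<beta>\<in>UNIV. l $ \<alpha> $ \<beta> \<bullet> (0 :: 'n matr))) at_top"
    unfolding curv_fun_def inner_coords2 by (intro tendsto_sum tendsto_inner tendsto_const lim)
  then have "((\<lambda>t::real. curv_fun l u) \<longlongrightarrow> 0) at_top" by (simp add: const)
  then have "curv_fun l u = 0" by (simp add: tendsto_const_iff)
  then show "l \<bullet> coords2 (curv \<G> u) = 0" by (simp add: curv_fun_def)
qed

end

section \<open>Coordinates on the quotient of \<open>\<gg>\<^sup>-\<^sup>1\<close> by \<open>\<pp>\<close>\<close>

text \<open>The elements of \<open>\<gg>\<^sub>-\<^sub>1\<close>: the column \<open>a\<close> is the component in \<open>\<gg>\<^sub>-\<^sub>1\<^sup>L\<close>, the row \<open>b\<close> the one in \<open>\<gg>\<^sub>-\<^sub>1\<^sup>R\<close>.\<close>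

definition minus_one :: "real ^ 'n \<Rightarrow> real ^ 'n \<Rightarrow> 'n::finite matr" where
  "minus_one a b = (\<chi> i j. case i of First \<Rightarrow> 0 | Mid k \<Rightarrow> (if j = First then a $ k else 0)
      | Last \<Rightarrow> (case j of Mid k \<Rightarrow> b $ k | _ \<Rightarrow> 0))"

definition L_coord :: "'n::finite matr \<Rightarrow> real ^ 'n" where "L_coord X = (\<chi> k. X $ Mid k $ First)"
definition R_coord :: "'n::finite matr \<Rightarrow> real ^ 'n" where "R_coord X = (\<chi> k. X $ Last $ Mid k)"
definition elem_m2 :: "'n::finite matr" where "elem_m2 = elem_mat Last First"

lemma minus_one_entry [simp]:
  "minus_one a b $ First $ j = 0" "minus_one a b $ Mid k $ First = a $ k" "minus_one a b $ Mid k $ Mid l = 0" "minus_one a b $ i $ Last = 0"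
  "minus_one a b $ Last $ First = 0" "minus_one a b $ Last $ Mid k = b $ k"
  by (simp_all add: minus_one_def split: idx.split)

lemma elem_m2_entry: "elem_m2 $ i $ j = (if i = Last \<and> j = First then 1 else 0)"
  by (simp add: elem_m2_def elem_mat_entry)

lemma L_coord_minus_one [simp]: "L_coord (minus_one a b) = a" and R_coord_minus_one [simp]: "R_coord (minus_one a b) = b"
  by (simp_all add: L_coord_def R_coord_def vec_eq_iff)

lemma minus_one_grade: "minus_one a b \<in> grade (-1)" "minus_one a 0 \<in> grade_m1_L" "minus_one 0 b \<in> grade_m1_R" "minus_one a b \<in> sl" "minus_one a b \<in> filt (-1)"
  by (simp_all add: in_grade_m1 grade_m1_L_def grade_m1_R_def all_idx sl_def in_filt_m1 trace_idx)

lemma grade_m1_LR: "X \<in> grade_m1_L \<Longrightarrow> X = minus_one (L_coord X) 0" "X \<in> grade_m1_R \<Longrightarrow> X = minus_one 0 (R_coord X)"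
  by (auto simp: grade_m1_L_def grade_m1_R_def in_grade_m1 matr_eq_iff all_idx L_coord_def R_coord_def)

lemma grade_m1_sl: "X \<in> grade_m1_L \<Longrightarrow> X \<in> filt (-1)" "X \<in> grade_m1_R \<Longrightarrow> X \<in> filt (-1)" "X \<in> filt (-1) \<Longrightarrow> X \<in> sl"
  by (auto simp: grade_m1_L_def grade_m1_R_def grade_def filt_def)

lemma minus_one_linear: "minus_one (a + a') (b + b') = minus_one a b + minus_one a' b'" "minus_one (a - a') (b - b') = minus_one a b - minus_one a' b'" "minus_one (r *\<^sub>R a) (r *\<^sub>R b) = r *\<^sub>R minus_one a b"
  "minus_one (- a) (- b) = - minus_one a b" "minus_one 0 0 = 0"
  by (simp_all add: matr_eq_iff all_idx)

lemma filt_m1_decomp: "X \<in> sl \<Longrightarrow> X - (minus_one (L_coord X) (R_coord X) + X $ Last $ First *\<^sub>R elem_m2) \<in> filt 0"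
  by (auto simp: in_filt_0 sl_def trace_idx L_coord_def R_coord_def elem_m2_entry)

lemma elem_m2_sl: "elem_m2 \<in> sl" by (simp add: sl_def trace_idx elem_m2_entry)

lemma commutator_minus_one: "commutator (minus_one a b) (minus_one a' b') = (b \<bullet> a' - b' \<bullet> a) *\<^sub>R elem_m2"
  by (auto simp: matr_eq_iff all_idx commutator_def matr_mult_entry elem_m2_entry inner_vec_def mult.commute)

lemma pairing_grade_1:
  assumes "\<Upsilon> \<in> grade 1"
  shows "pairing \<Upsilon> X = (\<chi> i. \<Upsilon> $ First $ Mid i) \<bullet> L_coord X + (\<chi> i. \<Upsilon> $ Mid i $ Last) \<bullet> R_coord X"
  using assms by (simp add: in_grade_1 all_idx pairing_sum sum_idx L_coord_def R_coord_def inner_vec_def sum.distrib)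

section \<open>The Levi decomposition of block upper triangular matrices\<close>

text \<open>The projection of \<open>P\<close> onto \<open>G\<^sub>0\<close> along \<open>P\<^sub>+\<close>, on the level of matrices.\<close>

definition blk_diag :: "'n::finite matr \<Rightarrow> 'n matr" where
  "blk_diag M = (\<chi> i j. if blk i = blk j then M $ i $ j else 0)"

lemma blk_diag_entry: "blk_diag M $ i $ j = (if blk i = blk j then M $ i $ j else 0)"
  by (simp add: blk_diag_def)

lemma upper_entry_zero: "M \<in> upper_mats \<Longrightarrow> blk j < blk i \<Longrightarrow> M $ i $ j = 0"
  by (force simp: upper_mats_def)

lemma blk_diag_mult:
  assumes "A \<in> upper_mats" "B \<in> upper_mats" shows "blk_diag A ** blk_diag B = blk_diag (A ** B)"
proof -
  have "(blk_diag A ** blk_diag B) $ i $ j = blk_diag (A ** B) $ i $ j" for i j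
  proof (cases "blk i = blk j")
    case True
    have "blk_diag A $ i $ k * blk_diag B $ k $ j = A $ i $ k * B $ k $ j" for k
      using upper_entry_zero[OF assms(1), of k i] upper_entry_zero[OF assms(2), of j k] True
      by (auto simp: blk_diag_entry) (metis linorder_neqE)
    then show ?thesis using True by (simp add: matrix_matrix_mult_def blk_diag_entry)
  next
    case False
    have "blk_diag A $ i $ k * blk_diag B $ k $ j = 0" for k using False by (simp add: blk_diag_entry)
    then have "(\<Sum>k\<in>UNIV. blk_diag A $ i $ k * blk_diag B $ k $ j) = 0" by (simp only: sum.neutral_const)
    then show ?thesis using False by (simp add: matrix_matrix_mult_def blk_diag_entry)
  qed
  then show ?thesis by (simp add: matr_eq_iff)
qed

lemma blk_diag_inverse:
  assumes M: "M \<in> upper_mats"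
  shows "blk_diag M ** blk_diag (matrix_inv M) = mat 1" "matrix_inv (blk_diag M) = blk_diag (matrix_inv M)"
    "blk_diag M \<in> upper_mats" "blk_diag M \<in> diag_mats"
proof -
  have i: "invertible M" using M by (simp add: upper_mats_def)
  have "blk_diag (mat 1) = mat 1" by (auto simp: matr_eq_iff blk_diag_entry mat_one_entry)
  then show 1: "blk_diag M ** blk_diag (matrix_inv M) = mat 1"
    using blk_diag_mult[OF M upper_inv[OF M]] matrix_inv_works(1)[OF i] by simp
  then show "matrix_inv (blk_diag M) = blk_diag (matrix_inv M)" by (rule matrix_inv_eqI(2))
  have "invertible (blk_diag M)" using matrix_inv_eqI(1)[OF 1] .
  then show "blk_diag M \<in> upper_mats" "blk_diag M \<in> diag_mats"
    by (auto simp: upper_mats_def diag_mats_def blk_diag_entry split: if_splits)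
qed

lemma filt1_upper_mult:
  assumes "A \<in> upper_mats" "N \<in> filt 1" shows "A ** N \<in> filt 1" "N ** A \<in> filt 1"
  using assms by (auto simp: in_upper in_filt_1 all_idx matr_mult_entry)

lemma upper_decomp:
  assumes M: "M \<in> upper_mats"
  obtains N where "N \<in> filt 1" "M = blk_diag M ** (mat 1 + N)"
proof
  let ?D' = "blk_diag (matrix_inv M)"
  note D = blk_diag_inverse[OF M]
  show "M = blk_diag M ** (mat 1 + (?D' ** M - mat 1))"
    using D(1) by (simp add: matrix_mul_assoc)
  have U: "?D' \<in> upper_mats" using blk_diag_inverse(3)[OF upper_inv[OF M]] .
  have "?D' ** M - mat 1 = ?D' ** (M - blk_diag M)"
    using matrix_left_right_inverse[of "blk_diag M" ?D'] D(1) by (simp add: mm.diff_right)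
  moreover have "M - blk_diag M \<in> filt 1"
    using upper_entry_zero[OF M] by (auto simp: in_filt_1 blk_diag_entry)
  ultimately show "?D' ** M - mat 1 \<in> filt 1" using filt1_upper_mult(1)[OF U] by simp
qed

lemma unipotent_inverse:
  assumes N: "N \<in> filt 1"
  obtains N' where "N' \<in> filt 1" "matrix_inv (mat 1 + N) = mat 1 + N'"
proof
  have "matrix_inv (mat 1 + N) = mat 1 - N + N ** N"
    by (rule matrix_inv_eqI(2)[OF unipotent_invertible[OF N]])
  then show "matrix_inv (mat 1 + N) = mat 1 + (N ** N - N)" by simp
  show "N ** N - N \<in> filt 1" by (intro filt1_linear(3) filt1_mult N)
qed

lemma unipotent_mult:
  "N \<in> filt 1 \<Longrightarrow> N' \<in> filt 1 \<Longrightarrow> (mat 1 + N) ** (mat 1 + N') = mat 1 + (N + N' + N ** N')"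
  "N \<in> filt 1 \<Longrightarrow> N' \<in> filt 1 \<Longrightarrow> N + N' + N ** N' \<in> filt 1"
  by (simp add: mm.add_left mm.add_right) (intro filt1_linear(2) filt1_mult)

text \<open>The action of \<open>P\<close> on \<open>\<gg>\<^sup>-\<^sup>1 / \<pp>\<close> preserves the splitting and involves only the diagonal blocks.\<close>

lemma conj_coords:
  assumes M: "M \<in> upper_mats" and X: "X \<in> filt (-1)"
  shows "M ** X ** matrix_inv M \<in> filt (-1)"
    "L_coord (M ** X ** matrix_inv M) $ k = matrix_inv M $ First $ First * (\<Sum>m\<in>UNIV. M $ Mid k $ Mid m * L_coord X $ m)"
    "R_coord (M ** X ** matrix_inv M) $ k = M $ Last $ Last * (\<Sum>m\<in>UNIV. R_coord X $ m * matrix_inv M $ Mid m $ Mid k)"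
proof -
  have i: "invertible M" using M by (simp add: upper_mats_def)
  have C: "matrix_inv M \<in> upper_mats" by (rule upper_inv[OF M])
  have "X \<in> sl" using X by (simp add: filt_def)
  note s = conj_sl[OF i this]
  have z: "matrix_inv M $ Last $ First = 0" "\<And>m. matrix_inv M $ Mid m $ First = 0" "\<And>m. matrix_inv M $ Last $ Mid m = 0"
    "M $ Last $ First = 0" "\<And>m. M $ Mid m $ First = 0" "\<And>m. M $ Last $ Mid m = 0" "X $ Last $ First = 0"
    using M C X by (auto simp: in_upper in_filt_m1)
  show "M ** X ** matrix_inv M \<in> filt (-1)"
    using s by (simp add: in_filt_m1 sl_def matr_mult_entry z)
  show "L_coord (M ** X ** matrix_inv M) $ k = matrix_inv M $ First $ First * (\<Sum>m\<in>UNIV. M $ Mid k $ Mid m * L_coord X $ m)"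
    by (simp add: L_coord_def matr_mult_entry z mult.commute)
  show "R_coord (M ** X ** matrix_inv M) $ k = M $ Last $ Last * (\<Sum>m\<in>UNIV. R_coord X $ m * matrix_inv M $ Mid m $ Mid k)"
    by (simp add: R_coord_def matr_mult_entry z sum_distrib_left mult_ac)
qed

lemma conj_coords_blk_diag:
  assumes M: "M \<in> upper_mats" and X: "X \<in> filt (-1)"
  shows "L_coord (M ** X ** matrix_inv M) = L_coord (blk_diag M ** X ** matrix_inv (blk_diag M))"
    "R_coord (M ** X ** matrix_inv M) = R_coord (blk_diag M ** X ** matrix_inv (blk_diag M))"
  using conj_coords(2,3)[OF M X] conj_coords(2,3)[OF blk_diag_inverse(3)[OF M] X]
  by (simp_all add: vec_eq_iff blk_diag_inverse(2)[OF M] blk_diag_entry)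

text \<open>The element of \<open>G\<^sub>0\<close> that acts by \<open>-1\<close> on the odd and by \<open>1\<close> on the even part of the grading.\<close>

definition sym_mat :: "'n::finite matr" where
  "sym_mat = (\<chi> i j. if i = j then (if blk i = 1 then -1 else 1) else 0)"

lemma sym_mat_mult_entry:
  "(sym_mat ** A) $ i $ j = (if blk i = 1 then - A $ i $ j else A $ i $ j)"
  "(A ** sym_mat) $ i $ j = (if blk j = 1 then - A $ i $ j else A $ i $ j)"
  by (auto simp: matrix_matrix_mult_def sym_mat_def if_distrib[of "\<lambda>x. x * _"] if_distrib[of "\<lambda>x. _ * x"] cong: if_cong)

lemma sym_mat_square: "sym_mat ** sym_mat = mat 1"
  by (auto simp: matr_eq_iff sym_mat_mult_entry) (auto simp: sym_mat_def mat_one_entry)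

lemma sym_mat_diag: "(sym_mat :: 'n::finite matr) \<in> diag_mats" "(sym_mat :: 'n matr) \<in> upper_mats"
  using matrix_inv_eqI(1)[OF sym_mat_square] by (auto simp: diag_mats_def upper_mats_def sym_mat_def split: if_splits)

lemma sym_mat_conj_grade:
  "X \<in> grade 1 \<Longrightarrow> sym_mat ** X = - (X ** sym_mat)" "X \<in> grade 2 \<Longrightarrow> sym_mat ** X = X ** sym_mat"
  by (auto simp: matr_eq_iff all_idx in_grade_1 in_grade_2 sym_mat_mult_entry)

text \<open>On \<open>\<gg>\<^sub>-\<^sub>1\<^sup>L\<close> the action is multiplication by the middle block divided by the first diagonal entry, and on
\<open>\<gg>\<^sub>-\<^sub>1\<^sup>R\<close> it is given by the last entry and the inverse of the middle block.  If both are \<open>-id\<close>, the middle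
block is scalar and the three blocks are determined up to a common factor.\<close>

lemma minus_id_blk_diag:
  assumes M: "M \<in> upper_mats" and neg: "\<And>a b. L_coord (M ** minus_one a b ** matrix_inv M) = - a \<and> R_coord (M ** minus_one a b ** matrix_inv M) = - b"
  shows "blk_diag M = (M $ First $ First) *\<^sub>R sym_mat"
proof -
  have i: "invertible M" using M by (simp add: upper_mats_def)
  let ?C = "matrix_inv M"
  have C: "?C \<in> upper_mats" by (rule upper_inv[OF M])
  have F: "M $ First $ First * ?C $ First $ First = 1"
    using arg_cong[OF matrix_inv_works(1)[OF i], of "\<lambda>A. A $ First $ First"] C by (simp add: matr_mult_entry mat_one_entry in_upper)
  have F0: "M $ First $ First \<noteq> 0" "?C $ First $ First \<noteq> 0" using F by auto
  have L0: "M $ Last $ Last \<noteq> 0" by (rule upper_diag_nonzero(2)[OF M])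
  have mid: "M $ Mid k $ Mid m = (if k = m then - M $ First $ First else 0)" for k m
  proof -
    have "- (axis m 1 :: real ^ 'a) $ k = L_coord (M ** minus_one (axis m 1) 0 ** ?C) $ k" using neg[of "axis m 1" 0] by simp
    also have "\<dots> = ?C $ First $ First * M $ Mid k $ Mid m"
      unfolding conj_coords(2)[OF M minus_one_grade(5)] by (simp add: axis_def if_distrib[of "\<lambda>x. _ * x"] cong: if_cong)
    finally have "?C $ First $ First * M $ Mid k $ Mid m = - (axis m 1 :: real ^ 'a) $ k" by simp
    then have "M $ First $ First * (?C $ First $ First * M $ Mid k $ Mid m) = - M $ First $ First * (axis m 1 :: real ^ 'a) $ k" by simp
    then show ?thesis using F by (simp add: mult.assoc[symmetric] axis_def)
  qed
  have midC: "M $ Last $ Last * ?C $ Mid m $ Mid k = (if k = m then - 1 else 0)" for k m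
  proof -
    have "- (axis m 1 :: real ^ 'a) $ k = R_coord (M ** minus_one 0 (axis m 1) ** ?C) $ k" using neg[of 0 "axis m 1"] by simp
    also have "\<dots> = M $ Last $ Last * ?C $ Mid m $ Mid k"
      unfolding conj_coords(3)[OF M minus_one_grade(5)] by (simp add: axis_def if_distrib[of "\<lambda>x. x * _"] cong: if_cong)
    finally show ?thesis by (auto simp: axis_def)
  qed
  \<comment> \<open>any index of the middle block; there is one because \<open>n \<ge> 1\<close>\<close>
  define k where "k = (undefined :: 'a)"
  have "1 = (M ** ?C) $ Mid k $ Mid k" using matrix_inv_works(1)[OF i] by (simp add: mat_one_entry)
  also have "\<dots> = - M $ First $ First * ?C $ Mid k $ Mid k"
    using M C by (simp add: matr_mult_entry in_upper mid if_distrib[of "\<lambda>x. x * _"] cong: if_cong)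
  finally have "M $ Last $ Last = M $ Last $ Last * (- M $ First $ First * ?C $ Mid k $ Mid k)" by simp
  also have "\<dots> = - M $ First $ First * (M $ Last $ Last * ?C $ Mid k $ Mid k)" by (simp only: mult_ac)
  finally have "M $ Last $ Last = M $ First $ First" by (simp add: midC)
  then show ?thesis by (simp add: matr_eq_iff all_idx blk_diag_entry sym_mat_def mid)
qed

context parabolic begin

section \<open>Frames of the contact distribution\<close>

abbreviation "F \<equiv> frame_vec \<G>"

lemma local_triv:
  obtains U s \<tau> where "open U" "x \<in> U" "smooth_map BA TA U s" "\<forall>y\<in>U. proj \<G> (s y) = y"
    "\<forall>u\<in>proj \<G> -` U. \<tau> u \<in> upper_mats \<and> R (s (proj \<G> u)) (\<tau> u) = u"
proof -
  have "\<forall>x. \<exists>U s \<tau>. open U \<and> x \<in> U \<and> smooth_map BA TA U s \<and> (\<forall>y\<in>U. proj \<G> (s y) = y) \<and>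
        smooth_map TA euclid_atlas (proj \<G> -` U) \<tau> \<and>
        (\<forall>u\<in>proj \<G> -` U. \<tau> u \<in> upper_mats \<and> ract \<G> (s (proj \<G> u)) (cls (\<tau> u)) = u) \<and>
        (\<forall>y\<in>U. \<forall>a\<in>P_grp. cls (\<tau> (ract \<G> (s y) a)) = a)"
    using parabolic unfolding parabolic_geometry_def principal_bundle_def by (elim conjE)
  then obtain U s \<tau> where "open U \<and> x \<in> U \<and> smooth_map BA TA U s \<and> (\<forall>y\<in>U. proj \<G> (s y) = y) \<and>
        smooth_map TA euclid_atlas (proj \<G> -` U) \<tau> \<and>
        (\<forall>u\<in>proj \<G> -` U. \<tau> u \<in> upper_mats \<and> ract \<G> (s (proj \<G> u)) (cls (\<tau> u)) = u) \<and>
        (\<forall>y\<in>U. \<forall>a\<in>P_grp. cls (\<tau> (ract \<G> (s y) a)) = a)"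
    by (elim allE[of _ x] exE)
  then show ?thesis using that[of U s \<tau>] by (elim conjE)
qed

lemma R_inv: "M \<in> upper_mats \<Longrightarrow> R (R u M) (matrix_inv M) = u"
  using R_mult[of M "matrix_inv M" u] upper_inv[of M] matrix_inv_works(1)[of M] R_one
  by (simp add: upper_mats_def)

lemma fiber_transitive:
  assumes "proj \<G> v = proj \<G> u" obtains M where "M \<in> upper_mats" "v = R u M"
proof -
  obtain U s \<tau> where U: "open U" "proj \<G> u \<in> U" "smooth_map BA TA U s" "\<forall>y\<in>U. proj \<G> (s y) = y"
    "\<forall>u\<in>proj \<G> -` U. \<tau> u \<in> upper_mats \<and> R (s (proj \<G> u)) (\<tau> u) = u"
    by (rule local_triv[of "proj \<G> u"]) (rule that)
  let ?o = "s (proj \<G> u)"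
  have "u \<in> proj \<G> -` U" "v \<in> proj \<G> -` U" using U(2) assms by simp_all
  from bspec[OF U(5) this(1)] bspec[OF U(5) this(2)]
  have u: "\<tau> u \<in> upper_mats" "R ?o (\<tau> u) = u" and v: "\<tau> v \<in> upper_mats" "R ?o (\<tau> v) = v"
    by (simp_all add: assms)
  have "R u (matrix_inv (\<tau> u)) = ?o" using R_inv[OF u(1), of ?o] u(2) by simp
  then have "R u (matrix_inv (\<tau> u) ** \<tau> v) = v"
    using R_mult[OF upper_inv[OF u(1)] v(1), of u] v(2) by simp
  then show ?thesis using that[OF upper_mult[OF upper_inv[OF u(1)] v(1)]] by simp
qed

lemma F_linear:
  assumes "X \<in> sl" "Y \<in> sl"
  shows "F u (X + Y) = F u X + F u Y" "F u (r *\<^sub>R X) = r *\<^sub>R F u X"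
  using mderiv_linear[OF proj_mderiv, of u] assms
  by (simp_all add: frame_vec_def conn_inv_linear linear_add linear_scale)

lemma F_par:
  assumes X: "X \<in> filt 0" shows "F u X = 0"
proof -
  let ?m = "\<lambda>t. mat_exp (t *\<^sub>R X)"
  have m0: "?m 0 = mat 1" by (simp add: mat_exp_zero)
  have pm: "mderiv TA BA (proj \<G>) (R u (?m 0)) (tangent_map TA BA (proj \<G>) u)"
    unfolding m0 R_one by (rule proj_mderiv)
  note E = smooth_atlas_euclid
  have "mderiv euclid_atlas BA (\<lambda>t. proj \<G> (R u (?m t))) 0 (\<lambda>r. tangent_map TA BA (proj \<G>) u (r *\<^sub>R conn_inv \<G> u X))"
    by (rule mderiv_compose[OF E TA fundamental_velocity[OF X m0 mat_exp_derivative mat_exp_upper[OF X]] pm])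
  moreover have "\<forall>\<^sub>F t in nhds 0. proj \<G> (R u (?m t)) = proj \<G> u"
    using mat_exp_upper[OF X] by eventually_elim (rule proj_R)
  ultimately have "mderiv euclid_atlas BA (\<lambda>t. proj \<G> u) 0 (\<lambda>r. tangent_map TA BA (proj \<G>) u (r *\<^sub>R conn_inv \<G> u X))"
    by (rule mderiv_transform[OF _ _ E])
  from fun_cong[OF mderiv_unique[OF this mderiv_const], of 1] show ?thesis by (simp add: frame_vec_def)
qed

text \<open>The derivative of \<open>proj\<close> does not notice the right action, so a change of the frame is compensated by
conjugation.\<close>

lemma F_R:
  assumes M: "M \<in> upper_mats" and X: "X \<in> sl"
  shows "F (R u M) X = F u (M ** X ** matrix_inv M)"
proof -
  have i: "invertible M" using M by (simp add: upper_mats_def)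
  have s: "M ** X ** matrix_inv M \<in> sl" by (rule conj_sl[OF i X])
  have e: "matrix_inv M ** (M ** X ** matrix_inv M) ** M = X"
    using matrix_inv_works[OF i] by (simp add: matrix_mul_assoc) (simp add: matrix_mul_assoc[symmetric])
  have "mderiv TA BA (\<lambda>v. proj \<G> (R v M)) u (\<lambda>\<xi>. tangent_map TA BA (proj \<G>) (R u M) (tangent_map TA TA (\<lambda>v. R v M) u \<xi>))"
    by (rule mderiv_compose[OF TA TA R_mderiv[OF M] proj_mderiv])
  then have "mderiv TA BA (proj \<G>) u (\<lambda>\<xi>. tangent_map TA BA (proj \<G>) (R u M) (tangent_map TA TA (\<lambda>v. R v M) u \<xi>))"
    by (simp add: proj_R[OF M])
  from fun_cong[OF mderiv_unique[OF this proj_mderiv], of "conn_inv \<G> u (M ** X ** matrix_inv M)"]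
  show ?thesis unfolding conn_inv_R[OF M s] e by (simp add: frame_vec_def)
qed

text \<open>The projection has local sections, hence its derivative is surjective at the points of a section.  The right
action transports this to the whole fibre.\<close>

lemma F_surj: obtains X where "X \<in> sl" "F u X = \<xi>"
proof -
  obtain U s \<tau> where U: "open U" "proj \<G> u \<in> U" "smooth_map BA TA U s" "\<forall>y\<in>U. proj \<G> (s y) = y"
    "\<forall>u\<in>proj \<G> -` U. \<tau> u \<in> upper_mats \<and> R (s (proj \<G> u)) (\<tau> u) = u"
    by (rule local_triv[of "proj \<G> u"]) (rule that)
  let ?x = "proj \<G> u" and ?o = "s (proj \<G> u)"
  have "mderiv BA BA (\<lambda>y. proj \<G> (s y)) ?x (\<lambda>v. tangent_map TA BA (proj \<G>) ?o (tangent_map BA TA s ?x v))"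
    by (rule mderiv_compose[OF BA TA smooth_map_mderiv[OF BA TA U(3,1,2)] proj_mderiv])
  moreover have "\<forall>\<^sub>F y in nhds ?x. proj \<G> (s y) = y"
    using eventually_nhds_in_open[OF U(1,2)] by eventually_elim (use U(4) in simp)
  ultimately have "mderiv BA BA (\<lambda>y. y) ?x (\<lambda>v. tangent_map TA BA (proj \<G>) ?o (tangent_map BA TA s ?x v))"
    by (rule mderiv_transform[OF _ _ BA])
  from fun_cong[OF mderiv_unique[OF this mderiv_id[OF BA]], of \<xi>]
  have 1: "F ?o (conn \<G> ?o (tangent_map BA TA s ?x \<xi>)) = \<xi>" by (simp add: frame_vec_def conn_inv_conn)
  obtain M where M: "M \<in> upper_mats" "?o = R u M"
    using fiber_transitive[of ?o u] U(2,4) by auto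
  have i: "invertible M" using M by (simp add: upper_mats_def)
  show ?thesis
  proof (rule that)
    show "M ** conn \<G> ?o (tangent_map BA TA s ?x \<xi>) ** matrix_inv M \<in> sl" by (rule conj_sl[OF i conn_sl])
    show "F u (M ** conn \<G> ?o (tangent_map BA TA s ?x \<xi>) ** matrix_inv M) = \<xi>"
      using F_R[OF M(1) conn_sl, of u ?o "tangent_map BA TA s ?x \<xi>"] 1 M(2) by simp
  qed
qed

lemma F_minus_one:
  assumes X: "X \<in> filt (-1)" shows "F u X = F u (minus_one (L_coord X) (R_coord X))"
proof -
  have "X $ Last $ First = 0" using X by (simp add: in_filt_m1)
  then have d: "X - minus_one (L_coord X) (R_coord X) \<in> filt 0" using filt_m1_decomp[OF grade_m1_sl(3)[OF X]] by simp
  have "F u (minus_one (L_coord X) (R_coord X) + (X - minus_one (L_coord X) (R_coord X))) = F u (minus_one (L_coord X) (R_coord X))"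
    unfolding F_linear(1)[OF minus_one_grade(4) filt0_sl(1)[OF d]] F_par[OF d] by simp
  then show ?thesis by simp
qed

lemma F_minus_one_linear:
  "F u (minus_one a b) + F u (minus_one a' b') = F u (minus_one (a + a') (b + b'))" "F u (minus_one a b) - F u (minus_one a' b') = F u (minus_one (a - a') (b - b'))"
  "- F u (minus_one a b) = F u (minus_one (- a) (- b))" "r *\<^sub>R F u (minus_one a b) = F u (minus_one (r *\<^sub>R a) (r *\<^sub>R b))" "F u (minus_one 0 0) = 0"
proof -
  show 1: "F u (minus_one a b) + F u (minus_one a' b') = F u (minus_one (a + a') (b + b'))" for a b a' b'
    by (simp add: minus_one_linear(1) F_linear(1) minus_one_grade)
  show 2: "r *\<^sub>R F u (minus_one a b) = F u (minus_one (r *\<^sub>R a) (r *\<^sub>R b))" for r a b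
    using F_linear(2)[OF minus_one_grade(4) minus_one_grade(4)] by (simp add: minus_one_linear(3))
  show 3: "- F u (minus_one a b) = F u (minus_one (- a) (- b))" for a b
    using 2[of "-1" a b] by simp
  show "F u (minus_one a b) - F u (minus_one a' b') = F u (minus_one (a - a') (b - b'))"
    using 1[of a b "- a'" "- b'"] unfolding 3[symmetric] by simp
  show "F u (minus_one 0 0) = 0" using 2[of 0 0 0] by simp
qed

text \<open>The distributions are defined by all frames over a point.  One frame suffices, because the action of \<open>P\<close>
on \<open>\<gg>\<^sup>-\<^sup>1 / \<pp>\<close> preserves both components.\<close>

lemma distributions:
  shows "contact_distr \<G> (proj \<G> u) = {F u (minus_one a b) | a b. True}"
    and "distr_L \<G> (proj \<G> u) = {F u (minus_one a 0) | a. True}"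
    and "distr_R \<G> (proj \<G> u) = {F u (minus_one 0 b) | b. True}"
proof -
  have tr: "\<exists>M\<in>upper_mats. F v X = F u (minus_one (L_coord (M ** X ** matrix_inv M)) (R_coord (M ** X ** matrix_inv M)))"
    if v: "proj \<G> v = proj \<G> u" and X: "X \<in> filt (-1)" for v X
  proof -
    obtain M where M: "M \<in> upper_mats" "v = R u M" using fiber_transitive[OF v] .
    show ?thesis
      using F_R[OF M(1) grade_m1_sl(3)[OF X], of u] F_minus_one[OF conj_coords(1)[OF M(1) X]] M by auto
  qed
  show "contact_distr \<G> (proj \<G> u) = {F u (minus_one a b) | a b. True}"
    unfolding contact_distr_def using tr minus_one_grade(5) by blast
  have L: "R_coord (M ** X ** matrix_inv M) = 0" if "M \<in> upper_mats" "X \<in> grade_m1_L" for M X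
  proof -
    have "R_coord X = 0" using grade_m1_LR(1)[OF that(2)] by (metis R_coord_minus_one)
    then show ?thesis by (simp add: vec_eq_iff conj_coords(3)[OF that(1) grade_m1_sl(1)[OF that(2)]])
  qed
  have R: "L_coord (M ** X ** matrix_inv M) = 0" if "M \<in> upper_mats" "X \<in> grade_m1_R" for M X
  proof -
    have "L_coord X = 0" using grade_m1_LR(2)[OF that(2)] by (metis L_coord_minus_one)
    then show ?thesis by (simp add: vec_eq_iff conj_coords(2)[OF that(1) grade_m1_sl(2)[OF that(2)]])
  qed
  show "distr_L \<G> (proj \<G> u) = {F u (minus_one a 0) | a. True}"
  proof
    show "distr_L \<G> (proj \<G> u) \<subseteq> {F u (minus_one a 0) | a. True}"
    proof
      fix \<xi> assume "\<xi> \<in> distr_L \<G> (proj \<G> u)"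
      then obtain v X where v: "proj \<G> v = proj \<G> u" "X \<in> grade_m1_L" "\<xi> = F v X" by (auto simp: distr_L_def)
      obtain M where "M \<in> upper_mats" "F v X = F u (minus_one (L_coord (M ** X ** matrix_inv M)) (R_coord (M ** X ** matrix_inv M)))"
        using tr[OF v(1) grade_m1_sl(1)[OF v(2)]] by blast
      then show "\<xi> \<in> {F u (minus_one a 0) | a. True}" using L[OF _ v(2)] v(3) by auto
    qed
    show "{F u (minus_one a 0) | a. True} \<subseteq> distr_L \<G> (proj \<G> u)"
      unfolding distr_L_def using minus_one_grade(2) by blast
  qed
  show "distr_R \<G> (proj \<G> u) = {F u (minus_one 0 b) | b. True}"
  proof
    show "distr_R \<G> (proj \<G> u) \<subseteq> {F u (minus_one 0 b) | b. True}"
    proof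
      fix \<xi> assume "\<xi> \<in> distr_R \<G> (proj \<G> u)"
      then obtain v X where v: "proj \<G> v = proj \<G> u" "X \<in> grade_m1_R" "\<xi> = F v X" by (auto simp: distr_R_def)
      obtain M where "M \<in> upper_mats" "F v X = F u (minus_one (L_coord (M ** X ** matrix_inv M)) (R_coord (M ** X ** matrix_inv M)))"
        using tr[OF v(1) grade_m1_sl(2)[OF v(2)]] by blast
      then show "\<xi> \<in> {F u (minus_one 0 b) | b. True}" using R[OF _ v(2)] v(3) by auto
    qed
    show "{F u (minus_one 0 b) | b. True} \<subseteq> distr_R \<G> (proj \<G> u)"
      unfolding distr_R_def using minus_one_grade(3) by blast
  qed
qed

section \<open>Orbits of the unipotent radical\<close>

lemma orbit_plus_eq: "orbit_plus \<G> u = (\<lambda>N. R u (mat 1 + N)) ` filt 1"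
  unfolding orbit_plus_def Pplus_unipotent by blast

text \<open>\<open>P\<^sub>+\<close> is normal in \<open>P\<close>, so \<open>P\<close> acts on \<open>\<G>\<^sub>0\<close> through the projection onto \<open>G\<^sub>0\<close>.\<close>

lemma orbit_plus_R:
  assumes D: "D \<in> upper_mats" and N: "N \<in> filt 1"
  shows "orbit_plus \<G> (R u (D ** (mat 1 + N))) = ract0 \<G> (orbit_plus \<G> u) (cls D)"
proof -
  have i: "D ** matrix_inv D = mat 1" "matrix_inv D ** D = mat 1" using D matrix_inv_works by (auto simp: upper_mats_def)
  note Di = upper_inv[OF D]
  note U = unipotent_upper
  have l: "orbit_plus \<G> (R u (D ** (mat 1 + N))) = (\<lambda>N'. R u (D ** (mat 1 + N) ** (mat 1 + N'))) ` filt 1"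
    unfolding orbit_plus_eq by (intro image_cong refl R_mult upper_mult D U N)
  have r: "ract0 \<G> (orbit_plus \<G> u) (cls D) = (\<lambda>N'. R u ((mat 1 + N') ** D)) ` filt 1"
    unfolding orbit_plus_eq ract0_def image_image by (intro image_cong refl R_mult D U)
  have "\<exists>N''\<in>filt 1. D ** (mat 1 + N) ** (mat 1 + N') = (mat 1 + N'') ** D" if N': "N' \<in> filt 1" for N'
  proof
    let ?K = "N + N' + N ** N'"
    show "D ** ?K ** matrix_inv D \<in> filt 1" by (intro filt1_upper_mult D Di unipotent_mult(2) N N')
    have "D ** (mat 1 + N) ** (mat 1 + N') = D ** (mat 1 + ?K)"
      using unipotent_mult(1)[OF N N'] by (simp only: matrix_mul_assoc[symmetric])
    also have "\<dots> = D + D ** ?K ** (matrix_inv D ** D)" by (simp add: i mm.add_right)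
    also have "\<dots> = (mat 1 + D ** ?K ** matrix_inv D) ** D" by (simp only: mm.add_left matrix_mul_assoc matrix_mul_lid)
    finally show "D ** (mat 1 + N) ** (mat 1 + N') = (mat 1 + D ** ?K ** matrix_inv D) ** D" .
  qed
  moreover have "\<exists>N'\<in>filt 1. (mat 1 + N'') ** D = D ** (mat 1 + N) ** (mat 1 + N')" if N'': "N'' \<in> filt 1" for N''
  proof -
    obtain Ni where Ni: "Ni \<in> filt 1" "matrix_inv (mat 1 + N) = mat 1 + Ni" using unipotent_inverse[OF N] .
    have iN: "(mat 1 + N) ** (mat 1 + Ni) = mat 1"
      using matrix_inv_works(1)[of "mat 1 + N"] unipotent_upper[OF N] Ni(2) by (simp add: upper_mats_def)
    define L where "L = matrix_inv D ** N'' ** D"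
    have L: "L \<in> filt 1" unfolding L_def by (intro filt1_upper_mult D Di N'')
    have DL: "D ** L = N'' ** D" by (simp add: L_def matrix_mul_assoc i)
    have "D ** (mat 1 + N) ** (mat 1 + (Ni + L + Ni ** L)) = D ** (mat 1 + N) ** ((mat 1 + Ni) ** (mat 1 + L))"
      by (simp only: unipotent_mult(1)[OF Ni(1) L])
    also have "\<dots> = D ** ((mat 1 + N) ** (mat 1 + Ni)) ** (mat 1 + L)" by (simp only: matrix_mul_assoc)
    also have "\<dots> = D ** (mat 1 + L)" by (simp only: iN matrix_mul_rid)
    also have "\<dots> = D + D ** L" by (simp add: mm.add_right)
    also have "\<dots> = (mat 1 + N'') ** D" by (simp add: DL mm.add_left)
    finally show ?thesis using unipotent_mult(2)[OF Ni(1) L] by metis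
  qed
  ultimately show ?thesis unfolding l r by (fastforce simp: image_iff)
qed

end

section \<open>The matrices of two composed symmetries\<close>

lemma mat_exp_scaled_mult:
  assumes Z: "Z \<in> filt 1" shows "mat_exp (s *\<^sub>R Z) ** mat_exp (t *\<^sub>R Z) = mat_exp ((s + t) *\<^sub>R Z)"
proof -
  have e: "mat_exp (r *\<^sub>R Z) = mat 1 + r *\<^sub>R Z + (r\<^sup>2 / 2) *\<^sub>R (Z ** Z)" for r
    by (simp add: mat_exp_nilpotent[OF filt1_linear(5)[OF Z]] mm.scaleR_left mm.scaleR_right power2_eq_square)
  show ?thesis unfolding e by (rule nilpotent_exp_mult[OF Z])
qed

lemma mat_exp_minus:
  assumes Z: "Z \<in> filt 1" shows "mat_exp Z ** mat_exp (- Z) = mat 1"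
  using mat_exp_scaled_mult[OF Z, of 1 "-1"] by (simp add: mat_exp_zero)

lemma sym_mat_mat_exp:
  assumes "\<Upsilon> \<in> grade 1" shows "sym_mat ** mat_exp (- \<Upsilon>) = mat_exp \<Upsilon> ** sym_mat"
proof -
  note f = grade_filt1(1)[OF assms]
  have s: "sym_mat ** \<Upsilon> = - (\<Upsilon> ** sym_mat)" by (rule sym_mat_conj_grade(1)[OF assms])
  have "sym_mat ** (\<Upsilon> ** \<Upsilon>) = sym_mat ** \<Upsilon> ** \<Upsilon>" by (simp only: matrix_mul_assoc)
  also have "\<dots> = - (\<Upsilon> ** sym_mat) ** \<Upsilon>" by (simp only: s)
  also have "\<dots> = - (\<Upsilon> ** (sym_mat ** \<Upsilon>))" by (simp only: mm.minus_left matrix_mul_assoc)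
  also have "\<dots> = \<Upsilon> ** \<Upsilon> ** sym_mat" by (simp add: s mm.minus_right matrix_mul_assoc)
  finally have ss: "sym_mat ** (\<Upsilon> ** \<Upsilon>) = \<Upsilon> ** \<Upsilon> ** sym_mat" .
  show ?thesis
    unfolding mat_exp_nilpotent[OF f] mat_exp_nilpotent[OF filt1_linear(4)[OF f]]
    by (simp add: mm.add_left mm.add_right mm.minus_left mm.minus_right mm.diff_right mm.scaleR_left mm.scaleR_right s ss)
qed

lemma sym_mat_mat_exp2:
  assumes "\<Upsilon> \<in> grade 2" shows "sym_mat ** mat_exp (- \<Upsilon>) = mat_exp (- \<Upsilon>) ** sym_mat"
proof -
  note f = grade_filt1(2)[OF assms]
  have s: "sym_mat ** \<Upsilon> = \<Upsilon> ** sym_mat" by (rule sym_mat_conj_grade(2)[OF assms])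
  have ss: "sym_mat ** (\<Upsilon> ** \<Upsilon>) = \<Upsilon> ** \<Upsilon> ** sym_mat"
    by (simp add: matrix_mul_assoc s) (simp add: matrix_mul_assoc[symmetric] s)
  show ?thesis
    unfolding mat_exp_nilpotent[OF filt1_linear(4)[OF f]]
    by (simp add: mm.add_left mm.add_right mm.minus_left mm.minus_right mm.diff_left mm.diff_right mm.scaleR_left mm.scaleR_right s ss)
qed

text \<open>In the second invariant frame \<open>w B\<close> with \<open>B = exp \<Upsilon>\<^sub>1 exp \<Upsilon>\<^sub>2\<close> the second symmetry is right multiplication
by \<open>D\<close>, hence \<open>B D B\<^sup>-\<^sup>1\<close> describes it in the frame \<open>w\<close>, and the first one contributes the
factor \<open>D\<close>.  Moving \<open>D\<close> through \<open>B\<^sup>-\<^sup>1\<close> inverts \<open>exp(- \<Upsilon>\<^sub>1)\<close> but not \<open>exp(- \<Upsilon>\<^sub>2)\<close>.  So the contributions of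
\<open>\<Upsilon>\<^sub>2\<close> cancel and those of \<open>\<Upsilon>\<^sub>1\<close> add up.\<close>

lemma symmetry_product:
  assumes 1: "\<Upsilon>\<^sub>1 \<in> grade 1" and 2: "\<Upsilon>\<^sub>2 \<in> grade 2"
  shows "mat_exp \<Upsilon>\<^sub>1 ** mat_exp \<Upsilon>\<^sub>2 ** sym_mat ** (mat_exp (- \<Upsilon>\<^sub>2) ** mat_exp (- \<Upsilon>\<^sub>1) ** sym_mat) = mat_exp (2 *\<^sub>R \<Upsilon>\<^sub>1)"
proof -
  have "sym_mat ** (mat_exp (- \<Upsilon>\<^sub>2) ** mat_exp (- \<Upsilon>\<^sub>1) ** sym_mat) = mat_exp (- \<Upsilon>\<^sub>2) ** (sym_mat ** mat_exp (- \<Upsilon>\<^sub>1)) ** sym_mat"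
    by (simp only: matrix_mul_assoc sym_mat_mat_exp2[OF 2])
  also have "\<dots> = mat_exp (- \<Upsilon>\<^sub>2) ** mat_exp \<Upsilon>\<^sub>1 ** (sym_mat ** sym_mat)"
    by (simp only: sym_mat_mat_exp[OF 1] matrix_mul_assoc)
  finally have a: "sym_mat ** (mat_exp (- \<Upsilon>\<^sub>2) ** mat_exp (- \<Upsilon>\<^sub>1) ** sym_mat) = mat_exp (- \<Upsilon>\<^sub>2) ** mat_exp \<Upsilon>\<^sub>1"
    by (simp add: sym_mat_square)
  have "mat_exp \<Upsilon>\<^sub>1 ** mat_exp \<Upsilon>\<^sub>2 ** sym_mat ** (mat_exp (- \<Upsilon>\<^sub>2) ** mat_exp (- \<Upsilon>\<^sub>1) ** sym_mat)
     = mat_exp \<Upsilon>\<^sub>1 ** mat_exp \<Upsilon>\<^sub>2 ** (mat_exp (- \<Upsilon>\<^sub>2) ** mat_exp \<Upsilon>\<^sub>1)"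
  proof -
    have "A ** sym_mat ** T = A ** (sym_mat ** T)" for A T :: "'a matr" by (simp only: matrix_mul_assoc)
    then show ?thesis by (simp only: a)
  qed
  also have "\<dots> = mat_exp \<Upsilon>\<^sub>1 ** (mat_exp \<Upsilon>\<^sub>2 ** mat_exp (- \<Upsilon>\<^sub>2)) ** mat_exp \<Upsilon>\<^sub>1"
    by (simp only: matrix_mul_assoc)
  also have "\<dots> = mat_exp (2 *\<^sub>R \<Upsilon>\<^sub>1)"
    using mat_exp_minus[OF grade_filt1(2)[OF 2]] mat_exp_scaled_mult[OF grade_filt1(1)[OF 1], of 1 1] by simp
  finally show ?thesis .
qed

text \<open>For \<open>X = minus_one q p\<close> and \<open>c = p \<bullet> q\<close> one has \<open>[\<Upsilon>, X] = c E\<close> and \<open>[E, \<Upsilon>] = \<Upsilon>\<close>.  So for \<open>c \<noteq> 0\<close> these three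
elements span a copy of \<open>sl(2)\<close>, and the exponential series of \<open>ad(2 \<Upsilon>)\<close> at \<open>X\<close> stops with
\<open>X + 2 c E - 2 c \<Upsilon>\<close>.\<close>

lemma conj_opposite:
  fixes \<Upsilon> :: "'n::finite matr"
  defines "p \<equiv> \<chi> i. \<Upsilon> $ First $ Mid i" and "q \<equiv> \<chi> i. \<Upsilon> $ Mid i $ Last"
  assumes g: "\<Upsilon> \<in> grade 1"
  shows "mat_exp (2 *\<^sub>R \<Upsilon>) ** minus_one q p ** matrix_inv (mat_exp (2 *\<^sub>R \<Upsilon>)) = minus_one q p + (2 * (p \<bullet> q)) *\<^sub>R (grading_elt - \<Upsilon>)"
proof -
  note f = grade_filt1(1)[OF g]
  define X W c where "X = minus_one q p" and "W = \<Upsilon> ** \<Upsilon>" and "c = p \<bullet> q"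
  have z: "\<Upsilon> $ First $ First = 0" "\<Upsilon> $ First $ Last = 0" "\<Upsilon> $ Last $ j = 0" "\<Upsilon> $ Mid k $ First = 0" "\<Upsilon> $ Mid k $ Mid l = 0" for j k l
    using g by (cases j; auto simp: in_grade_1)+
  have UX: "\<Upsilon> ** X = X ** \<Upsilon> + c *\<^sub>R grading_elt"
    by (auto simp: matr_eq_iff all_idx matr_mult_entry X_def c_def p_def q_def z grading_elt_def inner_vec_def mult.commute)
  have EU: "grading_elt ** \<Upsilon> = \<Upsilon> ** grading_elt + \<Upsilon>"
    by (auto simp: matr_eq_iff all_idx matr_mult_entry z grading_elt_def if_distrib[of "\<lambda>x. x * _"] if_distrib[of "\<lambda>x. _ * x"] cong: if_cong)
  have EW: "grading_elt ** W = W"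
    by (auto simp: matr_eq_iff all_idx matr_mult_entry W_def z grading_elt_def if_distrib[of "\<lambda>x. x * _"] cong: if_cong)
  have WU: "\<Upsilon> ** W = 0" using filt1_cube[OF f f f] by (simp add: W_def matrix_mul_assoc)
  have "W ** X = \<Upsilon> ** (\<Upsilon> ** X)" by (simp only: W_def matrix_mul_assoc)
  also have "\<dots> = \<Upsilon> ** X ** \<Upsilon> + c *\<^sub>R (\<Upsilon> ** grading_elt)" by (simp add: UX mm.add_right mm.scaleR_right matrix_mul_assoc)
  also have "\<dots> = X ** W + c *\<^sub>R (grading_elt ** \<Upsilon>) + c *\<^sub>R (\<Upsilon> ** grading_elt)" by (simp add: UX W_def mm.add_left mm.scaleR_left matrix_mul_assoc)
  finally have WX: "W ** X = X ** W + (2 * c) *\<^sub>R (\<Upsilon> ** grading_elt) + c *\<^sub>R \<Upsilon>"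
    by (simp add: EU scaleR_add_right matr_eq_iff)
  have C: "mat_exp (2 *\<^sub>R \<Upsilon>) = mat 1 + 2 *\<^sub>R \<Upsilon> + 2 *\<^sub>R W"
    by (simp add: mat_exp_nilpotent[OF filt1_linear(5)[OF f]] W_def mm.scaleR_left mm.scaleR_right)
  have inv: "invertible (mat_exp (2 *\<^sub>R \<Upsilon>))"
    using matrix_inv_eqI(1)[OF mat_exp_minus[OF filt1_linear(5)[OF f]]] .
  have "(mat 1 + 2 *\<^sub>R \<Upsilon> + 2 *\<^sub>R W) ** X = (X + (2 * c) *\<^sub>R (grading_elt - \<Upsilon>)) ** (mat 1 + 2 *\<^sub>R \<Upsilon> + 2 *\<^sub>R W)"
    by (simp add: mm.add_left mm.add_right mm.diff_left mm.scaleR_left mm.scaleR_right UX WX EW EU WU W_def[symmetric])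
       (simp add: matr_eq_iff algebra_simps)
  then show ?thesis unfolding conj_eq_iff[OF inv] unfolding C X_def c_def .
qed

lemma grading_elt_conj_unipotent:
  assumes N: "N \<in> filt 1"
  obtains Z where "Z \<in> filt 1" "matrix_inv (mat 1 + N) ** grading_elt ** (mat 1 + N) = grading_elt + Z"
proof
  have U: "mat 1 + N \<in> upper_mats" by (rule unipotent_upper[OF N])
  have i: "matrix_inv (mat 1 + N) ** (mat 1 + N) = mat 1" using matrix_inv_works(2)[of "mat 1 + N"] U by (simp add: upper_mats_def)
  have d: "grading_elt ** N - N ** grading_elt \<in> filt 1"
    using N by (auto simp: in_filt_1 all_idx matr_mult_entry grading_elt_def if_distrib[of "\<lambda>x. x * _"] if_distrib[of "\<lambda>x. _ * x"] cong: if_cong)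
  show "matrix_inv (mat 1 + N) ** (grading_elt ** N - N ** grading_elt) \<in> filt 1"
    by (rule filt1_upper_mult(1)[OF upper_inv[OF U] d])
  have "matrix_inv (mat 1 + N) ** grading_elt ** (mat 1 + N) = matrix_inv (mat 1 + N) ** ((mat 1 + N) ** grading_elt + (grading_elt ** N - N ** grading_elt))"
    by (simp add: matrix_mul_assoc[symmetric] mm.add_left mm.add_right mm.diff_right)
  also have "\<dots> = matrix_inv (mat 1 + N) ** (mat 1 + N) ** grading_elt + matrix_inv (mat 1 + N) ** (grading_elt ** N - N ** grading_elt)"
    by (simp only: mm.add_right[of "matrix_inv (mat 1 + N)"] matrix_mul_assoc)
  finally show "matrix_inv (mat 1 + N) ** grading_elt ** (mat 1 + N) = grading_elt + matrix_inv (mat 1 + N) ** (grading_elt ** N - N ** grading_elt)"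
    by (simp add: i)
qed

context parabolic begin

section \<open>The conformal class of metrics in a frame\<close>

lemma levi_F:
  assumes "regular_geometry \<G>"
  shows "levi \<G> (proj \<G> u) (F u (minus_one a b)) (F u (minus_one a' b')) =
    {(b \<bullet> a' - b' \<bullet> a) *\<^sub>R F u elem_m2 + \<tau> | \<tau>. \<tau> \<in> contact_distr \<G> (proj \<G> u)}"
  using assms minus_one_grade(1)[of a b] minus_one_grade(1)[of a' b'] F_linear(2)[OF elem_m2_sl elem_m2_sl]
  unfolding regular_geometry_def by (simp add: commutator_minus_one)

definition frame_inj :: "'p \<Rightarrow> bool" where
  "frame_inj u \<longleftrightarrow> (\<forall>a b. F u (minus_one a b) = 0 \<longrightarrow> a = 0 \<and> b = 0)"

text \<open>If the frame vector of the generator of \<open>\<gg>\<^sub>-\<^sub>2\<close> belonged to the contact distribution, \<open>\<theta>\<close> and with it every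
metric value would be zero.  Given this, a vector in the kernel of the frame has zero Levi bracket with
all others, and regularity identifies the Levi bracket with the non-degenerate bracket of \<open>\<gg>\<^sub>-\<^sub>1\<close>.\<close>

lemma frame_nondegenerate:
  assumes reg: "regular_geometry \<G>" and \<theta>: "transversal_identification \<G> (proj \<G> u) \<theta>"
    and ne: "contact_metric \<G> (proj \<G> u) \<theta> \<xi> \<eta> \<noteq> 0"
  shows "\<theta> (F u elem_m2) \<noteq> 0" "frame_inj u"
proof -
  note C = distributions(1)[of u]
  have lin: "linear \<theta>" and ker: "\<And>\<xi>. \<theta> \<xi> = 0 \<longleftrightarrow> \<xi> \<in> contact_distr \<G> (proj \<G> u)"
    using \<theta> by (auto simp: transversal_identification_def)
  have zero: "0 \<in> contact_distr \<G> (proj \<G> u)" using ker[of 0] linear_0[OF lin] by simp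
  show h: "\<theta> (F u elem_m2) \<noteq> 0"
  proof
    assume 0: "\<theta> (F u elem_m2) = 0"
    have all: "\<zeta> \<in> contact_distr \<G> (proj \<G> u)" for \<zeta>
    proof -
      obtain X where X: "X \<in> sl" "F u X = \<zeta>" by (rule F_surj)
      let ?Y = "minus_one (L_coord X) (R_coord X) + X $ Last $ First *\<^sub>R elem_m2"
      have d: "X - ?Y \<in> filt 0" by (rule filt_m1_decomp[OF X(1)])
      have s2: "X $ Last $ First *\<^sub>R elem_m2 \<in> sl" using sl_linear[OF elem_m2_sl elem_m2_sl, of "X $ Last $ First" 0] by simp
      have "F u (?Y + (X - ?Y)) = F u (minus_one (L_coord X) (R_coord X)) + X $ Last $ First *\<^sub>R F u elem_m2"
        unfolding F_linear(1)[OF sl_add[OF minus_one_grade(4) s2] filt0_sl(1)[OF d]] F_par[OF d] F_linear(1)[OF minus_one_grade(4) s2] F_linear(2)[OF elem_m2_sl elem_m2_sl] by simp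
      then have "\<theta> \<zeta> = \<theta> (F u (minus_one (L_coord X) (R_coord X)))"
        using X 0 by (simp add: linear_add[OF lin] linear_scale[OF lin])
      moreover have "\<theta> (F u (minus_one (L_coord X) (R_coord X))) = 0" unfolding ker C by blast
      ultimately show ?thesis using ker by simp
    qed
    obtain a b where 1: "\<xi> = F u (minus_one a b)" using all[of \<xi>] unfolding C by blast
    obtain a' b' where 2: "J_op \<G> (proj \<G> u) \<eta> = F u (minus_one a' b')" using all[of "J_op \<G> (proj \<G> u) \<eta>"] unfolding C by blast
    have "\<theta> ` levi \<G> (proj \<G> u) \<xi> (J_op \<G> (proj \<G> u) \<eta>) = {0}"
      unfolding 1 2 levi_F[OF reg] using all ker by auto
    then show False using ne by (simp add: contact_metric_def)
  qed
  show "frame_inj u" unfolding frame_inj_def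
  proof (intro allI impI)
    fix a b assume z: "F u (minus_one a b) = 0"
    have key: "b \<bullet> a' = b' \<bullet> a" for a' b'
    proof -
      have "levi \<G> (proj \<G> u) (F u (minus_one a b)) (F u (minus_one a' b')) = levi \<G> (proj \<G> u) (F u (minus_one 0 0)) (F u (minus_one a' b'))"
        using z F_minus_one_linear(5) by simp
      then have "{(b \<bullet> a' - b' \<bullet> a) *\<^sub>R F u elem_m2 + \<tau> | \<tau>. \<tau> \<in> contact_distr \<G> (proj \<G> u)} = {0 + \<tau> | \<tau>. \<tau> \<in> contact_distr \<G> (proj \<G> u)}"
        unfolding levi_F[OF reg] by simp
      then have "(b \<bullet> a' - b' \<bullet> a) *\<^sub>R F u elem_m2 + 0 \<in> contact_distr \<G> (proj \<G> u)" using zero by auto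
      then have "\<theta> ((b \<bullet> a' - b' \<bullet> a) *\<^sub>R F u elem_m2) = 0" using ker by simp
      then show ?thesis using h by (simp add: linear_scale[OF lin])
    qed
    show "a = 0 \<and> b = 0" using key[of b 0] key[of 0 a] by simp
  qed
qed

lemma F_minus_one_inj:
  assumes "frame_inj u" "F u (minus_one a b) = F u (minus_one a' b')"
  shows "a = a' \<and> b = b'"
proof -
  have "F u (minus_one (a - a') (b - b')) = 0" using assms(2) by (simp flip: F_minus_one_linear(2))
  then show ?thesis using assms(1) unfolding frame_inj_def by force
qed

lemma components_F:
  assumes inj: "frame_inj u"
  shows "comp_L \<G> (proj \<G> u) (F u (minus_one a b)) = F u (minus_one a 0)" "comp_R \<G> (proj \<G> u) (F u (minus_one a b)) = F u (minus_one 0 b)"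
    "J_op \<G> (proj \<G> u) (F u (minus_one a b)) = F u (minus_one a (- b))"
proof -
  note D = distributions[of u]
  show L: "comp_L \<G> (proj \<G> u) (F u (minus_one a b)) = F u (minus_one a 0)"
    unfolding comp_L_def D
  proof (rule the_equality)
    have "F u (minus_one a b) - F u (minus_one a 0) = F u (minus_one 0 b)" by (simp add: F_minus_one_linear(2))
    then show "F u (minus_one a 0) \<in> {F u (minus_one a 0) |a. True} \<and> F u (minus_one a b) - F u (minus_one a 0) \<in> {F u (minus_one 0 b) |b. True}" by blast
    fix l assume l: "l \<in> {F u (minus_one a 0) |a. True} \<and> F u (minus_one a b) - l \<in> {F u (minus_one 0 b) |b. True}"
    then obtain a' b' where "l = F u (minus_one a' 0)" "F u (minus_one a b) - l = F u (minus_one 0 b')" by blast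
    then show "l = F u (minus_one a 0)" using F_minus_one_inj[OF inj, of "a - a'" b 0 b'] by (simp add: F_minus_one_linear(2))
  qed
  show R: "comp_R \<G> (proj \<G> u) (F u (minus_one a b)) = F u (minus_one 0 b)"
    unfolding comp_R_def D
  proof (rule the_equality)
    have "F u (minus_one a b) - F u (minus_one 0 b) = F u (minus_one a 0)" by (simp add: F_minus_one_linear(2))
    then show "F u (minus_one 0 b) \<in> {F u (minus_one 0 b) |b. True} \<and> F u (minus_one a b) - F u (minus_one 0 b) \<in> {F u (minus_one a 0) |a. True}" by blast
    fix l assume l: "l \<in> {F u (minus_one 0 b) |b. True} \<and> F u (minus_one a b) - l \<in> {F u (minus_one a 0) |a. True}"
    then obtain a' b' where "l = F u (minus_one 0 b')" "F u (minus_one a b) - l = F u (minus_one a' 0)" by blast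
    then show "l = F u (minus_one 0 b)" using F_minus_one_inj[OF inj, of a "b - b'" a' 0] by (simp add: F_minus_one_linear(2))
  qed
  show "J_op \<G> (proj \<G> u) (F u (minus_one a b)) = F u (minus_one a (- b))"
    unfolding J_op_def L R by (simp add: F_minus_one_linear(2))
qed

lemma contact_metric_F:
  assumes reg: "regular_geometry \<G>" and \<theta>: "transversal_identification \<G> (proj \<G> u) \<theta>"
    and inj: "frame_inj u"
  shows "contact_metric \<G> (proj \<G> u) \<theta> (F u (minus_one a b)) (F u (minus_one a' b')) = (b \<bullet> a' + b' \<bullet> a) * \<theta> (F u elem_m2)"
proof -
  have lin: "linear \<theta>" and ker: "\<And>\<xi>. \<theta> \<xi> = 0 \<longleftrightarrow> \<xi> \<in> contact_distr \<G> (proj \<G> u)"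
    using \<theta> by (auto simp: transversal_identification_def)
  have zero: "0 \<in> contact_distr \<G> (proj \<G> u)" using ker[of 0] linear_0[OF lin] by simp
  let ?k = "b \<bullet> a' + b' \<bullet> a"
  have L: "levi \<G> (proj \<G> u) (F u (minus_one a b)) (J_op \<G> (proj \<G> u) (F u (minus_one a' b'))) = {?k *\<^sub>R F u elem_m2 + \<tau> | \<tau>. \<tau> \<in> contact_distr \<G> (proj \<G> u)}"
    unfolding components_F(3)[OF inj] levi_F[OF reg] by simp
  have "\<theta> (?k *\<^sub>R F u elem_m2 + \<tau>) = ?k * \<theta> (F u elem_m2)" if "\<tau> \<in> contact_distr \<G> (proj \<G> u)" for \<tau>
    using that ker[of \<tau>] by (simp add: linear_add[OF lin] linear_scale[OF lin])
  moreover from this[OF zero] have "?k * \<theta> (F u elem_m2) \<in> \<theta> ` {?k *\<^sub>R F u elem_m2 + \<tau> | \<tau>. \<tau> \<in> contact_distr \<G> (proj \<G> u)}"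
    using zero by (intro image_eqI[of _ _ "?k *\<^sub>R F u elem_m2 + 0"]) auto
  ultimately have "\<theta> ` {?k *\<^sub>R F u elem_m2 + \<tau> | \<tau>. \<tau> \<in> contact_distr \<G> (proj \<G> u)} = {?k * \<theta> (F u elem_m2)}"
    by auto
  then show ?thesis by (simp add: contact_metric_def L)
qed

text \<open>The definition of the covector uses all frames over the point.  They give the same value: the point of
\<open>\<G>\<^sub>0\<close> below \<open>u M\<close> depends only on \<open>u\<close> and the block diagonal part of \<open>M\<close>, and \<open>\<Upsilon>\<close> is equivariant under \<open>G\<^sub>0\<close> while the
trace form is invariant.\<close>

lemma covector_at_F:
  assumes inj: "frame_inj u" and \<Upsilon>: "G0_equivariant \<G> 1 \<Upsilon>"
  shows "covector_at \<G> (proj \<G> u) \<Upsilon> (F u (minus_one a b)) =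
    (\<chi> i. \<Upsilon> (orbit_plus \<G> u) $ First $ Mid i) \<bullet> a + (\<chi> i. \<Upsilon> (orbit_plus \<G> u) $ Mid i $ Last) \<bullet> b"
  unfolding covector_at_def
proof (rule the_equality)
  let ?Y = "\<Upsilon> (orbit_plus \<G> u)"
  have g: "?Y \<in> grade 1" using \<Upsilon> by (simp add: G0_equivariant_def bundle0_def)
  show "\<exists>v X. proj \<G> v = proj \<G> u \<and> X \<in> filt (-1) \<and> F v X = F u (minus_one a b) \<and>
     (\<chi> i. ?Y $ First $ Mid i) \<bullet> a + (\<chi> i. ?Y $ Mid i $ Last) \<bullet> b = pairing (\<Upsilon> (orbit_plus \<G> v)) X"
    by (rule exI[of _ u], rule exI[of _ "minus_one a b"]) (simp add: minus_one_grade(5) pairing_grade_1[OF g])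
  fix t assume "\<exists>v X. proj \<G> v = proj \<G> u \<and> X \<in> filt (-1) \<and> F v X = F u (minus_one a b) \<and> t = pairing (\<Upsilon> (orbit_plus \<G> v)) X"
  then obtain v X where v: "proj \<G> v = proj \<G> u" and X: "X \<in> filt (-1)" and e: "F v X = F u (minus_one a b)" and t: "t = pairing (\<Upsilon> (orbit_plus \<G> v)) X"
    by blast
  obtain M where M: "M \<in> upper_mats" "v = R u M" using fiber_transitive[OF v] .
  obtain N where N: "N \<in> filt 1" "M = blk_diag M ** (mat 1 + N)" using upper_decomp[OF M(1)] .
  let ?D = "blk_diag M"
  note D = blk_diag_inverse(3,4)[OF M(1)]
  have i: "invertible ?D" using D by (simp add: upper_mats_def)
  have "orbit_plus \<G> v = ract0 \<G> (orbit_plus \<G> u) (cls ?D)"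
    using orbit_plus_R[OF D(1) N(1), of u] N(2) M(2) by simp
  then have "\<Upsilon> (orbit_plus \<G> v) = Ad (m_inv PGL (cls ?D)) ?Y"
    using \<Upsilon> D(2) by (simp add: G0_equivariant_def bundle0_def G0_grp_def)
  also have "\<dots> = matrix_inv ?D ** ?Y ** ?D"
    using PGL_inv[OF i] Ad_cls[OF invertible_inverse(1)[OF i]] invertible_inverse(2)[OF i] by simp
  finally have "t = trace (matrix_inv ?D ** (?Y ** ?D ** X))"
    by (simp add: t pairing_def matrix_mul_assoc)
  also have "\<dots> = pairing ?Y (?D ** X ** matrix_inv ?D)"
    unfolding trace_mult_commute[of "matrix_inv ?D"] by (simp add: pairing_def matrix_mul_assoc)
  also have "\<dots> = (\<chi> i. ?Y $ First $ Mid i) \<bullet> L_coord (M ** X ** matrix_inv M) + (\<chi> i. ?Y $ Mid i $ Last) \<bullet> R_coord (M ** X ** matrix_inv M)"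
    unfolding pairing_grade_1[OF g] conj_coords_blk_diag[OF M(1) X] ..
  finally have t': "t = (\<chi> i. ?Y $ First $ Mid i) \<bullet> L_coord (M ** X ** matrix_inv M) + (\<chi> i. ?Y $ Mid i $ Last) \<bullet> R_coord (M ** X ** matrix_inv M)" .
  have "F u (minus_one (L_coord (M ** X ** matrix_inv M)) (R_coord (M ** X ** matrix_inv M))) = F u (minus_one a b)"
    using F_R[OF M(1) grade_m1_sl(3)[OF X], of u] F_minus_one[OF conj_coords(1)[OF M(1) X], of u] e M(2) by simp
  from F_minus_one_inj[OF inj this] show "t = (\<chi> i. ?Y $ First $ Mid i) \<bullet> a + (\<chi> i. ?Y $ Mid i $ Last) \<bullet> b"
    by (simp add: t')
qed

text \<open>In the frame the metric is \<open>(b \<bullet> a' + b' \<bullet> a) h\<close> with \<open>h = \<theta>(F u elem_m2)\<close>, so the row \<open>p\<close> and the column \<open>q\<close> of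
\<open>\<Upsilon>\<^sub>1\<close> correspond to the vector with components \<open>q / h\<close> in \<open>L\<close> and \<open>p / h\<close> in \<open>R\<close>.  These have
the product \<open>(p \<bullet> q) / h\<close>.\<close>

lemma metric_condition:
  assumes reg: "regular_geometry \<G>" and \<theta>: "transversal_identification \<G> (proj \<G> u) \<theta>" and \<Upsilon>: "G0_equivariant \<G> 1 \<Upsilon>"
    and v: "v = sharp \<G> (proj \<G> u) \<theta> (covector_at \<G> (proj \<G> u) \<Upsilon>)"
    and ne: "contact_metric \<G> (proj \<G> u) \<theta> (comp_R \<G> (proj \<G> u) v) (comp_L \<G> (proj \<G> u) v) \<noteq> 0"
  shows "(\<chi> i. \<Upsilon> (orbit_plus \<G> u) $ First $ Mid i) \<bullet> (\<chi> i. \<Upsilon> (orbit_plus \<G> u) $ Mid i $ Last) \<noteq> 0"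
proof -
  let ?p = "\<chi> i. \<Upsilon> (orbit_plus \<G> u) $ First $ Mid i" and ?q = "\<chi> i. \<Upsilon> (orbit_plus \<G> u) $ Mid i $ Last"
  define h where "h = \<theta> (F u elem_m2)"
  have h: "h \<noteq> 0" and inj: "frame_inj u"
    using frame_nondegenerate[OF reg \<theta> ne] by (auto simp: h_def)
  note metric = contact_metric_F[OF reg \<theta> inj, folded h_def] and C = distributions(1)[of u]
  let ?v = "F u (minus_one (?q /\<^sub>R h) (?p /\<^sub>R h))"
  have "sharp \<G> (proj \<G> u) \<theta> (covector_at \<G> (proj \<G> u) \<Upsilon>) = ?v"
    unfolding sharp_def
  proof (rule the_equality)
    show "?v \<in> contact_distr \<G> (proj \<G> u) \<and> (\<forall>\<xi>\<in>contact_distr \<G> (proj \<G> u). contact_metric \<G> (proj \<G> u) \<theta> ?v \<xi> = covector_at \<G> (proj \<G> u) \<Upsilon> \<xi>)"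
    proof (intro conjI ballI)
      show "?v \<in> contact_distr \<G> (proj \<G> u)" unfolding C by blast
      fix \<xi> assume "\<xi> \<in> contact_distr \<G> (proj \<G> u)"
      then obtain a b where "\<xi> = F u (minus_one a b)" unfolding C by blast
      then show "contact_metric \<G> (proj \<G> u) \<theta> ?v \<xi> = covector_at \<G> (proj \<G> u) \<Upsilon> \<xi>"
        using h by (simp add: metric covector_at_F[OF inj \<Upsilon>] inner_commute[of b] field_simps)
    qed
    fix w assume w: "w \<in> contact_distr \<G> (proj \<G> u) \<and> (\<forall>\<xi>\<in>contact_distr \<G> (proj \<G> u). contact_metric \<G> (proj \<G> u) \<theta> w \<xi> = covector_at \<G> (proj \<G> u) \<Upsilon> \<xi>)"
    then obtain a b where ab: "w = F u (minus_one a b)" unfolding C by blast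
    have m: "(b \<bullet> a' + b' \<bullet> a) * h = ?p \<bullet> a' + ?q \<bullet> b'" for a' b'
    proof -
      have "F u (minus_one a' b') \<in> contact_distr \<G> (proj \<G> u)" unfolding C by blast
      then have "contact_metric \<G> (proj \<G> u) \<theta> w (F u (minus_one a' b')) = covector_at \<G> (proj \<G> u) \<Upsilon> (F u (minus_one a' b'))" using w by blast
      then show ?thesis unfolding ab metric covector_at_F[OF inj \<Upsilon>] .
    qed
    have "(h *\<^sub>R b - ?p) \<bullet> a' = 0" for a' using m[of a' 0] by (simp add: inner_diff_left mult.commute)
    then have "h *\<^sub>R b - ?p = 0" using inner_eq_zero_iff by blast
    then have b: "b = ?p /\<^sub>R h" using h by (auto simp: eq_iff_diff_eq_0[symmetric] dest: sym)
    have "(h *\<^sub>R a - ?q) \<bullet> b' = 0" for b' using m[of 0 b'] by (simp add: inner_diff_left mult.commute inner_commute[of b'])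
    then have "h *\<^sub>R a - ?q = 0" using inner_eq_zero_iff by blast
    then have "a = ?q /\<^sub>R h" using h by (auto simp: eq_iff_diff_eq_0[symmetric] dest: sym)
    then show "w = ?v" using ab b by simp
  qed
  then have vv: "v = ?v" using v by simp
  show "?p \<bullet> ?q \<noteq> 0"
    using ne h unfolding vv components_F[OF inj] metric by simp
qed

section \<open>Two symmetries at one point\<close>

lemma symmetryD:
  assumes "symmetry_at \<G> x U s \<phi>"
  shows "open (proj \<G> -` U)" "smooth_map TA TA (proj \<G> -` U) \<phi>"
    "proj \<G> u = x \<Longrightarrow> u \<in> proj \<G> -` U" "proj \<G> u = x \<Longrightarrow> proj \<G> (\<phi> u) = x"
    "u \<in> proj \<G> -` U \<Longrightarrow> g \<in> P_grp \<Longrightarrow> \<phi> (ract \<G> u g) = ract \<G> (\<phi> u) g"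
    "u \<in> proj \<G> -` U \<Longrightarrow> conn \<G> (\<phi> u) (tangent_map TA TA \<phi> u \<xi>) = conn \<G> u \<xi>"
    "proj \<G> u = x \<Longrightarrow> F u (minus_one a b) \<in> contact_distr \<G> x \<Longrightarrow> F (\<phi> u) (minus_one a b) = - F u (minus_one a b)"
proof -
  have l: "local_diffeo BA U s" and xU: "x \<in> U" and sx: "s x = x"
    and T: "\<And>\<xi>. \<xi> \<in> contact_distr \<G> x \<Longrightarrow> tangent_map BA BA s x \<xi> = - \<xi>"
    and \<phi>: "smooth_map TA TA (proj \<G> -` U) \<phi>" "\<And>u. u \<in> proj \<G> -` U \<Longrightarrow> proj \<G> (\<phi> u) = s (proj \<G> u)"
      "\<And>u a. u \<in> proj \<G> -` U \<Longrightarrow> a \<in> P_grp \<Longrightarrow> \<phi> (ract \<G> u a) = ract \<G> (\<phi> u) a"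
      "\<And>u \<xi>. u \<in> proj \<G> -` U \<Longrightarrow> conn \<G> (\<phi> u) (tangent_map TA TA \<phi> u \<xi>) = conn \<G> u \<xi>"
    using assms by (simp_all add: symmetry_at_def local_automorphism_def)
  have U: "open U" "smooth_map BA BA U s" using l by (simp_all add: local_diffeo_def)
  have "continuous_on UNIV (proj \<G>)"
    using parabolic by (simp add: parabolic_geometry_def principal_bundle_def smooth_map_def)
  then show o: "open (proj \<G> -` U)" using U(1) by (simp add: continuous_on_open_vimage)
  show "smooth_map TA TA (proj \<G> -` U) \<phi>" by (rule \<phi>)
  show u: "proj \<G> u = x \<Longrightarrow> u \<in> proj \<G> -` U" for u using xU by simp
  then show pu: "proj \<G> u = x \<Longrightarrow> proj \<G> (\<phi> u) = x" for u using \<phi>(2) sx by simp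
  show "u \<in> proj \<G> -` U \<Longrightarrow> g \<in> P_grp \<Longrightarrow> \<phi> (ract \<G> u g) = ract \<G> (\<phi> u) g" by (rule \<phi>)
  show "u \<in> proj \<G> -` U \<Longrightarrow> conn \<G> (\<phi> u) (tangent_map TA TA \<phi> u \<xi>) = conn \<G> u \<xi>" by (rule \<phi>)
  assume x: "proj \<G> u = x" and c: "F u (minus_one a b) \<in> contact_distr \<G> x"
  have uU: "u \<in> proj \<G> -` U" by (rule u[OF x])
  have m1: "mderiv TA BA (\<lambda>v. proj \<G> (\<phi> v)) u (\<lambda>\<xi>. tangent_map TA BA (proj \<G>) (\<phi> u) (tangent_map TA TA \<phi> u \<xi>))"
    by (rule mderiv_compose[OF TA TA smooth_map_mderiv[OF TA TA \<phi>(1) o uU] proj_mderiv])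
  have ms: "mderiv BA BA s (proj \<G> u) (tangent_map BA BA s x)"
    using smooth_map_mderiv[OF BA BA U(2,1) xU] x by simp
  have m2: "mderiv TA BA (\<lambda>v. s (proj \<G> v)) u (\<lambda>\<xi>. tangent_map BA BA s x (tangent_map TA BA (proj \<G>) u \<xi>))"
    by (rule mderiv_compose[OF TA BA proj_mderiv ms])
  have "\<forall>\<^sub>F v in nhds u. proj \<G> (\<phi> v) = s (proj \<G> v)"
    using eventually_nhds_in_open[OF o uU] by eventually_elim (rule \<phi>(2))
  from fun_cong[OF mderiv_unique[OF mderiv_transform[OF m1 this TA] m2], of "conn_inv \<G> u (minus_one a b)"]
  have "tangent_map TA BA (proj \<G>) (\<phi> u) (tangent_map TA TA \<phi> u (conn_inv \<G> u (minus_one a b))) = - F u (minus_one a b)"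
    using T[OF c] by (simp add: frame_vec_def)
  moreover have "tangent_map TA TA \<phi> u (conn_inv \<G> u (minus_one a b)) = conn_inv \<G> (\<phi> u) (minus_one a b)"
    by (rule conn_inv_eqI[symmetric]) (simp add: \<phi>(4)[OF uU] conn_conn_inv minus_one_grade)
  ultimately show "F (\<phi> u) (minus_one a b) = - F u (minus_one a b)" by (simp add: frame_vec_def)
qed

text \<open>The covering map sends the frame \<open>u\<close> to some \<open>u M\<close>.  The symmetry is \<open>-id\<close> on the contact distribution, which
forces the block diagonal part of \<open>M\<close> to be a multiple of \<open>sym_mat\<close>.\<close>

lemma symmetry_on_orbit:
  assumes sym: "symmetry_at \<G> x U s \<phi>" and u: "proj \<G> u = x" and inj: "frame_inj u"
  shows "\<phi> ` orbit_plus \<G> u = ract0 \<G> (orbit_plus \<G> u) (cls sym_mat)"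
proof -
  note S = symmetryD[OF sym]
  obtain M where M: "M \<in> upper_mats" "\<phi> u = R u M" using fiber_transitive[of "\<phi> u" u] S(4)[OF u] u by auto
  have neg: "L_coord (M ** minus_one a b ** matrix_inv M) = - a \<and> R_coord (M ** minus_one a b ** matrix_inv M) = - b" for a b
  proof -
    have "F u (minus_one a b) \<in> contact_distr \<G> x" using distributions(1)[of u] u by auto
    then have "F u (M ** minus_one a b ** matrix_inv M) = F u (minus_one (- a) (- b))"
      using S(7)[OF u] F_R[OF M(1) minus_one_grade(4), of u a b] M(2) by (simp add: F_minus_one_linear(3))
    then show ?thesis using F_minus_one_inj[OF inj] F_minus_one[OF conj_coords(1)[OF M(1) minus_one_grade(5)], of u a b] by simp
  qed
  have D: "blk_diag M = (M $ First $ First) *\<^sub>R sym_mat" by (rule minus_id_blk_diag[OF M(1) neg])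
  obtain N where N: "N \<in> filt 1" "M = blk_diag M ** (mat 1 + N)" using upper_decomp[OF M(1)] .
  have "\<phi> ` orbit_plus \<G> u = orbit_plus \<G> (\<phi> u)"
  proof -
    have "a \<in> P_grp" if "a \<in> Pplus_grp" for a using that unipotent_upper by (auto simp: Pplus_unipotent P_grp_def)
    then show ?thesis unfolding orbit_plus_def image_image using S(5)[OF S(3)[OF u]] by (intro image_cong) auto
  qed
  also have "\<dots> = ract0 \<G> (orbit_plus \<G> u) (cls (blk_diag M))"
    using orbit_plus_R[OF blk_diag_inverse(3)[OF M(1)] N(1), of u] N(2) M(2) by simp
  also have "cls (blk_diag M) = cls sym_mat"
    unfolding D by (rule cls_scale) (rule upper_diag_nonzero(1)[OF M(1)])
  finally show ?thesis .
qed

lemma symmetry_weyl: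
  assumes sym: "symmetry_at \<G> x U s \<phi>" and u: "proj \<G> u = x" and inj: "frame_inj u"
    and \<sigma>: "weyl_structure \<G> \<sigma>" "weyl_invariant_at \<G> x \<phi> \<sigma>"
  shows "\<phi> (\<sigma> (orbit_plus \<G> u)) = R (\<sigma> (orbit_plus \<G> u)) sym_mat"
proof -
  have "\<phi> (\<sigma> (orbit_plus \<G> u)) = \<sigma> (ract0 \<G> (orbit_plus \<G> u) (cls sym_mat))"
    using \<sigma>(2) u symmetry_on_orbit[OF sym u inj] by (simp add: weyl_invariant_at_def)
  also have "\<dots> = R (\<sigma> (orbit_plus \<G> u)) sym_mat"
  proof -
    have "\<forall>u\<^sub>0\<in>bundle0 \<G>. \<forall>g\<in>G0_grp. \<sigma> (ract0 \<G> u\<^sub>0 g) = ract \<G> (\<sigma> u\<^sub>0) g"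
      using \<sigma>(1) unfolding weyl_structure_def by (elim conjE)
    moreover have "orbit_plus \<G> u \<in> bundle0 \<G>" "cls sym_mat \<in> (G0_grp :: 'n matr set set)"
      using sym_mat_diag(1)[where 'n = 'n] by (simp_all add: bundle0_def G0_grp_def)
    ultimately show ?thesis by blast
  qed
  finally show ?thesis .
qed

text \<open>The derivatives of the function at the point \<open>w\<close> of the invariant Weyl structure along \<open>X\<close> and \<open>C X C\<^sup>-\<^sup>1\<close>
agree, where \<open>C = exp(2 \<Upsilon>\<^sub>1)\<close>.  With the element \<open>X\<close> of \<open>conj_opposite\<close> this isolates the derivative along the
grading element \<open>E\<close>.  It passes from \<open>w\<close> to any other point of the orbit of \<open>P\<^sub>+\<close>, since \<open>P\<^sub>+\<close> changes \<open>E\<close>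
only by elements of \<open>\<pp>\<^sub>+\<close>.\<close>

lemma grading_derivative_vanishes:
  assumes reg: "regular_geometry \<G>" and normal: "normal_geometry \<G>"
    and sym: "symmetry_at \<G> x U s \<phi>" and sym': "symmetry_at \<G> x U' s' \<phi>'"
    and \<sigma>: "weyl_structure \<G> \<sigma>" "weyl_invariant_at \<G> x \<phi> \<sigma>"
    and \<Upsilon>: "G0_equivariant \<G> 1 \<Upsilon>\<^sub>1" "G0_equivariant \<G> 2 \<Upsilon>\<^sub>2"
    and \<sigma>': "weyl_structure \<G> (weyl_change \<G> \<sigma> \<Upsilon>\<^sub>1 \<Upsilon>\<^sub>2)" "weyl_invariant_at \<G> x \<phi>' (weyl_change \<G> \<sigma> \<Upsilon>\<^sub>1 \<Upsilon>\<^sub>2)"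
    and \<theta>: "transversal_identification \<G> x \<theta>" and v: "v = sharp \<G> x \<theta> (covector_at \<G> x \<Upsilon>\<^sub>1)"
    and ne: "contact_metric \<G> x \<theta> (comp_R \<G> x v) (comp_L \<G> x v) \<noteq> 0"
    and u: "proj \<G> u = x" and l: "\<And>\<beta>. \<beta> \<in> im_codiff \<Longrightarrow> l \<bullet> coords2 \<beta> = 0"
  shows "curv_fun_deriv l grading_elt u = 0"
proof -
  define Y1 Y2 w where "Y1 = \<Upsilon>\<^sub>1 (orbit_plus \<G> u)" and "Y2 = \<Upsilon>\<^sub>2 (orbit_plus \<G> u)" and "w = \<sigma> (orbit_plus \<G> u)"
  have g: "Y1 \<in> grade 1" "Y2 \<in> grade 2" using \<Upsilon> by (simp_all add: G0_equivariant_def bundle0_def Y1_def Y2_def)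
  note f = grade_filt1(1)[OF g(1)] grade_filt1(2)[OF g(2)]
  have inj: "frame_inj u"
    using frame_nondegenerate(2)[OF reg _ ne[folded u]] \<theta> u by simp
  define p q where "p = (\<chi> i. Y1 $ First $ Mid i)" and "q = (\<chi> i. Y1 $ Mid i $ Last)"
  have pq: "p \<bullet> q \<noteq> 0"
    using metric_condition[OF reg _ \<Upsilon>(1), of u \<theta> v] \<theta> v ne u by (simp add: p_def q_def Y1_def)
  have "w \<in> orbit_plus \<G> u" using \<sigma>(1) by (simp add: weyl_structure_def bundle0_def w_def)
  then obtain N where N: "N \<in> filt 1" "w = R u (mat 1 + N)" by (auto simp: orbit_plus_eq)
  have pw: "proj \<G> w = x" using proj_R[OF unipotent_upper[OF N(1)]] u N(2) by simp
  have up: "mat_exp Z \<in> upper_mats" if "Z \<in> filt 1" for Z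
  proof -
    have "Z + (1/2) *\<^sub>R (Z ** Z) \<in> filt 1" by (intro filt1_linear(2,5) filt1_mult that)
    from unipotent_upper[OF this] show ?thesis by (simp add: mat_exp_nilpotent[OF that] add.assoc)
  qed
  define B B' where "B = mat_exp Y1 ** mat_exp Y2" and "B' = mat_exp (- Y2) ** mat_exp (- Y1)"
  have fm: "- Y1 \<in> filt 1" "- Y2 \<in> filt 1" using f filt1_linear(4) by auto
  have uB: "B \<in> upper_mats" "B' \<in> upper_mats" "B' ** sym_mat \<in> upper_mats" "B ** sym_mat \<in> upper_mats"
    unfolding B_def B'_def using up[OF f(1)] up[OF f(2)] up[OF fm(1)] up[OF fm(2)] sym_mat_diag(2)[where 'n = 'n]
    by (simp_all add: upper_mult)
  have BB': "B ** (B' ** sym_mat) = sym_mat"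
  proof -
    have "B ** (B' ** sym_mat) = mat_exp Y1 ** (mat_exp Y2 ** mat_exp (- Y2)) ** mat_exp (- Y1) ** sym_mat"
      by (simp only: B_def B'_def matrix_mul_assoc)
    then show ?thesis by (simp add: mat_exp_minus[OF f(1)] mat_exp_minus[OF f(2)])
  qed
  have \<phi>w: "\<phi> w = R w sym_mat" unfolding w_def by (rule symmetry_weyl[OF sym u inj \<sigma>])
  have ch: "weyl_change \<G> \<sigma> \<Upsilon>\<^sub>1 \<Upsilon>\<^sub>2 (orbit_plus \<G> u) = R w B"
    by (simp add: weyl_change_def R_mult[OF up[OF f(1)] up[OF f(2)], folded Y1_def Y2_def] w_def[symmetric] Y1_def[symmetric] Y2_def[symmetric] B_def)
  have \<phi>'B: "\<phi>' (R w B) = R (R w B) sym_mat"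
    using symmetry_weyl[OF sym' u inj \<sigma>'] by (simp add: ch)
  note S = symmetryD[OF sym] and S' = symmetryD[OF sym']
  have pB: "proj \<G> (R w B) = x" using proj_R[OF uB(1)] pw by simp
  have "\<phi>' (\<phi> w) = \<phi>' (R (R w B) (B' ** sym_mat))"
    by (simp add: \<phi>w R_mult[OF uB(1,3)] BB')
  also have "\<dots> = R (\<phi>' (R w B)) (B' ** sym_mat)"
    by (rule S'(5)[OF S'(3)[OF pB]]) (use uB(3) in \<open>simp add: P_grp_def\<close>)
  also have "\<dots> = R w (B ** sym_mat ** (B' ** sym_mat))"
    by (simp add: \<phi>'B R_mult uB sym_mat_diag(2))
  also have "B ** sym_mat ** (B' ** sym_mat) = mat_exp (2 *\<^sub>R Y1)"
    unfolding B_def B'_def by (rule symmetry_product[OF g])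
  finally have comp: "\<phi>' (\<phi> w) = R w (mat_exp (2 *\<^sub>R Y1))" .
  define C where "C = mat_exp (2 *\<^sub>R Y1)"
  define NC where "NC = 2 *\<^sub>R Y1 + (1/2) *\<^sub>R (2 *\<^sub>R Y1 ** 2 *\<^sub>R Y1)"
  have f2: "2 *\<^sub>R Y1 \<in> filt 1" by (rule filt1_linear(5)[OF f(1)])
  have NC: "NC \<in> filt 1" unfolding NC_def by (intro filt1_linear(2,5) filt1_mult f)
  have CN: "C = mat 1 + NC" unfolding C_def NC_def mat_exp_nilpotent[OF f2] by (simp add: add.assoc)
  have iC: "invertible C" using up[OF f2] by (simp add: C_def upper_mats_def)
  \<comment> \<open>both symmetries preserve derivatives along constant fields, and so does the right action of \<open>C\<close> up to conjugation\<close>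
  have tr: "curv_fun_deriv l X w = curv_fun_deriv l (C ** X ** matrix_inv C) w" if X: "X \<in> sl" for X
  proof -
    have "curv_fun_deriv l X w = curv_fun_deriv l X (\<phi> w)"
      by (rule curv_fun_deriv_automorphism[OF S(1) S(3)[OF pw] S(2) S(6) X, symmetric])
    also have "\<dots> = curv_fun_deriv l X (\<phi>' (\<phi> w))"
      by (rule curv_fun_deriv_automorphism[OF S'(1) S'(3)[OF S(4)[OF pw]] S'(2) S'(6) X, symmetric])
    also have "\<dots> = curv_fun_deriv l (matrix_inv C ** (C ** X ** matrix_inv C) ** C) (R w C)"
    proof -
      have "matrix_inv C ** (C ** X ** matrix_inv C) ** C = X"
        using matrix_inv_works[OF iC] by (simp add: matrix_mul_assoc) (simp add: matrix_mul_assoc[symmetric])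
      then show ?thesis by (simp add: comp C_def)
    qed
    also have "\<dots> = curv_fun_deriv l (C ** X ** matrix_inv C) w"
      unfolding CN by (rule curv_fun_deriv_unipotent[OF normal l NC conj_sl[OF iC X, unfolded CN]])
    finally show ?thesis .
  qed
  have E: "grading_elt \<in> sl" using filt0_sl(1)[OF grading_elt_filt0] .
  have Ysl: "Y1 \<in> sl" by (rule filt0_sl(2)[OF f(1)])
  have EY: "grading_elt - Y1 \<in> sl" by (rule sl_diff[OF E Ysl])
  have s: "(2 * (p \<bullet> q)) *\<^sub>R (grading_elt - Y1) \<in> sl" using sl_linear[OF EY EY, of "2 * (p \<bullet> q)" 0] by simp
  have "curv_fun_deriv l (minus_one q p) w = curv_fun_deriv l (minus_one q p + (2 * (p \<bullet> q)) *\<^sub>R (grading_elt - Y1)) w"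
    using tr[OF minus_one_grade(4), of q p] conj_opposite[OF g(1)] by (simp add: C_def p_def q_def)
  then have "2 * (p \<bullet> q) * curv_fun_deriv l (grading_elt - Y1) w = 0"
    by (simp add: curv_fun_deriv_linear(1)[OF minus_one_grade(4) s] curv_fun_deriv_linear(2)[OF EY EY])
  then have "curv_fun_deriv l (grading_elt - Y1) w = 0" using pq by simp
  then have Ew: "curv_fun_deriv l grading_elt w = 0"
    using curv_fun_deriv_linear(1)[OF EY Ysl, of l w] curv_fun_deriv_nilpotent[OF normal l f(1)] by simp
  obtain Z where Z: "Z \<in> filt 1" "matrix_inv (mat 1 + N) ** grading_elt ** (mat 1 + N) = grading_elt + Z" using grading_elt_conj_unipotent[OF N(1)] .
  have "curv_fun_deriv l grading_elt u = curv_fun_deriv l (grading_elt + Z) w"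
    using curv_fun_deriv_unipotent[OF normal l N(1) E, of u] Z(2) N(2) by simp
  also have "\<dots> = 0"
    using Ew curv_fun_deriv_nilpotent[OF normal l Z(1)] by (simp add: curv_fun_deriv_linear(1)[OF E filt0_sl(2)[OF Z(1)]])
  finally show ?thesis .
qed

end

lemma coset_im_codiff:
  assumes "\<psi> \<in> im_codiff" shows "{(\<lambda>X Y. \<psi> X Y + \<beta> X Y) | \<beta>. \<beta> \<in> im_codiff} = im_codiff"
proof
  show "{(\<lambda>X Y. \<psi> X Y + \<beta> X Y) | \<beta>. \<beta> \<in> im_codiff} \<subseteq> im_codiff"
    using im_codiff_linear[OF assms, of _ 1 1] by auto
  show "im_codiff \<subseteq> {(\<lambda>X Y. \<psi> X Y + \<beta> X Y) | \<beta>. \<beta> \<in> im_codiff}"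
  proof
    fix \<phi> :: "'a matr \<Rightarrow> 'a matr \<Rightarrow> 'a matr" assume "\<phi> \<in> im_codiff"
    from im_codiff_linear[OF this assms, of 1 "-1"] have "(\<lambda>X Y. \<phi> X Y - \<psi> X Y) \<in> im_codiff" by simp
    then show "\<phi> \<in> {(\<lambda>X Y. \<psi> X Y + \<beta> X Y) | \<beta>. \<beta> \<in> im_codiff}"
      by (intro CollectI exI[of _ "\<lambda>X Y. \<phi> X Y - \<psi> X Y"] conjI) (simp add: fun_eq_iff)
  qed
qed

theorem mainTheorem4:
  fixes \<G> :: "('m::{t2_space,second_countable_topology}, 'e::euclidean_space,
               'p::{t2_space,second_countable_topology}, 'q::euclidean_space, 'n::finite) geometry"
    and x :: 'm and U U' :: "'m set" and s s' :: "'m \<Rightarrow> 'm" and \<phi> \<phi>' :: "'p \<Rightarrow> 'p"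
    and \<sigma> :: "'p set \<Rightarrow> 'p" and \<Upsilon>\<^sub>1 \<Upsilon>\<^sub>2 :: "'p set \<Rightarrow> 'n matr"
    and \<theta> :: "'e \<Rightarrow> real" and v :: 'e
  assumes "parabolic_geometry \<G>" and "regular_geometry \<G>" and "normal_geometry \<G>"
    and "symmetric_geometry \<G>"
    and "symmetry_at \<G> x U s \<phi>" and "involutive_at x s"
    and "symmetry_at \<G> x U' s' \<phi>'" and "involutive_at x s'"
    and "\<not> same_germ x s s'"
    and "weyl_structure \<G> \<sigma>" and "weyl_invariant_at \<G> x \<phi> \<sigma>"
    and "G0_equivariant \<G> 1 \<Upsilon>\<^sub>1" and "G0_equivariant \<G> 2 \<Upsilon>\<^sub>2"
    and "weyl_structure \<G> (weyl_change \<G> \<sigma> \<Upsilon>\<^sub>1 \<Upsilon>\<^sub>2)"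
    and "weyl_invariant_at \<G> x \<phi>' (weyl_change \<G> \<sigma> \<Upsilon>\<^sub>1 \<Upsilon>\<^sub>2)"
    and "transversal_identification \<G> x \<theta>"
    and "v = sharp \<G> x \<theta> (covector_at \<G> x \<Upsilon>\<^sub>1)"
    and "contact_metric \<G> x \<theta> (comp_R \<G> x v) (comp_L \<G> x v) \<noteq> 0"
  shows "harmonic_curv_vanishes_at \<G> x"
proof -
  interpret parabolic \<G> by standard (rule assms(1))
  have "curv \<G> u \<in> im_codiff" if u: "proj \<G> u = x" for u
  proof (rule curvature_boundary[OF assms(3)])
    fix l :: "('n matr ^ ('n idx \<times> 'n idx)) ^ ('n idx \<times> 'n idx)" and w :: 'p
    assume l: "\<And>\<beta>. \<beta> \<in> im_codiff \<Longrightarrow> l \<bullet> coords2 \<beta> = 0" and w: "proj \<G> w = proj \<G> u"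
    show "curv_fun_deriv l grading_elt w = 0"
      by (rule grading_derivative_vanishes[OF assms(2,3,5,7,10,11,12,13,14,15,16,17,18) w[unfolded u] l])
  qed
  then show ?thesis
    unfolding harmonic_curv_vanishes_at_def harmonic_curv_def by (intro allI impI coset_im_codiff)
qed

end
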